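(* Let $n\geqslant 2$ and set $$P_n=\prod_{\alpha\in \mathrm{spec}^{\times}(A_n)}\Big(1-\frac1\alpha A_n\Big)\in B_n(\varepsilon N),\qquad \mathfrak P_n=\mathfrak r(P_n)\in\mathrm{End}(V^{\otimes n}).$$ Then $\mathfrak P_n$ is the universal traceless projector on $V^{\otimes n}$, i.e. $\mathfrak P_n\mathfrak P_n=\mathfrak P_n$ and for all $T\in V^{\otimes n}$ and all $1\leqslant i<j\leqslant n$: (P1) $\mathrm{tr}^{(g)}_{ij}(\mathfrak P_nT)=0$; (P2) if $\mathrm{tr}^{(g)}_{kl}T=0$ for all $1\leqslant k<l\leqslant n$, then $\mathfrak P_nT=T$; (P3) $\mathfrak P_n\,\mathfrak r(s)\,T=\mathfrak r(s)\,\mathfrak P_n\,T$ for every $s\in\mathfrak S_n$.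
   Context: $V$ is a complex vector space of dimension $N\geqslant 1$ with a non-degenerate bilinear form $\langle\cdot,\cdot\rangle$, either symmetric ($\varepsilon=1$, $G(N)=O(N)$) or skew-symmetric ($\varepsilon=-1$, $G(N)=Sp(N)$, $N$ even). For a basis $e_a$, $g_{ab}=\langle e_a,e_b\rangle$, $g^{ac}g_{cb}=\delta^a_b$, $E=\sum_{a,b} g^{ab}e_a\otimes e_b$. The trace $\mathrm{tr}^{(g)}_{ij}:V^{\otimes n}\to V^{\otimes n-2}$ sends $v_1\otimes\dots\otimes v_n$ to $\langle v_i,v_j\rangle$ times the tensor with $v_i,v_j$ removed. The Brauer algebra $B_n(\delta)$ has as basis the perfect matchings (diagrams) of $n$ upper and $n$ lower nodes; $b_1b_2$ is computed by placing $b_1$ below $b_2$, identifying the upper nodes of $b_1$ with the lower nodes of $b_2$, and replacing each closed loop by a factor $\delta$. Lines joining nodes of the same row are called arcs. Diagrams without arcs span $\mathbb C\mathfrak S_n$ ($s\in\mathfrak S_n$ joins upper node $i$ to lower node $s(i)$). $d_{ij}$ ($i<j$) is the diagram with an arc joining upper nodes $i,j$, an arc joining lower nodes $i,j$, and vertical lines $k$–$k$ for the other $k$. Set $A_n=\sum_{1\leqslant i<j\leqslant n}d_{ij}$. The algebra homomorphism $\mathfrak r:B_n(\varepsilon N)\to\mathrm{End}(V^{\otimes n})$ is determined by: the transposition $s_i=(i\;i{+}1)$ acts as $\varepsilon$ times the flip of the factors $i,i+1$; $d_{i\,i+1}$ acts by $v_1\otimes\dots\otimes v_n\mapsto\langle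 v_i,v_{i+1}\rangle\,v_1\otimes\dots\otimes E\otimes\dots\otimes v_n$ ($E$ in positions $i,i+1$). Partitions are identified with Young diagrams; $\lambda'$ is the transposed partition; a partition is even if all its parts are even ($\varnothing$ is even). The content of a diagram is $c(\lambda)=\sum_{(i,j)\in\lambda}(j-i)$ and $c(\mu\backslash\lambda)=c(\mu)-c(\lambda)$. $c^\mu_{\nu\lambda}$ are Littlewood–Richardson coefficients. Define $\Lambda_{l,N}=\{\lambda\vdash l:\lambda_1'+\lambda_2'\leqslant N\}$ if $\varepsilon=1$, and $\{\lambda\vdash l:\lambda_1\leqslant N/2\}$ if $\varepsilon=-1$; $\Sigma_{n,N}=\{\mu\vdash n:\mu_1'\leqslant N\}$ if $\varepsilon=1$, and $\{\mu\vdash n:\mu_1\leqslant N\}$ if $\varepsilon=-1$. For $\lambda\vdash n-2f$: $\mathrm{cl}^{(f)}_N(\lambda)=\{\mu\in\Sigma_{n,N}:\mu\supset\lambda,\ c^\mu_{\nu\lambda}\ne0\text{ for some even }\nu\text{ with }|\nu|=2f\}$. Finally $$\mathrm{spec}^{\times}(A_n)=\{(\varepsilon N-1)f+c(\mu\backslash\lambda): f=1,\dots,\lfloor n/2\rfloor,\ \lambda\in\Lambda_{n-2f,N},\ \mu\in\mathrm{cl}^{(f)}_N(\lambda)\}\cap\varepsilon\mathbb N,$$ where $\varepsilon\mathbb N=\{\varepsilon k:k=1,2,\dots\}$. *)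

theory Defs
  imports
    Complex_Main
    "HOL-Library.Disjoint_Sets"
    "HOL-Combinatorics.Permutations"
begin

text \<open>
  Tensor positions, diagram nodes, and rows and columns of Young diagrams are numbered from 0 (so
  \<open>\<lambda>\<^sub>1 = row_len \<lambda> 0\<close> and \<open>\<lambda>'\<^sub>1 = col_len \<lambda> 0\<close>); contents \<open>j - i\<close> are not affected by this shift.
\<close>

text \<open>
  The space \<open>V\<close> is a type \<open>'v\<close> with a scalar multiplication \<open>scale\<close> and a finite basis \<open>Basis\<close>
  (locale \<^locale>\<open>finite_dimensional_vector_space\<close>).  A tensor of rank \<open>n\<close> is the array of its
  components with respect to \<open>Basis\<close>: it assigns a complex number to each word of length \<open>n\<close> in the
  basis vectors, and is 0 on all other lists.
\<close>

definition nondegenerate_form ::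
  "(complex \<Rightarrow> 'v::ab_group_add \<Rightarrow> 'v) \<Rightarrow> int \<Rightarrow> ('v \<Rightarrow> 'v \<Rightarrow> complex) \<Rightarrow> bool" where
  "nondegenerate_form scale eps form \<longleftrightarrow>
     (\<forall>x. Vector_Spaces.linear scale (*) (\<lambda>y. form x y)) \<and>
     (\<forall>y. Vector_Spaces.linear scale (*) (\<lambda>x. form x y)) \<and>
     (\<forall>x y. form y x = of_int eps * form x y) \<and>
     (\<forall>x. (\<forall>y. form x y = 0) \<longrightarrow> x = 0)"

definition inverse_gram :: "'v set \<Rightarrow> ('v \<Rightarrow> 'v \<Rightarrow> complex) \<Rightarrow> ('v \<Rightarrow> 'v \<Rightarrow> complex) \<Rightarrow> bool" where
  "inverse_gram Basis form ginv \<longleftrightarrow>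
     (\<forall>a\<in>Basis. \<forall>b\<in>Basis. (\<Sum>c\<in>Basis. ginv a c * form c b) = (if a = b then 1 else 0))"

definition basis_words :: "'v set \<Rightarrow> nat \<Rightarrow> 'v list set" where
  "basis_words Basis n = {w. set w \<subseteq> Basis \<and> length w = n}"

definition tensor_space :: "'v set \<Rightarrow> nat \<Rightarrow> ('v list \<Rightarrow> complex) set" where
  "tensor_space Basis n = {T. \<forall>w. w \<notin> basis_words Basis n \<longrightarrow> T w = 0}"

text \<open>The tensor \<open>v\<^sub>1 \<otimes> \<dots> \<otimes> v\<^sub>n\<close>, for the list \<open>vs = [v\<^sub>1, \<dots>, v\<^sub>n]\<close> of arbitrary vectors.\<close>

definition pure_tensor ::
  "(complex \<Rightarrow> 'v::ab_group_add \<Rightarrow> 'v) \<Rightarrow> 'v set \<Rightarrow> 'v list \<Rightarrow> 'v list \<Rightarrow> complex" where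
  "pure_tensor scale Basis vs =
     (\<lambda>w. if w \<in> basis_words Basis (length vs)
          then \<Prod>k<length vs. module.representation scale Basis (vs ! k) (w ! k) else 0)"

text \<open>
  Since \<open>T = (\<Sum>w. T w \<cdot> w\<^sub>1 \<otimes> \<dots> \<otimes> w\<^sub>n)\<close>, the following is the linear extension of the prescription
  on products of basis vectors; \<open>tensor_trace_pure_tensor\<close> below gives its value on products of
  arbitrary vectors.
\<close>

definition tensor_trace ::
  "(complex \<Rightarrow> 'v::ab_group_add \<Rightarrow> 'v) \<Rightarrow> 'v set \<Rightarrow> ('v \<Rightarrow> 'v \<Rightarrow> complex) \<Rightarrow> nat \<Rightarrow> nat \<Rightarrow> nat \<Rightarrow>
   ('v list \<Rightarrow> complex) \<Rightarrow> 'v list \<Rightarrow> complex" where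
  "tensor_trace scale Basis form n i j T =
     (\<lambda>u. \<Sum>w\<in>basis_words Basis n.
        T w * form (w ! i) (w ! j) * pure_tensor scale Basis (nths w (- {i, j})) u)"

lemma pure_tensor_basis_word:
  assumes "finite_dimensional_vector_space scale Basis" and w: "w \<in> basis_words Basis n"
  shows "pure_tensor scale Basis w = (\<lambda>u. if u = w then 1 else 0)"
proof
  interpret finite_dimensional_vector_space scale Basis by fact
  fix u
  have rep: "module.representation scale Basis (w ! k) = (\<lambda>v. if v = w ! k then 1 else 0)"
    if "k < n" for k
    using w that by (intro representation_basis independent_Basis) (auto simp: basis_words_def)
  show "pure_tensor scale Basis w u = (if u = w then 1 else 0)"
  proof (cases "u \<in> basis_words Basis n")
    case True
    have "(\<Prod>k<n. if u ! k = w ! k then 1 else 0 :: complex) = (if u = w then 1 else 0)"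
      using True w by (auto simp: basis_words_def list_eq_iff_nth_eq)
    then show ?thesis using True w rep by (simp add: pure_tensor_def basis_words_def)
  next
    case False
    then show ?thesis using w by (auto simp: pure_tensor_def basis_words_def)
  qed
qed

lemma tensor_trace_pure_tensor:
  assumes "finite_dimensional_vector_space scale Basis"
    and "nondegenerate_form scale eps form"
    and len: "length vs = n" and ij: "i < j" "j < n"
  shows "tensor_trace scale Basis form n i j (pure_tensor scale Basis vs) =
    (\<lambda>u. form (vs ! i) (vs ! j) * pure_tensor scale Basis (nths vs (- {i, j})) u)"
proof
  interpret finite_dimensional_vector_space scale Basis by fact
  define R where "R = (\<lambda>v. module.representation scale Basis v)"
  define js where "js = filter (\<lambda>k. k \<noteq> i \<and> k \<noteq> j) [0..<n]"
  have js_set: "set js = {..<n} - {i, j}" and js_dist: "distinct js"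
    by (auto simp: js_def)
  have nths_eq: "nths xs (- {i, j}) = map ((!) xs) js" if "length xs = n" for xs :: "'a list"
  proof -
    have "nths xs (- {i, j}) = nths (map ((!) xs) [0..<n]) (- {i, j})"
      using that by (metis map_nth)
    also have "\<dots> = map ((!) xs) (nths [0..<n] (- {i, j}))" by (rule nths_map)
    also have "nths [0..<n] (- {i, j}) = js"
      by (simp add: nths_def js_def zip_same_conv_map filter_map o_def)
    finally show ?thesis .
  qed
  define idx where "idx = inv_into {..<length js} ((!) js)"
  have js_bij: "bij_betw ((!) js) {..<length js} ({..<n} - {i, j})"
    using bij_betw_nth[OF js_dist refl js_set[symmetric]] by simp
  have idx_js: "idx (js ! m) = m" if "m < length js" for m
    unfolding idx_def using that js_bij by (intro inv_into_f_f) (auto simp: bij_betw_def)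
  have js_idx: "js ! idx k = k" and idx_less: "idx k < length js" if "k < n" "k \<noteq> i" "k \<noteq> j" for k
  proof -
    have k: "k \<in> (!) js ` {..<length js}" using that js_bij by (auto simp: bij_betw_def)
    show "js ! idx k = k" unfolding idx_def by (rule f_inv_into_f[OF k])
    show "idx k < length js" using inv_into_into[OF k] by (simp add: idx_def)
  qed
  have js_in: "js ! m < n" "js ! m \<noteq> i" "js ! m \<noteq> j" if "m < length js" for m
    using js_set nth_mem[OF that] by auto
  have prod_split: "(\<Prod>k<n. h k) = h i * h j * (\<Prod>m<length js. h (js ! m))"
    for h :: "nat \<Rightarrow> complex"
  proof -
    have "(\<Prod>k<n. h k) = h i * (h j * (\<Prod>k\<in>{..<n} - {i} - {j}. h k))"
      using ij by (subst prod.remove[of _ i], simp, simp, subst prod.remove[of _ j]) auto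
    also have "{..<n} - {i} - {j} = {..<n} - {i, j}" by auto
    also have "(\<Prod>k\<in>{..<n} - {i, j}. h k) = (\<Prod>m<length js. h (js ! m))"
      by (rule prod.reindex_bij_betw[OF js_bij, symmetric])
    finally show ?thesis by (simp add: mult.assoc)
  qed
  have form_expand: "form x y = (\<Sum>a\<in>Basis. \<Sum>b\<in>Basis. R x a * R y b * form a b)" for x y
  proof -
    have lin1: "Vector_Spaces.linear scale (*) (\<lambda>x. form x y)"
      and lin2: "Vector_Spaces.linear scale (*) (\<lambda>y. form x y)" for x y
      using assms(2) unfolding nondegenerate_form_def by blast+
    have expand: "(\<Sum>b\<in>Basis. scale (R z b) b) = z" for z
      unfolding R_def by (rule sum_representation_eq) (use independent_Basis span_Basis finite_Basis in auto)
    have left: "form x y = (\<Sum>a\<in>Basis. R x a * form a y)" for x y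
    proof -
      interpret l: Vector_Spaces.linear scale "(*)" "\<lambda>x. form x y" by (rule lin1)
      have "form x y = form (\<Sum>a\<in>Basis. scale (R x a) a) y" by (simp add: expand)
      also have "\<dots> = (\<Sum>a\<in>Basis. R x a * form a y)" by (simp only: l.sum l.scale)
      finally show ?thesis .
    qed
    have right: "form x y = (\<Sum>b\<in>Basis. R y b * form x b)" for x y
    proof -
      interpret l: Vector_Spaces.linear scale "(*)" "\<lambda>y. form x y" by (rule lin2)
      have "form x y = form x (\<Sum>b\<in>Basis. scale (R y b) b)" by (simp add: expand)
      also have "\<dots> = (\<Sum>b\<in>Basis. R y b * form x b)" by (simp only: l.sum l.scale)
      finally show ?thesis .
    qed
    show ?thesis
      unfolding left[of x y]
    proof (rule sum.cong[OF refl])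
      fix a
      show "R x a * form a y = (\<Sum>b\<in>Basis. R x a * R y b * form a b)"
        by (subst right) (simp add: sum_distrib_left mult.assoc)
    qed
  qed
  fix u
  define W where "W = basis_words Basis n"
  have fin_W: "finite W"
    unfolding W_def basis_words_def by (rule finite_lists_length_eq[OF finite_Basis])
  have W_len: "length w = n" if "w \<in> W" for w using that by (simp add: W_def basis_words_def)
  have W_nth: "w ! k \<in> Basis" if "w \<in> W" "k < n" for w k
    using that by (auto simp: W_def basis_words_def)
  have pure_w: "pure_tensor scale Basis (nths w (- {i, j})) u = (if map ((!) w) js = u then 1 else 0)"
    if "w \<in> W" for w
  proof -
    have "map ((!) w) js \<in> basis_words Basis (length js)"
      using W_nth[OF that] js_set by (auto simp: basis_words_def)
    then show ?thesis
      using W_len[OF that] pure_tensor_basis_word[OF assms(1)] by (auto simp: nths_eq)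
  qed
  have pure_vs: "pure_tensor scale Basis vs w = (\<Prod>k<n. R (vs ! k) (w ! k))" if "w \<in> W" for w
    using that by (simp add: pure_tensor_def len W_def R_def)
  have "tensor_trace scale Basis form n i j (pure_tensor scale Basis vs) u =
    (\<Sum>w\<in>W. if map ((!) w) js = u
      then (\<Prod>k<n. R (vs ! k) (w ! k)) * form (w ! i) (w ! j) else 0)"
    unfolding tensor_trace_def W_def[symmetric]
    by (intro sum.cong refl) (simp add: pure_w pure_vs)
  also have "\<dots> = (\<Sum>w\<in>{w\<in>W. map ((!) w) js = u}.
      (\<Prod>k<n. R (vs ! k) (w ! k)) * form (w ! i) (w ! j))"
    using fin_W by (simp add: sum.inter_filter)
  also have "\<dots> = form (vs ! i) (vs ! j) * pure_tensor scale Basis (nths vs (- {i, j})) u"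
  proof (cases "u \<in> basis_words Basis (length js)")
    case False
    then have "map ((!) w) js \<noteq> u" if "w \<in> W" for w
      using W_nth[OF that] js_set by (auto simp: basis_words_def)
    then have "{w\<in>W. map ((!) w) js = u} = {}" by auto
    then have "(\<Sum>w\<in>{w\<in>W. map ((!) w) js = u}. h w) = 0" for h :: "'a list \<Rightarrow> complex"
      by (simp only: sum.empty)
    then show ?thesis using False by (simp add: pure_tensor_def nths_eq[OF len])
  next
    case True
    define q where "q = (\<Prod>m<length js. R (vs ! (js ! m)) (u ! m))"
    define g where
      "g = (\<lambda>(a, b). map (\<lambda>k. if k = i then a else if k = j then b else u ! idx k) [0..<n])"
    have u_len: "length u = length js" and u_set: "set u \<subseteq> Basis"
      using True by (auto simp: basis_words_def)
    have "(\<Sum>w\<in>{w\<in>W. map ((!) w) js = u}. (\<Prod>k<n. R (vs ! k) (w ! k)) * form (w ! i) (w ! j)) =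
      (\<Sum>(a, b)\<in>Basis \<times> Basis. R (vs ! i) a * R (vs ! j) b * form a b * q)"
    proof (rule sum.reindex_bij_witness[where i = g and j = "\<lambda>w. (w ! i, w ! j)"])
      fix w assume "w \<in> {w\<in>W. map ((!) w) js = u}"
      then have w: "w \<in> W" and wu: "map ((!) w) js = u" by auto
      have u_nth: "u ! m = w ! (js ! m)" if "m < length js" for m
        using that wu by auto
      show "g (w ! i, w ! j) = w"
        using W_len[OF w] by (intro nth_equalityI) (auto simp: g_def u_nth idx_less js_idx)
      show "(w ! i, w ! j) \<in> Basis \<times> Basis" using W_nth[OF w] ij by auto
      show "(case (w ! i, w ! j) of (a, b) \<Rightarrow> R (vs ! i) a * R (vs ! j) b * form a b * q) =
        (\<Prod>k<n. R (vs ! k) (w ! k)) * form (w ! i) (w ! j)"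
        by (simp add: prod_split q_def u_nth)
    next
      fix p assume "p \<in> Basis \<times> Basis"
      then obtain a b where p: "p = (a, b)" "a \<in> Basis" "b \<in> Basis" by auto
      show "(g p ! i, g p ! j) = p" using ij p by (auto simp: g_def)
      have "u ! idx k \<in> Basis" if "k < n" "k \<noteq> i" "k \<noteq> j" for k
        using idx_less[OF that] u_len u_set by (metis nth_mem subsetD)
      then have "set (g p) \<subseteq> Basis"
        using p by (auto simp: g_def)
      moreover have "map ((!) (g p)) js = u"
        using u_len js_in by (intro nth_equalityI) (auto simp: g_def p idx_js)
      ultimately show "g p \<in> {w\<in>W. map ((!) w) js = u}"
        by (auto simp: W_def basis_words_def g_def p)
    qed
    also have "\<dots> = form (vs ! i) (vs ! j) * q"
      by (simp add: form_expand[of "vs ! i" "vs ! j"] sum_distrib_right sum.cartesian_product case_prod_beta)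
    also have "q = pure_tensor scale Basis (nths vs (- {i, j})) u"
      using True by (simp add: q_def R_def pure_tensor_def nths_eq[OF len])
    finally show ?thesis .
  qed
  finally show "tensor_trace scale Basis form n i j (pure_tensor scale Basis vs) u =
    form (vs ! i) (vs ! j) * pure_tensor scale Basis (nths vs (- {i, j})) u" .
qed

definition tensor_endomorphism ::
  "'v set \<Rightarrow> nat \<Rightarrow> (('v list \<Rightarrow> complex) \<Rightarrow> 'v list \<Rightarrow> complex) \<Rightarrow> bool" where
  "tensor_endomorphism Basis n F \<longleftrightarrow>
     (\<forall>T\<in>tensor_space Basis n. F T \<in> tensor_space Basis n) \<and>
     (\<forall>S\<in>tensor_space Basis n. \<forall>T\<in>tensor_space Basis n. \<forall>a b.
        F (\<lambda>w. a * S w + b * T w) = (\<lambda>w. a * F S w + b * F T w))"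

datatype node = Upper nat | Lower nat

definition nodes :: "nat \<Rightarrow> node set" where
  "nodes n = Upper ` {..<n} \<union> Lower ` {..<n}"

definition brauer_diagrams :: "nat \<Rightarrow> node set set set" where
  "brauer_diagrams n = {b. partition_on (nodes n) b \<and> (\<forall>e\<in>b. card e = 2)}"

definition perm_diagram :: "nat \<Rightarrow> (nat \<Rightarrow> nat) \<Rightarrow> node set set" where
  "perm_diagram n s = {{Upper i, Lower (s i)} | i. i < n}"

definition d_diagram :: "nat \<Rightarrow> nat \<Rightarrow> nat \<Rightarrow> node set set" where
  "d_diagram n i j =
     {{Upper i, Upper j}, {Lower i, Lower j}} \<union> {{Upper k, Lower k} | k. k < n \<and> k \<noteq> i \<and> k \<noteq> j}"

text \<open>
  To compute \<open>b\<^sub>1 b\<^sub>2\<close>, the diagram \<open>b\<^sub>1\<close> is placed below \<open>b\<^sub>2\<close>: the stacked picture has the three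
  rows \<open>Top\<close> (upper nodes of \<open>b\<^sub>2\<close>), \<open>Mid\<close> (lower nodes of \<open>b\<^sub>2\<close>, identified with the upper nodes of
  \<open>b\<^sub>1\<close>) and \<open>Bot\<close> (lower nodes of \<open>b\<^sub>1\<close>).
\<close>

datatype site = Top nat | Mid nat | Bot nat

fun place_below :: "node \<Rightarrow> site" where
  "place_below (Upper k) = Mid k"
| "place_below (Lower k) = Bot k"

fun place_above :: "node \<Rightarrow> site" where
  "place_above (Upper k) = Top k"
| "place_above (Lower k) = Mid k"

fun outer_site :: "node \<Rightarrow> site" where
  "outer_site (Upper k) = Top k"
| "outer_site (Lower k) = Bot k"

definition stack_connected :: "node set set \<Rightarrow> node set set \<Rightarrow> (site \<times> site) set" where
  "stack_connected b1 b2 =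
     ({(place_below x, place_below y) | x y. {x, y} \<in> b1} \<union>
      {(place_above x, place_above y) | x y. {x, y} \<in> b2})\<^sup>*"

definition diagram_comp :: "nat \<Rightarrow> node set set \<Rightarrow> node set set \<Rightarrow> node set set" where
  "diagram_comp n b1 b2 =
     {{x, y} | x y. x \<in> nodes n \<and> y \<in> nodes n \<and> x \<noteq> y \<and>
        (outer_site x, outer_site y) \<in> stack_connected b1 b2}"

text \<open>Closed loops are the connected components of the stacked picture inside the middle row.\<close>

definition diagram_loops :: "nat \<Rightarrow> node set set \<Rightarrow> node set set \<Rightarrow> nat" where
  "diagram_loops n b1 b2 =
     card {C. \<exists>k<n. C = stack_connected b1 b2 `` {Mid k} \<and> C \<subseteq> range Mid}"

text \<open>
  Elements of \<open>B\<^sub>n(\<delta>)\<close> are the functions from diagrams to coefficients that vanish outside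
  \<open>brauer_diagrams n\<close>.
\<close>

type_synonym brauer = "node set set \<Rightarrow> complex"

definition brauer_space :: "nat \<Rightarrow> brauer set" where
  "brauer_space n = {x. \<forall>b. b \<notin> brauer_diagrams n \<longrightarrow> x b = 0}"

definition brauer_basis :: "node set set \<Rightarrow> brauer" where
  "brauer_basis b = (\<lambda>c. if c = b then 1 else 0)"

definition brauer_one :: "nat \<Rightarrow> brauer" where
  "brauer_one n = brauer_basis (perm_diagram n id)"

definition brauer_mult :: "nat \<Rightarrow> complex \<Rightarrow> brauer \<Rightarrow> brauer \<Rightarrow> brauer" where
  "brauer_mult n \<delta> x y =
     (\<lambda>b. \<Sum>b1\<in>brauer_diagrams n. \<Sum>b2\<in>brauer_diagrams n.
        x b1 * y b2 * \<delta> ^ diagram_loops n b1 b2 * brauer_basis (diagram_comp n b1 b2) b)"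

definition A_elem :: "nat \<Rightarrow> brauer" where
  "A_elem n = (\<lambda>b. \<Sum>(i, j)\<in>{(i, j). i < j \<and> j < n}. brauer_basis (d_diagram n i j) b)"

text \<open>
  \<open>r\<close> is the algebra homomorphism \<open>B\<^sub>n(\<epsilon>N) \<rightarrow> End(V\<^sup>\<otimes>\<^sup>n)\<close> with the prescribed values on the
  generators; here \<open>N = card Basis\<close>.  The value of \<open>r\<close> is relevant only on \<open>brauer_space n\<close>.
\<close>

definition brauer_action ::
  "(complex \<Rightarrow> 'v::ab_group_add \<Rightarrow> 'v) \<Rightarrow> 'v set \<Rightarrow> int \<Rightarrow> ('v \<Rightarrow> 'v \<Rightarrow> complex) \<Rightarrow>
   ('v \<Rightarrow> 'v \<Rightarrow> complex) \<Rightarrow> nat \<Rightarrow>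
   (brauer \<Rightarrow> ('v list \<Rightarrow> complex) \<Rightarrow> 'v list \<Rightarrow> complex) \<Rightarrow> bool" where
  "brauer_action scale Basis eps form ginv n r \<longleftrightarrow>
     (\<forall>x\<in>brauer_space n. tensor_endomorphism Basis n (r x)) \<and>
     (\<forall>x\<in>brauer_space n. \<forall>y\<in>brauer_space n. \<forall>a c. \<forall>T\<in>tensor_space Basis n.
        r (\<lambda>b. a * x b + c * y b) T = (\<lambda>w. a * r x T w + c * r y T w)) \<and>
     (\<forall>T\<in>tensor_space Basis n. r (brauer_one n) T = T) \<and>
     (\<forall>x\<in>brauer_space n. \<forall>y\<in>brauer_space n. \<forall>T\<in>tensor_space Basis n.
        r (brauer_mult n (of_int (eps * int (card Basis))) x y) T = r x (r y T)) \<and>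
     (\<forall>i vs. length vs = n \<and> Suc i < n \<longrightarrow>
        r (brauer_basis (perm_diagram n (transpose i (Suc i)))) (pure_tensor scale Basis vs) =
          (\<lambda>w. of_int eps *
             pure_tensor scale Basis (vs[i := vs ! Suc i, Suc i := vs ! i]) w)) \<and>
     (\<forall>i vs. length vs = n \<and> Suc i < n \<longrightarrow>
        r (brauer_basis (d_diagram n i (Suc i))) (pure_tensor scale Basis vs) =
          (\<lambda>w. form (vs ! i) (vs ! Suc i) *
             (\<Sum>a\<in>Basis. \<Sum>b\<in>Basis. ginv a b * pure_tensor scale Basis (vs[i := a, Suc i := b]) w)))"

definition partitions :: "nat \<Rightarrow> nat list set" where
  "partitions m = {l. sorted_wrt (\<ge>) l \<and> 0 \<notin> set l \<and> sum_list l = m}"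

definition young :: "nat list \<Rightarrow> (nat \<times> nat) set" where
  "young l = {(i, j). i < length l \<and> j < l ! i}"

definition row_len :: "nat list \<Rightarrow> nat \<Rightarrow> nat" where
  "row_len l i = card {j. (i, j) \<in> young l}"

definition col_len :: "nat list \<Rightarrow> nat \<Rightarrow> nat" where
  "col_len l j = card {i. (i, j) \<in> young l}"

definition content :: "nat list \<Rightarrow> int" where
  "content l = (\<Sum>(i, j)\<in>young l. int j - int i)"

definition even_partition :: "nat list \<Rightarrow> bool" where
  "even_partition l \<longleftrightarrow> (\<forall>p\<in>set l. even p)"

text \<open>
  The coefficient \<open>c\<^sup>\<mu>\<^sub>\<nu>\<^sub>\<lambda>\<close> is the number of Littlewood--Richardson tableaux of skew shape \<open>\<mu>/\<nu>\<close> and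
  weight \<open>\<lambda>\<close>: semistandard fillings \<open>t\<close> with \<open>\<lambda>\<^sub>k\<close> entries equal to \<open>k\<close> whose reverse reading word
  (rows from top to bottom, each row from right to left) is a lattice word.  The nonempty prefixes of this
  word are indexed by their last cell.  Fillings are set to 0 outside the skew shape.
\<close>

definition reading_prefix :: "(nat \<times> nat) set \<Rightarrow> nat \<times> nat \<Rightarrow> (nat \<times> nat) set" where
  "reading_prefix D x = {y \<in> D. fst y < fst x \<or> (fst y = fst x \<and> snd y \<ge> snd x)}"

definition lr_tableau :: "(nat \<times> nat) set \<Rightarrow> nat list \<Rightarrow> (nat \<times> nat \<Rightarrow> nat) \<Rightarrow> bool" where
  "lr_tableau D lam t \<longleftrightarrow>
     (\<forall>x. x \<in> D \<longleftrightarrow> 0 < t x) \<and>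
     (\<forall>i j j'. (i, j) \<in> D \<and> (i, j') \<in> D \<and> j < j' \<longrightarrow> t (i, j) \<le> t (i, j')) \<and>
     (\<forall>i i' j. (i, j) \<in> D \<and> (i', j) \<in> D \<and> i < i' \<longrightarrow> t (i, j) < t (i', j)) \<and>
     (\<forall>k. card {x \<in> D. t x = Suc k} = row_len lam k) \<and>
     (\<forall>x\<in>D. \<forall>k\<ge>1. card {y \<in> reading_prefix D x. t y = Suc k}
                     \<le> card {y \<in> reading_prefix D x. t y = k})"

definition lr_coeff :: "nat list \<Rightarrow> nat list \<Rightarrow> nat list \<Rightarrow> nat" where
  "lr_coeff mu nu lam =
     (if young nu \<subseteq> young mu then card {t. lr_tableau (young mu - young nu) lam t} else 0)"

definition Lambda_set :: "int \<Rightarrow> nat \<Rightarrow> nat \<Rightarrow> nat list set" where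
  "Lambda_set eps l N =
     {lam \<in> partitions l. if eps = 1 then col_len lam 0 + col_len lam 1 \<le> N else 2 * row_len lam 0 \<le> N}"

definition Sigma_set :: "int \<Rightarrow> nat \<Rightarrow> nat \<Rightarrow> nat list set" where
  "Sigma_set eps n N =
     {mu \<in> partitions n. if eps = 1 then col_len mu 0 \<le> N else row_len mu 0 \<le> N}"

definition cl_set :: "int \<Rightarrow> nat \<Rightarrow> nat \<Rightarrow> nat \<Rightarrow> nat list \<Rightarrow> nat list set" where
  "cl_set eps n N f lam =
     {mu \<in> Sigma_set eps n N. young lam \<subseteq> young mu \<and>
        (\<exists>nu\<in>partitions (2 * f). even_partition nu \<and> lr_coeff mu nu lam \<noteq> 0)}"

definition spec_times :: "int \<Rightarrow> nat \<Rightarrow> nat \<Rightarrow> int set" where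
  "spec_times eps n N =
     {(eps * int N - 1) * int f + (content mu - content lam) | f lam mu.
        1 \<le> f \<and> f \<le> n div 2 \<and> lam \<in> Lambda_set eps (n - 2 * f) N \<and> mu \<in> cl_set eps n N f lam}
     \<inter> {eps * int k | k. k \<ge> 1}"

lemma finite_partitions: "finite (partitions m)"
proof (rule finite_subset)
  have "length l \<le> sum_list l" if "0 \<notin> set l" for l :: "nat list"
    using that by (induction l) auto
  then show "partitions m \<subseteq> {l. set l \<subseteq> {..m} \<and> length l \<le> m}"
    by (auto simp: partitions_def dest: member_le_sum_list)
qed (simp add: finite_lists_length_le)

lemma finite_spec_times: "finite (spec_times eps n N)"
proof -
  let ?h = "\<lambda>(f, lam, mu). (eps * int N - 1) * int f + (content mu - content lam)"
  let ?P = "\<Union>m\<le>n. partitions m"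
  have "spec_times eps n N \<subseteq> ?h ` ({..n div 2} \<times> ?P \<times> partitions n)"
  proof
    fix x assume "x \<in> spec_times eps n N"
    then obtain f lam mu where "x = ?h (f, lam, mu)" "f \<le> n div 2"
      "lam \<in> partitions (n - 2 * f)" "mu \<in> partitions n"
      by (auto simp: spec_times_def Lambda_set_def cl_set_def Sigma_set_def)
    moreover from this have "lam \<in> ?P" by (intro UN_I[of "n - 2 * f"]) auto
    ultimately show "x \<in> ?h ` ({..n div 2} \<times> ?P \<times> partitions n)"
      by (intro image_eqI[of _ _ "(f, lam, mu)"]) auto
  qed
  then show ?thesis
    by (rule finite_subset) (auto intro!: finite_imageI finite_cartesian_product finite_partitions)
qed

text \<open>
  The factors of \<open>P\<^sub>n\<close> commute with each other; they are multiplied in increasing order of the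
  elements of the finite set \<open>spec_times eps n N\<close>.
\<close>

definition P_factor :: "nat \<Rightarrow> int \<Rightarrow> brauer" where
  "P_factor n \<alpha> = (\<lambda>b. brauer_one n b - 1 / of_int \<alpha> * A_elem n b)"

definition P_elem :: "int \<Rightarrow> nat \<Rightarrow> nat \<Rightarrow> brauer" where
  "P_elem eps n N =
     foldr (\<lambda>\<alpha> Q. brauer_mult n (of_int (eps * int N)) (P_factor n \<alpha>) Q)
       (sorted_list_of_set (spec_times eps n N)) (brauer_one n)"

end

theory Submission
  imports
    Defs
    "HOL-Computational_Algebra.Fundamental_Theorem_Algebra"
    "HOL-Library.Function_Algebras"
begin

text \<open>
  In an orthonormal (for \<open>\<epsilon> = -1\<close>: symplectic) basis of \<open>V\<close>, the tensors form a Hermitian space on which the symmetric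
  group acts unitarily and every \<open>\<epsilon> d\<^sub>i\<^sub>j\<close> is positive semidefinite. So \<open>A\<^sub>n\<close> is diagonalisable, its kernel consists of
  the traceless tensors, and it suffices that its nonzero eigenvalues \<open>\<alpha>\<close> lie in the given set.

  Let \<open>f\<close> be maximal such that some \<open>f\<close>-fold contraction does not vanish on the eigenspace of \<open>\<alpha>\<close>. The contracted
  tensors are traceless. Choose an eigentensor \<open>w\<close> with nonzero contraction that is a joint eigenvector of the
  Jucys--Murphy elements of the last \<open>n - 2 f\<close> positions, with tableau of shape \<open>\<lambda>\<close>, and a joint eigenvector \<open>v\<close> of
  all Jucys--Murphy elements that is not orthogonal to \<open>w\<close>, with shape \<open>\<mu>\<close> and shape \<open>\<nu>\<close> of the first \<open>2 f\<close> steps.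
  Comparing the Casimir element \<open>(\<Sum>i<j. s\<^sub>i\<^sub>j - d\<^sub>i\<^sub>j)\<close> before and after the contraction gives
  \<open>\<alpha> = (\<epsilon> N - 1) f + c(\<mu>) - c(\<lambda>)\<close>. The rows of \<open>\<nu>\<close> are even because the contraction is invariant under
  permutations of the contracted pairs. The matrix coefficients of the symmetric group between the two vectors satisfy
  Garnir relations on both sides, and the lexicographically extremal nonvanishing one is a Littlewood--Richardson
  tableau of shape \<open>\<mu>/\<nu>\<close> and weight \<open>\<lambda>\<close>. The condition on \<open>\<mu>\<close> is the vanishing of (anti)symmetric tensors with
  too many factors, and the condition on \<open>\<lambda>\<close> follows from the positivity of the norm of \<open>E \<otimes> z\<close> after
  (anti)symmetrisation, for a traceless tensor \<open>z\<close>.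
\<close>

section \<open>Content sequences and Young diagrams\<close>

text \<open>It is enough that the nonzero spectrum of the operator lies in the given set: any
  further \<alpha> there only rescales eigenvectors, and by 1 on the kernel. The Brauer algebra need
  not be semisimple at this parameter, so diagonalisability is a property of its image on tensors
  and comes from positivity. The obstacle is the coefficient \<open>lr_coeff\<close>, which counts
  fillings. Its nonvanishing is not read off from a multiplicity; a filling is produced from one
  nonzero pairing of two vectors. Before that, both vectors are moved inside their representations,
  by exchanges of neighbouring contents that differ by at least 2, until each row of the new cells
  occupies consecutive positions. Then permutations within rows fix the vectors and Garnir relations
  hold also for skew shapes. For \<epsilon> = -1 the symmetric group acts with an extra sign. This
  is why the conditions on \<mu> and \<lambda> are transposed between the two cases: both times they
  speak of tensors antisymmetric in the ordinary sense.\<close>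

text \<open>A standard tableau is encoded by the sequence \<open>a\<close> of the contents of its cells, in the order in which
  they are added: the diagonal of content \<open>c\<close> is filled from the top left, so it has as many cells as \<open>c\<close> has
  occurrences in \<open>a\<close>. Negating the contents transposes the tableau.\<close>

definition content_count :: "(nat \<Rightarrow> int) \<Rightarrow> nat \<Rightarrow> nat \<Rightarrow> int \<Rightarrow> nat" where
  "content_count a lo k c = card {i \<in> {lo..<k}. a i = c}"

text \<open>\<open>min i j\<close> is the index of the cell \<open>(i, j)\<close> on its diagonal,
  counted from 0 at the border, so each diagonal is filled from its border end.\<close>

definition shape :: "(nat \<Rightarrow> int) \<Rightarrow> nat \<Rightarrow> nat \<Rightarrow> (nat \<times> nat) set" where
  "shape a lo k = {(i, j). min i j < content_count a lo k (int j - int i)}"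

text \<open>At most one of \<open>nat (- a k)\<close> and \<open>nat (a k)\<close> is nonzero;
  together they give the border cell of the diagonal with content \<open>a k\<close>. The shift by
  the number of cells already there leads to the next free cell.\<close>

definition cell :: "(nat \<Rightarrow> int) \<Rightarrow> nat \<Rightarrow> nat \<Rightarrow> nat \<times> nat" where
  "cell a lo k = (content_count a lo k (a k) + nat (- a k), content_count a lo k (a k) + nat (a k))"

text \<open>The conditions of Okounkov and Vershik on content vectors. For \<open>q = lo\<close> the
  first clause ranges over an empty interval and so forces \<open>a lo = 0\<close>.\<close>

definition tableau_seq :: "(nat \<Rightarrow> int) \<Rightarrow> nat \<Rightarrow> nat \<Rightarrow> bool" where
  "tableau_seq a lo n \<longleftrightarrow>
     (\<forall>q\<in>{lo..<n}. (0 < a q \<longrightarrow> (\<exists>i\<in>{lo..<q}. a i = a q - 1)) \<and> (a q < 0 \<longrightarrow> (\<exists>i\<in>{lo..<q}. a i = a q + 1))) \<and>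
     (\<forall>p\<in>{lo..<n}. \<forall>q\<in>{p<..<n}. a p = a q \<longrightarrow>
        (\<exists>i\<in>{p<..<q}. a i = a p + 1) \<and> (\<exists>i\<in>{p<..<q}. a i = a p - 1))"

definition downset :: "(nat \<times> nat) set \<Rightarrow> bool" where
  "downset Y \<longleftrightarrow> (\<forall>i j i' j'. (i, j) \<in> Y \<and> i' \<le> i \<and> j' \<le> j \<longrightarrow> (i', j') \<in> Y)"

lemma downsetD: "downset Y \<Longrightarrow> (i, j) \<in> Y \<Longrightarrow> i' \<le> i \<Longrightarrow> j' \<le> j \<Longrightarrow> (i', j') \<in> Y"
  unfolding downset_def by blast

lemma content_count_Suc:
  assumes "lo \<le> k"
  shows "content_count a lo (Suc k) c = content_count a lo k c + (if c = a k then 1 else 0)"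
proof -
  have "{i \<in> {lo..<Suc k}. a i = c} = {i \<in> {lo..<k}. a i = c} \<union> (if c = a k then {k} else {})"
    using assms by (auto simp: less_Suc_eq)
  then show ?thesis unfolding content_count_def by (simp add: card_insert_if)
qed

lemma content_count_mono: "k \<le> k' \<Longrightarrow> content_count a lo k c \<le> content_count a lo k' c"
  unfolding content_count_def by (intro card_mono) auto

lemma content_count_uminus: "content_count (\<lambda>i. - a i) lo k c = content_count a lo k (- c)"
  unfolding content_count_def by (rule arg_cong[of _ _ card]) auto

lemma shape_start [simp]: "shape a lo lo = {}"
  by (simp add: shape_def content_count_def)

lemma shape_uminus: "(i, j) \<in> shape (\<lambda>i. - a i) lo k \<longleftrightarrow> (j, i) \<in> shape a lo k"
  by (simp add: shape_def content_count_uminus min.commute)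

lemma cell_uminus: "cell (\<lambda>i. - a i) lo k = prod.swap (cell a lo k)"
  by (simp add: cell_def content_count_uminus)

lemma cell_content: "int (snd (cell a lo k)) - int (fst (cell a lo k)) = a k"
  by (simp add: cell_def)

lemma cell_notin_shape: "cell a lo k \<notin> shape a lo k"
  by (simp add: shape_def cell_def)

lemma shape_Suc:
  assumes "lo \<le> k"
  shows "shape a lo (Suc k) = insert (cell a lo k) (shape a lo k)"
proof -
  have "(i, j) \<in> shape a lo (Suc k) \<longleftrightarrow> (i, j) = cell a lo k \<or> (i, j) \<in> shape a lo k" for i j
  proof (cases "int j - int i = a k")
    case True
    have "min i j < Suc d \<longleftrightarrow> (i = d + nat (- a k) \<and> j = d + nat (a k)) \<or> min i j < d" for d
    proof -
      have "nat (a k) = j - i" "nat (- a k) = i - j" using True by auto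
      then show ?thesis by (cases "i \<le> j") auto
    qed
    then show ?thesis by (simp add: shape_def cell_def content_count_Suc[OF assms] True)
  next
    case False
    then have "(i, j) \<noteq> cell a lo k" using cell_content by (metis fst_conv snd_conv)
    then show ?thesis using False by (simp add: shape_def content_count_Suc[OF assms])
  qed
  then show ?thesis by auto
qed

lemma finite_shape: "lo \<le> k \<Longrightarrow> finite (shape a lo k)"
  by (induction k rule: dec_induct) (auto simp: shape_Suc)

lemma card_shape: "lo \<le> k \<Longrightarrow> card (shape a lo k) = k - lo"
  by (induction k rule: dec_induct)
    (auto simp: shape_Suc finite_shape cell_notin_shape Suc_diff_le)

lemma sum_content_shape: "lo \<le> k \<Longrightarrow> (\<Sum>(i, j)\<in>shape a lo k. int j - int i) = (\<Sum>k\<in>{lo..<k}. a k)"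
proof (induction k rule: dec_induct)
  case (step k)
  then show ?case
    using cell_content[of a lo k]
    by (simp add: shape_Suc finite_shape cell_notin_shape split_beta)
qed simp

lemma shape_mono: "k \<le> k' \<Longrightarrow> shape a lo k \<subseteq> shape a lo k'"
  using content_count_mono by (force simp: shape_def intro: less_le_trans)

lemma shape_eq_cells:
  assumes "lo \<le> lo'" "lo' \<le> k"
  shows "shape a lo k = shape a lo lo' \<union> cell a lo ` {lo'..<k}"
  using assms(2)
proof (induction k rule: dec_induct)
  case (step k)
  then show ?case using assms(1) by (auto simp: shape_Suc atLeastLessThanSuc)
qed simp

lemma inj_on_cell: "inj_on (cell a lo) {lo..}"
proof (rule linorder_inj_onI)
  fix x y assume "x < y" "x \<in> {lo..}"
  then have "cell a lo x \<in> shape a lo (Suc x)" "shape a lo (Suc x) \<subseteq> shape a lo y"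
    using shape_mono[of "Suc x" y a lo] by (auto simp: shape_Suc)
  then show "cell a lo x \<noteq> cell a lo y" using cell_notin_shape[of a lo y] by auto
qed auto

lemma tableau_seq_uminus:
  assumes "tableau_seq a lo n"
  shows "tableau_seq (\<lambda>i. - a i) lo n"
proof -
  have eq: "- a i = - a q - 1 \<longleftrightarrow> a i = a q + 1" "- a i = - a q + 1 \<longleftrightarrow> a i = a q - 1" for i q by auto
  show ?thesis
    unfolding tableau_seq_def eq neg_0_less_iff_less neg_less_0_iff_less neg_equal_iff_equal
    using assms unfolding tableau_seq_def by blast
qed

section \<open>Content sequences build Young diagrams\<close>

lemma tableau_seq_between:
  assumes "tableau_seq a lo n" "lo \<le> p" "p < q" "q < n" "a p = a q"
  shows "\<exists>i. p < i \<and> i < q \<and> a i = a p + 1"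
proof -
  have "p \<in> {lo..<n}" "q \<in> {p<..<n}" using assms by auto
  then have "\<exists>i\<in>{p<..<q}. a i = a p + 1" using assms unfolding tableau_seq_def by blast
  then show ?thesis by auto
qed

lemma tableau_seq_neg:
  assumes "tableau_seq a lo n" "lo \<le> q" "q < n" "a q < 0"
  shows "\<exists>i\<in>{lo..<q}. a i = a q + 1"
  using assms unfolding tableau_seq_def by auto

text \<open>The upper neighbour lies on the diagonal of content \<open>a k + 1\<close>. If the
  diagonal of the new cell is still empty, the first clause of \<open>tableau_seq\<close> supplies
  the first cell of that diagonal. Otherwise a step with content \<open>a k + 1\<close> occurs after
  the last earlier step \<open>p\<close> with content \<open>a k\<close>: closedness of the diagram
  after \<open>p\<close> gives all cells needed but one, and the later step adds this one.\<close>

lemma cell_above: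
  assumes a: "tableau_seq a lo n" and k: "lo \<le> k" "k < n"
    and IH: "\<And>k'. lo \<le> k' \<Longrightarrow> k' \<le> k \<Longrightarrow> downset (shape a lo k')"
    and c: "cell a lo k = (Suc i, j)"
  shows "(i, j) \<in> shape a lo k"
proof -
  define d where "d = content_count a lo k (a k)"
  have ij: "Suc i = d + nat (- a k)" "j = d + nat (a k)" using c by (auto simp: cell_def d_def)
  have co: "int j - int i = a k + 1" using cell_content[of a lo k] c by simp
  have pos: "content_count a lo q c > 0" if "p \<in> {lo..<q}" "a p = c" for p q c
  proof -
    have "{i \<in> {lo..<q}. a i = c} \<noteq> {}" using that by blast
    then show ?thesis unfolding content_count_def by (simp add: card_gt_0_iff)
  qed
  show ?thesis
  proof (cases "d = 0")
    case True
    then have "a k < 0" "j = 0" using ij by auto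
    then obtain p where "p \<in> {lo..<k}" "a p = a k + 1" using tableau_seq_neg[OF a k] by blast
    then have "content_count a lo k (a k + 1) > 0" by (rule pos)
    then show ?thesis using co \<open>j = 0\<close> by (simp add: shape_def)
  next
    case False
    define S where "S = {i \<in> {lo..<k}. a i = a k}"
    have "S \<noteq> {}" "finite S" using False by (auto simp: d_def content_count_def S_def card_eq_0_iff)
    define p where "p = Max S"
    have p: "p \<in> S" unfolding p_def using \<open>S \<noteq> {}\<close> \<open>finite S\<close> by simp
    then have p': "p \<in> {lo..<k}" "a p = a k" by (auto simp: S_def)
    have pmax: "q \<le> p" if "q \<in> S" for q unfolding p_def using \<open>finite S\<close> that by simp
    obtain q where q: "p < q" "q < k" "a q = a k + 1"
      using tableau_seq_between[OF a, of p k] k p' by auto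
    have "{i \<in> {lo..<Suc p}. a i = a k} = S" using p' pmax by (fastforce simp: S_def less_Suc_eq_le)
    then have "content_count a lo (Suc p) (a k) = d" by (simp add: content_count_def d_def S_def)
    moreover have "int (j - 1) - int i = a k" "min i (j - 1) < d"
    proof -
      show "int (j - 1) - int i = a k" using ij False co by linarith
      show "min i (j - 1) < d" using ij False by (cases "0 \<le> a k") auto
    qed
    ultimately have in_p: "(i, j - 1) \<in> shape a lo (Suc p)" by (simp add: shape_def)
    have "Suc (content_count a lo (Suc p) (a k + 1)) \<le> content_count a lo (Suc q) (a k + 1)"
      using content_count_mono[of "Suc p" q a lo "a k + 1"] q p' by (simp add: content_count_Suc)
    also have "\<dots> \<le> content_count a lo k (a k + 1)" using q by (intro content_count_mono) simp
    finally have step: "Suc (content_count a lo (Suc p) (a k + 1)) \<le> content_count a lo k (a k + 1)" .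
    show ?thesis
    proof (cases i)
      case 0
      then show ?thesis using step co by (simp add: shape_def)
    next
      case (Suc i')
      have "downset (shape a lo (Suc p))" using p' by (intro IH) auto
      then have "(i', j - 1) \<in> shape a lo (Suc p)"
        using in_p Suc downsetD[of "shape a lo (Suc p)" i "j - 1" i' "j - 1"] by simp
      moreover have "int (j - 1) - int i' = a k + 1" using co Suc ij False by (simp add: of_nat_diff)
      ultimately have "min i' (j - 1) < content_count a lo (Suc p) (a k + 1)" by (simp add: shape_def)
      then have "min i j < content_count a lo k (a k + 1)" using step Suc by (auto simp: min_def split: if_splits)
      then show ?thesis using co by (simp add: shape_def)
    qed
  qed
qed

lemma downset_uminus: "downset (shape (\<lambda>i. - a i) lo k) \<longleftrightarrow> downset (shape a lo k)"
  unfolding downset_def shape_uminus by blast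

lemma downset_shape:
  assumes a: "tableau_seq a lo n" and k: "lo \<le> k" "k \<le> n"
  shows "downset (shape a lo k)"
  using k
proof (induction k rule: less_induct)
  case (less k)
  show ?case
  proof (cases "k = lo")
    case True then show ?thesis by (simp add: downset_def)
  next
    case False
    then obtain m where m: "k = Suc m" "lo \<le> m" "m < n" using less.prems by (cases k) auto
    have IH: "downset (shape a lo k')" if "lo \<le> k'" "k' \<le> m" for k'
      using less.IH[of k'] that m by simp
    obtain i j where c: "cell a lo m = (i, j)" by fastforce
    have up: "(i', j) \<in> shape a lo m" if "i = Suc i'" for i'
      using cell_above[OF a m(2,3) IH] c that by simp
    \<comment> \<open>The transposed tableau has the negated contents, so the left neighbour is an
      upper neighbour there.\<close>
    have left: "(i, j') \<in> shape a lo m" if "j = Suc j'" for j'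
      using cell_above[OF tableau_seq_uminus[OF a] m(2,3), of j' i] IH c that
      by (simp add: downset_uminus cell_uminus shape_uminus)
    have "downset (insert (i, j) (shape a lo m))"
      unfolding downset_def
    proof (intro allI impI, elim conjE)
      fix x y i' j' assume xy: "(x, y) \<in> insert (i, j) (shape a lo m)" "i' \<le> x" "j' \<le> y"
      show "(i', j') \<in> insert (i, j) (shape a lo m)"
      proof (cases "(x, y) = (i, j)")
        case False
        then show ?thesis using xy downsetD[OF IH[OF m(2) order_refl]] by auto
      next
        case True
        show ?thesis
        proof (cases "i' = i \<and> j' = j")
          case False
          then consider "i' < i" | "j' < j" using xy True by fastforce
          then show ?thesis
          proof cases
            case 1
            then show ?thesis using up[of "i - 1"] xy True downsetD[OF IH[OF m(2) order_refl], of "i - 1" j i' j'] by auto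
          next
            case 2
            then show ?thesis using left[of "j - 1"] xy True downsetD[OF IH[OF m(2) order_refl], of i "j - 1" i' j'] by auto
          qed
        qed simp
      qed
    qed
    then show ?thesis using m c by (simp add: shape_Suc)
  qed
qed

text \<open>A cell added in a higher row must lie in a column further to the right, since the
  diagram is closed; its content would then exceed the previous one by at least 2.\<close>

lemma row_cell_mono:
  assumes a: "tableau_seq a lo n" and k: "lo \<le> k" "Suc k < n" and le: "a (Suc k) \<le> a k + 1"
  shows "fst (cell a lo k) \<le> fst (cell a lo (Suc k))"
proof (rule ccontr)
  obtain i j i' j' where c: "cell a lo k = (i, j)" "cell a lo (Suc k) = (i', j')" by fastforce
  assume "\<not> ?thesis"
  then have lt: "i' < i" using c by simp
  have ds: "downset (shape a lo (Suc k))" using assms by (intro downset_shape) auto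
  have "(i, j) \<in> shape a lo (Suc k)" "(i', j') \<notin> shape a lo (Suc k)"
    using c k cell_notin_shape[of a lo "Suc k"] by (auto simp: shape_Suc)
  then have "j < j'" using lt downsetD[OF ds, of i j i' j'] by linarith
  then show False using le lt cell_content[of a lo k] cell_content[of a lo "Suc k"] c by simp
qed

lemma row_cell_mono':
  assumes a: "tableau_seq a lo n" and lo': "lo \<le> lo'"
    and sorted: "\<And>k. lo' \<le> k \<Longrightarrow> Suc k < n \<Longrightarrow> a (Suc k) \<le> a k + 1"
    and kl: "lo' \<le> k" "k \<le> l" "l < n"
  shows "fst (cell a lo k) \<le> fst (cell a lo l)"
  using kl(2,1,3)
proof (induction l rule: dec_induct)
  case (step l)
  then show ?case using row_cell_mono[OF a, of l] sorted[of l] lo' by fastforce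
qed simp

lemma col_cell_less:
  assumes a: "tableau_seq a lo n" and k: "lo \<le> k" "k < l" "l < n"
    and r: "fst (cell a lo k) = fst (cell a lo l)"
  shows "snd (cell a lo k) < snd (cell a lo l)"
proof (rule ccontr)
  assume neg: "\<not> ?thesis"
  obtain i j j' where c: "cell a lo k = (i, j)" "cell a lo l = (i, j')"
    using r by (cases "cell a lo k"; cases "cell a lo l") auto
  have "cell a lo k \<in> shape a lo l"
    using k shape_mono[of "Suc k" l a lo] by (auto simp: shape_Suc)
  then have "(i, j') \<in> shape a lo l"
    using downset_shape[OF a, of l] k c neg downsetD[of "shape a lo l" i j i j'] by simp
  then show False using cell_notin_shape[of a lo l] c by simp
qed

text \<open>The place to the right of the first cell belongs to the diagram after both steps but not
  before them, so the second step must fill it.\<close>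

lemma same_row_consecutive:
  assumes a: "tableau_seq a lo n" and k: "lo \<le> k" "Suc k < n"
    and r: "fst (cell a lo k) = fst (cell a lo (Suc k))"
  shows "a (Suc k) = a k + 1"
proof -
  obtain i j j' where c: "cell a lo k = (i, j)" "cell a lo (Suc k) = (i, j')"
    using r by (cases "cell a lo k"; cases "cell a lo (Suc k)") auto
  have "j < j'" using col_cell_less[OF a k(1) _ k(2) r] c by simp
  have "(i, j') \<in> shape a lo (Suc (Suc k))" using k c by (simp add: shape_Suc)
  then have "(i, j + 1) \<in> shape a lo (Suc (Suc k))"
    using downset_shape[OF a, of "Suc (Suc k)"] k \<open>j < j'\<close>
      downsetD[of "shape a lo (Suc (Suc k))" i j' i "j + 1"] by simp
  moreover have "(i, j + 1) \<notin> shape a lo k"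
  proof
    assume "(i, j + 1) \<in> shape a lo k"
    then have "(i, j) \<in> shape a lo k"
      using downset_shape[OF a, of k] k downsetD[of "shape a lo k" i "j + 1" i j] by simp
    then show False using cell_notin_shape[of a lo k] c by simp
  qed
  ultimately have "(i, j + 1) = cell a lo (Suc k)" using k c by (auto simp: shape_Suc)
  then show ?thesis using c cell_content[of a lo k] cell_content[of a lo "Suc k"] by simp
qed

text \<open>The second cell lies on the next diagonal. Further up on it the place is already
  occupied; further down, closedness would require the right neighbour of the first cell to be
  present before that cell itself.\<close>

lemma consecutive_same_row:
  assumes a: "tableau_seq a lo n" and k: "lo \<le> k" "Suc k < n" and suc: "a (Suc k) = a k + 1"
  shows "fst (cell a lo (Suc k)) = fst (cell a lo k)"
proof -
  obtain i j i' j' where c: "cell a lo k = (i, j)" "cell a lo (Suc k) = (i', j')" by fastforce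
  have co: "int j' - int i' = int j - int i + 1"
    using cell_content[of a lo k] cell_content[of a lo "Suc k"] c suc by simp
  have ds: "downset (shape a lo k)" "downset (shape a lo (Suc k))" "downset (shape a lo (Suc (Suc k)))"
    using a k by (auto intro!: downset_shape)
  have mem: "(i, j) \<in> shape a lo (Suc k)" "(i, j) \<notin> shape a lo k" "(i', j') \<notin> shape a lo (Suc k)"
    "(i', j') \<in> shape a lo (Suc (Suc k))"
    using c k cell_notin_shape[of a lo k] cell_notin_shape[of a lo "Suc k"] by (auto simp: shape_Suc)
  have "\<not> i' < i" using downsetD[OF ds(2) mem(1), of i' j'] mem(3) co by force
  moreover have "\<not> i < i'"
  proof
    assume lt: "i < i'"
    have "(i, j + 1) \<in> shape a lo (Suc (Suc k))" using co lt by (intro downsetD[OF ds(3) mem(4)]) auto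
    then have "(i, j + 1) \<in> shape a lo k" using k c lt by (auto simp: shape_Suc)
    then have "(i, j) \<in> shape a lo k" using downsetD[OF ds(1)] by auto
    then show False using mem by simp
  qed
  ultimately show ?thesis using c by simp
qed

section \<open>Row lengths and partitions\<close>

definition row_card :: "(nat \<times> nat) set \<Rightarrow> nat \<Rightarrow> nat" where
  "row_card Y i = card {j. (i, j) \<in> Y}"

lemma finite_row: "finite Y \<Longrightarrow> finite {j. (i, j) \<in> Y}"
  using finite_vimageI[of Y "Pair i"] by (simp add: vimage_def inj_on_def)

lemma downset_row:
  assumes "downset Y" "finite Y"
  shows "(i, j) \<in> Y \<longleftrightarrow> j < row_card Y i"
proof -
  have *: "A = {..<card A}" if "finite A" "\<And>x y. x \<in> A \<Longrightarrow> y \<le> x \<Longrightarrow> y \<in> A" for A :: "nat set"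
  proof (cases "A = {}")
    case False
    then have "A = {..Max A}" using that by (auto intro: Max_ge Max_in)
    then show ?thesis by (metis card_atMost lessThan_Suc_atMost)
  qed simp
  have "{j. (i, j) \<in> Y} = {..<row_card Y i}"
    unfolding row_card_def
    by (rule *) (use assms finite_row in \<open>auto dest: downsetD\<close>)
  then show ?thesis by blast
qed

lemma row_card_antimono:
  assumes "downset Y" "finite Y" "i \<le> i'"
  shows "row_card Y i' \<le> row_card Y i"
  unfolding row_card_def using assms finite_row[OF assms(2)]
  by (intro card_mono) (auto dest: downsetD)

text \<open>Each two steps add a horizontal domino, because contents increasing by 1 stay in one
  row; so every row length changes by 0 or 2.\<close>

lemma even_rows:
  assumes a: "tableau_seq a 0 n" and le: "2 * f \<le> n"
    and dom: "\<And>k. k < f \<Longrightarrow> a (2 * k + 1) = a (2 * k) + 1"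
  shows "even (row_card (shape a 0 (2 * f)) i)"
  using le dom
proof (induction f)
  case (Suc f)
  let ?Y = "shape a 0 (2 * f)"
  have r: "fst (cell a 0 (2 * f + 1)) = fst (cell a 0 (2 * f))"
    using consecutive_same_row[OF a, of "2 * f"] Suc.prems by simp
  have Y: "shape a 0 (2 * Suc f) = insert (cell a 0 (2 * f + 1)) (insert (cell a 0 (2 * f)) ?Y)"
    by (simp add: shape_Suc)
  have ne: "cell a 0 (2 * f) \<notin> ?Y" "cell a 0 (2 * f + 1) \<notin> ?Y" "cell a 0 (2 * f + 1) \<noteq> cell a 0 (2 * f)"
    using cell_notin_shape[of a 0 "2 * f"] cell_notin_shape[of a 0 "2 * f + 1"] by (auto simp: shape_Suc)
  show ?case
  proof (cases "fst (cell a 0 (2 * f)) = i")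
    case True
    then obtain j j' where c: "cell a 0 (2 * f) = (i, j)" "cell a 0 (2 * f + 1) = (i, j')"
      using r by (metis prod.collapse)
    have "{x. (i, x) \<in> shape a 0 (2 * Suc f)} = insert j' (insert j {x. (i, x) \<in> ?Y})"
      unfolding Y using c by auto
    then have "row_card (shape a 0 (2 * Suc f)) i = Suc (Suc (row_card ?Y i))"
      using ne c finite_row[OF finite_shape[of 0 "2 * f" a], of i] by (simp add: row_card_def)
    then show ?thesis using Suc by simp
  next
    case False
    then have "{x. (i, x) \<in> shape a 0 (2 * Suc f)} = {x. (i, x) \<in> ?Y}"
      unfolding Y using r by (auto dest: arg_cong[where f = fst])
    then show ?thesis using Suc by (simp add: row_card_def)
  qed
qed (simp add: row_card_def)

lemma partition_of_downset:
  assumes "downset Y" "finite Y"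
  obtains l where "l \<in> partitions (card Y)" "young l = Y" "l = map (row_card Y) [0..<length l]"
    "\<And>i. row_card Y i > 0 \<longleftrightarrow> i < length l"
proof
  \<comment> \<open>The transposed diagram serves to count the rows: its first row is the first
    column of \<open>Y\<close>.\<close>
  define Y' where "Y' = {(j, i). (i, j) \<in> Y}"
  define h where "h = row_card Y' 0"
  define l where "l = map (row_card Y) [0..<h]"
  have Y': "finite Y'" "downset Y'"
  proof -
    have "Y' = prod.swap ` Y" by (force simp: Y'_def)
    then show "finite Y'" using assms by simp
    show "downset Y'" using assms(1) unfolding downset_def Y'_def by blast
  qed
  have pos: "row_card Y i > 0 \<longleftrightarrow> i < h" for i
    using downset_row[OF assms, of i 0] downset_row[OF Y'(2,1), of 0 i] by (simp add: Y'_def h_def)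
  show len: "row_card Y i > 0 \<longleftrightarrow> i < length l" for i using pos by (simp add: l_def)
  show "l = map (row_card Y) [0..<length l]" by (simp add: l_def)
  show young: "young l = Y"
  proof -
    have "(i, j) \<in> young l \<longleftrightarrow> (i, j) \<in> Y" for i j
      using downset_row[OF assms, of i j] pos[of i] by (auto simp: young_def l_def)
    then show ?thesis by auto
  qed
  have "card (young l) = sum_list l" for l
  proof -
    have "young l = (SIGMA i:{..<length l}. {..<l ! i})" by (auto simp: young_def)
    then have "card (young l) = (\<Sum>i<length l. l ! i)" by simp
    then show ?thesis by (simp add: sum_list_sum_nth lessThan_atLeast0)
  qed
  then have "sum_list l = card Y" using young by metis
  moreover have "sorted_wrt (\<ge>) l"
    using row_card_antimono[OF assms] by (auto simp: l_def sorted_wrt_iff_nth_less)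
  moreover have "0 \<notin> set l"
  proof
    assume "0 \<in> set l"
    then obtain i where "i < h" "row_card Y i = 0" by (auto simp: l_def)
    then show False using pos[of i] by simp
  qed
  ultimately show "l \<in> partitions (card Y)" by (simp add: partitions_def)
qed

text \<open>Sorting by exchanges of neighbours: a minimiser of \<open>\<Sum>k. k * a k\<close> admits no further exchange.\<close>

lemma sorting:
  fixes a :: "nat \<Rightarrow> int"
  assumes P: "P a"
    and step: "\<And>b k. P b \<Longrightarrow> lo \<le> k \<Longrightarrow> Suc k < n \<Longrightarrow> b k + 2 \<le> b (Suc k) \<Longrightarrow> P (b \<circ> transpose k (Suc k))"
  obtains \<pi> where "\<pi> permutes {lo..<n}" "P (a \<circ> \<pi>)"
    "\<And>k. lo \<le> k \<Longrightarrow> Suc k < n \<Longrightarrow> (a \<circ> \<pi>) (Suc k) \<le> (a \<circ> \<pi>) k + 1"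
proof -
  define Q where "Q = {\<pi>. \<pi> permutes {lo..<n} \<and> P (a \<circ> \<pi>)}"
  define m where "m = (\<lambda>\<pi>. \<Sum>k\<in>{lo..<n}. int k * a (\<pi> k))"
  have "finite Q" unfolding Q_def by (rule finite_subset[OF _ finite_permutations[of "{lo..<n}"]]) auto
  moreover have "id \<in> Q" using P by (simp add: Q_def permutes_id)
  ultimately obtain \<pi> where \<pi>: "\<pi> \<in> Q" "\<And>\<sigma>. \<sigma> \<in> Q \<Longrightarrow> \<not> m \<sigma> < m \<pi>"
    using ex_min_if_finite[of "m ` Q"] by auto
  show thesis
  proof (rule that[of \<pi>])
    fix k assume k: "lo \<le> k" "Suc k < n"
    show "(a \<circ> \<pi>) (Suc k) \<le> (a \<circ> \<pi>) k + 1"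
    proof (rule ccontr)
      assume "\<not> ?thesis"
      then have far: "(a \<circ> \<pi>) k + 2 \<le> (a \<circ> \<pi>) (Suc k)" by simp
      let ?\<sigma> = "\<pi> \<circ> transpose k (Suc k)"
      have "?\<sigma> permutes {lo..<n}"
        using \<pi>(1) k by (intro permutes_compose permutes_swap_id) (auto simp: Q_def)
      moreover have "P (a \<circ> ?\<sigma>)" using step[of "a \<circ> \<pi>" k] k far \<pi>(1) by (simp add: Q_def comp_assoc del: comp_apply)
      ultimately have "?\<sigma> \<in> Q" by (simp add: Q_def)
      have "{lo..<n} = insert k (insert (Suc k) ({lo..<n} - {k, Suc k}))" using k by auto
      then have sum: "sum h {lo..<n} = h k + (h (Suc k) + sum h ({lo..<n} - {k, Suc k}))" for h :: "nat \<Rightarrow> int"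
        by (smt (verit) Diff_iff finite.simps finite_Diff finite_atLeastLessThan insertCI insertE n_not_Suc_n sum.insert)
      have "(\<Sum>x\<in>{lo..<n} - {k, Suc k}. int x * a (?\<sigma> x)) = (\<Sum>x\<in>{lo..<n} - {k, Suc k}. int x * a (\<pi> x))"
        by (intro sum.cong) (auto simp: transpose_def)
      then have "m ?\<sigma> < m \<pi>" using far by (simp add: m_def sum algebra_simps)
      then show False using \<pi>(2) \<open>?\<sigma> \<in> Q\<close> by blast
    qed
  qed (use \<pi>(1) in \<open>auto simp: Q_def\<close>)
qed

lemma content_count_permute:
  assumes "\<pi> permutes {lo'..<n}" "lo \<le> lo'"
  shows "content_count (a \<circ> \<pi>) lo n c = content_count a lo n c"
proof -
  have \<pi>: "\<pi> permutes {lo..<n}" using assms by (auto intro: permutes_subset)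
  have "\<pi> ` {i \<in> {lo..<n}. a (\<pi> i) = c} = {i \<in> \<pi> ` {lo..<n}. a i = c}" by blast
  then have "bij_betw \<pi> {i \<in> {lo..<n}. (a \<circ> \<pi>) i = c} {i \<in> {lo..<n}. a i = c}"
    using permutes_inj[OF \<pi>] by (simp add: bij_betw_def permutes_image[OF \<pi>] inj_on_subset[of _ UNIV])
  then show ?thesis unfolding content_count_def by (rule bij_betw_same_card)
qed

lemma shape_permute:
  assumes "\<pi> permutes {lo'..<n}" "lo \<le> lo'"
  shows "shape (a \<circ> \<pi>) lo n = shape a lo n"
  by (simp add: shape_def content_count_permute[OF assms])

section \<open>Lexicographically least monomials\<close>

text \<open>The monomial with exponent vector \<open>b\<close>, evaluated at the points
  \<open>y ! j + t\<close>, as a polynomial in \<open>t\<close>.\<close>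

definition shift_prod :: "complex list \<Rightarrow> nat list \<Rightarrow> complex poly" where
  "shift_prod y b = (\<Prod>j<length y. [:y ! j, 1:] ^ (b ! j))"

lemma shift_prod_Cons:
  "shift_prod (y0 # y) (b0 # b) = [:y0, 1:] ^ b0 * shift_prod y b"
  by (simp add: shift_prod_def prod.lessThan_Suc_shift del: prod.lessThan_Suc)

lemma shift_prod_Nil [simp]: "shift_prod [] b = 1"
  by (simp add: shift_prod_def)

lemma tail_set:
  assumes "finite S" "\<forall>b\<in>S. length b = Suc J"
  shows "bij_betw tl {b\<in>S. hd b = \<beta>} {b'. \<beta> # b' \<in> S}" "finite {b'. \<beta> # b' \<in> S}"
proof -
  have "{b\<in>S. hd b = \<beta>} = (#) \<beta> ` {b'. \<beta> # b' \<in> S}"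
  proof (intro set_eqI iffI)
    fix b assume "b \<in> {b\<in>S. hd b = \<beta>}"
    then have "b = \<beta> # tl b" "b \<in> S" using assms(2) by (cases b; auto)+
    then show "b \<in> (#) \<beta> ` {b'. \<beta> # b' \<in> S}" by auto
  qed auto
  then show "bij_betw tl {b\<in>S. hd b = \<beta>} {b'. \<beta> # b' \<in> S}"
    by (auto simp: bij_betw_def inj_on_def image_image)
  show "finite {b'. \<beta> # b' \<in> S}"
    using finite_vimageI[OF assms(1), of "(#) \<beta>"] by (simp add: vimage_def)
qed

text \<open>One exponent of the first variable is isolated as a coefficient of \<open>R\<close>,
  which is nonzero by the induction hypothesis. A nonzero \<open>R\<close> has only finitely many
  roots, so some value \<open>[:y0, 1:]\<close> of the first variable is not among them.\<close>

lemma exists_nonzero_value: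
  fixes c :: "nat list \<Rightarrow> complex"
  assumes "finite S" "S \<noteq> {}" "\<forall>b\<in>S. length b = J \<and> c b \<noteq> 0"
  shows "\<exists>y. length y = J \<and> (\<Sum>b\<in>S. [:c b:] * shift_prod y b) \<noteq> 0"
  using assms
proof (induction J arbitrary: S c)
  case 0
  then have "S = {[]}" by auto
  then show ?case using 0 by auto
next
  case (Suc J)
  obtain b0 where b0: "b0 \<in> S" using Suc.prems by auto
  define \<beta> where "\<beta> = hd b0"
  define S' where "S' = {b'. \<beta> # b' \<in> S}"
  have len: "\<forall>b\<in>S. length b = Suc J" using Suc.prems by auto
  have "tl b0 \<in> S'" using b0 len by (cases b0) (auto simp: S'_def \<beta>_def)
  then have S': "S' \<noteq> {}" "finite S'" using tail_set(2)[OF Suc.prems(1) len] by (auto simp: S'_def)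
  have "\<forall>b\<in>S'. length b = J \<and> c (\<beta> # b) \<noteq> 0" using Suc.prems by (auto simp: S'_def)
  from Suc.IH[OF S'(2) S'(1) this] obtain y where y: "length y = J"
    "(\<Sum>b\<in>S'. [:c (\<beta> # b):] * shift_prod y b) \<noteq> 0" (is "?Q \<noteq> 0") by auto
  define R :: "complex poly poly" where
    "R = (\<Sum>b\<in>S. monom ([:c b:] * shift_prod y (tl b)) (hd b))"
  have "coeff R \<beta> = (\<Sum>b\<in>S. if hd b = \<beta> then [:c b:] * shift_prod y (tl b) else 0)"
    by (auto simp: R_def coeff_sum intro!: sum.cong)
  also have "\<dots> = (\<Sum>b\<in>{b\<in>S. hd b = \<beta>}. [:c b:] * shift_prod y (tl b))"
    using Suc.prems(1) by (rule sum.inter_filter[symmetric])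
  also have "\<dots> = (\<Sum>b\<in>{b\<in>S. hd b = \<beta>}. [:c (\<beta> # tl b):] * shift_prod y (tl b))"
  proof (rule sum.cong[OF refl])
    fix b assume "b \<in> {b \<in> S. hd b = \<beta>}"
    then have "b = \<beta> # tl b" using len by (cases b) auto
    then show "[:c b:] * shift_prod y (tl b) = [:c (\<beta> # tl b):] * shift_prod y (tl b)" by simp
  qed
  also have "\<dots> = ?Q" unfolding S'_def
    by (rule sum.reindex_bij_betw[OF tail_set(1)[OF Suc.prems(1) len]])
  finally have "R \<noteq> 0" using y by auto
  then obtain i where i: "coeff R i \<noteq> 0" by (metis leading_coeff_0_iff)
  \<comment> \<open>evaluate the outer variable at \<open>t + y0\<close>, for a number \<open>y0\<close>\<close>
  have "\<exists>y0. poly R [:y0, 1:] \<noteq> 0"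
  proof (rule ccontr)
    assume "\<not> ?thesis"
    then have "range (\<lambda>y0. [:y0, 1:]) \<subseteq> {x. poly R x = 0}" by auto
    moreover have "finite {x. poly R x = 0}" using \<open>R \<noteq> 0\<close> by (rule poly_roots_finite)
    ultimately have "finite (range (\<lambda>y0::complex. [:y0, 1:]))" by (rule finite_subset)
    then have "finite (UNIV::complex set)" by (rule finite_imageD) (auto simp: inj_on_def)
    then show False using infinite_UNIV_char_0 by blast
  qed
  then obtain y0 where y0: "poly R [:y0, 1:] \<noteq> 0" by auto
  have "poly R [:y0, 1:] = (\<Sum>b\<in>S. [:c b:] * shift_prod (y0 # y) b)"
    unfolding R_def poly_sum
  proof (rule sum.cong[OF refl])
    fix b assume "b \<in> S"
    then have "b = hd b # tl b" using len by (cases b) auto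
    then have "shift_prod (y0 # y) b = [:y0, 1:] ^ hd b * shift_prod y (tl b)"
      by (metis shift_prod_Cons)
    then show "poly (monom ([:c b:] * shift_prod y (tl b)) (hd b)) [:y0, 1:] =
      [:c b:] * shift_prod (y0 # y) b" by (simp add: poly_monom mult_ac)
  qed
  then show ?case using y0 y(1) by (intro exI[of _ "y0 # y"]) auto
qed

text \<open>For fixed \<open>j\<close> the coefficient of \<open>t ^ j\<close> in
  \<open>poly R [:y0:]\<close> is a polynomial in \<open>y0\<close>. For \<open>j > K\<close> it
  vanishes at every number, hence identically.\<close>

lemma degree_coeff_le:
  fixes R :: "complex poly poly"
  assumes "\<And>y0. degree (poly R [:y0:]) \<le> K"
  shows "degree (coeff R i) \<le> K"
proof (rule degree_le, intro allI impI)
  fix j assume j: "K < j"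
  have "poly (map_poly (\<lambda>p. coeff p j) R) y0 = 0" for y0
  proof -
    have "coeff (poly R [:y0:]) j = (\<Sum>i\<le>degree R. coeff (coeff R i * [:y0:] ^ i) j)"
      by (simp add: poly_altdef coeff_sum)
    also have "\<dots> = (\<Sum>i\<le>degree R. coeff (coeff R i) j * y0 ^ i)"
    proof -
      have "[:y0:] ^ i = [:y0 ^ i:]" for i by (simp add: poly_const_pow)
      then show ?thesis by (simp add: mult.commute)
    qed
    also have "\<dots> = poly (map_poly (\<lambda>p. coeff p j) R) y0"
    proof -
      have "degree (map_poly (\<lambda>p. coeff p j) R) \<le> degree R" by (intro degree_le) (simp add: coeff_map_poly coeff_eq_0)
      then have "poly (map_poly (\<lambda>p. coeff p j) R) y0 =
         (\<Sum>i\<le>degree R. coeff (map_poly (\<lambda>p. coeff p j) R) i * y0 ^ i)"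
        unfolding poly_altdef by (intro sum.mono_neutral_left) (auto simp: coeff_eq_0)
      then show ?thesis by (simp add: coeff_map_poly)
    qed
    finally show ?thesis using assms[of y0] j by (simp add: coeff_eq_0)
  qed
  then have "map_poly (\<lambda>p. coeff p j) R = 0" using poly_all_0_iff_0 by blast
  then have "coeff (map_poly (\<lambda>p. coeff p j) R) i = 0" by simp
  then show "coeff (coeff R i) j = 0" by (simp add: coeff_map_poly)
qed

lemma degree_poly_le:
  fixes R :: "complex poly poly"
  assumes "\<And>i. degree (coeff R i) \<le> K" "degree R \<le> d" "degree q \<le> 1"
  shows "degree (poly R q) \<le> K + d"
  unfolding poly_altdef
proof (rule degree_sum_le)
  fix i assume i: "i \<in> {..degree R}"
  have "degree (coeff R i * q ^ i) \<le> degree (coeff R i) + degree (q ^ i)" by (rule degree_mult_le)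
  also have "degree (q ^ i) \<le> degree q * i" by (rule degree_power_le)
  also have "degree q * i \<le> 1 * i" using assms(3) by (rule mult_right_mono) simp
  also have "degree (coeff R i) \<le> K" by (rule assms(1))
  finally show "degree (coeff R i * q ^ i) \<le> K + d" using i assms(2) by auto
qed simp

text \<open>The idea: with \<open>\<beta>\<close> the exponent of the first variable in the lexicographically least monomial, divide by
  \<open>(y\<^sub>0 + t)\<^sup>\<beta>\<close> and put \<open>y\<^sub>0 = - t\<close>; this isolates the monomials with exponent \<open>\<beta>\<close>.\<close>

lemma lex_min_exponent_bound:
  fixes c :: "nat list \<Rightarrow> complex"
  assumes "finite S" "\<forall>b\<in>S. length b = J \<and> c b \<noteq> 0 \<and> (\<forall>j<J. b ! j \<le> r ! j)" "length r = J"
    and "bs \<in> S" "\<forall>b\<in>S. b \<noteq> bs \<longrightarrow> (\<exists>j<J. bs ! j < b ! j \<and> (\<forall>l<j. b ! l = bs ! l))"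
    and "\<forall>y. length y = J \<longrightarrow> degree (\<Sum>b\<in>S. [:c b:] * shift_prod y b) \<le> k"
    and "j < J"
  shows "(\<Sum>l\<le>j. bs ! l) + (\<Sum>l<j. bs ! l) \<le> (\<Sum>l<j. r ! l) + k"
  using assms
proof (induction J arbitrary: S c r bs k j)
  case 0
  then show ?case by blast
next
  case (Suc J)
  obtain \<beta> bs' where bs: "bs = \<beta> # bs'" using Suc.prems(2,4) by (cases bs) auto
  obtain r0 r' where r: "r = r0 # r'" using Suc.prems(3) by (cases r) auto
  define S' where "S' = {b'. \<beta> # b' \<in> S}"
  define c' where "c' = (\<lambda>b. c (\<beta> # b))"
  have len: "\<forall>b\<in>S. length b = Suc J" using Suc.prems by auto
  have hdtl: "b = hd b # tl b" if "b \<in> S" for b using that len by (cases b) auto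
  have finS': "finite S'" unfolding S'_def using tail_set(2)[OF Suc.prems(1) len] .
  have bsS': "bs' \<in> S'" using Suc.prems bs by (auto simp: S'_def)
  have S': "\<forall>b\<in>S'. length b = J \<and> c' b \<noteq> 0 \<and> (\<forall>j<J. b ! j \<le> r' ! j)"
  proof
    fix b assume "b \<in> S'"
    then have b: "\<beta> # b \<in> S" by (simp add: S'_def)
    have "b ! j \<le> r' ! j" if "j < J" for j
      using Suc.prems(2) b that r by (metis Suc_less_eq nth_Cons_Suc)
    then show "length b = J \<and> c' b \<noteq> 0 \<and> (\<forall>j<J. b ! j \<le> r' ! j)"
      using Suc.prems(2) b by (auto simp: c'_def)
  qed
  have ge: "\<beta> \<le> hd b" if "b \<in> S" for b
  proof (cases "b = bs")
    case True then show ?thesis by (simp add: bs)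
  next
    case False
    from Suc.prems(5)[rule_format, OF that this]
    obtain j where j: "bs ! j < b ! j" "\<forall>l<j. b ! l = bs ! l" by blast
    have b0: "b ! 0 = hd b" "bs ! 0 = \<beta>" using hdtl[OF that] bs by (metis nth_Cons_0, simp)
    show ?thesis
    proof (cases j)
      case 0 then show ?thesis using j(1) b0 by simp
    next
      case (Suc j') then show ?thesis using j(2) b0 by (metis order_refl zero_less_Suc)
    qed
  qed
  have hd_le: "hd b \<le> r0" if "b \<in> S" for b
  proof -
    have "b ! 0 \<le> r ! 0" using Suc.prems(2) that by blast
    then show ?thesis using hdtl[OF that] r by (metis nth_Cons_0)
  qed
  have lex': "\<forall>b\<in>S'. b \<noteq> bs' \<longrightarrow> (\<exists>j<J. bs' ! j < b ! j \<and> (\<forall>l<j. b ! l = bs' ! l))"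
  proof (intro ballI impI)
    fix b assume b: "b \<in> S'" "b \<noteq> bs'"
    then obtain j where j: "j < Suc J" "bs ! j < (\<beta> # b) ! j" "\<forall>l<j. (\<beta> # b) ! l = bs ! l"
      using Suc.prems(5) bs by (force simp: S'_def)
    then obtain j' where j': "j = Suc j'" using bs by (cases j) auto
    have "\<forall>l<j'. b ! l = bs' ! l" using j(3) bs j' by (metis Suc_less_eq nth_Cons_Suc)
    then show "\<exists>j<J. bs' ! j < b ! j \<and> (\<forall>l<j. b ! l = bs' ! l)"
      using j j' bs by (intro exI[of _ j']) auto
  qed
  \<comment> \<open>\<open>[:[:0, 1:], 1:]\<close> is \<open>y0 + t\<close> with \<open>y0\<close>
    as the outer variable. After the division by \<open>(y0 + t) ^ \<beta>\<close>, the substitution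
    \<open>y0 = - t\<close> leaves exactly the terms whose first exponent is \<beta>.\<close>
  define R where "R = (\<lambda>y. \<Sum>b\<in>S. [:[:0, 1:], 1:] ^ (hd b - \<beta>) * [:[:c b:] * shift_prod y (tl b):])"
  have Q: "poly (R y) [:0, -1:] = (\<Sum>b\<in>S'. [:c' b:] * shift_prod y b)" for y
  proof -
    have "poly (R y) [:0, -1:] = (\<Sum>b\<in>S. if hd b = \<beta> then [:c b:] * shift_prod y (tl b) else 0)"
      unfolding R_def poly_sum
    proof (rule sum.cong[OF refl])
      fix b assume b: "b \<in> S"
      show "poly ([:[:0, 1:], 1:] ^ (hd b - \<beta>) * [:[:c b:] * shift_prod y (tl b):]) [:0, - 1:] =
         (if hd b = \<beta> then [:c b:] * shift_prod y (tl b) else 0)"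
        using ge[OF b] by (auto simp: poly_power)
    qed
    also have "\<dots> = (\<Sum>b\<in>{b\<in>S. hd b = \<beta>}. [:c b:] * shift_prod y (tl b))"
      using Suc.prems(1) by (rule sum.inter_filter[symmetric])
    also have "\<dots> = (\<Sum>b\<in>{b\<in>S. hd b = \<beta>}. [:c' (tl b):] * shift_prod y (tl b))"
    proof (rule sum.cong[OF refl])
      fix b assume "b \<in> {b \<in> S. hd b = \<beta>}"
      then have "b = \<beta> # tl b" using hdtl by auto
      then show "[:c b:] * shift_prod y (tl b) = [:c' (tl b):] * shift_prod y (tl b)"
        unfolding c'_def by simp
    qed
    also have "\<dots> = (\<Sum>b\<in>S'. [:c' b:] * shift_prod y b)" unfolding S'_def
      by (rule sum.reindex_bij_betw[OF tail_set(1)[OF Suc.prems(1) len]])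
    finally show ?thesis .
  qed
  have split: "(\<Sum>b\<in>S. [:c b:] * shift_prod (y0 # y) b) = [:y0, 1:] ^ \<beta> * poly (R y) [:y0:]" for y0 y
    unfolding R_def poly_sum sum_distrib_left
  proof (rule sum.cong[OF refl])
    fix b assume b: "b \<in> S"
    have "shift_prod (y0 # y) b = [:y0, 1:] ^ hd b * shift_prod y (tl b)"
      using hdtl[OF b] by (metis shift_prod_Cons)
    also have "[:y0, 1:] ^ hd b = [:y0, 1:] ^ \<beta> * [:y0, 1:] ^ (hd b - \<beta>)"
      using ge[OF b] by (simp flip: power_add)
    finally show "[:c b:] * shift_prod (y0 # y) b =
      [:y0, 1:] ^ \<beta> * poly ([:[:0, 1:], 1:] ^ (hd b - \<beta>) * [:[:c b:] * shift_prod y (tl b):]) [:y0:]"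
      by (simp add: mult_ac poly_power)
  qed
  have degR: "\<beta> + degree (poly (R y) [:y0:]) \<le> k" if "length y = J" "poly (R y) [:y0:] \<noteq> 0" for y y0
  proof -
    have "degree (\<Sum>b\<in>S. [:c b:] * shift_prod (y0 # y) b) \<le> k"
      using Suc.prems(6)[rule_format, of "y0 # y"] that(1) by simp
    then have "degree ([:y0, 1:] ^ \<beta> * poly (R y) [:y0:]) \<le> k" by (simp only: split)
    moreover have "degree ([:y0, 1:] ^ \<beta> * poly (R y) [:y0:]) = degree ([:y0, 1:] ^ \<beta>) + degree (poly (R y) [:y0:])"
      using that by (intro degree_mult_eq) auto
    ultimately show ?thesis by (simp add: degree_power_eq)
  qed
  have \<beta>k: "\<beta> \<le> k"
  proof (rule ccontr)
    assume neg: "\<not> \<beta> \<le> k"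
    obtain y where y: "length y = J" "(\<Sum>b\<in>S'. [:c' b:] * shift_prod y b) \<noteq> 0"
      using exists_nonzero_value[OF finS', of J c'] bsS' S' by auto
    have "poly (R y) [:y0:] = 0" for y0 using degR[OF y(1), of y0] neg by auto
    then have "range (\<lambda>y0. [:y0:]) \<subseteq> {x. poly (R y) x = 0}" by auto
    moreover have "infinite (range (\<lambda>y0::complex. [:y0:]))"
      using infinite_UNIV_char_0[where 'a=complex] finite_imageD[of "\<lambda>y0::complex. [:y0:]" UNIV] by (auto simp: inj_on_def)
    ultimately have "R y = 0" using poly_roots_finite finite_subset by blast
    then show False using Q[of y] y by simp
  qed
  have deg0: "degree (R y) \<le> r0 - \<beta>" for y
    unfolding R_def
  proof (rule degree_sum_le)
    fix b assume b: "b \<in> S"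
    have "degree ([:[:0, 1:], 1:] ^ (hd b - \<beta>) * [:[:c b:] * shift_prod y (tl b):])
       \<le> degree ([:[:0::complex, 1:], 1:] ^ (hd b - \<beta>)) + degree [:[:c b:] * shift_prod y (tl b):]"
      by (rule degree_mult_le)
    also have "\<dots> \<le> r0 - \<beta>" using hd_le[OF b] by (simp add: degree_power_eq)
    finally show "degree ([:[:0, 1:], 1:] ^ (hd b - \<beta>) * [:[:c b:] * shift_prod y (tl b):]) \<le> r0 - \<beta>" .
  qed (use Suc.prems(1) in simp)
  \<comment> \<open>For every number \<open>y0\<close> the degree in \<open>t\<close> is at most
    \<open>k - \<beta>\<close>, and the degree in \<open>y0\<close> is at most
    \<open>r0 - \<beta>\<close>; putting \<open>y0 = - t\<close> adds the two. The sum takes the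
    place of \<open>k\<close> in the induction.\<close>
  have degQ: "\<forall>y. length y = J \<longrightarrow> degree (\<Sum>b\<in>S'. [:c' b:] * shift_prod y b) \<le> (k - \<beta>) + (r0 - \<beta>)"
  proof (intro allI impI)
    fix y :: "complex list" assume y: "length y = J"
    have "degree (poly (R y) [:y0:]) \<le> k - \<beta>" for y0
      using degR[OF y, of y0] by (cases "poly (R y) [:y0:] = 0") auto
    then have "degree (coeff (R y) i) \<le> k - \<beta>" for i by (rule degree_coeff_le)
    then have "degree (poly (R y) [:0, -1:]) \<le> (k - \<beta>) + (r0 - \<beta>)"
      using deg0 by (rule degree_poly_le) simp
    then show "degree (\<Sum>b\<in>S'. [:c' b:] * shift_prod y b) \<le> (k - \<beta>) + (r0 - \<beta>)" by (simp add: Q)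
  qed
  have \<beta>r: "\<beta> \<le> r0" using hd_le[OF Suc.prems(4)] bs by simp
  show ?case
  proof (cases j)
    case 0
    then show ?thesis using bs \<beta>k by simp
  next
    case (Suc j')
    have "(\<Sum>l\<le>j'. bs' ! l) + (\<Sum>l<j'. bs' ! l) \<le> (\<Sum>l<j'. r' ! l) + ((k - \<beta>) + (r0 - \<beta>))"
      by (rule Suc.IH[OF finS' S' _ bsS' lex' degQ]) (use Suc.prems(3,7) r Suc in auto)
    moreover have "(\<Sum>l\<le>j. bs ! l) = \<beta> + (\<Sum>l\<le>j'. bs' ! l)"
      unfolding Suc bs by (simp add: sum.atMost_Suc_shift del: sum.atMost_Suc)
    moreover have "(\<Sum>l<j. bs ! l) = \<beta> + (\<Sum>l<j'. bs' ! l)" "(\<Sum>l<j. r ! l) = r0 + (\<Sum>l<j'. r' ! l)"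
      unfolding Suc bs r by (simp_all add: sum.lessThan_Suc_shift del: sum.lessThan_Suc)
    ultimately show ?thesis using \<beta>k \<beta>r by simp
  qed
qed

section \<open>Commuting self-adjoint operators\<close>

text \<open>Tensors will be functions on all lists, which form an infinite-dimensional space. Finite
  dimension and definiteness are therefore required of the subspace \<open>W\<close> only.\<close>

locale hermitian_space = vector_space scale
  for scale :: "complex \<Rightarrow> 'b::ab_group_add \<Rightarrow> 'b" (infixr "*s" 75) +
  fixes W :: "'b set" and ip :: "'b \<Rightarrow> 'b \<Rightarrow> complex" and B :: "'b set"
  assumes subspace_W: "subspace W"
    and finite_B: "finite B" and W_span: "W \<subseteq> span B"
    and ip_add_right: "ip x (y + z) = ip x y + ip x z"
    and ip_scale_right: "ip x (c *s y) = c * ip x y"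
    and ip_commute: "ip y x = cnj (ip x y)"
    and ip_definite: "x \<in> W \<Longrightarrow> ip x x = 0 \<Longrightarrow> x = 0"
begin

lemma ip_zero_right [simp]: "ip x 0 = 0"
  using ip_scale_right[of x 0 x] by simp

lemma ip_minus_right: "ip x (- y) = - ip x y"
  using ip_scale_right[of x "-1" y] by simp

lemma ip_diff_right: "ip x (y - z) = ip x y - ip x z"
  using ip_add_right[of x y "- z"] ip_minus_right by simp

lemma ip_sum_right: "ip x (\<Sum>i\<in>I. f i) = (\<Sum>i\<in>I. ip x (f i))"
  by (induction I rule: infinite_finite_induct) (auto simp: ip_add_right)

lemma ip_add_left: "ip (x + y) z = ip x z + ip y z"
  by (metis complex_cnj_add ip_add_right ip_commute)

lemma ip_scale_left: "ip (c *s x) z = cnj c * ip x z"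
  by (metis complex_cnj_mult ip_scale_right ip_commute)

lemma ip_diff_left: "ip (x - y) z = ip x z - ip y z"
  by (metis complex_cnj_diff ip_diff_right ip_commute)

lemma ip_sum_left: "ip (\<Sum>i\<in>I. f i) x = (\<Sum>i\<in>I. ip (f i) x)"
  by (subst (1 2) ip_commute) (simp add: ip_sum_right)

lemma W_closed: "x \<in> W \<Longrightarrow> y \<in> W \<Longrightarrow> x + y \<in> W" "x \<in> W \<Longrightarrow> y \<in> W \<Longrightarrow> x - y \<in> W" "x \<in> W \<Longrightarrow> c *s x \<in> W"
  "0 \<in> W"
  using subspace_W by (auto intro: subspace_add subspace_diff subspace_scale subspace_0)

definition lin :: "('b \<Rightarrow> 'b) \<Rightarrow> bool" where
  "lin F \<longleftrightarrow> (\<forall>x y. F (x + y) = F x + F y) \<and> (\<forall>c x. F (c *s x) = c *s F x)"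

lemma lin_add: "lin F \<Longrightarrow> F (x + y) = F x + F y"
  and lin_scale: "lin F \<Longrightarrow> F (c *s x) = c *s F x"
  by (auto simp: lin_def)

lemma lin_zero: "lin F \<Longrightarrow> F 0 = 0"
  using lin_scale[of F 0 0] by simp

lemma lin_diff: "lin F \<Longrightarrow> F (x - y) = F x - F y"
  using lin_add[of F x "- y"] lin_scale[of F "-1" y] by simp

lemma lin_minus: "lin F \<Longrightarrow> F (- x) = - F x"
  using lin_scale[of F "-1" x] by simp

lemma lin_sum: "lin F \<Longrightarrow> F (\<Sum>i\<in>I. f i) = (\<Sum>i\<in>I. F (f i))"
  by (induction I rule: infinite_finite_induct) (auto simp: lin_add lin_zero)

lemma lin_funpow: "lin F \<Longrightarrow> lin (F ^^ i)"
  by (induction i) (auto simp: lin_def)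

definition selfadjoint :: "('b \<Rightarrow> 'b) \<Rightarrow> bool" where
  "selfadjoint F \<longleftrightarrow> lin F \<and> (\<forall>x\<in>W. F x \<in> W) \<and> (\<forall>x\<in>W. \<forall>y\<in>W. ip (F x) y = ip x (F y))"

lemma selfadjoint_real:
  assumes "selfadjoint X" "x \<in> W" "x \<noteq> 0" "X x = c *s x"
  shows "cnj c = c"
proof -
  have "ip (X x) x = ip x (X x)" using assms by (auto simp: selfadjoint_def)
  then have "cnj c * ip x x = c * ip x x" using assms by (simp add: ip_scale_left ip_scale_right)
  then show ?thesis using ip_definite assms by auto
qed

text \<open>The factors \<open>X - c\<close>, applied one after the other. A list with
  \<open>kill X cs x = 0\<close> is an annihilating polynomial of \<open>x\<close>, split into
  linear factors.\<close>

fun kill :: "('b \<Rightarrow> 'b) \<Rightarrow> complex list \<Rightarrow> 'b \<Rightarrow> 'b" where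
  "kill X [] x = x"
| "kill X (c # cs) x = kill X cs (X x - c *s x)"

definition evalp :: "('b \<Rightarrow> 'b) \<Rightarrow> complex poly \<Rightarrow> 'b \<Rightarrow> 'b" where
  "evalp X p x = (\<Sum>i\<le>degree p. coeff p i *s (X ^^ i) x)"

lemma evalp_bound:
  assumes "degree p \<le> m"
  shows "evalp X p x = (\<Sum>i\<le>m. coeff p i *s (X ^^ i) x)"
  unfolding evalp_def using assms by (intro sum.mono_neutral_left) (auto simp: coeff_eq_0)

lemma evalp_factor:
  assumes "lin X"
  shows "evalp X ([:- c, 1:] * q) x = evalp X q (X x - c *s x)"
proof -
  define m where "m = degree q"
  have "degree ([:- c, 1:] * q) \<le> Suc m"
    using degree_mult_le[of "[:- c, 1:]" q] by (simp add: m_def)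
  then have "evalp X ([:- c, 1:] * q) x = (\<Sum>i\<le>Suc m. coeff ([:- c, 1:] * q) i *s (X ^^ i) x)"
    by (rule evalp_bound)
  also have "\<dots> = (\<Sum>i\<le>Suc m. (case i of 0 \<Rightarrow> 0 | Suc j \<Rightarrow> coeff q j) *s (X ^^ i) x - c *s coeff q i *s (X ^^ i) x)"
    by (intro sum.cong) (auto simp: algebra_simps coeff_pCons split: nat.split)
  also have "\<dots> = (\<Sum>i\<le>Suc m. (case i of 0 \<Rightarrow> 0 | Suc j \<Rightarrow> coeff q j) *s (X ^^ i) x) -
      (\<Sum>i\<le>Suc m. c *s coeff q i *s (X ^^ i) x)" by (rule sum_subtractf)
  also have "(\<Sum>i\<le>Suc m. (case i of 0 \<Rightarrow> 0 | Suc j \<Rightarrow> coeff q j) *s (X ^^ i) x) = (\<Sum>i\<le>m. coeff q i *s (X ^^ Suc i) x)"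
    by (simp add: sum.atMost_Suc_shift del: sum.atMost_Suc funpow.simps)
  also have "(\<Sum>i\<le>Suc m. c *s coeff q i *s (X ^^ i) x) = (\<Sum>i\<le>m. c *s coeff q i *s (X ^^ i) x)"
    by (simp add: m_def coeff_eq_0)
  also have "(\<Sum>i\<le>m. coeff q i *s (X ^^ Suc i) x) - \<dots> = (\<Sum>i\<le>m. coeff q i *s (X ^^ i) (X x - c *s x))"
    unfolding sum_subtractf[symmetric]
    by (intro sum.cong) (auto simp: lin_diff[OF lin_funpow[OF assms]] lin_scale[OF lin_funpow[OF assms]] funpow_swap1 algebra_simps)
  finally show ?thesis by (simp add: evalp_def m_def)
qed

lemma exists_kill_poly:
  assumes "lin X" "evalp X p x = 0" "p \<noteq> 0"
  shows "\<exists>cs. kill X cs x = 0"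
  using assms(2,3)
proof (induction "degree p" arbitrary: p x)
  case 0
  then obtain c where "p = [:c:]" "c \<noteq> 0" by (metis degree_eq_zeroE pCons_0_0)
  then have "c *s x = 0" using 0 by (simp add: evalp_def)
  then show ?case using \<open>c \<noteq> 0\<close> by (intro exI[of _ "[]"]) simp
next
  case (Suc d)
  then obtain c where "poly p c = 0" using fundamental_theorem_of_algebra[of p]
    by (metis constant_degree nat.distinct(1))
  then obtain q where q: "p = [:- c, 1:] * q" by (metis poly_eq_0_iff_dvd dvdE)
  then have "q \<noteq> 0" using Suc by auto
  then have "degree p = Suc (degree q)" unfolding q by (subst degree_mult_eq) auto
  then have "d = degree q" using Suc by simp
  moreover have "evalp X q (X x - c *s x) = 0" using Suc.prems q evalp_factor[OF assms(1)] by simp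
  ultimately obtain cs where "kill X cs (X x - c *s x) = 0" using Suc.hyps(1) \<open>q \<noteq> 0\<close> by blast
  then show ?case by (intro exI[of _ "c # cs"]) simp
qed

text \<open>One more iterate of \<open>x\<close> than there are spanning vectors must be linearly
  dependent; the relation is a nonzero polynomial, which splits over the complex numbers.\<close>

lemma exists_kill:
  assumes "lin X" "\<And>x. x \<in> W \<Longrightarrow> X x \<in> W" "x \<in> W"
  shows "\<exists>cs. kill X cs x = 0"
proof -
  define f where "f = (\<lambda>i. (X ^^ i) x)"
  define m where "m = card B"
  have fW: "f i \<in> W" for i by (induction i) (auto simp: f_def assms)
  have "\<exists>u. (\<exists>i\<le>m. u i \<noteq> 0) \<and> (\<Sum>i\<le>m. u i *s f i) = 0"
  proof (cases "inj_on f {..m}")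
    case True
    have "f ` {..m} \<subseteq> span B" using fW W_span by auto
    then have "dependent (f ` {..m})"
      using independent_span_bound[OF finite_B, of "f ` {..m}"] True by (auto simp: card_image m_def)
    then obtain u where u: "\<exists>v\<in>f ` {..m}. u v \<noteq> 0" "(\<Sum>v\<in>f ` {..m}. u v *s v) = 0"
      by (subst (asm) dependent_finite) auto
    then have "(\<Sum>i\<le>m. u (f i) *s f i) = 0" using True by (simp add: sum.reindex)
    then show ?thesis using u by (intro exI[of _ "\<lambda>i. u (f i)"]) auto
  next
    \<comment> \<open>Two equal iterates give a relation at once: their difference.\<close>
    case False
    then obtain i j where ij: "i \<le> m" "j \<le> m" "i \<noteq> j" "f i = f j" by (auto simp: inj_on_def)
    have "(\<Sum>k\<le>m. ((if k = i then 1 else 0) - (if k = j then 1 else 0)) *s f k) =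
      (\<Sum>k\<le>m. (if k = i then f k else 0) - (if k = j then f k else 0))"
      by (intro sum.cong) auto
    also have "\<dots> = 0" using ij by (simp add: sum_subtractf)
    finally show ?thesis using ij
      by (intro exI[of _ "\<lambda>k. (if k = i then 1 else 0) - (if k = j then 1 else 0)"]) auto
  qed
  then obtain u where u: "\<exists>i\<le>m. u i \<noteq> 0" "(\<Sum>i\<le>m. u i *s f i) = 0" by auto
  define p where "p = (\<Sum>i\<le>m. monom (u i) i)"
  have co: "coeff p i = (if i \<le> m then u i else 0)" for i
    by (simp add: p_def coeff_sum if_distrib cong: if_cong)
  then have "p \<noteq> 0" using u by (metis coeff_0)
  moreover have "degree p \<le> m" by (rule degree_le) (simp add: co)
  then have "evalp X p x = 0" using u by (simp add: evalp_bound co f_def)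
  ultimately show ?thesis using exists_kill_poly[OF assms(1)] by blast
qed

text \<open>If \<open>u = X y - c y\<close> were nonzero, it would be an eigenvector with real
  eigenvalue \<open>c\<close>, and then \<open>ip u u = ip (X u - c u) y = 0\<close>. This excludes
  Jordan blocks.\<close>

lemma selfadjoint_square:
  assumes "selfadjoint X" "y \<in> W" "X (X y - c *s y) = c *s (X y - c *s y)"
  shows "X y = c *s y"
proof -
  define u where "u = X y - c *s y"
  have u: "u \<in> W" using assms by (auto simp: u_def selfadjoint_def intro!: W_closed)
  have "u = 0"
  proof (rule ccontr)
    assume "u \<noteq> 0"
    have Xu: "X u = c *s u" using assms by (simp add: u_def)
    have c: "cnj c = c" using selfadjoint_real[OF assms(1) u \<open>u \<noteq> 0\<close> Xu] .
    have "ip u u = ip u (X y) - c * ip u y" by (simp add: u_def ip_diff_right ip_scale_right)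
    also have "ip u (X y) = ip (X u) y" using assms u by (auto simp: selfadjoint_def)
    also have "\<dots> = c * ip u y" by (simp add: Xu ip_scale_left c)
    finally show False using ip_definite[OF u] \<open>u \<noteq> 0\<close> by simp
  qed
  then show ?thesis by (simp add: u_def)
qed

text \<open>Induction along the linear factors that annihilate \<open>x\<close>. If
  \<open>X x - c x\<close> is a combination of eigenvectors, it equals some
  \<open>X x1 - c x1\<close> up to an eigenvector for \<open>c\<close>; then \<open>x - x1\<close>
  is killed by the square of \<open>X - c\<close> and is itself an eigenvector.\<close>

lemma eigen_span:
  assumes X: "selfadjoint X" and Z: "subspace Z" "Z \<subseteq> W" "\<And>z. z \<in> Z \<Longrightarrow> X z \<in> Z" and x: "x \<in> Z"
  shows "x \<in> span {z \<in> Z. \<exists>c. X z = c *s z}"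
proof -
  let ?E = "{z \<in> Z. \<exists>c. X z = c *s z}"
  have linX: "lin X" using X by (simp add: selfadjoint_def)
  have EZ: "span ?E \<subseteq> Z" by (rule span_minimal) (use Z in auto)
  \<comment> \<open>On an eigenvector with eigenvalue \<open>ce \<noteq> c\<close> the operator
    \<open>X - c\<close> is inverted by dividing by \<open>ce - c\<close>; the eigenvectors for
    \<open>c\<close> itself are collected in \<open>yc\<close>.\<close>
  have split: "\<exists>x1\<in>span ?E. \<exists>yc\<in>Z. X yc = c *s yc \<and> y = X x1 - c *s x1 + yc" if "y \<in> span ?E" for y c
    using that
  proof (induction rule: span_induct_alt)
    case base
    show ?case using subspace_0[OF Z(1)] span_zero lin_zero[OF linX]
      by (intro bexI[of _ 0]) auto
  next
    case (step k e y)
    then obtain x1 yc where IH: "x1 \<in> span ?E" "yc \<in> Z" "X yc = c *s yc" "y = X x1 - c *s x1 + yc" by blast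
    obtain ce where e: "e \<in> Z" "X e = ce *s e" "e \<in> ?E" using step by blast
    show ?case
    proof (cases "ce = c")
      case True
      have "k *s e + yc \<in> Z" using e IH Z by (intro subspace_add subspace_scale) auto
      moreover have "X (k *s e + yc) = c *s (k *s e + yc)"
        using e IH True by (simp add: lin_add[OF linX] lin_scale[OF linX] algebra_simps)
      ultimately show ?thesis using IH by (intro bexI[of _ x1] bexI[of _ "k *s e + yc"]) auto
    next
      case False
      define x2 where "x2 = (k / (ce - c)) *s e + x1"
      have "x2 \<in> span ?E" unfolding x2_def by (rule span_add[OF span_scale[OF span_base[OF e(3)]] IH(1)])
      moreover have eq: "X x2 - c *s x2 = k *s e + (X x1 - c *s x1)"
      proof -
        have "k / (ce - c) * ce - c * (k / (ce - c)) = k / (ce - c) * (ce - c)"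
          by (metis left_diff_distrib mult.commute)
        then have "k / (ce - c) * ce - c * (k / (ce - c)) = k" using False by simp
        then have "(k / (ce - c)) *s ce *s e - c *s (k / (ce - c)) *s e = k *s e"
          by (simp only: scale_scale scale_left_diff_distrib[symmetric])
        then show ?thesis
          by (simp add: x2_def lin_add[OF linX] lin_scale[OF linX] e(2) scale_right_distrib)
      qed
      moreover have "k *s e + y = X x2 - c *s x2 + yc" unfolding eq using IH(4) by (simp add: add.assoc)
      ultimately show ?thesis using IH(2,3) by blast
    qed
  qed
  have "kill X cs x = 0 \<Longrightarrow> x \<in> Z \<Longrightarrow> x \<in> span ?E" for cs
  proof (induction cs arbitrary: x)
    case Nil
    then show ?case by (simp add: span_zero)
  next
    case (Cons c cs)
    have "X x - c *s x \<in> Z" using Cons Z by (intro subspace_diff subspace_scale) auto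
    then have "X x - c *s x \<in> span ?E" using Cons by simp
    from split[OF this] obtain x1 yc where s: "x1 \<in> span ?E" "yc \<in> Z" "X yc = c *s yc"
      "X x - c *s x = X x1 - c *s x1 + yc" by blast
    define x' where "x' = x - x1"
    have x': "x' \<in> Z" unfolding x'_def using Cons s EZ Z by (intro subspace_diff) auto
    have "X x' - c *s x' = (X x - c *s x) - (X x1 - c *s x1)"
      by (simp add: x'_def lin_diff[OF linX] scale_right_diff_distrib)
    also have "\<dots> = yc" unfolding s(4) by simp
    finally have "X (X x' - c *s x') = c *s (X x' - c *s x')" using s(3) by simp
    moreover have "x' \<in> W" using x' Z(2) by auto
    ultimately have "X x' = c *s x'" by (rule selfadjoint_square[OF X, rotated])
    then have "x' \<in> span ?E" using x' by (intro span_base) auto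
    then have "x' + x1 \<in> span ?E" using s by (intro span_add) auto
    then show ?case by (simp add: x'_def)
  qed
  moreover have "\<exists>cs. kill X cs x = 0" using X x Z by (intro exists_kill) (auto simp: selfadjoint_def)
  ultimately show ?thesis using x by blast
qed

text \<open>The functional \<Psi> carries a nonvanishing condition through the choice: eigenvectors
  of \<open>X\<close> span \<open>Z\<close>, so \<Psi> is nonzero on one of them, and the other
  operators preserve its eigenspace. Later \<Psi> is a component of a contraction, or the pairing
  with a fixed tensor.\<close>

lemma exists_joint_eigenvector:
  fixes \<Psi> :: "'b \<Rightarrow> complex"
  assumes "\<And>X. X \<in> set Xs \<Longrightarrow> selfadjoint X"
    and "subspace Z" "Z \<subseteq> W" "\<And>X z. X \<in> set Xs \<Longrightarrow> z \<in> Z \<Longrightarrow> X z \<in> Z"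
    and "\<And>X Y z. X \<in> set Xs \<Longrightarrow> Y \<in> set Xs \<Longrightarrow> z \<in> Z \<Longrightarrow> X (Y z) = Y (X z)"
    and "\<And>x y. \<Psi> (x + y) = \<Psi> x + \<Psi> y" "\<And>c x. \<Psi> (c *s x) = c * \<Psi> x"
    and "w \<in> Z" "\<Psi> w \<noteq> 0"
  shows "\<exists>v\<in>Z. \<Psi> v \<noteq> 0 \<and> (\<forall>X\<in>set Xs. \<exists>c. X v = c *s v)"
  using assms(1-5,8,9)
proof (induction Xs arbitrary: Z w)
  case Nil
  then show ?case by auto
next
  case (Cons X Xs)
  let ?E = "{z \<in> Z. \<exists>c. X z = c *s z}"
  have "\<exists>e\<in>?E. \<Psi> e \<noteq> 0"
  proof (rule ccontr)
    assume neg: "\<not> ?thesis"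
    have \<Psi>0: "\<Psi> 0 = 0" using assms(7)[of 0 0] by simp
    have "\<Psi> w = 0" if "w \<in> span ?E" for w
      using that by (induction rule: span_induct_alt) (use neg in \<open>auto simp: \<Psi>0 assms(6,7)\<close>)
    moreover have "w \<in> span ?E" by (rule eigen_span) (use Cons.prems in auto)
    ultimately show False using Cons.prems by auto
  qed
  then obtain e c where e: "e \<in> Z" "X e = c *s e" "\<Psi> e \<noteq> 0" by auto
  define Z' where "Z' = {z \<in> Z. X z = c *s z}"
  have linX: "lin X" and linXs: "\<And>Y. Y \<in> set Xs \<Longrightarrow> lin Y" using Cons.prems(1) by (auto simp: selfadjoint_def)
  have "subspace Z'" unfolding Z'_def subspace_def
    using Cons.prems(2) by (auto simp: subspace_def lin_add[OF linX] lin_scale[OF linX] lin_zero[OF linX] algebra_simps)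
  moreover have "Y z \<in> Z'" if "Y \<in> set Xs" "z \<in> Z'" for Y z
  proof -
    have "Y (X z) = X (Y z)" using Cons.prems(5)[of Y X z] that by (auto simp: Z'_def)
    then show ?thesis using that Cons.prems(4) linXs[OF that(1)] by (auto simp: Z'_def lin_scale)
  qed
  ultimately have "\<exists>v\<in>Z'. \<Psi> v \<noteq> 0 \<and> (\<forall>X\<in>set Xs. \<exists>c. X v = c *s v)"
    using e Cons.prems by (intro Cons.IH[of Z' e]) (auto simp: Z'_def)
  then show ?case by (auto simp: Z'_def)
qed

end

section \<open>Jucys--Murphy elements\<close>

lemma transpose_conj:
  assumes "inj p"
  shows "p \<circ> transpose i k = transpose (p i) (p k) \<circ> p"
  using assms by (auto simp: fun_eq_iff transpose_def inj_eq)

locale symmetric_group_rep = hermitian_space scale W ip B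
  for scale :: "complex \<Rightarrow> 'b::ab_group_add \<Rightarrow> 'b" (infixr "*s" 75) and W ip B +
  fixes n :: nat and act :: "(nat \<Rightarrow> nat) \<Rightarrow> 'b \<Rightarrow> 'b"
  assumes act_lin: "p permutes {..<n} \<Longrightarrow> lin (act p)"
    and act_W: "p permutes {..<n} \<Longrightarrow> x \<in> W \<Longrightarrow> act p x \<in> W"
    and act_id: "x \<in> W \<Longrightarrow> act id x = x"
    and act_comp: "p permutes {..<n} \<Longrightarrow> q permutes {..<n} \<Longrightarrow> x \<in> W \<Longrightarrow> act p (act q x) = act (p \<circ> q) x"
    and act_unitary: "p permutes {..<n} \<Longrightarrow> x \<in> W \<Longrightarrow> y \<in> W \<Longrightarrow> ip (act p x) (act p y) = ip x y"
begin

abbreviation sw :: "nat \<Rightarrow> 'b \<Rightarrow> 'b" where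
  "sw k \<equiv> act (transpose k (Suc k))"

text \<open>The Jucys--Murphy elements of the symmetric group on \<open>{lo..<n}\<close>. By the argument of Okounkov and Vershik, their
  joint eigenvalues are the contents of standard tableaux.\<close>

definition jm :: "nat \<Rightarrow> nat \<Rightarrow> 'b \<Rightarrow> 'b" where
  "jm lo k v = (\<Sum>i\<in>{lo..<k}. act (transpose i k) v)"

lemma perm_transpose [simp]: "i < n \<Longrightarrow> k < n \<Longrightarrow> transpose i k permutes {..<n}"
  by (auto intro: permutes_swap_id)

lemma act_transpose_twice: "i < n \<Longrightarrow> k < n \<Longrightarrow> x \<in> W \<Longrightarrow> act (transpose i k) (act (transpose i k) x) = x"
  by (simp add: act_comp act_id)

lemma act_transpose_selfadjoint: "i < n \<Longrightarrow> k < n \<Longrightarrow> x \<in> W \<Longrightarrow> y \<in> W \<Longrightarrow>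
  ip (act (transpose i k) x) y = ip x (act (transpose i k) y)"
  using act_unitary[of "transpose i k" x "act (transpose i k) y"]
  by (simp add: act_transpose_twice act_W)

lemma jm_lin: "k < n \<Longrightarrow> lin (jm lo k)"
  unfolding lin_def jm_def using act_lin
  by (auto simp: lin_def sum.distrib scale_sum_right intro!: sum.cong)

lemma jm_W: "k < n \<Longrightarrow> x \<in> W \<Longrightarrow> jm lo k x \<in> W"
  unfolding jm_def by (intro subspace_sum[OF subspace_W] act_W) auto

lemma jm_selfadjoint: "k < n \<Longrightarrow> selfadjoint (jm lo k)"
  unfolding selfadjoint_def
proof (intro conjI ballI)
  fix x y assume "k < n" "x \<in> W" "y \<in> W"
  then show "ip (jm lo k x) y = ip x (jm lo k y)"
    unfolding jm_def ip_sum_left ip_sum_right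
    by (intro sum.cong refl act_transpose_selfadjoint) auto
qed (auto simp: jm_lin jm_W)

lemma act_conj:
  assumes "p permutes {..<n}" "i < n" "k < n" "v \<in> W"
  shows "act p (act (transpose i k) v) = act (transpose (p i) (p k)) (act p v)"
proof -
  have "p i < n" "p k < n" using assms permutes_in_image[OF assms(1)] by auto
  then show ?thesis using assms by (simp add: act_comp transpose_conj[OF permutes_inj[OF assms(1)]])
qed

lemma act_jm:
  assumes p: "p permutes {..<n}" and k: "k < n" and v: "v \<in> W"
  shows "act p (jm lo k v) = (\<Sum>i\<in>{lo..<k}. act (transpose (p i) (p k)) (act p v))"
  unfolding jm_def lin_sum[OF act_lin[OF p]]
  using assms by (intro sum.cong refl act_conj) auto

lemma act_jm_commute:
  assumes p: "p permutes {..<n}" and k: "k < n" "p k = k" and v: "v \<in> W" and im: "p ` {lo..<k} = {lo..<k}"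
  shows "act p (jm lo k v) = jm lo k (act p v)"
proof -
  have "inj_on p {lo..<k}" using permutes_inj[OF p] by (auto intro: inj_on_subset)
  then have "(\<Sum>i\<in>{lo..<k}. act (transpose (p i) k) (act p v)) = (\<Sum>i\<in>p ` {lo..<k}. act (transpose i k) (act p v))"
    by (simp add: sum.reindex)
  then show ?thesis using assms by (simp add: act_jm jm_def[of lo k "act p v"])
qed

lemma sw_jm_commute:
  assumes "lo \<le> k" "Suc k < n" "j < n" "j \<noteq> k" "j \<noteq> Suc k" "v \<in> W"
  shows "sw k (jm lo j v) = jm lo j (sw k v)"
proof (rule act_jm_commute)
  show "transpose k (Suc k) ` {lo..<j} = {lo..<j}"
  proof (cases "j < k")
    case True
    then have "transpose k (Suc k) i = i" if "i \<in> {lo..<j}" for i using that by (auto simp: transpose_def)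
    then show ?thesis by auto
  next
    case False
    then have "transpose k (Suc k) permutes {lo..<j}" using assms by (intro permutes_swap_id) auto
    then show ?thesis by (rule permutes_image)
  qed
qed (use assms in \<open>auto simp: transpose_def\<close>)

text \<open>Each transposition in the element of smaller index permutes the summands of the other
  element.\<close>

lemma jm_commute:
  assumes "j < n" "k < n" "v \<in> W"
  shows "jm lo j (jm lo k v) = jm lo k (jm lo j v)"
proof -
  have *: "jm lo j (jm lo k v) = jm lo k (jm lo j v)" if "j < k" "k < n" for j k
  proof -
    have "act (transpose i j) (jm lo k v) = jm lo k (act (transpose i j) v)" if "i \<in> {lo..<j}" for i
    proof (rule act_jm_commute)
      have "transpose i j permutes {lo..<k}" using that \<open>j < k\<close> by (intro permutes_swap_id) auto
      then show "transpose i j ` {lo..<k} = {lo..<k}" by (rule permutes_image)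
    qed (use that \<open>j < k\<close> \<open>k < n\<close> assms in auto)
    then show ?thesis unfolding jm_def[of lo j] lin_sum[OF jm_lin[OF \<open>k < n\<close>]] by simp
  qed
  show ?thesis using *[of j k] *[of k j] assms by (cases j k rule: linorder_cases) auto
qed

text \<open>The relation of the degenerate affine Hecke algebra: conjugation by \<open>sw k\<close>
  carries the summands of \<open>jm lo k\<close> to those of \<open>jm lo (Suc k)\<close>, except
  for the transposition of \<open>k\<close> and \<open>Suc k\<close>.\<close>

lemma sw_jm:
  assumes "lo \<le> k" "Suc k < n" "v \<in> W"
  shows "sw k (jm lo k v) = jm lo (Suc k) (sw k v) - v"
proof -
  have "jm lo (Suc k) (sw k v) = (\<Sum>i\<in>{lo..<k}. act (transpose i (Suc k)) (sw k v)) + sw k (sw k v)"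
    using assms by (simp add: jm_def atLeastLessThanSuc add.commute)
  also have "(\<Sum>i\<in>{lo..<k}. act (transpose i (Suc k)) (sw k v)) = sw k (jm lo k v)"
    using assms by (subst act_jm) (auto intro!: sum.cong simp: transpose_def)
  finally show ?thesis using assms by (simp add: act_transpose_twice)
qed

section \<open>Joint eigenvectors and their contents\<close>

definition jm_eigen :: "nat \<Rightarrow> 'b \<Rightarrow> (nat \<Rightarrow> complex) \<Rightarrow> bool" where
  "jm_eigen lo v a \<longleftrightarrow> v \<in> W \<and> v \<noteq> 0 \<and> (\<forall>k\<in>{lo..<n}. jm lo k v = a k *s v)"

text \<open>By \<open>sw_jm\<close> and self-adjointness, \<open>d * ip v (sw k v) = ip v v\<close>.
  Hence \<open>d\<close> is not 0 and \<open>u\<close> is the component of \<open>sw k v\<close>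
  orthogonal to \<open>v\<close>. Its squared norm is \<open>1 - 1 / d ^ 2\<close> times that of
  \<open>v\<close>, so it vanishes exactly for \<open>d = 1\<close> and \<open>d = -1\<close>;
  otherwise \<open>u\<close> realises the exchanged eigenvalues.\<close>

lemma jm_eigen_swap:
  assumes e: "jm_eigen lo v a" and k: "lo \<le> k" "Suc k < n"
  defines "d \<equiv> a (Suc k) - a k"
  defines "u \<equiv> sw k v - (1 / d) *s v"
  shows "d \<noteq> 0" and "d\<^sup>2 = 1 \<Longrightarrow> u = 0"
    and "sw k u + (1 / d) *s u = (1 - 1 / d\<^sup>2) *s v"
    and "d\<^sup>2 \<noteq> 1 \<Longrightarrow> jm_eigen lo u (a \<circ> transpose k (Suc k))"
proof -
  have v: "v \<in> W" "v \<noteq> 0" and X: "\<And>j. lo \<le> j \<Longrightarrow> j < n \<Longrightarrow> jm lo j v = a j *s v"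
    using e by (auto simp: jm_eigen_def)
  note lins = act_lin[OF perm_transpose[of k "Suc k"]]
  have sv: "sw k v \<in> W" using v k by (intro act_W) auto
  have vv: "ip v v \<noteq> 0" using v ip_definite by auto
  have real: "cnj (a j) = a j" if "lo \<le> j" "j < n" for j
    using selfadjoint_real[OF jm_selfadjoint v X] that by auto
  have "a k *s sw k v = jm lo (Suc k) (sw k v) - v"
    using sw_jm[OF k v(1)] X[of k] k by (simp add: lin_scale[OF lins])
  then have X1: "jm lo (Suc k) (sw k v) = a k *s sw k v + v" by (simp add: algebra_simps)
  have "ip (jm lo (Suc k) v) (sw k v) = ip v (jm lo (Suc k) (sw k v))"
    using jm_selfadjoint[of "Suc k" lo] k v sv by (auto simp: selfadjoint_def)
  then have "a (Suc k) * ip v (sw k v) = a k * ip v (sw k v) + ip v v"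
    using X[of "Suc k"] real[of "Suc k"] k by (simp add: X1 ip_scale_left ip_scale_right ip_add_right)
  then have dip: "d * ip v (sw k v) = ip v v" by (simp add: d_def algebra_simps)
  then show d: "d \<noteq> 0" using vv by auto
  have da: "d + a k = a (Suc k)" by (simp add: d_def)
  have cd: "cnj d = d" using real k by (simp add: d_def)
  have ip1: "ip v (sw k v) = ip v v / d" using dip d by (simp add: field_simps)
  have ip2: "ip (sw k v) v = ip v v / d"
    using act_transpose_selfadjoint[of k "Suc k" v v] k v ip1 by simp
  have ip3: "ip (sw k v) (sw k v) = ip v v" using k v by (intro act_unitary) auto
  have uu: "ip u u = ip v v * (1 - 1 / d\<^sup>2)"
    unfolding u_def ip_diff_left ip_diff_right ip_scale_left ip_scale_right ip1 ip2 ip3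
    using d by (simp add: cd field_simps power2_eq_square)
  have uW: "u \<in> W" unfolding u_def using v sv by (intro W_closed) auto
  show "u = 0" if "d\<^sup>2 = 1" using uu that ip_definite[OF uW] by simp
  have ssv: "sw k (sw k v) = v" using k v by (simp add: act_transpose_twice)
  have rec: "sw k u + (1 / d) *s u = (1 - 1 / d\<^sup>2) *s v"
    unfolding u_def using k
    by (simp add: lin_diff[OF lins] lin_scale[OF lins] ssv scale_right_diff_distrib scale_left_diff_distrib power2_eq_square)
  then show "sw k u + (1 / d) *s u = (1 - 1 / d\<^sup>2) *s v" .
  show "jm_eigen lo u (a \<circ> transpose k (Suc k))" if "d\<^sup>2 \<noteq> 1"
    unfolding jm_eigen_def
  proof (intro conjI ballI)
    show "u \<in> W" by (rule uW)
    show "u \<noteq> 0"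
    proof
      assume "u = 0"
      then have "(1 - 1 / d\<^sup>2) *s v = 0" using rec k by (simp add: lin_zero[OF lins])
      then show False using that v d by (simp add: field_simps)
    qed
    fix j assume j: "j \<in> {lo..<n}"
    have lj: "lin (jm lo j)" using j by (intro jm_lin) auto
    consider "j = k" | "j = Suc k" | "j \<noteq> k" "j \<noteq> Suc k" by blast
    then show "jm lo j u = (a \<circ> transpose k (Suc k)) j *s u"
    proof cases
      case 1
      have "sw k (jm lo k (sw k v)) = jm lo (Suc k) v - sw k v"
        using sw_jm[OF k sv] by (simp add: ssv)
      then have "sw k (sw k (jm lo k (sw k v))) = a (Suc k) *s sw k v - v"
        using X[of "Suc k"] k by (simp add: lin_diff[OF lins] lin_scale[OF lins] ssv)
      then have "jm lo k (sw k v) = a (Suc k) *s sw k v - v"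
        using k sv by (simp add: act_transpose_twice jm_W)
      then have "jm lo k u = a (Suc k) *s sw k v - (1 + a k / d) *s v"
        using lj 1 X[of k] k by (simp add: u_def lin_diff lin_scale algebra_simps)
      also have "1 + a k / d = a (Suc k) / d" by (simp add: da[symmetric] add_divide_distrib d)
      finally show ?thesis using 1 by (simp add: u_def scale_right_diff_distrib)
    next
      case 2
      have "jm lo (Suc k) u = a k *s sw k v + (1 - a (Suc k) / d) *s v"
        using lj 2 X[of "Suc k"] k X1 by (simp add: u_def lin_diff lin_scale algebra_simps)
      also have "1 - a (Suc k) / d = - (a k / d)" by (simp add: da[symmetric] add_divide_distrib d)
      finally show ?thesis using 2 by (simp add: u_def scale_right_diff_distrib)
    next
      case 3
      have "jm lo j (sw k v) = a j *s sw k v"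
        using sw_jm_commute[OF k _ 3 v(1)] j X[of j] k by (simp add: lin_scale[OF lins])
      then show ?thesis using 3 j X[of j] lj by (simp add: u_def lin_diff lin_scale scale_right_diff_distrib transpose_def mult.commute)
    qed
  qed
qed

text \<open>\<open>jm lo lo\<close> is an empty sum, so the first eigenvalue is 0. If
  \<open>a (Suc q) - a q\<close> is not an integer, the exchange is possible and moves
  \<open>a (Suc q)\<close> to position \<open>q\<close>, where the induction hypothesis
  applies.\<close>

lemma jm_eigen_integral:
  assumes "jm_eigen lo v a" "lo \<le> q" "q < n"
  shows "a q \<in> \<int>"
  using assms(2,3,1)
proof (induction q arbitrary: v a rule: dec_induct)
  case base
  then have "jm lo lo v = a lo *s v" "v \<noteq> 0" by (auto simp: jm_eigen_def)
  then have "a lo *s v = 0" "v \<noteq> 0" by (auto simp: jm_def)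
  then show ?case by simp
next
  case (step q)
  have IH: "b q \<in> \<int>" if "jm_eigen lo u b" for u b using step.IH[OF _ that] step.prems by simp
  let ?d = "a (Suc q) - a q"
  show ?case
  proof (cases "?d \<in> \<int>")
    case True
    then have "?d + a q \<in> \<int>" using IH[OF step.prems(2)] by (rule Ints_add)
    then show ?thesis by simp
  next
    case False
    then have "?d\<^sup>2 \<noteq> 1" by (auto simp: power2_eq_1_iff)
    from jm_eigen_swap(4)[OF step.prems(2) step.hyps(1) step.prems(1) this]
    show ?thesis using IH by fastforce
  qed
qed

definition jm_content :: "nat \<Rightarrow> 'b \<Rightarrow> (nat \<Rightarrow> int) \<Rightarrow> bool" where
  "jm_content lo v a \<longleftrightarrow> v \<in> W \<and> v \<noteq> 0 \<and> (\<forall>k\<in>{lo..<n}. jm lo k v = of_int (a k) *s v)"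

lemma jm_content_eigen: "jm_content lo v a \<longleftrightarrow> jm_eigen lo v (\<lambda>k. of_int (a k))"
  by (simp add: jm_content_def jm_eigen_def)

lemma exists_jm_content:
  assumes "v \<in> W" "v \<noteq> 0" "\<And>k. lo \<le> k \<Longrightarrow> k < n \<Longrightarrow> \<exists>c. jm lo k v = c *s v"
  shows "\<exists>a. jm_content lo v a"
proof -
  have "\<forall>k. \<exists>c. lo \<le> k \<and> k < n \<longrightarrow> jm lo k v = c *s v" using assms(3) by blast
  then obtain c where c: "\<And>k. lo \<le> k \<Longrightarrow> k < n \<Longrightarrow> jm lo k v = c k *s v" by metis
  then have e: "jm_eigen lo v c" using assms by (auto simp: jm_eigen_def)
  define a where "a = (\<lambda>k. \<lfloor>Re (c k)\<rfloor>)"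
  have "of_int (a k) = c k" if "lo \<le> k" "k < n" for k
    using jm_eigen_integral[OF e that] by (auto simp: a_def elim!: Ints_cases)
  then show ?thesis using c assms by (intro exI[of _ a]) (auto simp: jm_content_def)
qed

definition swap_vec :: "nat \<Rightarrow> (nat \<Rightarrow> int) \<Rightarrow> 'b \<Rightarrow> 'b" where
  "swap_vec k a v = sw k v - (1 / of_int (a (Suc k) - a k)) *s v"

text \<open>The last claim recovers \<open>v\<close> from the exchanged vector. It is what carries
  nonvanishing conditions from \<open>v\<close> over to \<open>swap_vec k a v\<close>.\<close>

lemma jm_content_swap:
  assumes e: "jm_content lo v a" and k: "lo \<le> k" "Suc k < n"
  shows "a (Suc k) \<noteq> a k"
    and "a (Suc k) = a k + 1 \<Longrightarrow> sw k v = v"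
    and "a (Suc k) = a k - 1 \<Longrightarrow> sw k v = - v"
    and "a (Suc k) \<noteq> a k + 1 \<Longrightarrow> a (Suc k) \<noteq> a k - 1 \<Longrightarrow> jm_content lo (swap_vec k a v) (a \<circ> transpose k (Suc k))"
    and "a (Suc k) \<noteq> a k + 1 \<Longrightarrow> a (Suc k) \<noteq> a k - 1 \<Longrightarrow>
      \<exists>c c'. v = c *s sw k (swap_vec k a v) + c' *s swap_vec k a v"
proof -
  note sw = jm_eigen_swap[OF e[unfolded jm_content_eigen] k, folded of_int_diff swap_vec_def]
  show "a (Suc k) \<noteq> a k" using sw(1) by auto
  show "sw k v = v" if "a (Suc k) = a k + 1" using sw(2) that by (simp add: swap_vec_def)
  show "sw k v = - v" if "a (Suc k) = a k - 1"
    using sw(2) that by (simp add: swap_vec_def eq_neg_iff_add_eq_0)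
  assume far: "a (Suc k) \<noteq> a k + 1" "a (Suc k) \<noteq> a k - 1"
  define d where "d = (of_int (a (Suc k) - a k) :: complex)"
  have "d\<^sup>2 \<noteq> 1"
  proof
    assume "d\<^sup>2 = 1"
    then have "d = of_int 1 \<or> d = of_int (-1)" by (simp add: power2_eq_1_iff)
    then have "a (Suc k) - a k = 1 \<or> a (Suc k) - a k = -1" unfolding d_def of_int_eq_iff .
    then show False using far by auto
  qed
  then show "jm_content lo (swap_vec k a v) (a \<circ> transpose k (Suc k))"
    using sw(4) by (simp add: jm_content_eigen comp_def d_def swap_vec_def)
  have "d \<noteq> 0" using sw(1) by (simp add: d_def)
  define e where "e = 1 - 1 / d\<^sup>2"
  have "e \<noteq> 0" using \<open>d \<noteq> 0\<close> \<open>d\<^sup>2 \<noteq> 1\<close> by (simp add: e_def field_simps)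
  have "sw k (swap_vec k a v) + (1 / d) *s swap_vec k a v = e *s v"
    using sw(3) by (simp add: d_def e_def swap_vec_def)
  then have "(1 / e) *s (sw k (swap_vec k a v) + (1 / d) *s swap_vec k a v) = v"
    using \<open>e \<noteq> 0\<close> by simp
  then have "v = (1 / e) *s sw k (swap_vec k a v) + (1 / (e * d)) *s swap_vec k a v"
    by (simp add: scale_right_distrib)
  then show "\<exists>c c'. v = c *s sw k (swap_vec k a v) + c' *s swap_vec k a v" by blast
qed

text \<open>On such a vector the two neighbouring transpositions act by opposite signs, against the
  braid relation.\<close>

lemma jm_content_braid:
  assumes e: "jm_content lo v a" and k: "lo \<le> k" "Suc (Suc k) < n"
    and eq: "a (Suc (Suc k)) = a k" and s: "\<sigma> = 1 \<or> \<sigma> = -1" "a (Suc k) = a k + \<sigma>"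
  shows False
proof -
  have v: "v \<in> W" "v \<noteq> 0" using e by (auto simp: jm_content_def)
  have s1: "sw k v = of_int \<sigma> *s v" using jm_content_swap(2,3)[OF e, of k] k s by auto
  have s2: "sw (Suc k) v = of_int (- \<sigma>) *s v" using jm_content_swap(2,3)[OF e, of "Suc k"] k s eq by auto
  note lins = act_lin[OF perm_transpose[of k "Suc k"]] act_lin[OF perm_transpose[of "Suc k" "Suc (Suc k)"]]
  have "transpose k (Suc k) \<circ> (transpose (Suc k) (Suc (Suc k)) \<circ> transpose k (Suc k)) =
    transpose (Suc k) (Suc (Suc k)) \<circ> (transpose k (Suc k) \<circ> transpose (Suc k) (Suc (Suc k)))"
    by (auto simp: fun_eq_iff transpose_def)
  then have "sw k (sw (Suc k) (sw k v)) = sw (Suc k) (sw k (sw (Suc k) v))"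
    using k v by (simp add: act_comp act_W permutes_compose)
  moreover have "sw k (sw (Suc k) (sw k v)) = of_int (- \<sigma>) *s v"
    using k s(1) by (auto simp: s1 s2 lin_minus[OF lins(1)] lin_minus[OF lins(2)])
  moreover have "sw (Suc k) (sw k (sw (Suc k) v)) = of_int \<sigma> *s v"
    using k s(1) by (auto simp: s1 s2 lin_minus[OF lins(1)] lin_minus[OF lins(2)])
  ultimately have "of_int (- \<sigma>) *s v = of_int \<sigma> *s v" by simp
  then have "of_int (- \<sigma>) = (of_int \<sigma> :: complex) \<or> v = 0" by (simp only: scale_cancel_right)
  then show False using v s(1) by auto
qed

text \<open>In a shortest counterexample the content \<open>a p\<close> does not recur strictly
  between \<open>p\<close> and \<open>q\<close>. The entries next to both ends must be
  \<open>a p - \<sigma>\<close>, since any other one could be exchanged with its end to shorten the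
  interval. If they are one and the same entry, the braid relation is violated; if not, they form a
  shorter pair, between which \<open>a p\<close> would recur.\<close>

lemma jm_content_between:
  assumes "jm_content lo v a" "lo \<le> p" "p < q" "q < n" "a p = a q" "\<sigma> = 1 \<or> \<sigma> = -1"
  shows "\<exists>i\<in>{p<..<q}. a i = a p + \<sigma>"
  using assms
proof (induction "q - p" arbitrary: v a p q \<sigma> rule: less_induct)
  case less
  show ?case
  proof (rule ccontr)
    assume neg: "\<not> ?thesis"
    note e = less.prems(1)
    have noc: "a i \<noteq> a p" if "i \<in> {p<..<q}" for i
    proof
      assume "a i = a p"
      then have "\<exists>j\<in>{p<..<i}. a j = a p + \<sigma>" using less.hyps[of i p v a \<sigma>] less.prems that by auto
      then show False using neg that by auto
    qed
    have "q \<noteq> Suc p" using jm_content_swap(1)[OF e, of p] less.prems by auto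
    then have pq: "Suc p < q" using less.prems by simp
    define r where "r = q - 1"
    have r: "q = Suc r" "p < r" using pq by (auto simp: r_def)
    have ar: "a r = a p - \<sigma>"
    proof (rule ccontr)
      assume ne: "a r \<noteq> a p - \<sigma>"
      have "a r \<noteq> a p + \<sigma>" using neg r by auto
      then have far: "a (Suc r) \<noteq> a r + 1" "a (Suc r) \<noteq> a r - 1" using ne less.prems r by auto
      have "jm_content lo (swap_vec r a v) (a \<circ> transpose r (Suc r))"
        using jm_content_swap(4)[OF e _ _ far] less.prems r by simp
      then have "\<exists>i\<in>{p<..<r}. (a \<circ> transpose r (Suc r)) i = (a \<circ> transpose r (Suc r)) p + \<sigma>"
        by (rule less.hyps[rotated]) (use less.prems r in \<open>auto simp: transpose_def\<close>)
      then obtain i where "i \<in> {p<..<r}" "a i = a p + \<sigma>" using r by (auto simp: transpose_def)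
      then show False using neg r by auto
    qed
    have ap: "a (Suc p) = a p - \<sigma>"
    proof (rule ccontr)
      assume ne: "a (Suc p) \<noteq> a p - \<sigma>"
      have "a (Suc p) \<noteq> a p + \<sigma>" using neg pq by auto
      then have far: "a (Suc p) \<noteq> a p + 1" "a (Suc p) \<noteq> a p - 1" using ne less.prems by auto
      have "jm_content lo (swap_vec p a v) (a \<circ> transpose p (Suc p))"
        using jm_content_swap(4)[OF e _ _ far] less.prems pq by simp
      then have "\<exists>i\<in>{Suc p<..<q}. (a \<circ> transpose p (Suc p)) i = (a \<circ> transpose p (Suc p)) (Suc p) + \<sigma>"
        by (rule less.hyps[rotated]) (use less.prems pq in \<open>auto simp: transpose_def\<close>)
      then obtain i where "i \<in> {Suc p<..<q}" "a i = a p + \<sigma>" using pq by (auto simp: transpose_def)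
      then show False using neg by auto
    qed
    show False
    proof (cases "r = Suc p")
      case True
      then show False
        using jm_content_braid[OF e, of p "- \<sigma>"] less.prems ap r by auto
    next
      case False
      then have "\<exists>i\<in>{Suc p<..<r}. a i = a (Suc p) + \<sigma>"
        using less.hyps[of r "Suc p" v a \<sigma>] less.prems r ar ap by auto
      then show False using noc ap r by auto
    qed
  qed
qed

text \<open>A preceding content that is not a neighbour can be exchanged, which moves
  \<open>a (Suc r)\<close> one step to the left. This cannot go on down to position
  \<open>lo\<close>, which only holds the content 0.\<close>

lemma jm_content_neighbour:
  assumes "jm_content lo v a" "lo \<le> q" "q < n" "a q \<noteq> 0"
  shows "\<exists>i\<in>{lo..<q}. a i = a q + 1 \<or> a i = a q - 1"
  using assms(2,3,1,4)
proof (induction q arbitrary: v a rule: dec_induct)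
  case base
  then have "jm lo lo v = of_int (a lo) *s v" "v \<noteq> 0" by (auto simp: jm_content_def)
  then have "of_int (a lo) *s v = 0" "v \<noteq> 0" by (auto simp: jm_def)
  then show ?case using base by simp
next
  case (step r)
  note e = step.prems(2)
  show ?case
  proof (cases "a (Suc r) = a r + 1 \<or> a (Suc r) = a r - 1")
    case True
    then show ?thesis using step by (intro bexI[of _ r]) auto
  next
    case False
    then have "jm_content lo (swap_vec r a v) (a \<circ> transpose r (Suc r))"
      using jm_content_swap(4)[OF e] step by auto
    from step.IH[OF _ this] obtain i where "i \<in> {lo..<r}" "a i = a (Suc r) + 1 \<or> a i = a (Suc r) - 1"
      using step.prems by (auto simp: transpose_def)
    then show ?thesis by (intro bexI[of _ i]) auto
  qed
qed

text \<open>A neighbour further away from 0 has, by induction, an earlier entry one step nearer to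
  0. This repeats the content \<open>a q\<close> at an earlier position, to which the induction
  applies again.\<close>

lemma jm_content_towards_zero:
  assumes "jm_content lo v a" "lo \<le> q" "q < n" "0 < \<sigma> * a q" "\<sigma> = 1 \<or> \<sigma> = -1"
  shows "\<exists>i\<in>{lo..<q}. a i = a q - \<sigma>"
  using assms(2-4)
proof (induction q rule: less_induct)
  case (less q)
  have "a q \<noteq> 0" using less.prems by auto
  then obtain i where i: "i \<in> {lo..<q}" "a i = a q + \<sigma> \<or> a i = a q - \<sigma>"
    using jm_content_neighbour[OF assms(1) less.prems(1,2)] assms(5) by auto
  show ?case
  proof (cases "a i = a q - \<sigma>")
    case False
    then have ai: "a i = a q + \<sigma>" using i by simp
    then obtain i' where i': "i' \<in> {lo..<i}" "a i' = a i - \<sigma>"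
      using less.IH[of i] less.prems i assms(5) by (auto simp: distrib_left)
    then have eq: "a i' = a q" using ai by simp
    then obtain i'' where "i'' \<in> {lo..<i'}" "a i'' = a i' - \<sigma>"
      using less.IH[of i'] less.prems i i' by auto
    then show ?thesis using i i' eq by (intro bexI[of _ i'']) auto
  qed (use i in auto)
qed

theorem jm_content_tableau:
  assumes "jm_content lo v a"
  shows "tableau_seq a lo n"
  unfolding tableau_seq_def
proof (intro conjI ballI impI)
  fix q assume q: "q \<in> {lo..<n}"
  show "\<exists>i\<in>{lo..<q}. a i = a q - 1" if "0 < a q"
    using jm_content_towards_zero[OF assms, of q 1] q that by auto
  show "\<exists>i\<in>{lo..<q}. a i = a q + 1" if "a q < 0"
    using jm_content_towards_zero[OF assms, of q "-1"] q that by auto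
next
  fix p q assume "p \<in> {lo..<n}" "q \<in> {p<..<n}" "a p = a q"
  then show "\<exists>i\<in>{p<..<q}. a i = a p + 1" "\<exists>i\<in>{p<..<q}. a i = a p - 1"
    using jm_content_between[OF assms, of p q 1] jm_content_between[OF assms, of p q "-1"] by auto
qed

text \<open>Sorting of contents realised on eigenvectors: every exchange replaces the vector by
  \<open>swap_vec\<close>, and \<open>P\<close> is the property that has to survive. With \<sigma> =
  -1 the transposed tableau is sorted, so that columns take the part of rows.\<close>

lemma jm_sorting:
  assumes v: "jm_content lo v a" "P v a" and lo: "lo \<le> lo'" "hi \<le> n" and \<sigma>: "\<sigma> = 1 \<or> \<sigma> = (-1::int)"
    and step: "\<And>u b k. jm_content lo u b \<Longrightarrow> P u b \<Longrightarrow> lo' \<le> k \<Longrightarrow> Suc k < hi \<Longrightarrow> \<sigma> * b k + 2 \<le> \<sigma> * b (Suc k) \<Longrightarrow>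
      P (swap_vec k b u) (b \<circ> transpose k (Suc k))"
  obtains \<pi> u where "\<pi> permutes {lo'..<hi}" "jm_content lo u (a \<circ> \<pi>)" "P u (a \<circ> \<pi>)"
    "\<And>k. lo' \<le> k \<Longrightarrow> Suc k < hi \<Longrightarrow> \<sigma> * (a \<circ> \<pi>) (Suc k) \<le> \<sigma> * (a \<circ> \<pi>) k + 1"
proof -
  have ss: "\<sigma> * (\<sigma> * x) = x" for x using \<sigma> by auto
  let ?Q = "\<lambda>c. \<exists>u b. c = (\<lambda>k. \<sigma> * b k) \<and> jm_content lo u b \<and> P u b"
  obtain \<pi> where \<pi>: "\<pi> permutes {lo'..<hi}" "?Q ((\<lambda>k. \<sigma> * a k) \<circ> \<pi>)"
    "\<And>k. lo' \<le> k \<Longrightarrow> Suc k < hi \<Longrightarrow> ((\<lambda>k. \<sigma> * a k) \<circ> \<pi>) (Suc k) \<le> ((\<lambda>k. \<sigma> * a k) \<circ> \<pi>) k + 1"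
  proof (rule sorting[of ?Q "\<lambda>k. \<sigma> * a k" lo' hi])
    show "?Q (\<lambda>k. \<sigma> * a k)" using v by blast
    fix c k assume c: "?Q c" and k: "lo' \<le> k" "Suc k < hi" and far: "c k + 2 \<le> c (Suc k)"
    then obtain u b where b: "c = (\<lambda>k. \<sigma> * b k)" "jm_content lo u b" "P u b" by blast
    have "b (Suc k) \<noteq> b k + 1" "b (Suc k) \<noteq> b k - 1" using far b \<sigma> by auto
    then have "jm_content lo (swap_vec k b u) (b \<circ> transpose k (Suc k))"
      using jm_content_swap(4)[OF b(2)] k lo by simp
    moreover have "P (swap_vec k b u) (b \<circ> transpose k (Suc k))" using step b k far by simp
    ultimately show "?Q (c \<circ> transpose k (Suc k))"
      using b by (intro exI[of _ "swap_vec k b u"] exI[of _ "b \<circ> transpose k (Suc k)"]) (auto simp: comp_def)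
  qed blast
  from \<pi>(2) obtain u b where b: "(\<lambda>k. \<sigma> * a k) \<circ> \<pi> = (\<lambda>k. \<sigma> * b k)" "jm_content lo u b" "P u b" by blast
  have "\<sigma> * (\<sigma> * (a \<circ> \<pi>) k) = \<sigma> * (\<sigma> * b k)" for k using fun_cong[OF b(1), of k] by simp
  then have "a \<circ> \<pi> = b" by (simp add: ss fun_eq_iff)
  then show thesis using that[OF \<pi>(1), of u] b \<pi>(3) by simp
qed

end

section \<open>Row permutations and Garnir relations\<close>

lemma exists_permutation_matching:
  assumes "finite A" "\<And>c. card {x \<in> A. f x = c} = card {x \<in> A. f' x = c}"
  obtains p where "p permutes A" "\<And>x. x \<in> A \<Longrightarrow> f x = f' (p x)"
proof -
  have "count (image_mset g (mset_set A)) c = card {x \<in> A. g x = c}" for g :: "'a \<Rightarrow> 'b" and c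
  proof -
    have "count (image_mset g (mset_set A)) c = (\<Sum>y\<in>g -` {c} \<inter> set_mset (mset_set A). count (mset_set A) y)"
      by (rule count_image_mset)
    also have "\<dots> = (\<Sum>y\<in>g -` {c} \<inter> A. 1)"
      unfolding finite_set_mset_mset_set[OF assms(1)]
      by (rule sum.cong[OF refl]) (use assms(1) in auto)
    also have "g -` {c} \<inter> A = {x \<in> A. g x = c}" by auto
    finally show ?thesis by simp
  qed
  then have "image_mset f (mset_set A) = image_mset f' (mset_set A)"
    using assms(2) by (intro multiset_eqI) simp
  from image_mset_eq_implies_permutes[OF assms(1) this] obtain p
    where "p permutes A" "\<forall>x\<in>A. f x = f' (p x)" .
  then show thesis using that[of p] by simp
qed

context symmetric_group_rep
begin

definition symz :: "nat set \<Rightarrow> 'b \<Rightarrow> 'b" where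
  "symz D v = (\<Sum>p | p permutes D. act p v)"

lemma permutes_lessThan: "p permutes D \<Longrightarrow> D \<subseteq> {..<n} \<Longrightarrow> p permutes {..<n}"
  by (rule permutes_subset)

lemma symz_lin: "D \<subseteq> {..<n} \<Longrightarrow> lin (symz D)"
  unfolding lin_def symz_def
proof (intro conjI allI)
  assume D: "D \<subseteq> {..<n}"
  fix x y c
  show "(\<Sum>p | p permutes D. act p (x + y)) = (\<Sum>p | p permutes D. act p x) + (\<Sum>p | p permutes D. act p y)"
    unfolding sum.distrib[symmetric]
    by (intro sum.cong refl lin_add act_lin permutes_lessThan[OF _ D]) auto
  show "(\<Sum>p | p permutes D. act p (c *s x)) = c *s (\<Sum>p | p permutes D. act p x)"
    unfolding scale_sum_right
    by (intro sum.cong refl lin_scale act_lin permutes_lessThan[OF _ D]) auto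
qed

lemma symz_act:
  assumes D: "D \<subseteq> {..<n}" and q: "q permutes D" and v: "v \<in> W"
  shows "symz D (act q v) = symz D v"
proof -
  have "symz D v = (\<Sum>p | p permutes D. act (p \<circ> q) v)"
    unfolding symz_def by (rule sum_permutations_compose_right[OF q])
  also have "\<dots> = symz D (act q v)"
    unfolding symz_def using v permutes_lessThan[OF _ D] q
    by (intro sum.cong refl act_comp[symmetric]) auto
  finally show ?thesis ..
qed

text \<open>The larger symmetriser absorbs permutations of \<open>D\<close>, so
  \<open>symz D' (symz D v)\<close> is \<open>symz D' v\<close> times the number of these
  permutations.\<close>

lemma symz_superset:
  assumes D: "D \<subseteq> D'" "D' \<subseteq> {..<n}" and v: "v \<in> W" and z: "symz D v = 0"
  shows "symz D' v = 0"
proof -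
  have fin: "finite D" using D finite_subset by (meson finite_lessThan)
  have "of_nat (card {q. q permutes D}) *s symz D' v = (\<Sum>q | q permutes D. symz D' v)"
    by (simp add: sum_constant_scale)
  also have "\<dots> = (\<Sum>q | q permutes D. symz D' (act q v))"
    using D v by (intro sum.cong refl symz_act[symmetric]) (auto intro: permutes_subset)
  also have "\<dots> = symz D' (symz D v)"
    unfolding symz_def[of D] by (rule lin_sum[OF symz_lin[OF D(2)], symmetric])
  also have "\<dots> = 0" using lin_zero[OF symz_lin[OF D(2)]] z by simp
  finally show ?thesis using card_permutations[OF refl fin] by simp
qed

lemma permutes_conj:
  assumes "p permutes D" "bij h"
  shows "h \<circ> p \<circ> inv h permutes h ` D"
  unfolding permutes_def
proof (intro conjI allI impI)
  fix x assume "x \<notin> h ` D"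
  then have "inv h x \<notin> D" using assms(2) by (metis bij_inv_eq_iff image_eqI)
  then show "(h \<circ> p \<circ> inv h) x = x"
    using permutes_not_in[OF assms(1)] assms(2) by (simp add: bij_is_surj surj_f_inv_f)
next
  fix y
  have "bij (h \<circ> p \<circ> inv h)" using assms by (intro bij_comp permutes_bij bij_imp_bij_inv) auto
  then show "\<exists>!x. (h \<circ> p \<circ> inv h) x = y" by (metis bij_pointE)
qed

lemma symz_image:
  assumes h: "h permutes {..<n}" and D: "D \<subseteq> {..<n}" and v: "v \<in> W" and hv: "act h v = v"
  shows "symz (h ` D) v = act h (symz D v)"
proof -
  have b: "bij h" using h by (rule permutes_bij)
  have "act h (symz D v) = (\<Sum>p | p permutes D. act h (act p v))"
    unfolding symz_def by (rule lin_sum[OF act_lin[OF h]])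
  also have "\<dots> = (\<Sum>p | p permutes h ` D. act p (act h v))"
  proof (rule sum.reindex_bij_witness[where i = "\<lambda>q. inv h \<circ> q \<circ> h" and j = "\<lambda>p. h \<circ> p \<circ> inv h"])
    fix p assume p: "p \<in> {p. p permutes D}"
    show "inv h \<circ> (h \<circ> p \<circ> inv h) \<circ> h = p"
      using b by (simp add: fun_eq_iff bij_is_inj inv_f_f)
    show "h \<circ> p \<circ> inv h \<in> {p. p permutes h ` D}" using p permutes_conj[OF _ b] by auto
    have 1: "h \<circ> p \<circ> inv h permutes {..<n}"
      using p permutes_lessThan[OF _ D] h by (auto intro!: permutes_compose permutes_inv)
    have "act (h \<circ> p \<circ> inv h) (act h v) = act (h \<circ> p) v"
      using act_comp[OF 1 h v] b by (simp add: comp_assoc bij_is_inj)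
    then show "act (h \<circ> p \<circ> inv h) (act h v) = act h (act p v)"
      using p permutes_lessThan[OF _ D] h v by (simp add: act_comp)
  next
    fix q assume "q \<in> {p. p permutes h ` D}"
    then have "inv h \<circ> q \<circ> inv (inv h) permutes inv h ` h ` D"
      by (intro permutes_conj bij_imp_bij_inv b) auto
    then show "inv h \<circ> q \<circ> h \<in> {p. p permutes D}"
      using b by (simp add: inv_inv_eq image_image bij_is_inj)
    show "h \<circ> (inv h \<circ> q \<circ> h) \<circ> inv h = q"
      using b by (simp add: fun_eq_iff bij_is_surj surj_f_inv_f)
  qed
  finally show ?thesis by (simp add: symz_def hv)
qed

text \<open>After sorting, the new cells of a row occupy consecutive positions and neighbouring ones
  have contents differing by 1, so that their transpositions fix \<open>v\<close>. Longer
  transpositions are conjugates of these.\<close>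

lemma transposition_in_row:
  assumes e: "jm_content lo v a" and lo: "lo \<le> lo'"
    and sorted: "\<And>k. lo' \<le> k \<Longrightarrow> Suc k < n \<Longrightarrow> a (Suc k) \<le> a k + 1"
    and kl: "lo' \<le> k" "k < l" "l < n" and r: "fst (cell a lo k) = fst (cell a lo l)"
  shows "act (transpose k l) v = v"
  using kl(2,3) r
proof (induction "l - k" arbitrary: l)
  case 0 then show ?case by simp
next
  case (Suc d)
  note t = jm_content_tableau[OF e]
  have v: "v \<in> W" using e by (auto simp: jm_content_def)
  obtain m where m: "l = Suc m" "k \<le> m" using Suc by (cases l) auto
  have "fst (cell a lo k) \<le> fst (cell a lo m)" "fst (cell a lo m) \<le> fst (cell a lo l)"
    using row_cell_mono'[OF t lo sorted, of k m] row_cell_mono'[OF t lo sorted, of m l] m kl Suc by auto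
  then have rm: "fst (cell a lo m) = fst (cell a lo (Suc m))" "fst (cell a lo k) = fst (cell a lo m)"
    using Suc m by auto
  have s: "sw m v = v"
    using same_row_consecutive[OF t _ _ rm(1)] jm_content_swap(2)[OF e, of m] m kl lo Suc by auto
  show ?case
  proof (cases "m = k")
    case True then show ?thesis using s m by simp
  next
    case False
    then have IH: "act (transpose k m) v = v"
      using Suc.hyps(1)[of m] Suc.hyps(2) Suc.prems m rm by auto
    have "transpose k l = transpose m (Suc m) \<circ> (transpose k m \<circ> transpose m (Suc m))"
      using False m by (auto simp: fun_eq_iff transpose_def)
    then have "act (transpose k l) v = sw m (act (transpose k m) (sw m v))"
      using m Suc.prems v by (simp add: act_comp permutes_compose)
    then show ?thesis by (simp add: s IH)
  qed
qed

text \<open>Induction on the number of moved points: composing with the transposition of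
  \<open>k\<close> and \<open>h k\<close> makes \<open>k\<close> a fixed point and still preserves
  the rows.\<close>

lemma row_permutation_invariant:
  assumes e: "jm_content lo v a" and lo: "lo \<le> lo'"
    and sorted: "\<And>k. lo' \<le> k \<Longrightarrow> Suc k < n \<Longrightarrow> a (Suc k) \<le> a k + 1"
    and h: "h permutes {lo'..<n}" "\<And>k. k \<in> {lo'..<n} \<Longrightarrow> fst (cell a lo (h k)) = fst (cell a lo k)"
  shows "act h v = v"
  using h
proof (induction "card {k. h k \<noteq> k}" arbitrary: h rule: less_induct)
  case less
  have v: "v \<in> W" using e by (auto simp: jm_content_def)
  have "{k. h k \<noteq> k} \<subseteq> {lo'..<n}" using permutes_not_in[OF less.prems(1)] by blast
  then have fin: "finite {k. h k \<noteq> k}" by (rule finite_subset) simp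
  show ?case
  proof (cases "h = id")
    case True then show ?thesis using v by (simp add: act_id)
  next
    case False
    then obtain k where k: "h k \<noteq> k" by (auto simp: fun_eq_iff)
    define l where "l = h k"
    have kin: "k \<in> {lo'..<n}" using k permutes_not_in[OF less.prems(1)] by blast
    have lin: "l \<in> {lo'..<n}" using kin permutes_in_image[OF less.prems(1)] by (simp add: l_def)
    have row: "fst (cell a lo k) = fst (cell a lo l)" using less.prems(2)[OF kin] by (simp add: l_def)
    have tv: "act (transpose k l) v = v"
    proof (cases k l rule: linorder_cases)
      case less
      then show ?thesis using transposition_in_row[OF e lo sorted _ less _ row] kin lin by simp
    next
      case greater
      then have "act (transpose l k) v = v"
        using transposition_in_row[OF e lo sorted _ greater _ row[symmetric]] kin lin by simp
      then show ?thesis by (simp add: transpose_commute[of k l])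
    qed (use k in \<open>simp add: l_def\<close>)
    define h' where "h' = transpose k l \<circ> h"
    have h': "h' permutes {lo'..<n}"
      unfolding h'_def using kin lin less.prems(1) by (intro permutes_compose permutes_swap_id) auto
    have "h' x = h x" if "h x \<noteq> k" "h x \<noteq> l" for x using that by (simp add: h'_def)
    moreover have "h' k = k" by (simp add: h'_def l_def)
    moreover have "h l \<noteq> l" using k permutes_inj[OF less.prems(1)] by (metis injD l_def)
    ultimately have "{x. h' x \<noteq> x} \<subseteq> {x. h x \<noteq> x} - {k}"
      using k by (auto simp: h'_def transpose_def split: if_splits)
    then have "{x. h' x \<noteq> x} \<subset> {x. h x \<noteq> x}" using k by blast
    then have "card {x. h' x \<noteq> x} < card {x. h x \<noteq> x}" by (rule psubset_card_mono[OF fin])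
    moreover have "fst (cell a lo (h' x)) = fst (cell a lo x)" if "x \<in> {lo'..<n}" for x
    proof -
      have "fst (cell a lo (transpose k l y)) = fst (cell a lo y)" for y
        unfolding transpose_def using row by simp
      then show ?thesis using less.prems(2)[OF that] by (simp add: h'_def)
    qed
    ultimately have hv: "act h' v = v" by (intro less.hyps[OF _ h'])
    have "h = transpose k l \<circ> h'" by (simp add: h'_def fun_eq_iff)
    moreover have "h' permutes {..<n}" using h' by (auto intro: permutes_subset)
    ultimately have "act h v = act (transpose k l) (act h' v)"
      using kin lin v by (simp add: act_comp)
    then show ?thesis by (simp add: hv tv)
  qed
qed

text \<open>Suppose the symmetrised vector is nonzero. The exchanges that sort the contents in
  increasing order multiply it by \<open>1 - 1 / d\<close> with \<open>d \<le> -2\<close>, so it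
  stays nonzero. In the end no neighbours descend by 1, since their transposition would act by -1,
  and the contents increase weakly. But the contents at \<open>k\<close> and \<open>l\<close>, which
  differ by 1 only, are never exchanged with each other.\<close>

lemma symz_window:
  assumes e: "jm_content lo v a" and xy: "lo \<le> x" "y < n"
    and kl: "x \<le> k" "k < l" "l \<le> y" "a l = a k - 1"
  shows "symz {x..y} v = 0"
proof (rule ccontr)
  assume nz: "symz {x..y} v \<noteq> 0"
  let ?D = "{x..y}"
  have D: "?D \<subseteq> {..<n}" using xy by auto
  define P where "P = (\<lambda>u (b::nat \<Rightarrow> int). symz ?D u \<noteq> 0 \<and> (\<exists>k l. x \<le> k \<and> k < l \<and> l \<le> y \<and> b l = b k - 1))"
  have sym_sw: "symz ?D (sw i u) = symz ?D u" if "u \<in> W" "x \<le> i" "Suc i \<le> y" for u i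
    using symz_act[OF D _ that(1), of "transpose i (Suc i)"] that permutes_swap_id[of i ?D "Suc i"] by auto
  obtain \<pi> u where u: "jm_content lo u (a \<circ> \<pi>)" "P u (a \<circ> \<pi>)"
    "\<And>k. x \<le> k \<Longrightarrow> Suc k < Suc y \<Longrightarrow> (-1) * (a \<circ> \<pi>) (Suc k) \<le> (-1) * (a \<circ> \<pi>) k + 1"
  proof (rule jm_sorting[of lo v a P x "Suc y" "-1"])
    show "P v a" using nz kl by (auto simp: P_def)
    fix u b i assume u: "jm_content lo u b" "P u b" and i: "x \<le> i" "Suc i < Suc y" and far: "-1 * b i + 2 \<le> -1 * b (Suc i)"
    have uW: "u \<in> W" using u by (auto simp: jm_content_def)
    define d where "d = (of_int (b (Suc i) - b i) :: complex)"
    have "d = of_int (b (Suc i) - b i)" "b (Suc i) - b i \<noteq> 1" "b (Suc i) - b i \<noteq> 0"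
      using far by (auto simp: d_def)
    then have d: "1 - 1 / d \<noteq> 0" by (metis diff_eq_diff_eq diff_zero divide_eq_1_iff eq_iff_diff_eq_0 of_int_eq_1_iff)
    have "symz ?D (swap_vec i b u) = (1 - 1 / d) *s symz ?D u"
      using uW i sym_sw[OF uW, of i] lin_diff[OF symz_lin[OF D]] lin_scale[OF symz_lin[OF D]]
      by (simp add: swap_vec_def d_def scale_left_diff_distrib)
    then have "symz ?D (swap_vec i b u) \<noteq> 0" using d u by (simp add: P_def)
    moreover obtain k l where kl: "x \<le> k" "k < l" "l \<le> y" "b l = b k - 1" using u by (auto simp: P_def)
    then have "\<not> (k = i \<and> l = Suc i)" using far by auto
    then have "transpose i (Suc i) k < transpose i (Suc i) l" "x \<le> transpose i (Suc i) k" "transpose i (Suc i) l \<le> y"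
      using kl i by (auto simp: transpose_def)
    moreover have "(b \<circ> transpose i (Suc i)) (transpose i (Suc i) l) = (b \<circ> transpose i (Suc i)) (transpose i (Suc i) k) - 1"
      using kl by simp
    ultimately show "P (swap_vec i b u) (b \<circ> transpose i (Suc i))" unfolding P_def by blast
  qed (use e xy in auto)
  define b where "b = a \<circ> \<pi>"
  note u = u[folded b_def]
  have uW: "u \<in> W" using u by (auto simp: jm_content_def)
  have asc: "b i \<le> b (Suc i)" if "x \<le> i" "Suc i \<le> y" for i
  proof -
    have "b i \<noteq> b (Suc i) + 1"
    proof
      assume "b i = b (Suc i) + 1"
      then have "sw i u = - u" using jm_content_swap(3)[OF u(1), of i] that xy by simp
      then have "symz ?D u = - symz ?D u"
        using sym_sw[OF uW that] lin_minus[OF symz_lin[OF D]] by simp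
      then have "(1 + 1) *s symz ?D u = 0" by (simp only: scale_left_distrib scale_one eq_neg_iff_add_eq_0)
      then show False using u(2) by (simp add: P_def)
    qed
    then show ?thesis using u(3)[of i] that by simp
  qed
  have mono: "x \<le> i \<Longrightarrow> j \<le> y \<Longrightarrow> b i \<le> b j" if "i \<le> j" for i j
    using that
  proof (induction j rule: dec_induct)
    case (step j) then show ?case using asc[of j] by auto
  qed simp
  obtain k l where "x \<le> k" "k < l" "l \<le> y" "b l = b k - 1" using u(2) by (auto simp: P_def)
  then show False using mono[of k l] by simp
qed

text \<open>\<open>S\<close> has more cells than there are columns for new cells of row
  \<open>Suc j\<close> to the left of the first new cell of row \<open>j\<close>; so the diagram
  contains the cell directly below the latter. The positions between these two cells form a window
  for \<open>symz_window\<close>. It consists of row \<open>j\<close> and a part of row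
  \<open>Suc j\<close> that is not larger than \<open>S\<close>, and a permutation within the rows
  carries it into the given set.\<close>

lemma garnir:
  assumes e: "jm_content lo v a" and lo: "lo \<le> lo'" "lo' \<le> n"
    and sorted: "\<And>k. lo' \<le> k \<Longrightarrow> Suc k < n \<Longrightarrow> a (Suc k) \<le> a k + 1"
    and S: "S \<subseteq> {k \<in> {lo'..<n}. fst (cell a lo k) = Suc j}"
    and card: "row_card (shape a lo lo') j < card S + row_card (shape a lo lo') (Suc j)"
  shows "symz ({k \<in> {lo'..<n}. fst (cell a lo k) = j} \<union> S) v = 0"
proof -
  define row where "row = (\<lambda>k. fst (cell a lo k))"
  define J where "J = (\<lambda>j. {k \<in> {lo'..<n}. row k = j})"
  define \<nu> where "\<nu> = row_card (shape a lo lo')"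
  note t = jm_content_tableau[OF e]
  have v: "v \<in> W" using e by (auto simp: jm_content_def)
  have ds: "downset (shape a lo lo')" "downset (shape a lo n)" using t lo by (auto intro!: downset_shape)
  have fs: "finite (shape a lo lo')" "finite (shape a lo n)" using lo by (auto intro!: finite_shape)
  have cells: "shape a lo n = shape a lo lo' \<union> cell a lo ` {lo'..<n}" by (rule shape_eq_cells[OF lo])
  have new: "cell a lo k \<notin> shape a lo lo'" if "lo' \<le> k" for k
    using shape_mono[OF that, of a lo] cell_notin_shape[of a lo k] by blast
  have BJ: "S \<subseteq> J (Suc j)" using S by (auto simp: J_def row_def)
  have inj: "inj_on (cell a lo) {lo'..<n}"
    by (rule inj_on_subset[OF inj_on_cell]) (use lo in auto)
  have col_inj: "k = k'" if "k \<in> {lo'..<n}" "k' \<in> {lo'..<n}" "row k = row k'" "snd (cell a lo k) = snd (cell a lo k')" for k k'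
    using inj_onD[OF inj, of k k'] that by (simp add: prod_eq_iff row_def)
  have row_bound: "\<nu> i \<le> c" if "cell a lo k = (i, c)" "lo' \<le> k" for i c k
    using new[OF that(2)] that(1) downset_row[OF ds(1) fs(1), of i c] unfolding \<nu>_def by simp
  \<comment> \<open>the cell of row \<open>Suc j\<close> directly below the first new cell of row \<open>j\<close>\<close>
  have "\<exists>k\<in>S. \<nu> j \<le> snd (cell a lo k)"
  proof (rule ccontr)
    assume neg: "\<not> ?thesis"
    have "snd (cell a lo k) \<in> {\<nu> (Suc j)..<\<nu> j}" if "k \<in> S" for k
    proof -
      have "lo' \<le> k" "fst (cell a lo k) = Suc j" using that BJ by (auto simp: J_def row_def)
      then have "\<nu> (Suc j) \<le> snd (cell a lo k)"
        using row_bound[of k "Suc j" "snd (cell a lo k)"] by (simp add: prod_eq_iff)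
      moreover have "snd (cell a lo k) < \<nu> j" using neg that by (simp add: not_le)
      ultimately show ?thesis by simp
    qed
    moreover have "inj_on (\<lambda>k. snd (cell a lo k)) S"
    proof (rule inj_onI)
      fix k k' assume "k \<in> S" "k' \<in> S" "snd (cell a lo k) = snd (cell a lo k')"
      then show "k = k'" using col_inj[of k k'] subsetD[OF BJ, of k] subsetD[OF BJ, of k'] by (auto simp: J_def)
    qed
    ultimately have "card S \<le> card {\<nu> (Suc j)..<\<nu> j}"
      by (intro card_inj_on_le) auto
    then show False using card row_card_antimono[OF ds(1) fs(1), of j "Suc j"] by (simp add: \<nu>_def)
  qed
  then obtain k1 where k1: "k1 \<in> S" "\<nu> j \<le> snd (cell a lo k1)" by blast
  obtain c1 where c1: "cell a lo k1 = (Suc j, c1)" "\<nu> j \<le> c1"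
    using k1 BJ by (cases "cell a lo k1") (auto simp: J_def row_def)
  have "(Suc j, c1) \<in> shape a lo n" using c1 k1 BJ cells by (force simp: J_def)
  then have "(Suc j, \<nu> j) \<in> shape a lo n" "(j, \<nu> j) \<in> shape a lo n"
    using c1 by (auto intro: downsetD[OF ds(2)])
  moreover have "(j, \<nu> j) \<notin> shape a lo lo'" "(Suc j, \<nu> j) \<notin> shape a lo lo'"
    using downset_row[OF ds(1) fs(1)] row_card_antimono[OF ds(1) fs(1), of j "Suc j"] by (auto simp: \<nu>_def)
  ultimately obtain x y where x: "x \<in> {lo'..<n}" "cell a lo x = (j, \<nu> j)"
    and y: "y \<in> {lo'..<n}" "cell a lo y = (Suc j, \<nu> j)"
    by (auto simp: cells)
  have mono: "row k \<le> row l" if "lo' \<le> k" "k \<le> l" "l < n" for k l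
    unfolding row_def using row_cell_mono'[OF t lo(1) sorted that] .
  have xy: "x < y"
  proof (rule ccontr)
    assume "\<not> x < y"
    then have "row y \<le> row x" using mono[of y x] x y by auto
    then show False using x y by (simp add: row_def)
  qed
  define S' where "S' = {k \<in> J (Suc j). k \<le> y}"
  have colmono: "snd (cell a lo k) < snd (cell a lo l)" if "lo' \<le> k" "k < l" "l < n" "row k = row l" for k l
    using col_cell_less[OF t, of k l] that lo by (auto simp: row_def)
  have D: "{x..y} = J j \<union> S'"
  proof (intro set_eqI iffI)
    fix k assume k: "k \<in> {x..y}"
    then have "row x \<le> row k" "row k \<le> row y" using mono x y by auto
    then have "row k = j \<or> row k = Suc j" using x y by (auto simp: row_def)
    then show "k \<in> J j \<union> S'" using k x y by (auto simp: J_def S'_def)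
  next
    fix k assume k: "k \<in> J j \<union> S'"
    have "x \<le> k"
    proof (rule ccontr)
      assume "\<not> x \<le> k"
      then have lt: "lo' \<le> k" "k < x" "row k \<le> row x" using k mono[of k x] x by (auto simp: J_def S'_def)
      then have "row k = j" using k x by (auto simp: J_def S'_def row_def)
      then have "snd (cell a lo k) < \<nu> j" using colmono[of k x] lt x by (auto simp: row_def)
      then show False using row_bound[of k j "snd (cell a lo k)"] lt \<open>row k = j\<close> by (simp add: row_def prod_eq_iff)
    qed
    moreover have "k \<le> y"
    proof (rule ccontr)
      assume "\<not> k \<le> y"
      then have "k \<in> J j" "row y \<le> row k" using k mono[of y k] y by (auto simp: J_def S'_def)
      then show False using y by (auto simp: J_def row_def)
    qed
    ultimately show "k \<in> {x..y}" by simp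
  qed
  have "a y = a x - 1" using cell_content[of a lo x] cell_content[of a lo y] x y by simp
  then have z: "symz (J j \<union> S') v = 0"
    using symz_window[OF e, of x y x y] x y lo xy by (simp flip: D)
  have "card S' \<le> card S"
  proof -
    have "inj_on (\<lambda>k. snd (cell a lo k)) S'"
    proof (rule inj_onI)
      fix k k' assume "k \<in> S'" "k' \<in> S'" "snd (cell a lo k) = snd (cell a lo k')"
      then show "k = k'" using col_inj[of k k'] by (auto simp: S'_def J_def)
    qed
    moreover have "snd (cell a lo k) \<in> {\<nu> (Suc j)..\<nu> j}" if "k \<in> S'" for k
    proof -
      have k: "lo' \<le> k" "k \<le> y" "row k = Suc j" "k < n" using that by (auto simp: S'_def J_def)
      have "\<nu> (Suc j) \<le> snd (cell a lo k)"
        using row_bound[of k "Suc j" "snd (cell a lo k)"] k by (simp add: row_def prod_eq_iff)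
      moreover have "snd (cell a lo k) \<le> snd (cell a lo y)"
        using colmono[of k y] k y by (cases "k = y") (auto simp: row_def)
      ultimately show ?thesis using y by simp
    qed
    ultimately have "card S' \<le> card {\<nu> (Suc j)..\<nu> j}" by (intro card_inj_on_le) auto
    also have "\<dots> \<le> card S" using card by (simp add: \<nu>_def)
    finally show ?thesis .
  qed
  then obtain S'' where S'': "S'' \<subseteq> S" "card S'' = card S'" "finite S''"
    using obtain_subset_with_card_n by metis
  have fB': "finite S'" by (simp add: S'_def J_def)
  let ?A = "{lo'..<n}"
  \<comment> \<open>Matching both the row and the membership in the chosen subset yields a
    permutation that sends \<open>S'\<close> onto \<open>S''\<close> and, since it preserves rows,
    fixes \<open>v\<close>.\<close>
  obtain h where h: "h permutes ?A" "\<And>k. k \<in> ?A \<Longrightarrow> (row k, k \<in> S') = (row (h k), h k \<in> S'')"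
  proof (rule exists_permutation_matching[of ?A "\<lambda>k. (row k, k \<in> S')" "\<lambda>k. (row k, k \<in> S'')"])
    fix c :: "nat \<times> bool"
    obtain i b where c: "c = (i, b)" by fastforce
    have sub: "S' \<subseteq> J (Suc j)" "S'' \<subseteq> J (Suc j)" using S'' BJ by (auto simp: S'_def)
    have "card {k \<in> ?A. (row k, k \<in> X) = c} = (if b then (if i = Suc j then card X else 0)
       else (if i = Suc j then card (J i) - card X else card (J i)))" if "X \<subseteq> J (Suc j)" "finite X" for X
    proof -
      have "{k \<in> ?A. (row k, k \<in> X) = c} = (if b then (if i = Suc j then X else {}) else
        (if i = Suc j then J i - X else J i))"
        using that(1) by (auto simp: c J_def)
      then show ?thesis using that by (auto simp: card_Diff_subset)
    qed
    from this[OF sub(1) fB'] this[OF sub(2) S''(3)]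
    show "card {k \<in> ?A. (row k, k \<in> S') = c} = card {k \<in> ?A. (row k, k \<in> S'') = c}" by (simp add: S''(2))
  qed auto
  have hn: "h permutes {..<n}" using h(1) by (auto intro: permutes_subset)
  have hv: "act h v = v"
    using row_permutation_invariant[OF e lo(1) sorted h(1)] h(2) by (simp add: row_def)
  have "symz (h ` (J j \<union> S')) v = 0"
    using symz_image[OF hn _ v hv, of "J j \<union> S'"] z lin_zero[OF act_lin[OF hn]] by (auto simp: J_def S'_def)
  moreover have "h ` (J j \<union> S') \<subseteq> J j \<union> S"
  proof
    fix y assume "y \<in> h ` (J j \<union> S')"
    then obtain k where k: "k \<in> J j \<union> S'" "y = h k" by blast
    then have "k \<in> ?A" by (auto simp: J_def S'_def)
    then show "y \<in> J j \<union> S" using h(2)[of k] k S''(1) permutes_in_image[OF h(1), of k] by (auto simp: J_def)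
  qed
  moreover have "J j \<union> S \<subseteq> {..<n}" using BJ by (auto simp: J_def)
  ultimately have "symz (J j \<union> S) v = 0" using symz_superset v by blast
  then show ?thesis by (simp add: J_def row_def)
qed

end

section \<open>Littlewood--Richardson tableaux from matrix coefficients\<close>

text \<open>The entry at \<open>(j, l)\<close> counts the positions in row \<open>l\<close> of
  \<open>v\<close> that \<open>g\<close> sends into row \<open>j\<close> of \<open>u\<close>. The
  matrix labels the double coset of \<open>g\<close> modulo the permutations that preserve the rows
  on either side.\<close>

definition cnt :: "nat set \<Rightarrow> (nat \<Rightarrow> nat) \<Rightarrow> (nat \<Rightarrow> nat) \<Rightarrow> (nat \<Rightarrow> nat) \<Rightarrow> nat \<Rightarrow> nat \<Rightarrow> nat" where
  "cnt A u v g j l = card {p \<in> A. v p = l \<and> u (g p) = j}"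

definition csum :: "nat set \<Rightarrow> ((nat \<Rightarrow> nat) \<Rightarrow> complex) \<Rightarrow> (nat \<Rightarrow> nat) \<Rightarrow> (nat \<Rightarrow> nat) \<Rightarrow> (nat \<Rightarrow> nat \<Rightarrow> nat) \<Rightarrow> complex" where
  "csum A F u v M = (\<Sum>g | g permutes A \<and> cnt A u v g = M. F g)"

lemma csum_nonzero_cnt: "csum A F u v M \<noteq> 0 \<Longrightarrow> \<exists>g. g permutes A \<and> cnt A u v g = M"
  unfolding csum_def by (metis (mono_tags, lifting) empty_Collect_eq sum.empty)

lemma sum_const_poly: "(\<Sum>x\<in>X. [:f x:]) = [:\<Sum>x\<in>X. f x:]"
  by (induction X rule: infinite_finite_induct) auto

lemma prod_const_poly: "(\<Prod>x\<in>X. [:f x:]) = [:\<Prod>x\<in>X. f x:]"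
  by (induction X rule: infinite_finite_induct) (auto simp: one_pCons mult.commute)

lemma shift_prod_fibres:
  assumes "finite I" "\<And>p. p \<in> I \<Longrightarrow> f p < length y"
  shows "(\<Prod>p\<in>I. [:y ! f p, 1:]) = shift_prod y (map (\<lambda>j. card {p \<in> I. f p = j}) [0..<length y])"
proof -
  have "(\<Prod>p\<in>I. [:y ! f p, 1:]) = (\<Prod>j\<in>{..<length y}. \<Prod>p\<in>{p \<in> I. f p = j}. [:y ! f p, 1:])"
    using assms by (intro prod.group[symmetric]) auto
  also have "\<dots> = (\<Prod>j\<in>{..<length y}. [:y ! j, 1:] ^ card {p \<in> I. f p = j})"
    by (intro prod.cong refl) simp
  finally show ?thesis by (simp add: shift_prod_def)
qed

text \<open>Averaging over the permutations of \<open>C\<close> leaves the sum unchanged, because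
  \<open>H\<close> is invariant, and replaces the values of \<open>F\<close> by sums that
  vanish.\<close>

lemma sum_permutes_invariant_zero:
  fixes F H :: "(nat \<Rightarrow> nat) \<Rightarrow> complex"
  assumes A: "finite A" "C \<subseteq> A" and G: "G \<subseteq> {g. g permutes A}"
    and inv: "\<And>g \<pi>. g \<in> G \<Longrightarrow> \<pi> permutes C \<Longrightarrow> g \<circ> \<pi> \<in> G \<and> H (g \<circ> \<pi>) = H g"
    and zero: "\<And>g. g \<in> G \<Longrightarrow> (\<Sum>\<pi> | \<pi> permutes C. F (g \<circ> \<pi>)) = 0"
  shows "(\<Sum>g\<in>G. F g * H g) = 0"
proof -
  have fin: "finite C" using A finite_subset by blast
  have "(\<Sum>g\<in>G. F g * H g) = (\<Sum>g\<in>G. F (g \<circ> \<pi>) * H g)" if "\<pi> permutes C" for \<pi>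
  proof -
    have "(\<Sum>g\<in>G. F g * H g) = (\<Sum>g\<in>G. F (g \<circ> \<pi>) * H (g \<circ> \<pi>))"
    proof (rule sum.reindex_bij_witness[where i = "\<lambda>g. g \<circ> \<pi>" and j = "\<lambda>g. g \<circ> inv \<pi>"])
      fix g assume g: "g \<in> G"
      show "g \<circ> inv \<pi> \<circ> \<pi> = g" using permutes_inv_o[OF that] by (simp add: comp_assoc)
      show "g \<circ> \<pi> \<circ> inv \<pi> = g" using permutes_inv_o[OF that] by (simp add: comp_assoc)
      show "g \<circ> inv \<pi> \<in> G" using inv[OF g permutes_inv[OF that]] by simp
      show "g \<circ> \<pi> \<in> G" using inv[OF g that] by simp
      show "F (g \<circ> inv \<pi> \<circ> \<pi>) * H (g \<circ> inv \<pi> \<circ> \<pi>) = F g * H g"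
        using permutes_inv_o[OF that] by (simp add: comp_assoc)
    qed
    also have "\<dots> = (\<Sum>g\<in>G. F (g \<circ> \<pi>) * H g)" using inv that by (intro sum.cong) auto
    finally show ?thesis .
  qed
  then have "(\<Sum>\<pi> | \<pi> permutes C. \<Sum>g\<in>G. F g * H g) = (\<Sum>\<pi> | \<pi> permutes C. \<Sum>g\<in>G. F (g \<circ> \<pi>) * H g)"
    by (rule sum.cong[OF refl]) blast
  also have "\<dots> = (\<Sum>g\<in>G. \<Sum>\<pi> | \<pi> permutes C. F (g \<circ> \<pi>) * H g)" by (rule sum.swap)
  also have "\<dots> = 0" using zero by (simp flip: sum_distrib_right)
  finally show ?thesis using card_permutations[OF refl fin] by simp
qed

text \<open>Consider the permutations whose matrix differs from \<open>M\<close> only in how the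
  columns \<open>i\<close> and \<open>Suc i\<close> share their joint sums, and weight
  \<open>g\<close> with the product of \<open>y ! u (g p) + t\<close> over the positions
  \<open>p\<close> of row \<open>Suc i\<close> of \<open>v\<close>. Expand over the sets
  \<open>X\<close> of positions that take \<open>t\<close>. The Garnir relation for row
  \<open>i\<close> and \<open>X\<close> removes the terms with more than \<open>k\<close> factors
  \<open>t\<close>, so the degree in \<open>t\<close> is at most \<open>k\<close>. The exponent
  vectors are the columns \<open>Suc i\<close> of the matrices, and
  \<open>lex_min_exponent_bound\<close> applies.\<close>

lemma pair_bound:
  fixes F :: "(nat \<Rightarrow> nat) \<Rightarrow> complex"
  assumes A: "finite A" and u: "\<And>p. p \<in> A \<Longrightarrow> u p < R"
    and garnir: "\<And>X g. X \<subseteq> {p \<in> A. v p = Suc i} \<Longrightarrow> k < card X \<Longrightarrow> g permutes A \<Longrightarrow>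
      (\<Sum>\<pi> | \<pi> permutes {p \<in> A. v p = i} \<union> X. F (g \<circ> \<pi>)) = 0"
    and M: "csum A F u v M \<noteq> 0"
    and lex: "\<And>M'. csum A F u v M' \<noteq> 0 \<Longrightarrow> (\<And>j l. l \<noteq> i \<Longrightarrow> l \<noteq> Suc i \<Longrightarrow> M' j l = M j l) \<Longrightarrow>
      (\<And>j. M' j i + M' j (Suc i) = M j i + M j (Suc i)) \<Longrightarrow> M' \<noteq> M \<Longrightarrow>
      \<exists>j. M j (Suc i) < M' j (Suc i) \<and> (\<forall>j'<j. M' j' (Suc i) = M j' (Suc i))"
    and j: "j < R"
  shows "(\<Sum>l\<le>j. M l (Suc i)) \<le> (\<Sum>l<j. M l i) + k"
proof -
  define I where "I = {p \<in> A. v p = i}"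
  define I' where "I' = {p \<in> A. v p = Suc i}"
  have finI: "finite I'" "finite I" using A by (auto simp: I'_def I_def)
  let ?c = "cnt A u v"
  \<comment> \<open>These conditions are preserved when \<open>g\<close> is composed with
    permutations of row \<open>i\<close> and a part of row \<open>Suc i\<close> of \<open>v\<close>.
    Together with column \<open>Suc i\<close> they determine the matrix of a permutation.\<close>
  define inert where "inert = (\<lambda>N. (\<forall>j l. l \<noteq> i \<and> l \<noteq> Suc i \<longrightarrow> N j l = M j l) \<and>
    (\<forall>j. N j i + N j (Suc i) = M j i + M j (Suc i)))"
  define G where "G = {g. g permutes A \<and> inert (?c g)}"
  define bvec where "bvec = (\<lambda>N. map (\<lambda>j. N j (Suc i)) [0..<R] :: nat list)"
  define c where "c = (\<lambda>b. \<Sum>g\<in>{g \<in> G. bvec (?c g) = b}. F g)"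
  define S where "S = {b \<in> (\<lambda>g. bvec (?c g)) ` G. c b \<noteq> 0}"
  define r where "r = map (\<lambda>j. M j i + M j (Suc i)) [0..<R]"
  have finG: "finite G" unfolding G_def by (rule finite_subset[OF _ finite_permutations[OF A]]) auto
  have zeroR: "?c g j l = 0" if "g permutes A" "R \<le> j" for g j l
  proof -
    have "u (g p) < R" if "p \<in> A" for p
      using u[of "g p"] permutes_in_image[OF \<open>g permutes A\<close>] that by simp
    then have "{p \<in> A. v p = l \<and> u (g p) = j} = {}" using that(2) by force
    then show ?thesis by (simp only: cnt_def card.empty)
  qed
  have inj: "N = N'" if "inert N" "inert N'" "bvec N = bvec N'" "\<exists>g. g permutes A \<and> N = ?c g" "\<exists>g. g permutes A \<and> N' = ?c g" for N N'
  proof -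
    have e: "N j (Suc i) = N' j (Suc i)" for j
    proof (cases "j < R")
      case True
      then have "bvec N ! j = bvec N' ! j" using that(3) by simp
      then show ?thesis using True by (simp add: bvec_def)
    next
      case False
      then show ?thesis using that(4,5) zeroR by force
    qed
    have "N j l = N' j l" for j l
    proof -
      consider "l = i" | "l = Suc i" | "l \<noteq> i" "l \<noteq> Suc i" by blast
      then show ?thesis
      proof cases
        case 1
        have "N j i + N j (Suc i) = N' j i + N' j (Suc i)" using that(1,2) by (simp add: inert_def)
        then show ?thesis using e[of j] 1 by simp
      next
        case 2 then show ?thesis using e by simp
      next
        case 3 then show ?thesis using that(1,2) by (simp add: inert_def)
      qed
    qed
    then show ?thesis by blast
  qed
  have ccsum: "c (bvec N) = csum A F u v N" if "inert N" "\<exists>g. g permutes A \<and> N = ?c g" for N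
  proof -
    have "{g \<in> G. bvec (?c g) = bvec N} = {g. g permutes A \<and> ?c g = N}"
      using that inj[of _ N] by (auto simp: G_def)
    then show ?thesis by (simp add: c_def csum_def)
  qed
  have inertM: "inert M" by (simp add: inert_def)
  obtain gM where gM: "gM permutes A" "?c gM = M" using csum_nonzero_cnt[OF M] by blast
  have exM: "\<exists>g. g permutes A \<and> M = ?c g" using gM by blast
  have gMG: "gM \<in> G" using gM inertM by (simp add: G_def)
  have S_mem: "\<exists>N. b = bvec N \<and> inert N \<and> (\<exists>g. g permutes A \<and> N = ?c g) \<and> csum A F u v N \<noteq> 0" if b: "b \<in> S" for b
  proof -
    obtain g where g: "g permutes A" "inert (?c g)" "b = bvec (?c g)" "c b \<noteq> 0"
      using b by (auto simp: S_def G_def)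
    have "\<exists>g'. g' permutes A \<and> ?c g = ?c g'" using g(1) by blast
    then have "csum A F u v (?c g) \<noteq> 0" using ccsum[OF g(2)] g(3,4) by simp
    then show ?thesis using g by blast
  qed
  have "(\<Sum>l\<le>j. bvec M ! l) + (\<Sum>l<j. bvec M ! l) \<le> (\<Sum>l<j. r ! l) + k"
  proof (rule lex_min_exponent_bound[of S R c r "bvec M" k j])
    show "finite S" using finG by (simp add: S_def)
    show "\<forall>b\<in>S. length b = R \<and> c b \<noteq> 0 \<and> (\<forall>j<R. b ! j \<le> r ! j)"
    proof
      fix b assume b: "b \<in> S"
      then obtain N where N: "b = bvec N" "inert N" using S_mem by blast
      have "b ! j \<le> r ! j" if "j < R" for j
      proof -
        have "N j i + N j (Suc i) = M j i + M j (Suc i)" using N(2) by (simp add: inert_def)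
        then show ?thesis using that by (simp add: N(1) bvec_def r_def)
      qed
      then show "length b = R \<and> c b \<noteq> 0 \<and> (\<forall>j<R. b ! j \<le> r ! j)"
        using b N(1) by (auto simp: S_def bvec_def)
    qed
    show "length r = R" by (simp add: r_def)
    show "bvec M \<in> S" using gMG gM M ccsum[OF inertM exM] by (auto simp: S_def intro!: image_eqI[of _ _ gM])
    show "\<forall>b\<in>S. b \<noteq> bvec M \<longrightarrow> (\<exists>j<R. bvec M ! j < b ! j \<and> (\<forall>l<j. b ! l = bvec M ! l))"
    proof (intro ballI impI)
      fix b assume b: "b \<in> S" "b \<noteq> bvec M"
      then obtain N g where N: "b = bvec N" "inert N" "g permutes A" "N = ?c g" "csum A F u v N \<noteq> 0"
        using S_mem by blast
      then obtain j where j: "M j (Suc i) < N j (Suc i)" "\<forall>j'<j. N j' (Suc i) = M j' (Suc i)"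
        using lex[of N] b by (auto simp: inert_def)
      have "j < R" using j(1) zeroR[OF N(3), of j "Suc i"] N(4) by (metis not_le not_less0)
      then show "\<exists>j<R. bvec M ! j < b ! j \<and> (\<forall>l<j. b ! l = bvec M ! l)"
        using j by (intro exI[of _ j]) (simp add: N(1) bvec_def)
    qed
    show "\<forall>y. length y = R \<longrightarrow> degree (\<Sum>b\<in>S. [:c b:] * shift_prod y b) \<le> k"
    proof (intro allI impI)
      fix y :: "complex list" assume y: "length y = R"
      \<comment> \<open>The product over the positions that do not take \<open>t\<close>; permuting
        row \<open>i\<close> together with \<open>X\<close> leaves it unchanged.\<close>
      define H where "H = (\<lambda>X g. \<Prod>p\<in>I' - X. y ! u (g p))"
      have "(\<Sum>b\<in>S. [:c b:] * shift_prod y b) = (\<Sum>b\<in>(\<lambda>g. bvec (?c g)) ` G. [:c b:] * shift_prod y b)"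
        using finG by (intro sum.mono_neutral_left) (auto simp: S_def)
      also have "\<dots> = (\<Sum>b\<in>(\<lambda>g. bvec (?c g)) ` G. \<Sum>g\<in>{g \<in> G. bvec (?c g) = b}. [:F g:] * shift_prod y (bvec (?c g)))"
      proof (intro sum.cong refl)
        fix b
        have "[:c b:] = (\<Sum>g\<in>{g \<in> G. bvec (?c g) = b}. [:F g:])"
          unfolding c_def by (rule sum_const_poly[symmetric])
        then show "[:c b:] * shift_prod y b = (\<Sum>g\<in>{g \<in> G. bvec (?c g) = b}. [:F g:] * shift_prod y (bvec (?c g)))"
          by (simp only: sum_distrib_right) (auto intro!: sum.cong)
      qed
      also have "\<dots> = (\<Sum>g\<in>G. [:F g:] * shift_prod y (bvec (?c g)))"
        by (rule sum.image_gen[OF finG, symmetric])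
      also have "\<dots> = (\<Sum>g\<in>G. [:F g:] * (\<Sum>X\<in>Pow I'. [:H X g:] * [:0, 1:] ^ card X))"
      proof (intro sum.cong refl arg_cong2[of _ _ _ _ "(*)"])
        fix g assume "g \<in> G"
        then have g: "g permutes A" by (simp add: G_def)
        have "shift_prod y (bvec (?c g)) = (\<Prod>p\<in>I'. [:y ! u (g p), 1:])"
        proof -
          have "{p \<in> A. v p = Suc i \<and> u (g p) = j} = {p \<in> I'. u (g p) = j}" for j by (auto simp: I'_def)
          then have "bvec (?c g) = map (\<lambda>j. card {p \<in> I'. u (g p) = j}) [0..<length y]"
            by (simp add: bvec_def y cnt_def)
          then show ?thesis
            using shift_prod_fibres[OF finI(1), of "\<lambda>p. u (g p)" y] u permutes_in_image[OF g]
            by (auto simp: I'_def y)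
        qed
        also have "\<dots> = (\<Prod>p\<in>I'. [:0, 1:] + [:y ! u (g p):])" by simp
        also have "\<dots> = (\<Sum>X\<in>Pow I'. (\<Prod>p\<in>X. [:0, 1:]) * (\<Prod>p\<in>I' - X. [:y ! u (g p):]))"
          by (rule prod_add[OF finI(1)])
        also have "\<dots> = (\<Sum>X\<in>Pow I'. [:H X g:] * [:0, 1:] ^ card X)"
        proof (intro sum.cong refl)
          fix X
          show "(\<Prod>p\<in>X. [:0, 1:]) * (\<Prod>p\<in>I' - X. [:y ! u (g p):]) = [:H X g:] * [:0, 1:] ^ card X"
            by (simp add: H_def prod_const_poly)
        qed
        finally show "shift_prod y (bvec (?c g)) = (\<Sum>X\<in>Pow I'. [:H X g:] * [:0, 1:] ^ card X)" .
      qed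
      also have "\<dots> = (\<Sum>X\<in>Pow I'. \<Sum>g\<in>G. [:F g:] * ([:H X g:] * [:0, 1:] ^ card X))"
        unfolding sum_distrib_left by (rule sum.swap)
      also have "\<dots> = (\<Sum>X\<in>Pow I'. [:\<Sum>g\<in>G. F g * H X g:] * [:0, 1:] ^ card X)"
      proof (intro sum.cong refl)
        fix X
        have "[:\<Sum>g\<in>G. F g * H X g:] = (\<Sum>g\<in>G. [:F g:] * [:H X g:])"
          by (simp add: sum_const_poly mult.commute)
        then show "(\<Sum>g\<in>G. [:F g:] * ([:H X g:] * [:0, 1:] ^ card X)) = [:\<Sum>g\<in>G. F g * H X g:] * [:0, 1:] ^ card X"
          by (simp only: sum_distrib_right mult.assoc)
      qed
      finally have eq: "(\<Sum>b\<in>S. [:c b:] * shift_prod y b) = (\<Sum>X\<in>Pow I'. [:\<Sum>g\<in>G. F g * H X g:] * [:0, 1:] ^ card X)" .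
      have vanish: "(\<Sum>g\<in>G. F g * H X g) = 0" if X: "X \<subseteq> I'" "k < card X" for X
      proof (rule sum_permutes_invariant_zero[OF A, where C = "I \<union> X"])
        show "I \<union> X \<subseteq> A" using X by (auto simp: I_def I'_def)
        show "G \<subseteq> {g. g permutes A}" by (auto simp: G_def)
        show "(\<Sum>\<pi> | \<pi> permutes I \<union> X. F (g \<circ> \<pi>)) = 0" if "g \<in> G" for g
          using garnir[of X g] that X by (auto simp: I_def I'_def G_def)
        fix g \<pi> assume g: "g \<in> G" and \<pi>: "\<pi> permutes I \<union> X"
        have \<pi>A: "\<pi> permutes A" using \<pi> X by (auto simp: I_def I'_def intro: permutes_subset)
        have gA: "g permutes A" using g by (simp add: G_def)
        have inIX: "v (\<pi> p) \<in> {i, Suc i}" "v p \<in> {i, Suc i}" if "p \<in> I \<union> X" for p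
          using that permutes_in_image[OF \<pi>, of p] X by (auto simp: I_def I'_def)
        have other: "?c (g \<circ> \<pi>) j l = ?c g j l" if "l \<noteq> i" "l \<noteq> Suc i" for j l
        proof -
          have "\<pi> p = p" if "v p = l" for p
            using permutes_not_in[OF \<pi>, of p] inIX(2)[of p] that \<open>l \<noteq> i\<close> \<open>l \<noteq> Suc i\<close> by auto
          then have "{p \<in> A. v p = l \<and> u ((g \<circ> \<pi>) p) = j} = {p \<in> A. v p = l \<and> u (g p) = j}" by auto
          then show ?thesis by (simp add: cnt_def)
        qed
        have sum: "?c (g \<circ> \<pi>) j i + ?c (g \<circ> \<pi>) j (Suc i) = ?c g j i + ?c g j (Suc i)" for j
        proof -
          have *: "?c h j i + ?c h j (Suc i) = card {p \<in> A. v p \<in> {i, Suc i} \<and> u (h p) = j}" for h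
          proof -
            have "{p \<in> A. v p \<in> {i, Suc i} \<and> u (h p) = j} =
              {p \<in> A. v p = i \<and> u (h p) = j} \<union> {p \<in> A. v p = Suc i \<and> u (h p) = j}" by auto
            then show ?thesis unfolding cnt_def using A by (subst card_Un_disjoint[symmetric]) auto
          qed
          have vv: "v (\<pi> p) \<in> {i, Suc i} \<longleftrightarrow> v p \<in> {i, Suc i}" for p
            using inIX[of p] permutes_not_in[OF \<pi>, of p] by (cases "p \<in> I \<union> X") auto
          have "bij_betw \<pi> {p \<in> A. v p \<in> {i, Suc i} \<and> u ((g \<circ> \<pi>) p) = j} {p \<in> A. v p \<in> {i, Suc i} \<and> u (g p) = j}"
          proof -
            have 1: "{p \<in> A. v p \<in> {i, Suc i} \<and> u ((g \<circ> \<pi>) p) = j} = {p \<in> A. v (\<pi> p) \<in> {i, Suc i} \<and> u (g (\<pi> p)) = j}"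
              using vv by auto
            have 2: "\<pi> ` {p \<in> A. v (\<pi> p) \<in> {i, Suc i} \<and> u (g (\<pi> p)) = j} = {p \<in> \<pi> ` A. v p \<in> {i, Suc i} \<and> u (g p) = j}" by blast
            show ?thesis
              using inj_on_subset[OF permutes_inj[OF \<pi>] subset_UNIV] by (simp only: bij_betw_def 1 2 permutes_image[OF \<pi>A])
          qed
          then show ?thesis unfolding * by (rule bij_betw_same_card)
        qed
        have "g \<circ> \<pi> \<in> G"
          using g other sum permutes_compose[OF \<pi>A gA] by (simp add: G_def inert_def)
        moreover have "H X (g \<circ> \<pi>) = H X g"
          unfolding H_def
        proof (intro prod.cong refl)
          fix p assume "p \<in> I' - X"
          then have "p \<notin> I \<union> X" by (auto simp: I_def I'_def)
          then show "y ! u ((g \<circ> \<pi>) p) = y ! u (g p)" using permutes_not_in[OF \<pi>] by simp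
        qed
        ultimately show "g \<circ> \<pi> \<in> G \<and> H X (g \<circ> \<pi>) = H X g" by simp
      qed
      show "degree (\<Sum>b\<in>S. [:c b:] * shift_prod y b) \<le> k"
        unfolding eq
      proof (rule degree_sum_le)
        fix X assume X: "X \<in> Pow I'"
        show "degree ([:\<Sum>g\<in>G. F g * H X g:] * [:0, 1:] ^ card X) \<le> k"
        proof (cases "k < card X")
          case True then show ?thesis using vanish[of X] X by simp
        next
          case False
          have "degree ([:\<Sum>g\<in>G. F g * H X g:] * [:0, 1:] ^ card X) \<le>
            degree [:\<Sum>g\<in>G. F g * H X g:] + degree ([:0::complex, 1:] ^ card X)" by (rule degree_mult_le)
          also have "\<dots> \<le> k" using False by (simp add: degree_power_eq)
          finally show ?thesis .
        qed
      qed (simp add: finI)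
    qed
    show "j < R" by (rule j)
  qed
  moreover have "(\<Sum>l\<le>j. bvec M ! l) = (\<Sum>l\<le>j. M l (Suc i))" using j by (intro sum.cong) (auto simp: bvec_def)
  moreover have "(\<Sum>l<j. bvec M ! l) = (\<Sum>l<j. M l (Suc i))" using j by (intro sum.cong) (auto simp: bvec_def)
  \<comment> \<open>\<open>r ! l\<close> is the sum of both columns, so column \<open>Suc i\<close>
    can be cancelled once on either side of the bound.\<close>
  moreover have "(\<Sum>l<j. r ! l) = (\<Sum>l<j. M l i) + (\<Sum>l<j. M l (Suc i))"
    unfolding sum.distrib[symmetric] using j by (intro sum.cong) (auto simp: r_def)
  ultimately show ?thesis by linarith
qed

text \<open>By the two invariances \<open>F\<close> is constant on the permutations with a given
  matrix, so the sum is a positive multiple of \<open>F g0\<close>.\<close>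

lemma csum_nonzero:
  assumes A: "finite A" and g0: "g0 permutes A" "F g0 \<noteq> 0"
    and left: "\<And>h g. h permutes A \<Longrightarrow> g permutes A \<Longrightarrow> (\<And>x. x \<in> A \<Longrightarrow> u (h x) = u x) \<Longrightarrow> F (h \<circ> g) = F g"
    and right: "\<And>h g. h permutes A \<Longrightarrow> g permutes A \<Longrightarrow> (\<And>x. x \<in> A \<Longrightarrow> v (h x) = v x) \<Longrightarrow> F (g \<circ> h) = F g"
  shows "csum A F u v (cnt A u v g0) \<noteq> 0"
proof -
  have "F g = F g0" if g: "g permutes A" "cnt A u v g = cnt A u v g0" for g
  proof -
    have pair: "card {x \<in> A. (v x, u (h x)) = c} = cnt A u v h (snd c) (fst c)" for h c
      unfolding cnt_def by (rule arg_cong[of _ _ card]) auto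
    obtain k where k: "k permutes A" "\<And>x. x \<in> A \<Longrightarrow> (v x, u (g0 x)) = (v (k x), u (g (k x)))"
      by (rule exists_permutation_matching[OF A, of "\<lambda>x. (v x, u (g0 x))" "\<lambda>x. (v x, u (g x))"])
        (use pair g(2) in auto)
    \<comment> \<open>Then \<open>h \<circ> g0 = g \<circ> k\<close>, where \<open>h\<close>
      preserves the labels \<open>u\<close> and \<open>k\<close> preserves the labels
      \<open>v\<close>.\<close>
    define h where "h = g \<circ> k \<circ> inv g0"
    have gk: "g \<circ> k permutes A" using permutes_compose[OF k(1) g(1)] .
    have h: "h permutes A" unfolding h_def using permutes_compose[OF permutes_inv[OF g0(1)] gk] .
    have "h \<circ> g0 = g \<circ> k" using permutes_inv_o(2)[OF g0(1)] by (simp add: h_def comp_assoc)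
    have "u (h y) = u y" if "y \<in> A" for y
    proof -
      have "inv g0 y \<in> A" using that permutes_in_image[OF permutes_inv[OF g0(1)]] by simp
      then show ?thesis using k(2)[of "inv g0 y"] permutes_inverses(1)[OF g0(1)] by (simp add: h_def)
    qed
    then have "F (h \<circ> g0) = F g0" using left[OF h g0(1)] by simp
    moreover have "F (g \<circ> k) = F g" using right[OF k(1) g(1)] k(2) by simp
    ultimately show ?thesis using \<open>h \<circ> g0 = g \<circ> k\<close> by simp
  qed
  then have "csum A F u v (cnt A u v g0) = (\<Sum>g | g permutes A \<and> cnt A u v g = cnt A u v g0. F g0)"
    unfolding csum_def by (intro sum.cong) auto
  moreover have "card {g. g permutes A \<and> cnt A u v g = cnt A u v g0} \<noteq> 0"
  proof -
    have "finite {g. g permutes A \<and> cnt A u v g = cnt A u v g0}"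
      by (rule finite_subset[OF _ finite_permutations[OF A]]) auto
    moreover have "g0 \<in> {g. g permutes A \<and> cnt A u v g = cnt A u v g0}" using g0 by simp
    ultimately show ?thesis by (metis card_0_eq empty_iff)
  qed
  ultimately show ?thesis using g0(2) by simp
qed

text \<open>Used on two levels: for rows of numbers and, with that order in place of
  \<open>lt\<close>, for matrices as sequences of rows.\<close>

definition first_less :: "('a \<Rightarrow> 'a \<Rightarrow> bool) \<Rightarrow> (nat \<Rightarrow> 'a) \<Rightarrow> (nat \<Rightarrow> 'a) \<Rightarrow> bool" where
  "first_less lt f g \<longleftrightarrow> (\<exists>q. lt (f q) (g q) \<and> (\<forall>q'<q. f q' = g q'))"

lemma first_less_total:
  assumes "\<And>x y. x \<noteq> y \<Longrightarrow> lt x y \<or> lt y x" "f \<noteq> g"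
  shows "first_less lt f g \<or> first_less lt g f"
proof -
  define q where "q = (LEAST q. f q \<noteq> g q)"
  have "\<exists>q. f q \<noteq> g q" using assms(2) by blast
  then have "f q \<noteq> g q" unfolding q_def by (rule LeastI_ex)
  moreover have "f q' = g q'" if "q' < q" for q' using not_less_Least that unfolding q_def by blast
  ultimately show ?thesis using assms(1)[of "f q" "g q"] unfolding first_less_def by metis
qed

lemma first_less_trans:
  assumes trans: "\<And>x y z. lt x y \<Longrightarrow> lt y z \<Longrightarrow> lt x z" and "first_less lt f g" "first_less lt g h"
  shows "first_less lt f h"
proof -
  obtain p q where p: "lt (f p) (g p)" "\<forall>q'<p. f q' = g q'" and q: "lt (g q) (h q)" "\<forall>q'<q. g q' = h q'"
    using assms(2,3) unfolding first_less_def by blast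
  have "lt (f (min p q)) (h (min p q))"
    using p q trans by (cases p q rule: linorder_cases) auto
  moreover have "\<forall>q'<min p q. f q' = h q'" using p(2) q(2) by simp
  ultimately show ?thesis unfolding first_less_def by blast
qed

lemma finite_total_maximum:
  assumes "finite S" "S \<noteq> {}" "\<And>x y. x \<noteq> y \<Longrightarrow> lt x y \<or> lt y x" "\<And>x y z. lt x y \<Longrightarrow> lt y z \<Longrightarrow> lt x z"
  shows "\<exists>m\<in>S. \<forall>x\<in>S. x \<noteq> m \<longrightarrow> lt x m"
  using assms(1,2)
proof (induction rule: finite_ne_induct)
  case (insert x S)
  then obtain m where m: "m \<in> S" "\<forall>y\<in>S. y \<noteq> m \<longrightarrow> lt y m" by blast
  consider "x = m" | "lt x m" | "lt m x" using assms(3) by blast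
  then show ?case
  proof cases
    case 3
    have "lt y x" if "y \<in> S" for y
    proof (cases "y = m")
      case False
      then have "lt y m" using m(2) that by simp
      then show ?thesis using assms(4) 3 by blast
    qed (use 3 in simp)
    then show ?thesis by blast
  qed (use m in blast)+
qed simp

lemma lex_max_matrix:
  fixes S :: "(nat \<Rightarrow> nat \<Rightarrow> nat) set"
  assumes "finite S" "S \<noteq> {}"
  obtains M where "M \<in> S" "\<And>M'. M' \<in> S \<Longrightarrow> M' \<noteq> M \<Longrightarrow>
    \<exists>j i. M' j i < M j i \<and> (\<forall>j'<j. M' j' = M j') \<and> (\<forall>i'<i. M' j i' = M j i')"
proof -
  have t1: "first_less (<) f g \<or> first_less (<) g f" if "f \<noteq> g" for f g :: "nat \<Rightarrow> nat"
    by (rule first_less_total[OF _ that]) auto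
  have t2: "first_less (<) f h" if "first_less (<) f g" "first_less (<) g h" for f g h :: "nat \<Rightarrow> nat"
    by (rule first_less_trans[OF _ that]) auto
  have "\<exists>M\<in>S. \<forall>M'\<in>S. M' \<noteq> M \<longrightarrow> first_less (first_less (<)) M' M"
  proof (rule finite_total_maximum[OF assms])
    fix f g h :: "nat \<Rightarrow> nat \<Rightarrow> nat"
    show "first_less (first_less (<)) f g \<or> first_less (first_less (<)) g f" if "f \<noteq> g"
      by (rule first_less_total[OF _ that]) (rule t1)
    show "first_less (first_less (<)) f h" if "first_less (first_less (<)) f g" "first_less (first_less (<)) g h"
      by (rule first_less_trans[OF _ that]) (rule t2)
  qed
  then obtain M where M: "M \<in> S" "\<forall>M'\<in>S. M' \<noteq> M \<longrightarrow> first_less (first_less (<)) M' M" by blast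
  show thesis
  proof (rule that[OF M(1)])
    fix M' assume "M' \<in> S" "M' \<noteq> M"
    then have "first_less (first_less (<)) M' M" using M(2) by blast
    then show "\<exists>j i. M' j i < M j i \<and> (\<forall>j'<j. M' j' = M j') \<and> (\<forall>i'<i. M' j i' = M j i')"
      unfolding first_less_def by blast
  qed
qed

text \<open>Inverting the permutations exchanges the two sides; in this way
  \<open>pair_bound\<close> also yields the inequalities between neighbouring rows of the
  matrix.\<close>

lemma csum_transpose:
  assumes "finite A"
  shows "csum A (\<lambda>g. F (inv g)) v u (\<lambda>l j. M j l) = csum A F u v M"
proof -
  have c: "cnt A v u (inv g) l j = cnt A u v g j l" if g: "g permutes A" for g l j
  proof -
    have "{p \<in> A. v p = l \<and> u (g p) = j} = {p \<in> A. v (inv g (g p)) = l \<and> u (g p) = j}"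
      by (simp only: permutes_inverses(2)[OF g])
    moreover have "g ` {p \<in> A. v (inv g (g p)) = l \<and> u (g p) = j} = {p \<in> g ` A. u p = j \<and> v (inv g p) = l}"
      by blast
    ultimately have "g ` {p \<in> A. v p = l \<and> u (g p) = j} = {p \<in> g ` A. u p = j \<and> v (inv g p) = l}" by simp
    then have "bij_betw g {p \<in> A. v p = l \<and> u (g p) = j} {p \<in> A. u p = j \<and> v (inv g p) = l}"
      unfolding permutes_image[OF g]
      by (rule bij_betw_imageI[OF inj_on_subset[OF permutes_inj[OF g] subset_UNIV]])
    then show ?thesis unfolding cnt_def by (rule bij_betw_same_card[symmetric])
  qed
  show ?thesis
    unfolding csum_def
  proof (rule sum.reindex_bij_witness[where i = inv and j = inv])
    fix g assume "g \<in> {g. g permutes A \<and> cnt A v u g = (\<lambda>l j. M j l)}"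
    then have g: "g permutes A" "cnt A v u g = (\<lambda>l j. M j l)" by auto
    show "inv (inv g) = g" by (rule permutes_inv_inv[OF g(1)])
    have "cnt A u v (inv g) j l = M j l" for j l
      using c[OF permutes_inv[OF g(1)], of l j] g(2) permutes_inv_inv[OF g(1)] by simp
    then have "cnt A u v (inv g) = M" by blast
    then show "inv g \<in> {g. g permutes A \<and> cnt A u v g = M}" using permutes_inv[OF g(1)] by simp
  next
    fix g assume "g \<in> {g. g permutes A \<and> cnt A u v g = M}"
    then have g: "g permutes A" "cnt A u v g = M" by auto
    show "inv (inv g) = g" by (rule permutes_inv_inv[OF g(1)])
    have "cnt A v u (inv g) = (\<lambda>l j. M j l)" using c[OF g(1)] g(2) by (intro ext) simp
    then show "inv g \<in> {g. g permutes A \<and> cnt A v u g = (\<lambda>l j. M j l)}" using permutes_inv[OF g(1)] by simp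
  qed simp
qed

text \<open>\<open>F g\<close> will be a matrix coefficient of \<open>g\<close> between two row-sorted vectors, hence a function of the matrix
  \<open>cnt A u v g\<close>. By the Garnir relations on either side, the lexicographically extremal matrix on which it does
  not vanish satisfies the inequalities that define a Littlewood--Richardson tableau.\<close>

theorem leading_matrix:
  fixes F :: "(nat \<Rightarrow> nat) \<Rightarrow> complex"
  assumes A: "finite A" and u: "\<And>p. p \<in> A \<Longrightarrow> u p < R" and v: "\<And>p. p \<in> A \<Longrightarrow> v p < L"
    and g0: "g0 permutes A" "F g0 \<noteq> 0"
    and left: "\<And>h g. h permutes A \<Longrightarrow> g permutes A \<Longrightarrow> (\<And>x. x \<in> A \<Longrightarrow> u (h x) = u x) \<Longrightarrow> F (h \<circ> g) = F g"
    and right: "\<And>h g. h permutes A \<Longrightarrow> g permutes A \<Longrightarrow> (\<And>x. x \<in> A \<Longrightarrow> v (h x) = v x) \<Longrightarrow> F (g \<circ> h) = F g"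
    and garnir_left: "\<And>j X g. X \<subseteq> {p \<in> A. u p = Suc j} \<Longrightarrow> ku j < card X \<Longrightarrow> g permutes A \<Longrightarrow>
      (\<Sum>\<pi> | \<pi> permutes {p \<in> A. u p = j} \<union> X. F (\<pi> \<circ> g)) = 0"
    and garnir_right: "\<And>i X g. X \<subseteq> {p \<in> A. v p = Suc i} \<Longrightarrow> kv i < card X \<Longrightarrow> g permutes A \<Longrightarrow>
      (\<Sum>\<pi> | \<pi> permutes {p \<in> A. v p = i} \<union> X. F (g \<circ> \<pi>)) = 0"
  obtains g where "g permutes A"
    "\<And>i j. j < R \<Longrightarrow> (\<Sum>l\<le>j. cnt A u v g l (Suc i)) \<le> (\<Sum>l<j. cnt A u v g l i) + kv i"
    "\<And>i j. i < L \<Longrightarrow> (\<Sum>l\<le>i. cnt A u v g (Suc j) l) \<le> (\<Sum>l<i. cnt A u v g j l) + ku j"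
proof -
  define S where "S = {M. csum A F u v M \<noteq> 0}"
  have "S \<subseteq> cnt A u v ` {g. g permutes A}" using csum_nonzero_cnt by (fastforce simp: S_def)
  then have finS: "finite S" using finite_permutations[OF A] finite_surj by blast
  have "csum A F u v (cnt A u v g0) \<noteq> 0"
    by (rule csum_nonzero[where F = F, OF A g0]) (fact left, fact right)
  then have "S \<noteq> {}" by (auto simp: S_def)
  then obtain M where M: "csum A F u v M \<noteq> 0" and
    max: "\<And>M'. csum A F u v M' \<noteq> 0 \<Longrightarrow> M' \<noteq> M \<Longrightarrow>
    \<exists>j i. M' j i < M j i \<and> (\<forall>j'<j. M' j' = M j') \<and> (\<forall>i'<i. M' j i' = M j i')"
    using lex_max_matrix[OF finS] by (auto simp: S_def)
  obtain g where g: "g permutes A" "cnt A u v g = M" using csum_nonzero_cnt[OF M] by blast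
  show thesis
  proof (rule that[OF g(1)])
    fix i j assume j: "j < R"
    have "(\<Sum>l\<le>j. M l (Suc i)) \<le> (\<Sum>l<j. M l i) + kv i"
    proof (rule pair_bound[OF A u garnir_right M _ j])
      fix M' assume M': "csum A F u v M' \<noteq> 0" "M' \<noteq> M"
        and other: "\<And>j l. l \<noteq> i \<Longrightarrow> l \<noteq> Suc i \<Longrightarrow> M' j l = M j l"
        and sum: "\<And>j. M' j i + M' j (Suc i) = M j i + M j (Suc i)"
      obtain j0 i0 where d: "M' j0 i0 < M j0 i0" "\<forall>j'<j0. M' j' = M j'" "\<forall>i'<i0. M' j0 i' = M j0 i'"
        using max[OF M'] by blast
      \<comment> \<open>The joint sums of the columns \<open>i\<close> and \<open>Suc i\<close> are
        fixed, so a smaller entry in column \<open>i\<close> means a larger one in column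
        \<open>Suc i\<close>: maximality of \<open>M\<close> makes its column \<open>Suc i\<close>
        least, as \<open>pair_bound\<close> requires.\<close>
      have "i0 = i \<or> i0 = Suc i" using other[of i0 j0] d(1) by auto
      then have "M' j0 i < M j0 i" using d sum[of j0] by auto
      then have "M j0 (Suc i) < M' j0 (Suc i)" using sum[of j0] by simp
      then show "\<exists>j. M j (Suc i) < M' j (Suc i) \<and> (\<forall>j'<j. M' j' (Suc i) = M j' (Suc i))"
        using d(2) by (intro exI[of _ j0]) simp
    qed auto
    then show "(\<Sum>l\<le>j. cnt A u v g l (Suc i)) \<le> (\<Sum>l<j. cnt A u v g l i) + kv i" by (simp add: g(2))
  next
    fix i j assume i: "i < L"
    have "(\<Sum>l\<le>i. M (Suc j) l) \<le> (\<Sum>l<i. M j l) + ku j"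
    proof (rule pair_bound[where u = v and v = u and R = L and i = j and k = "ku j" and j = i and
        F = "\<lambda>g. F (inv g)" and M = "\<lambda>l j. M j l", OF A v])
      show "csum A (\<lambda>g. F (inv g)) v u (\<lambda>l j. M j l) \<noteq> 0" using M csum_transpose[OF A] by simp
      show "i < L" by (rule i)
    next
      fix X g assume X: "X \<subseteq> {p \<in> A. u p = Suc j}" "ku j < card X" and g: "g permutes A"
      have "(\<Sum>\<pi> | \<pi> permutes {p \<in> A. u p = j} \<union> X. F (inv (g \<circ> \<pi>))) =
        (\<Sum>\<pi> | \<pi> permutes {p \<in> A. u p = j} \<union> X. F (\<pi> \<circ> inv g))"
      proof (rule sum.reindex_bij_witness[where i = inv and j = inv])
        fix \<pi> assume "\<pi> \<in> {\<pi>. \<pi> permutes {p \<in> A. u p = j} \<union> X}"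
        then have \<pi>: "\<pi> permutes {p \<in> A. u p = j} \<union> X" by simp
        then show "inv (inv \<pi>) = \<pi>" by (rule permutes_inv_inv)
        then show "inv (inv \<pi>) = \<pi>" .
        show "inv \<pi> \<in> {\<pi>. \<pi> permutes {p \<in> A. u p = j} \<union> X}" using permutes_inv[OF \<pi>] by simp
        then show "inv \<pi> \<in> {\<pi>. \<pi> permutes {p \<in> A. u p = j} \<union> X}" .
        have "inv (g \<circ> \<pi>) = inv \<pi> \<circ> inv g"
          using permutes_bij[OF g] permutes_bij[OF \<pi>] by (rule o_inv_distrib)
        then show "F (inv \<pi> \<circ> inv g) = F (inv (g \<circ> \<pi>))" by simp
      qed
      also have "\<dots> = 0" using garnir_left[OF X permutes_inv[OF g]] .
      finally show "(\<Sum>\<pi> | \<pi> permutes {p \<in> A. u p = j} \<union> X. F (inv (g \<circ> \<pi>))) = 0" .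
    next
      fix N assume N: "csum A (\<lambda>g. F (inv g)) v u N \<noteq> 0" "N \<noteq> (\<lambda>l j. M j l)"
        and other: "\<And>l k. k \<noteq> j \<Longrightarrow> k \<noteq> Suc j \<Longrightarrow> N l k = M k l"
        and sum: "\<And>l. N l j + N l (Suc j) = M j l + M (Suc j) l"
      have "csum A F u v (\<lambda>j l. N l j) \<noteq> 0" using csum_transpose[OF A, of F v u "\<lambda>j l. N l j"] N(1) by simp
      moreover have "(\<lambda>j l. N l j) \<noteq> M" using N(2) by auto
      ultimately obtain j0 i0 where d: "N i0 j0 < M j0 i0" "\<forall>j'<j0. (\<lambda>l. N l j') = M j'" "\<forall>i'<i0. N i' j0 = M j0 i'"
        using max by blast
      have "j0 = j \<or> j0 = Suc j" using other[of j0 i0] d(1) by auto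
      \<comment> \<open>If row \<open>Suc j\<close> were the first to differ, row \<open>j\<close>
        would agree, and the fixed sums would make row \<open>Suc j\<close> agree as well.\<close>
      moreover have "j0 \<noteq> Suc j"
      proof
        assume j0: "j0 = Suc j"
        then have "N i0 j = M j i0" using d(2) by (metis lessI)
        then show False using sum[of i0] d(1) j0 by simp
      qed
      ultimately have j0: "j0 = j" by simp
      show "\<exists>l. M (Suc j) l < N l (Suc j) \<and> (\<forall>l'<l. N l' (Suc j) = M (Suc j) l')"
      proof (intro exI[of _ i0] conjI allI impI)
        show "M (Suc j) i0 < N i0 (Suc j)" using sum[of i0] d(1) j0 by simp
        fix l' assume "l' < i0"
        then show "N l' (Suc j) = M (Suc j) l'" using d(3) sum[of l'] j0 by simp
      qed
    qed auto
    then show "(\<Sum>l\<le>i. cnt A u v g (Suc j) l) \<le> (\<Sum>l<i. cnt A u v g j l) + ku j" by (simp add: g(2))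
  qed
qed

section \<open>From the leading matrix to a Littlewood--Richardson tableau\<close>

lemma sum_cnt_rows:
  assumes "finite A" "g permutes A" "\<And>p. p \<in> A \<Longrightarrow> v p < L"
  shows "(\<Sum>i<L. cnt A u v g j i) = card {p \<in> A. u p = j}"
proof -
  have "(\<Sum>i<L. cnt A u v g j i) = card (\<Union>i<L. {p \<in> A. v p = i \<and> u (g p) = j})"
    unfolding cnt_def using assms(1) by (subst card_UN_disjoint) auto
  also have "(\<Union>i<L. {p \<in> A. v p = i \<and> u (g p) = j}) = {p \<in> A. u (g p) = j}"
    using assms(3) by auto
  also have "card \<dots> = card (g ` {p \<in> A. u (g p) = j})"
    using inj_on_subset[OF permutes_inj[OF assms(2)] subset_UNIV] by (rule card_image[symmetric])
  also have "g ` {p \<in> A. u (g p) = j} = {p \<in> g ` A. u p = j}" by blast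
  finally show ?thesis by (simp only: permutes_image[OF assms(2)])
qed

lemma sum_cnt_columns:
  assumes "finite A" "g permutes A" "\<And>p. p \<in> A \<Longrightarrow> u p < R"
  shows "(\<Sum>j<R. cnt A u v g j i) = card {p \<in> A. v p = i}"
proof -
  have "u (g p) < R" if "p \<in> A" for p using assms(3)[of "g p"] that permutes_in_image[OF assms(2)] by simp
  then have "{p \<in> A. v p = i} = (\<Union>j<R. {p \<in> A. v p = i \<and> u (g p) = j})" by auto
  also have "card \<dots> = (\<Sum>j<R. cnt A u v g j i)"
    unfolding cnt_def using assms(1) by (subst card_UN_disjoint) auto
  finally show ?thesis ..
qed

lemma young_row_len: "(i, j) \<in> young l \<longleftrightarrow> j < row_len l i"
proof -
  have "{j. (i, j) \<in> young l} = (if i < length l then {..<l ! i} else {})" by (auto simp: young_def)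
  then show ?thesis by (auto simp: row_len_def young_def)
qed

lemma finite_young: "finite (young l)"
proof -
  have "young l = (SIGMA i:{..<length l}. {..<l ! i})" by (auto simp: young_def)
  then show ?thesis by simp
qed

lemma row_len_0: "length l \<le> k \<Longrightarrow> row_len l k = 0"
  by (simp add: row_len_def young_def)

text \<open>\<open>card\<close> is 0 on infinite sets, so one tableau makes \<open>lr_coeff\<close>
  nonzero only together with finiteness. The weight bounds the entries by the number of
  parts.\<close>

lemma finite_lr_tableaux:
  assumes "finite D"
  shows "finite {t. lr_tableau D lam t}"
proof (rule finite_subset[OF _ finite_set_of_finite_funs[OF assms finite_atMost[of "length lam"], of 0]])
  show "{t. lr_tableau D lam t} \<subseteq> {f. \<forall>x. (x \<in> D \<longrightarrow> f x \<in> {..length lam}) \<and> (x \<notin> D \<longrightarrow> f x = 0)}"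
  proof (intro subsetI CollectI allI)
    fix t x assume "t \<in> {t. lr_tableau D lam t}"
    then have t: "\<And>x. x \<in> D \<longleftrightarrow> 0 < t x" "\<And>k. card {x \<in> D. t x = Suc k} = row_len lam k"
      by (auto simp: lr_tableau_def)
    have "t x \<le> length lam" if "x \<in> D"
    proof (rule ccontr)
      assume "\<not> ?thesis"
      then obtain k where k: "t x = Suc k" "length lam \<le> k" by (cases "t x") auto
      then have "card {x \<in> D. t x = Suc k} = 0" using t(2) row_len_0 by simp
      then have "{x \<in> D. t x = Suc k} = {}" using assms by simp
      then show False using k that by blast
    qed
    then show "(x \<in> D \<longrightarrow> t x \<in> {..length lam}) \<and> (x \<notin> D \<longrightarrow> t x = 0)" using t(1)[of x] by auto
  qed
qed

text \<open>\<open>M j i\<close> is the number of entries \<open>i + 1\<close> in row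
  \<open>j\<close> of the tableau, each row being filled in weakly increasing order. Then
  \<open>column\<close> makes the columns strict and \<open>ballot\<close> makes the reading word a
  lattice word.\<close>

theorem lr_from_matrix:
  fixes M :: "nat \<Rightarrow> nat \<Rightarrow> nat" and \<mu> \<nu> :: "nat \<Rightarrow> nat"
  assumes mu: "\<And>j c. (j, c) \<in> young mu \<longleftrightarrow> c < \<mu> j" and nu: "\<And>j c. (j, c) \<in> young nu \<longleftrightarrow> c < \<nu> j"
    and le: "\<And>j. \<nu> j \<le> \<mu> j" and anti: "\<And>i j. i \<le> j \<Longrightarrow> \<mu> j \<le> \<mu> i" "\<And>i j. i \<le> j \<Longrightarrow> \<nu> j \<le> \<nu> i"
    and R: "\<And>j. R \<le> j \<Longrightarrow> \<mu> j = 0" and L: "\<And>i j. L \<le> i \<Longrightarrow> M j i = 0"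
    and rows: "\<And>j. (\<Sum>i<L. M j i) = \<mu> j - \<nu> j"
    and cols: "\<And>i. (\<Sum>j<R. M j i) = row_len lam i"
    and ballot: "\<And>i j. j < R \<Longrightarrow> (\<Sum>l\<le>j. M l (Suc i)) \<le> (\<Sum>l<j. M l i)"
    and column: "\<And>i j. i < L \<Longrightarrow> (\<Sum>l\<le>i. M (Suc j) l) \<le> (\<Sum>l<i. M j l) + (\<nu> j - \<nu> (Suc j))"
  shows "lr_coeff mu nu lam \<noteq> 0" and "young lam \<subseteq> young mu"
proof -
  define D where "D = young mu - young nu"
  define S where "S = (\<lambda>j k. \<Sum>l<k. M j l)"
  \<comment> \<open>\<open>S j k\<close> counts the entries of row \<open>j\<close> that are at most
    \<open>k\<close>; a cell gets the first value whose block reaches beyond it.\<close>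
  define t where "t = (\<lambda>(j, c). if \<nu> j \<le> c \<and> c < \<mu> j then Suc (LEAST k. c - \<nu> j < S j (Suc k)) else 0)"
  have D: "(j, c) \<in> D \<longleftrightarrow> \<nu> j \<le> c \<and> c < \<mu> j" for j c by (auto simp: D_def mu nu)
  have finD: "finite D" using finite_young by (simp add: D_def)
  have Smono: "k \<le> k' \<Longrightarrow> S j k \<le> S j k'" for j k k' unfolding S_def by (intro sum_mono2) auto
  have SL: "S j L = \<mu> j - \<nu> j" for j using rows by (simp add: S_def)
  have Rj: "j < R" if "(j, c) \<in> D" for j c using that R[of j] by (force simp: D)
  have t_iff: "t (j, c) = Suc k \<longleftrightarrow> S j k \<le> c - \<nu> j \<and> c - \<nu> j < S j (Suc k)" if "(j, c) \<in> D" for j c k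
  proof -
    define k0 where "k0 = (LEAST k. c - \<nu> j < S j (Suc k))"
    have t: "t (j, c) = Suc k0" using that by (simp add: D t_def k0_def)
    have "c - \<nu> j < S j L" using that by (auto simp: D SL)
    also have "\<dots> \<le> S j (Suc L)" by (rule Smono) simp
    finally have k0: "c - \<nu> j < S j (Suc k0)" unfolding k0_def by (rule LeastI)
    have k0': "S j k0 \<le> c - \<nu> j"
    proof (cases k0)
      case (Suc m)
      then have "\<not> c - \<nu> j < S j (Suc m)" using not_less_Least[of m "\<lambda>k. c - \<nu> j < S j (Suc k)"] by (simp add: k0_def)
      then show ?thesis using Suc by simp
    qed (simp add: S_def)
    show ?thesis
    proof
      assume "t (j, c) = Suc k"
      then show "S j k \<le> c - \<nu> j \<and> c - \<nu> j < S j (Suc k)" using t k0 k0' by simp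
    next
      assume k: "S j k \<le> c - \<nu> j \<and> c - \<nu> j < S j (Suc k)"
      have "\<not> k < k0" using Smono[of "Suc k" k0 j] k k0' by auto
      moreover have "\<not> k0 < k" using Smono[of "Suc k0" k j] k k0 by auto
      ultimately show "t (j, c) = Suc k" using t by simp
    qed
  qed
  have pos: "x \<in> D \<longleftrightarrow> 0 < t x" for x by (cases x) (auto simp: D t_def)
  have rows_weak: "t (j, c) \<le> t (j, c')" if "(j, c) \<in> D" "(j, c') \<in> D" "c < c'" for j c c'
  proof -
    have p: "0 < t (j, c)" "0 < t (j, c')" using pos that by blast+
    obtain k k' where k: "t (j, c) = Suc k" "t (j, c') = Suc k'"
      using p by (metis gr0_implies_Suc)
    have "S j k \<le> c - \<nu> j" "c' - \<nu> j < S j (Suc k')"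
      using t_iff[OF that(1), of k] t_iff[OF that(2), of k'] k by auto
    then have "S j k < S j (Suc k')" using that by linarith
    then have "k < Suc k'" using Smono[of "Suc k'" k j] by linarith
    then show ?thesis using k by simp
  qed
  have col_step: "t (j, c) < t (Suc j, c)" if "(j, c) \<in> D" "(Suc j, c) \<in> D" for j c
  proof -
    have p: "0 < t (j, c)" "0 < t (Suc j, c)" using pos that by blast+
    obtain k k' where k: "t (j, c) = Suc k" "t (Suc j, c) = Suc k'"
      using p by (metis gr0_implies_Suc)
    have k1: "S j k \<le> c - \<nu> j" "S (Suc j) k' \<le> c - \<nu> (Suc j)" "c - \<nu> (Suc j) < S (Suc j) (Suc k')"
      using t_iff[OF that(1), of k] t_iff[OF that(2), of k'] k by auto
    have "k' < L"
    proof (rule ccontr)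
      assume "\<not> k' < L"
      then have "S (Suc j) L \<le> S (Suc j) k'" by (intro Smono) simp
      then show False using k1(2) that(2) SL[of "Suc j"] by (auto simp: D)
    qed
    \<comment> \<open>The end of the block of \<open>k' + 1\<close> in the lower row does not exceed
      the end of the block of \<open>k'\<close> in the upper one, so the entry above is at most
      \<open>k'\<close>.\<close>
    then have "S (Suc j) (Suc k') \<le> S j k' + (\<nu> j - \<nu> (Suc j))"
      using column[of k' j] by (simp add: S_def lessThan_Suc_atMost)
    then have "c - \<nu> j < S j k'" using k1(3) that[unfolded D] anti(2)[of j "Suc j"] by linarith
    then have "S j k < S j k'" using k1(1) by simp
    then have "k < k'" using Smono[of k' k j] by linarith
    then show ?thesis using k by simp
  qed
  have cols_strict: "t (i, c) < t (i', c)" if "i < i'" "(i, c) \<in> D" "(i', c) \<in> D" for i i' c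
    using that(1,3)
  proof (induction i')
    case (Suc i')
    have m: "(i', c) \<in> D"
      using Suc.prems that(2) anti(1)[of i' "Suc i'"] anti(2)[of i i'] by (auto simp: D)
    show ?case
    proof (cases "i = i'")
      case True then show ?thesis using col_step that(2) Suc.prems by blast
    next
      case False
      then have "t (i, c) < t (i', c)" using Suc m by simp
      also have "\<dots> < t (Suc i', c)" using col_step m Suc.prems by blast
      finally show ?thesis .
    qed
  qed simp
  have Sle: "S j k \<le> \<mu> j - \<nu> j" for j k
  proof -
    have "S j k \<le> S j (max k L)" by (rule Smono) simp
    also have "\<dots> = S j L" unfolding S_def using L by (intro sum.mono_neutral_right) auto
    finally show ?thesis by (simp add: SL)
  qed
  have count: "card {x \<in> D. fst x < J \<and> t x = Suc k} = (\<Sum>j<J. M j k)" for J k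
  proof -
    have "{x \<in> D. fst x < J \<and> t x = Suc k} = (SIGMA j:{..<J}. {\<nu> j + S j k..<\<nu> j + S j (Suc k)})"
    proof (intro set_eqI)
      fix x :: "nat \<times> nat"
      obtain j c where x: "x = (j, c)" by fastforce
      have "(j, c) \<in> D \<and> t (j, c) = Suc k \<longleftrightarrow> \<nu> j + S j k \<le> c \<and> c < \<nu> j + S j (Suc k)"
      proof
        assume "(j, c) \<in> D \<and> t (j, c) = Suc k"
        then show "\<nu> j + S j k \<le> c \<and> c < \<nu> j + S j (Suc k)" using t_iff[of j c k] D[of j c] by auto
      next
        assume c: "\<nu> j + S j k \<le> c \<and> c < \<nu> j + S j (Suc k)"
        then have "(j, c) \<in> D" using Sle[of j "Suc k"] by (auto simp: D)
        then show "(j, c) \<in> D \<and> t (j, c) = Suc k" using t_iff[of j c k] c by auto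
      qed
      then show "x \<in> {x \<in> D. fst x < J \<and> t x = Suc k} \<longleftrightarrow> x \<in> (SIGMA j:{..<J}. {\<nu> j + S j k..<\<nu> j + S j (Suc k)})"
        using x by auto
    qed
    then show ?thesis by (simp add: S_def)
  qed
  have weight: "card {x \<in> D. t x = Suc k} = row_len lam k" for k
  proof -
    have "{x \<in> D. t x = Suc k} = {x \<in> D. fst x < R \<and> t x = Suc k}" using Rj by auto
    then show ?thesis by (simp add: count cols)
  qed
  have lattice: "card {y \<in> reading_prefix D x. t y = Suc k} \<le> card {y \<in> reading_prefix D x. t y = k}"
    if "x \<in> D" "1 \<le> k" for x k
  proof -
    have i: "k = Suc (k - 1)" using that(2) by simp
    define i where "i = k - 1"
    note i = i[folded i_def]
    obtain j c where x: "x = (j, c)" by fastforce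
    \<comment> \<open>Rows are read from the right, so larger entries of the current row come first.
      The worst case counts the whole row for \<open>Suc k\<close> and nothing of it for
      \<open>k\<close>.\<close>
    have "card {y \<in> reading_prefix D x. t y = Suc k} \<le> card {y \<in> D. fst y < Suc j \<and> t y = Suc (Suc i)}"
      using finD by (intro card_mono) (auto simp: reading_prefix_def x i)
    also have "\<dots> = (\<Sum>l\<le>j. M l (Suc i))" by (simp add: count lessThan_Suc_atMost)
    also have "\<dots> \<le> (\<Sum>l<j. M l i)" using Rj that(1) x by (intro ballot) auto
    also have "\<dots> = card {y \<in> D. fst y < j \<and> t y = Suc i}" by (simp add: count)
    also have "\<dots> \<le> card {y \<in> reading_prefix D x. t y = k}"
      using finD by (intro card_mono) (auto simp: reading_prefix_def x i)
    finally show ?thesis .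
  qed
  have "lr_tableau D lam t"
    unfolding lr_tableau_def using pos rows_weak cols_strict weight lattice by blast
  then have "card {t. lr_tableau D lam t} \<noteq> 0"
    using finite_lr_tableaux[OF finD, of lam] by auto
  moreover have "young nu \<subseteq> young mu"
  proof clarify
    fix j c assume "(j, c) \<in> young nu"
    then show "(j, c) \<in> young mu" using le[of j] by (simp add: mu nu)
  qed
  ultimately show "lr_coeff mu nu lam \<noteq> 0" by (simp add: lr_coeff_def D_def)
  \<comment> \<open>The ballot condition keeps the value \<open>k + 1\<close> out of the rows before
    row \<open>k\<close>. Since columns are strict, it then occurs at most \<open>\<mu> k\<close>
    times, which is the inclusion of the diagrams.\<close>
  have upper: "k \<le> j" if "M j k \<noteq> 0" for j k
    using that
  proof (induction k arbitrary: j)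
    case (Suc k)
    show ?case
    proof (rule ccontr)
      assume "\<not> Suc k \<le> j"
      then have j: "j \<le> k" by simp
      have "Suc k < L" using L[of "Suc k" j] Suc.prems by (metis not_less)
      then have "M j (Suc k) \<le> (\<Sum>i<L. M j i)" by (intro member_le_sum) auto
      then have "j < R" using rows[of j] R[of j] Suc.prems by (metis diff_0_eq_0 le_zero_eq not_less)
      then have "(\<Sum>l\<le>j. M l (Suc k)) \<le> (\<Sum>l<j. M l k)" by (rule ballot)
      also have "\<dots> = 0" using Suc.IH j by (force intro!: sum.neutral)
      finally show False using Suc.prems by simp
    qed
  qed simp
  have row_le: "row_len lam k \<le> \<mu> k" for k
  proof -
    have "snd x < \<mu> k" if "x \<in> {x \<in> D. t x = Suc k}" for x
    proof -
      obtain j c where x: "x = (j, c)" by fastforce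
      then have "S j k < S j (Suc k)" using that t_iff[of j c k] by auto
      then have "k \<le> j" using upper[of j k] by (simp add: S_def)
      then show ?thesis using that x anti(1)[of k j] by (auto simp: D)
    qed
    moreover have "inj_on snd {x \<in> D. t x = Suc k}"
    proof (rule inj_onI)
      fix x y assume xy: "x \<in> {x \<in> D. t x = Suc k}" "y \<in> {x \<in> D. t x = Suc k}" "snd x = snd y"
      obtain i i' c where c: "x = (i, c)" "y = (i', c)" using xy(3) by (cases x; cases y) auto
      then show "x = y"
        using cols_strict[of i i' c] cols_strict[of i' i c] xy
        by (cases i i' rule: linorder_cases) auto
    qed
    ultimately have "card {x \<in> D. t x = Suc k} \<le> card {..<\<mu> k}" by (intro card_inj_on_le[of snd]) auto
    then show ?thesis by (simp add: weight)
  qed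
  show "young lam \<subseteq> young mu"
  proof clarify
    fix i j assume "(i, j) \<in> young lam"
    then have "j < row_len lam i" by (simp add: young_row_len)
    then have "j < \<mu> i" using row_le[of i] by simp
    then show "(i, j) \<in> young mu" by (simp add: mu)
  qed
qed

lemma card_row_cells:
  assumes lo: "lo \<le> lo'" "lo' \<le> n"
  shows "card {p \<in> {lo'..<n}. fst (cell a lo p) = j} = row_card (shape a lo n) j - row_card (shape a lo lo') j"
proof -
  let ?J = "{p \<in> {lo'..<n}. fst (cell a lo p) = j}"
  have cells: "shape a lo n = shape a lo lo' \<union> cell a lo ` {lo'..<n}" by (rule shape_eq_cells[OF lo])
  have "{c. (j, c) \<in> shape a lo n} = {c. (j, c) \<in> shape a lo lo'} \<union> (\<lambda>p. snd (cell a lo p)) ` ?J"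
  proof (intro set_eqI iffI)
    fix c assume "c \<in> {c. (j, c) \<in> shape a lo n}"
    then consider "(j, c) \<in> shape a lo lo'" | p where "p \<in> {lo'..<n}" "(j, c) = cell a lo p"
      by (auto simp: cells)
    then show "c \<in> {c. (j, c) \<in> shape a lo lo'} \<union> (\<lambda>p. snd (cell a lo p)) ` ?J"
    proof cases
      case 2
      then have "p \<in> ?J" "c = snd (cell a lo p)" by (metis (mono_tags, lifting) fst_conv mem_Collect_eq, metis snd_conv)
      then show ?thesis by blast
    qed simp
  next
    fix c assume "c \<in> {c. (j, c) \<in> shape a lo lo'} \<union> (\<lambda>p. snd (cell a lo p)) ` ?J"
    then show "c \<in> {c. (j, c) \<in> shape a lo n}" by (auto simp: cells)
  qed
  moreover have "{c. (j, c) \<in> shape a lo lo'} \<inter> (\<lambda>p. snd (cell a lo p)) ` ?J = {}"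
  proof -
    have "cell a lo p \<notin> shape a lo lo'" if "lo' \<le> p" for p
      using shape_mono[OF that, of a lo] cell_notin_shape[of a lo p] by blast
    moreover have "(j, c) = cell a lo p" if "c = snd (cell a lo p)" "fst (cell a lo p) = j" for c p
      using that by (simp add: prod_eq_iff)
    ultimately show ?thesis by fastforce
  qed
  moreover have "inj_on (\<lambda>p. snd (cell a lo p)) ?J"
  proof (rule inj_onI)
    fix p q assume "p \<in> ?J" "q \<in> ?J" "snd (cell a lo p) = snd (cell a lo q)"
    then show "p = q" using inj_onD[OF inj_on_cell[of a lo], of p q] lo by (auto simp: prod_eq_iff)
  qed
  moreover have "finite {c. (j, c) \<in> shape a lo lo'}" using finite_row[OF finite_shape[OF lo(1)]] .
  ultimately show ?thesis
    by (simp add: row_card_def card_Un_disjoint card_image)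
qed

context symmetric_group_rep
begin

text \<open>The pairings \<open>ip \<xi> (act g w)\<close> are the coefficients \<open>F\<close>. On
  the side of \<xi> the labels are the rows of the skew shape, and a Garnir relation needs more than
  \<open>\<nu> j - \<nu> (Suc j)\<close> cells of the lower row. On the side of \<open>w\<close> the
  shape starts empty, and one cell is enough.\<close>

theorem lr_coeff_nonzero:
  assumes \<xi>: "jm_content 0 \<xi> b" "\<And>k. lo \<le> k \<Longrightarrow> Suc k < n \<Longrightarrow> b (Suc k) \<le> b k + 1"
    and w: "jm_content lo w a" "\<And>k. lo \<le> k \<Longrightarrow> Suc k < n \<Longrightarrow> a (Suc k) \<le> a k + 1"
    and lo: "lo \<le> n" and g0: "g0 permutes {lo..<n}" "ip \<xi> (act g0 w) \<noteq> 0"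
    and mu: "young mu = shape b 0 n" and nu: "young nu = shape b 0 lo" and lam: "young lam = shape a lo n"
  shows "lr_coeff mu nu lam \<noteq> 0" "young lam \<subseteq> young mu"
proof -
  define A where "A = {lo..<n}"
  define u where "u = (\<lambda>p. fst (cell b 0 p))"
  define v where "v = (\<lambda>p. fst (cell a lo p))"
  define F where "F = (\<lambda>g. ip \<xi> (act g w))"
  define \<mu> where "\<mu> = row_card (shape b 0 n)"
  define \<nu> where "\<nu> = row_card (shape b 0 lo)"
  have An: "A \<subseteq> {..<n}" by (auto simp: A_def)
  have finA: "finite A" by (simp add: A_def)
  have pn: "g permutes A \<Longrightarrow> g permutes {..<n}" for g using An by (rule permutes_subset[rotated])
  have \<xi>W: "\<xi> \<in> W" and wW: "w \<in> W" using \<xi> w by (auto simp: jm_content_def)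
  note tb = jm_content_tableau[OF \<xi>(1)] and ta = jm_content_tableau[OF w(1)]
  have ds: "downset (shape b 0 n)" "downset (shape b 0 lo)" "downset (shape a lo n)"
    using tb ta lo by (auto intro!: downset_shape)
  have fs: "finite (shape b 0 n)" "finite (shape b 0 lo)" "finite (shape a lo n)"
    using lo by (auto intro!: finite_shape)
  have rl: "row_len lam i = row_card (shape a lo n) i" for i by (simp add: row_len_def row_card_def lam)
  have uR: "u p < length mu" if "p \<in> A" for p
  proof -
    have "cell b 0 p \<in> young mu" using that shape_eq_cells[of 0 lo n b] lo by (auto simp: mu A_def)
    then show ?thesis by (cases "cell b 0 p") (auto simp: young_def u_def)
  qed
  have vL: "v p < length lam" if "p \<in> A" for p
  proof -
    have "cell a lo p \<in> young lam" using that shape_eq_cells[of lo lo n a] lo by (auto simp: lam A_def)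
    then show ?thesis by (cases "cell a lo p") (auto simp: young_def v_def)
  qed
  obtain g where g: "g permutes A"
    "\<And>i j. j < length mu \<Longrightarrow> (\<Sum>l\<le>j. cnt A u v g l (Suc i)) \<le> (\<Sum>l<j. cnt A u v g l i) + 0"
    "\<And>i j. i < length lam \<Longrightarrow> (\<Sum>l\<le>i. cnt A u v g (Suc j) l) \<le> (\<Sum>l<i. cnt A u v g j l) + (\<nu> j - \<nu> (Suc j))"
  proof (rule leading_matrix[where A = A and u = u and R = "length mu" and v = v and L = "length lam" and ?g0.0 = g0 and
        F = F and ku = "\<lambda>j. \<nu> j - \<nu> (Suc j)" and kv = "\<lambda>i. 0"])
    show "finite A" "g0 permutes A" "F g0 \<noteq> 0" using g0 by (auto simp: A_def F_def)
    show "u p < length mu" "v p < length lam" if "p \<in> A" for p using that uR vL by auto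
  next
    fix h g assume h: "h permutes A" and g: "g permutes A" and pres: "\<And>x. x \<in> A \<Longrightarrow> u (h x) = u x"
    have "act h \<xi> = \<xi>"
      using row_permutation_invariant[OF \<xi>(1), of lo h] \<xi>(2) h pres by (simp add: A_def u_def)
    then show "F (h \<circ> g) = F g"
      using act_unitary[OF pn[OF h] \<xi>W act_W[OF pn[OF g] wW]] pn[OF h] pn[OF g] wW
      by (simp add: F_def act_comp[symmetric])
  next
    fix h g assume h: "h permutes A" and g: "g permutes A" and pres: "\<And>x. x \<in> A \<Longrightarrow> v (h x) = v x"
    have "act h w = w"
      using row_permutation_invariant[OF w(1), of lo h] w(2) h pres by (simp add: A_def v_def)
    then show "F (g \<circ> h) = F g"
      using pn[OF h] pn[OF g] wW by (simp add: F_def act_comp[symmetric])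
  next
    fix j X g assume X: "X \<subseteq> {p \<in> A. u p = Suc j}" "\<nu> j - \<nu> (Suc j) < card X" and g: "g permutes A"
    let ?C = "{p \<in> A. u p = j} \<union> X"
    have C: "?C \<subseteq> {..<n}" using X An by auto
    have z: "symz ?C \<xi> = 0"
      using garnir[OF \<xi>(1), where lo' = lo and S = X and j = j] \<xi>(2) lo X by (simp add: A_def u_def \<nu>_def)
    \<comment> \<open>By unitarity, a permutation that acts after \<open>g\<close> is moved to \<xi>
      as its inverse.\<close>
    have "(\<Sum>\<pi> | \<pi> permutes ?C. F (\<pi> \<circ> g)) = (\<Sum>\<pi> | \<pi> permutes ?C. ip (act \<pi> \<xi>) (act g w))"
    proof (rule sum.reindex_bij_witness[where i = inv and j = inv])
      fix \<pi> assume "\<pi> \<in> {\<pi>. \<pi> permutes ?C}"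
      then have \<pi>: "\<pi> permutes ?C" by simp
      show "inv (inv \<pi>) = \<pi>" "inv (inv \<pi>) = \<pi>" using permutes_inv_inv[OF \<pi>] by auto
      show "inv \<pi> \<in> {\<pi>. \<pi> permutes ?C}" "inv \<pi> \<in> {\<pi>. \<pi> permutes ?C}" using permutes_inv[OF \<pi>] by auto
      have p: "\<pi> permutes {..<n}" "inv \<pi> permutes {..<n}"
        using \<pi> permutes_inv[OF \<pi>] permutes_subset[OF _ C] by auto
      have gw: "act g w \<in> W" using act_W[OF pn[OF g] wW] .
      have "act \<pi> (act (inv \<pi>) \<xi>) = \<xi>"
        using p \<xi>W permutes_inv_o(1)[OF \<pi>] by (simp add: act_comp act_id)
      then have "ip (act (inv \<pi>) \<xi>) (act g w) = ip \<xi> (act \<pi> (act g w))"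
        using act_unitary[OF p(1) act_W[OF p(2) \<xi>W] gw] by simp
      then show "ip (act (inv \<pi>) \<xi>) (act g w) = F (\<pi> \<circ> g)"
        using p pn[OF g] wW by (simp add: F_def act_comp)
    qed
    also have "\<dots> = ip (symz ?C \<xi>) (act g w)" by (simp add: symz_def ip_sum_left)
    also have "\<dots> = 0" using z ip_commute[of "act g w" 0] by simp
    finally show "(\<Sum>\<pi> | \<pi> permutes ?C. F (\<pi> \<circ> g)) = 0" .
  next
    fix i X g assume X: "X \<subseteq> {p \<in> A. v p = Suc i}" "0 < card X" and g: "g permutes A"
    let ?C = "{p \<in> A. v p = i} \<union> X"
    have C: "?C \<subseteq> {..<n}" using X An by auto
    have z: "symz ?C w = 0"
      using garnir[OF w(1), where lo' = lo and S = X and j = i] w(2) lo X by (simp add: A_def v_def row_card_def)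
    have "(\<Sum>\<pi> | \<pi> permutes ?C. F (g \<circ> \<pi>)) = (\<Sum>\<pi> | \<pi> permutes ?C. ip \<xi> (act g (act \<pi> w)))"
      using permutes_subset[OF _ C] pn[OF g] wW by (intro sum.cong) (auto simp: F_def act_comp)
    also have "\<dots> = ip \<xi> (act g (symz ?C w))"
      by (simp add: symz_def lin_sum[OF act_lin[OF pn[OF g]]] ip_sum_right)
    also have "\<dots> = 0" using z lin_zero[OF act_lin[OF pn[OF g]]] by simp
    finally show "(\<Sum>\<pi> | \<pi> permutes ?C. F (g \<circ> \<pi>)) = 0" .
  qed blast
  define M where "M = cnt A u v g"
  note g = g[folded M_def]
  have *: "lr_coeff mu nu lam \<noteq> 0 \<and> young lam \<subseteq> young mu"
  proof (rule conjI; rule lr_from_matrix[where mu = mu and \<mu> = \<mu> and nu = nu and \<nu> = \<nu> and R = "length mu" and L = "length lam" and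
        M = M and lam = lam])
    show "(j, c) \<in> young mu \<longleftrightarrow> c < \<mu> j" "(j, c) \<in> young nu \<longleftrightarrow> c < \<nu> j" for j c
      using downset_row ds fs by (auto simp: mu nu \<mu>_def \<nu>_def)
    then show "(j, c) \<in> young mu \<longleftrightarrow> c < \<mu> j" "(j, c) \<in> young nu \<longleftrightarrow> c < \<nu> j" for j c by auto
    have le: "\<nu> j \<le> \<mu> j" for j
      unfolding \<mu>_def \<nu>_def row_card_def
      by (intro card_mono finite_row fs) (use shape_mono[OF lo, of b 0] in blast)
    then show "\<nu> j \<le> \<mu> j" "\<nu> j \<le> \<mu> j" for j by auto
    show "\<mu> j \<le> \<mu> i" "\<mu> j \<le> \<mu> i" "\<nu> j \<le> \<nu> i" "\<nu> j \<le> \<nu> i" if "i \<le> j" for i j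
      using row_card_antimono that ds fs by (auto simp: \<mu>_def \<nu>_def)
    show "\<mu> j = 0" "\<mu> j = 0" if "length mu \<le> j" for j
    proof -
      have "{c. (j, c) \<in> young mu} = {}" using that by (auto simp: young_def)
      then show "\<mu> j = 0" "\<mu> j = 0" by (simp_all add: \<mu>_def row_card_def mu)
    qed
    show "M j i = 0" "M j i = 0" if "length lam \<le> i" for i j
    proof -
      have "{p \<in> A. v p = i \<and> u (g p) = j} = {}" using vL that by fastforce
      then show "M j i = 0" "M j i = 0" by (simp_all only: M_def cnt_def card.empty)
    qed
    have "(\<Sum>i<length lam. M j i) = \<mu> j - \<nu> j" for j
      unfolding M_def using sum_cnt_rows[OF finA g(1) vL, where u = u and j = j] card_row_cells[of 0 lo n b j] lo
      by (simp add: A_def u_def \<mu>_def \<nu>_def)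
    then show "(\<Sum>i<length lam. M j i) = \<mu> j - \<nu> j" "(\<Sum>i<length lam. M j i) = \<mu> j - \<nu> j" for j by auto
    have "(\<Sum>j<length mu. M j i) = row_len lam i" for i
      unfolding M_def using sum_cnt_columns[OF finA g(1) uR, where v = v and i = i] card_row_cells[of lo lo n a i] lo
      by (simp add: A_def v_def rl row_card_def)
    then show "(\<Sum>j<length mu. M j i) = row_len lam i" "(\<Sum>j<length mu. M j i) = row_len lam i" for i by auto
    show "(\<Sum>l\<le>j. M l (Suc i)) \<le> (\<Sum>l<j. M l i)" "(\<Sum>l\<le>j. M l (Suc i)) \<le> (\<Sum>l<j. M l i)" if "j < length mu" for i j
      using g(2)[OF that] by auto
    show "(\<Sum>l\<le>i. M (Suc j) l) \<le> (\<Sum>l<i. M j l) + (\<nu> j - \<nu> (Suc j))"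
      "(\<Sum>l\<le>i. M (Suc j) l) \<le> (\<Sum>l<i. M j l) + (\<nu> j - \<nu> (Suc j))" if "i < length lam" for i j
      using g(3)[OF that] by auto
  qed
  then show "lr_coeff mu nu lam \<noteq> 0" "young lam \<subseteq> young mu" by auto
qed

end

section \<open>Operators on tensors\<close>

lemma finite_basis_words: "finite S \<Longrightarrow> finite (basis_words S n)"
  unfolding basis_words_def by (rule finite_lists_length_eq)

lemma basis_words_Suc: "basis_words S (Suc n) = (\<lambda>(a, u). a # u) ` (S \<times> basis_words S n)"
  by (force simp: basis_words_def image_def length_Suc_conv)

lemma basis_words_0 [simp]: "basis_words S 0 = {[]}"
  by (auto simp: basis_words_def)

lemma basis_words_Cons [simp]: "a # u \<in> basis_words S (Suc n) \<longleftrightarrow> a \<in> S \<and> u \<in> basis_words S n"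
  by (auto simp: basis_words_def)

lemma sum_basis_words_Suc:
  "(\<Sum>w\<in>basis_words S (Suc n). f w) = (\<Sum>a\<in>S. \<Sum>u\<in>basis_words S n. f (a # u))"
proof -
  have "inj_on (\<lambda>(a, u). a # u) (S \<times> basis_words S n)" by (auto simp: inj_on_def)
  then have "(\<Sum>w\<in>basis_words S (Suc n). f w) = (\<Sum>(a, u)\<in>S \<times> basis_words S n. f (a # u))"
    unfolding basis_words_Suc by (subst sum.reindex) (auto simp: case_prod_beta comp_def)
  then show ?thesis by (simp add: sum.cartesian_product)
qed

lemma sum_prod_basis_words:
  fixes f :: "nat \<Rightarrow> 's \<Rightarrow> complex"
  shows "(\<Sum>x\<in>basis_words S n. \<Prod>k<n. f k (x ! k)) = (\<Prod>k<n. \<Sum>s\<in>S. f k s)"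
proof (induction n arbitrary: f)
  case (Suc n)
  have "(\<Sum>x\<in>basis_words S (Suc n). \<Prod>k<Suc n. f k (x ! k)) =
    (\<Sum>a\<in>S. \<Sum>u\<in>basis_words S n. f 0 a * (\<Prod>k<n. f (Suc k) (u ! k)))"
    unfolding sum_basis_words_Suc by (simp add: prod.lessThan_Suc_shift del: prod.lessThan_Suc)
  also have "\<dots> = (\<Sum>a\<in>S. f 0 a) * (\<Prod>k<n. \<Sum>s\<in>S. f (Suc k) s)"
    by (simp add: Suc.IH[symmetric] sum_product)
  finally show ?case by (simp add: prod.lessThan_Suc_shift del: prod.lessThan_Suc)
qed simp

lemma basis_words_nth: "w \<in> basis_words S n \<Longrightarrow> k < n \<Longrightarrow> w ! k \<in> S"
  and basis_words_length: "w \<in> basis_words S n \<Longrightarrow> length w = n"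
  by (auto simp: basis_words_def)

lemma basis_words_update: "w \<in> basis_words S n \<Longrightarrow> a \<in> S \<Longrightarrow> w[i := a] \<in> basis_words S n"
  using set_update_subset_insert[of w i a] by (auto simp: basis_words_def)

lemma basis_words_permute: "w \<in> basis_words S n \<Longrightarrow> p permutes {..<n} \<Longrightarrow> permute_list p w \<in> basis_words S n"
  by (simp add: basis_words_def)

lemma sum_fun_apply: "(\<Sum>x\<in>X. f x) w = (\<Sum>x\<in>X. f x w)"
  by (induction X rule: infinite_finite_induct) auto

definition tscale :: "complex \<Rightarrow> ('w \<Rightarrow> complex) \<Rightarrow> 'w \<Rightarrow> complex" where
  "tscale c T = (\<lambda>w. c * T w)"

lemma vector_space_tscale: "vector_space tscale"
  by unfold_locales (auto simp: tscale_def fun_eq_iff algebra_simps)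

text \<open>\<open>I\<close> is a basis of \<open>V\<close> with Gram matrix \<open>g\<close>. The elements of \<open>S\<close> label a second basis, in which the Gram matrix
  is real and has the square \<open>eps\<close>; \<open>C\<close> and \<open>K\<close> are the two matrices of the change of basis, and \<open>h\<close> is the
  Hermitian product for which the second basis is orthonormal. The assumption \<open>star\<close> then says that, up to the sign
  \<open>eps\<close>, inserting \<open>E\<close> is adjoint to contracting two tensor factors.\<close>

locale tensor_model =
  fixes I :: "'v set" and N :: nat and eps :: int and g ginv h :: "'v \<Rightarrow> 'v \<Rightarrow> complex"
    and S :: "'s set" and C :: "'s \<Rightarrow> 'v \<Rightarrow> complex" and K :: "'v \<Rightarrow> 's \<Rightarrow> complex"
  assumes finite_I: "finite I" and card_I: "card I = N" and eps: "eps = 1 \<or> eps = -1"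
    and g_sym: "a \<in> I \<Longrightarrow> b \<in> I \<Longrightarrow> g b a = of_int eps * g a b"
    and ginv_sym: "a \<in> I \<Longrightarrow> b \<in> I \<Longrightarrow> ginv b a = of_int eps * ginv a b"
    and ginv_g: "a \<in> I \<Longrightarrow> b \<in> I \<Longrightarrow> (\<Sum>c\<in>I. ginv a c * g c b) = (if a = b then 1 else 0)"
    and g_ginv: "a \<in> I \<Longrightarrow> b \<in> I \<Longrightarrow> (\<Sum>c\<in>I. g a c * ginv c b) = (if a = b then 1 else 0)"
    and finite_S: "finite S"
    and h_def: "h a b = (\<Sum>x\<in>S. cnj (C x a) * C x b)"
    and K_C: "a \<in> I \<Longrightarrow> b \<in> I \<Longrightarrow> (\<Sum>x\<in>S. K a x * C x b) = (if a = b then 1 else 0)"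
    and star: "a' \<in> I \<Longrightarrow> b' \<in> I \<Longrightarrow>
      (\<Sum>a\<in>I. \<Sum>b\<in>I. cnj (ginv a b) * h a a' * h b b') = of_int eps * g a' b'"
begin

abbreviation words :: "nat \<Rightarrow> 'v list set" where
  "words n \<equiv> basis_words I n"

abbreviation W :: "nat \<Rightarrow> ('v list \<Rightarrow> complex) set" where
  "W n \<equiv> tensor_space I n"

lemma W_zero: "T \<in> W n \<Longrightarrow> w \<notin> words n \<Longrightarrow> T w = 0"
  by (auto simp: tensor_space_def)

definition ip :: "nat \<Rightarrow> ('v list \<Rightarrow> complex) \<Rightarrow> ('v list \<Rightarrow> complex) \<Rightarrow> complex" where
  "ip n T U = (\<Sum>u\<in>words n. \<Sum>w\<in>words n. cnj (T u) * (\<Prod>k<n. h (u ! k) (w ! k)) * U w)"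

text \<open>Components with respect to the second basis, in which \<open>ip\<close> becomes the
  standard Hermitian product.\<close>

definition Chat :: "nat \<Rightarrow> ('v list \<Rightarrow> complex) \<Rightarrow> 's list \<Rightarrow> complex" where
  "Chat n T x = (\<Sum>w\<in>words n. (\<Prod>k<n. C (x ! k) (w ! k)) * T w)"

lemma finite_words [simp]: "finite (words n)"
  by (rule finite_basis_words[OF finite_I])

lemma eps_square [simp]: "of_int eps * (of_int eps :: complex) = 1" "of_int eps * (of_int eps * (z::complex)) = z"
  using eps by auto

lemma ip_Chat: "ip n T U = (\<Sum>x\<in>basis_words S n. cnj (Chat n T x) * Chat n U x)"
proof -
  have "ip n T U = (\<Sum>u\<in>words n. \<Sum>w\<in>words n. \<Sum>x\<in>basis_words S n.
      (cnj (T u) * (\<Prod>k<n. cnj (C (x ! k) (u ! k)))) * ((\<Prod>k<n. C (x ! k) (w ! k)) * U w))"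
    unfolding ip_def h_def sum_prod_basis_words[of "\<lambda>k s. cnj (C s (_ ! k)) * C s (_ ! k)", symmetric]
    by (intro sum.cong refl) (simp add: sum_distrib_left sum_distrib_right prod.distrib mult_ac)
  also have "\<dots> = (\<Sum>x\<in>basis_words S n. \<Sum>u\<in>words n. \<Sum>w\<in>words n.
      (cnj (T u) * (\<Prod>k<n. cnj (C (x ! k) (u ! k)))) * ((\<Prod>k<n. C (x ! k) (w ! k)) * U w))"
    by (subst sum.swap[where A = "words n" and B = "basis_words S n"]) (subst (2) sum.swap, rule refl)
  also have "\<dots> = (\<Sum>x\<in>basis_words S n. cnj (Chat n T x) * Chat n U x)"
    by (intro sum.cong refl)
      (simp only: Chat_def cnj_sum sum_product complex_cnj_mult cnj_prod, intro sum.cong refl, simp add: mult_ac)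
  finally show ?thesis .
qed

lemma Chat_inverse:
  assumes "w \<in> words n"
  shows "(\<Sum>x\<in>basis_words S n. (\<Prod>k<n. K (w ! k) (x ! k)) * Chat n T x) = T w"
proof -
  have "(\<Sum>x\<in>basis_words S n. (\<Prod>k<n. K (w ! k) (x ! k)) * Chat n T x) =
    (\<Sum>x\<in>basis_words S n. \<Sum>u\<in>words n. (\<Prod>k<n. K (w ! k) (x ! k) * C (x ! k) (u ! k)) * T u)"
    unfolding Chat_def by (simp add: sum_distrib_left prod.distrib mult_ac)
  also have "\<dots> = (\<Sum>u\<in>words n. (\<Sum>x\<in>basis_words S n. \<Prod>k<n. K (w ! k) (x ! k) * C (x ! k) (u ! k)) * T u)"
    by (subst sum.swap) (simp add: sum_distrib_right)
  also have "\<dots> = (\<Sum>u\<in>words n. (\<Prod>k<n. \<Sum>s\<in>S. K (w ! k) s * C s (u ! k)) * T u)"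
    by (simp add: sum_prod_basis_words[of "\<lambda>k s. K (w ! k) s * C s (_ ! k)"])
  also have "\<dots> = (\<Sum>u\<in>words n. if u = w then T u else 0)"
  proof (intro sum.cong refl)
    fix u assume u: "u \<in> words n"
    have "(\<Prod>k<n. \<Sum>s\<in>S. K (w ! k) s * C s (u ! k)) = (\<Prod>k<n. if w ! k = u ! k then 1 else 0)"
      using u assms basis_words_nth by (intro prod.cong refl K_C) auto
    also have "\<dots> = (if u = w then 1 else 0)"
    proof (cases "u = w")
      case False
      then obtain k where "k < n" "w ! k \<noteq> u ! k"
        using u assms by (metis basis_words_length nth_equalityI)
      then show ?thesis using False by (auto intro!: prod_zero)
    qed simp
    finally show "(\<Prod>k<n. \<Sum>s\<in>S. K (w ! k) s * C s (u ! k)) * T u = (if u = w then T u else 0)" by simp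
  qed
  also have "\<dots> = T w" using assms by simp
  finally show ?thesis .
qed

lemma ip_self: "ip n T T = of_real (\<Sum>x\<in>basis_words S n. (norm (Chat n T x))\<^sup>2)"
  unfolding ip_Chat by (simp add: complex_norm_square[symmetric] mult.commute)

lemma ip_definite:
  assumes "T \<in> W n" "ip n T T = 0"
  shows "T = 0"
proof -
  have "(\<Sum>x\<in>basis_words S n. (norm (Chat n T x))\<^sup>2) = 0"
    using assms(2) unfolding ip_self of_real_eq_0_iff .
  then have "\<forall>x\<in>basis_words S n. Chat n T x = 0"
    using finite_basis_words[OF finite_S, of n] by (simp add: sum_nonneg_eq_0_iff)
  then have "T w = 0" if "w \<in> words n" for w using Chat_inverse[OF that, of T] by simp
  then show ?thesis using assms(1) by (auto simp: fun_eq_iff tensor_space_def)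
qed

lemma ip_nonneg: "0 \<le> Re (ip n T T)" "Im (ip n T T) = 0"
  unfolding ip_self by (auto intro: sum_nonneg)

lemma ip_positive: "T \<in> W n \<Longrightarrow> T \<noteq> 0 \<Longrightarrow> 0 < Re (ip n T T)"
  using ip_nonneg[of n T] ip_definite[of T n] by (metis complex_eq_iff less_eq_real_def zero_complex.sel)

text \<open>For \<open>eps = -1\<close> permutations carry their sign, so a transposition acts by
  \<open>eps\<close> times the flip. Being multiplied by \<open>- eps\<close> under transpositions
  therefore means antisymmetry in the ordinary sense, for either value of
  \<open>eps\<close>.\<close>

definition sg :: "(nat \<Rightarrow> nat) \<Rightarrow> complex" where
  "sg p = (if eps = 1 then 1 else of_int (sign p))"

definition pact :: "nat \<Rightarrow> (nat \<Rightarrow> nat) \<Rightarrow> ('v list \<Rightarrow> complex) \<Rightarrow> 'v list \<Rightarrow> complex" where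
  "pact n p T = (\<lambda>w. if w \<in> words n then sg p * T (permute_list p w) else 0)"

lemma word_expansion:
  assumes T: "T \<in> W n"
  shows "T = (\<Sum>w\<in>words n. tscale (T w) (\<lambda>v. if v = w then 1 else 0))"
proof
  fix v
  have "(\<Sum>w\<in>words n. tscale (T w) (\<lambda>v. if v = w then 1 else 0)) v = (\<Sum>w\<in>words n. if v = w then T w else 0)"
    unfolding sum_fun_apply tscale_def by (intro sum.cong refl) auto
  then show "T v = (\<Sum>w\<in>words n. tscale (T w) (\<lambda>v. if v = w then 1 else 0)) v"
    using W_zero[OF T] by auto
qed

sublocale rep: hermitian_space tscale "W n" "ip n" "(\<lambda>w v. if v = w then 1 else 0) ` words n" for n
proof (intro hermitian_space.intro vector_space_tscale hermitian_space_axioms.intro)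
  interpret vector_space tscale by (rule vector_space_tscale)
  show "subspace (W n)" by (auto simp: subspace_def tensor_space_def tscale_def)
  let ?B = "(\<lambda>w v. if v = w then 1 else 0) ` words n :: ('v list \<Rightarrow> complex) set"
  show "finite ?B" by simp
  show "W n \<subseteq> span ?B"
  proof
    fix T assume "T \<in> W n"
    then have "T = (\<Sum>w\<in>words n. tscale (T w) (\<lambda>v. if v = w then 1 else 0))" by (rule word_expansion)
    also have "\<dots> \<in> span ?B" by (intro span_sum span_scale span_base) auto
    finally show "T \<in> span ?B" .
  qed
  fix x y z :: "'v list \<Rightarrow> complex" and c
  show "ip n x (y + z) = ip n x y + ip n x z"
    by (simp add: ip_def algebra_simps sum.distrib)
  show "ip n x (tscale c y) = c * ip n x y"
    by (simp add: ip_def tscale_def sum_distrib_left mult_ac)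
  show "ip n y x = cnj (ip n x y)"
    by (simp add: ip_Chat mult.commute)
  show "x \<in> W n \<Longrightarrow> ip n x x = 0 \<Longrightarrow> x = 0" by (rule ip_definite)
qed

lemma sg_compose: "p permutes {..<n} \<Longrightarrow> q permutes {..<n} \<Longrightarrow> sg (p \<circ> q) = sg p * sg q"
  using permutes_imp_permutation[of "{..<n}"] by (simp add: sg_def sign_compose)

lemma cnj_sg: "cnj (sg p) * sg p = 1"
  by (simp add: sg_def sign_def)

lemma bij_permute_words:
  assumes "p permutes {..<n}"
  shows "bij_betw (permute_list p) (words n) (words n)"
proof (rule bij_betw_byWitness[where f' = "permute_list (inv p)"])
  note ip = permutes_inv[OF assms]
  show "\<forall>w\<in>words n. permute_list (inv p) (permute_list p w) = w"
  proof
    fix w assume "w \<in> words n"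
    then have l: "length w = n" by (rule basis_words_length)
    then have "permute_list (inv p) (permute_list p w) = permute_list (p \<circ> inv p) w"
      using ip by (simp add: permute_list_compose)
    then show "permute_list (inv p) (permute_list p w) = w" using permutes_inv_o(1)[OF assms] by simp
  qed
  show "\<forall>w\<in>words n. permute_list p (permute_list (inv p) w) = w"
  proof
    fix w assume "w \<in> words n"
    then have l: "length w = n" by (rule basis_words_length)
    then have "permute_list p (permute_list (inv p) w) = permute_list (inv p \<circ> p) w"
      using assms by (simp add: permute_list_compose)
    then show "permute_list p (permute_list (inv p) w) = w" using permutes_inv_o(2)[OF assms] by simp
  qed
qed (use assms permutes_inv[OF assms] basis_words_permute in auto)

sublocale rep: symmetric_group_rep tscale "W n" "ip n" "(\<lambda>w v. if v = w then 1 else 0) ` words n" n "pact n" for n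
proof
  fix p q and x y :: "'v list \<Rightarrow> complex"
  show "rep.lin (pact n p)"
    by (auto simp: rep.lin_def pact_def fun_eq_iff algebra_simps tscale_def)
  show "pact n p x \<in> W n" by (auto simp: pact_def tensor_space_def)
  show "pact n id x = x" if "x \<in> W n"
    using W_zero[OF that] by (auto simp: pact_def fun_eq_iff sg_def)
  show "pact n p (pact n q x) = pact n (p \<circ> q) x" if "p permutes {..<n}" "q permutes {..<n}"
  proof
    fix w
    show "pact n p (pact n q x) w = pact n (p \<circ> q) x w"
      using that sg_compose[OF that] basis_words_permute[OF _ that(1)] basis_words_length[of w I n]
      by (auto simp: pact_def permute_list_compose)
  qed
  show "ip n (pact n p x) (pact n p y) = ip n x y" if p: "p permutes {..<n}"
  proof -
    have hp: "(\<Prod>k<n. h (u ! k) (w ! k)) = (\<Prod>k<n. h (permute_list p u ! k) (permute_list p w ! k))"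
      if "u \<in> words n" "w \<in> words n" for u w
    proof -
      have "(\<Prod>k<n. h (permute_list p u ! k) (permute_list p w ! k)) = (\<Prod>k<n. h (u ! p k) (w ! p k))"
        using that p by (intro prod.cong) (auto simp: permute_list_nth basis_words_length)
      also have "\<dots> = (\<Prod>k<n. h (u ! k) (w ! k))"
        using prod.permute[OF p, of "\<lambda>k. h (u ! k) (w ! k)"] by (simp add: comp_def)
      finally show ?thesis ..
    qed
    have "ip n (pact n p x) (pact n p y) = (\<Sum>u\<in>words n. \<Sum>w\<in>words n.
        cnj (x (permute_list p u)) * (\<Prod>k<n. h (permute_list p u ! k) (permute_list p w ! k)) * y (permute_list p w))"
      unfolding ip_def pact_def
    proof (intro sum.cong refl)
      fix u w assume uw: "u \<in> words n" "w \<in> words n"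
      have "cnj (sg p * x (permute_list p u)) * H * (sg p * y (permute_list p w)) =
         (cnj (sg p) * sg p) * (cnj (x (permute_list p u)) * H * y (permute_list p w))" for H
        by simp
      then show "cnj (if u \<in> words n then sg p * x (permute_list p u) else 0) * (\<Prod>k<n. h (u ! k) (w ! k)) *
          (if w \<in> words n then sg p * y (permute_list p w) else 0) =
        cnj (x (permute_list p u)) * (\<Prod>k<n. h (permute_list p u ! k) (permute_list p w ! k)) * y (permute_list p w)"
        using uw by (simp only: if_True cnj_sg hp[OF uw] mult_1)
    qed
    also have "\<dots> = (\<Sum>u\<in>words n. \<Sum>w\<in>words n.
        cnj (x (permute_list p u)) * (\<Prod>k<n. h (permute_list p u ! k) (w ! k)) * y w)"
      by (intro sum.cong refl sum.reindex_bij_betw[OF bij_permute_words[OF p],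
        where g = "\<lambda>w. cnj (x (permute_list p _)) * (\<Prod>k<n. h (permute_list p _ ! k) (w ! k)) * y w"])
    also have "\<dots> = ip n x y"
      unfolding ip_def by (rule sum.reindex_bij_betw[OF bij_permute_words[OF p],
        where g = "\<lambda>u. \<Sum>w\<in>words n. cnj (x u) * (\<Prod>k<n. h (u ! k) (w ! k)) * y w"])
    finally show ?thesis .
  qed
qed

end

section \<open>Sums over pairs of positions\<close>

definition pairs :: "nat \<Rightarrow> (nat \<times> nat) set" where
  "pairs n = {(i, j). i < j \<and> j < n}"

lemma finite_pairs: "finite (pairs n)"
  by (rule finite_subset[of _ "{..<n} \<times> {..<n}"]) (auto simp: pairs_def)

lemma sum_pairs_0 [simp]: "sum f (pairs 0) = 0"
  by (simp add: pairs_def)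

lemma sum_pairs_Suc:
  "(\<Sum>(i, j)\<in>pairs (Suc n). f i j) = (\<Sum>(i, j)\<in>pairs n. f i j) + (\<Sum>i<n. f i n)"
proof -
  have "pairs (Suc n) = pairs n \<union> (\<lambda>i. (i, n)) ` {..<n}" by (auto simp: pairs_def less_Suc_eq)
  moreover have "pairs n \<inter> (\<lambda>i. (i, n)) ` {..<n} = {}" by (auto simp: pairs_def)
  ultimately show ?thesis
    using finite_pairs[of n] by (simp add: sum.union_disjoint sum.reindex inj_on_def)
qed

lemma sum_pairs_first:
  "(\<Sum>(i, j)\<in>pairs (Suc n). f i j) = (\<Sum>j<n. f 0 (Suc j)) + (\<Sum>(i, j)\<in>pairs n. f (Suc i) (Suc j))"
proof (induction n)
  case (Suc n)
  have shift: "(\<Sum>i<Suc n. f i (Suc n)) = f 0 (Suc n) + (\<Sum>i<n. f (Suc i) (Suc n))"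
    by (rule sum.lessThan_Suc_shift)
  show ?case
    unfolding sum_pairs_Suc[of f "Suc n"] Suc.IH sum_pairs_Suc[of "\<lambda>i j. f (Suc i) (Suc j)"] shift
    by (simp add: ac_simps)
qed (simp add: sum_pairs_Suc)

lemma sum_pairs_symmetric:
  fixes f :: "nat \<Rightarrow> nat \<Rightarrow> 'a::ab_group_add"
  assumes sym: "\<And>i j. i < n \<Longrightarrow> j < n \<Longrightarrow> f i j = f j i" and p: "p permutes {..<n}"
  shows "(\<Sum>(i, j)\<in>pairs n. f (p i) (p j)) = (\<Sum>(i, j)\<in>pairs n. f i j)"
proof -
  define srt where "srt = (\<lambda>(i::nat, j). (min i j, max i j))"
  have lt: "q i < n \<longleftrightarrow> i < n" if "q permutes {..<n}" for q i using permutes_in_image[OF that, of i] by simp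
  have *: "srt (q i, q j) \<in> pairs n" if "q permutes {..<n}" "(i, j) \<in> pairs n" for q i j
  proof -
    have "q i \<noteq> q j" using that permutes_inj[OF that(1)] by (auto simp: pairs_def inj_eq)
    then show ?thesis using that(2) lt[OF that(1)] by (auto simp: pairs_def srt_def)
  qed
  have srt: "srt (q (fst (srt (i, j))), q (snd (srt (i, j)))) = srt (q i, q j)" for q i j
    by (auto simp: srt_def min_def max_def)
  have fs: "(case srt (i, j) of (x, y) \<Rightarrow> f x y) = f i j" if "i < n" "j < n" for i j
    using sym that by (auto simp: srt_def min_def max_def)
  show ?thesis
  proof (rule sum.reindex_bij_witness[where i = "\<lambda>(i, j). srt (inv p i, inv p j)" and j = "\<lambda>(i, j). srt (p i, p j)"])
    fix x assume x: "x \<in> pairs n"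
    obtain i j where ij: "x = (i, j)" by fastforce
    have s: "srt (i, j) = (i, j)" using x ij by (auto simp: pairs_def srt_def)
    show "(case x of (i, j) \<Rightarrow> srt (p i, p j)) \<in> pairs n" using *[OF p] x ij by simp
    show "(case x of (i, j) \<Rightarrow> srt (inv p i, inv p j)) \<in> pairs n" using *[OF permutes_inv[OF p]] x ij by simp
    show "(case case x of (i, j) \<Rightarrow> srt (p i, p j) of (i, j) \<Rightarrow> srt (inv p i, inv p j)) = x"
      using srt[of "inv p" "p i" "p j"] by (simp add: ij case_prod_beta permutes_inverses[OF p] s)
    show "(case case x of (i, j) \<Rightarrow> srt (inv p i, inv p j) of (i, j) \<Rightarrow> srt (p i, p j)) = x"
      using srt[of p "inv p i" "inv p j"] by (simp add: ij case_prod_beta permutes_inverses[OF p] s)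
    show "(case case x of (i, j) \<Rightarrow> srt (p i, p j) of (i, j) \<Rightarrow> f i j) = (case x of (i, j) \<Rightarrow> f (p i) (p j))"
      using fs[of "p i" "p j"] x lt[OF p] by (auto simp: ij pairs_def)
  qed
qed

lemma permute_list_transpose:
  assumes "i < length w" "j < length w"
  shows "permute_list (transpose i j) w = w[i := w ! j, j := w ! i]"
proof (rule nth_equalityI)
  fix k assume "k < length (permute_list (transpose i j) w)"
  then show "permute_list (transpose i j) w ! k = w[i := w ! j, j := w ! i] ! k"
    using assms by (auto simp: permute_list_def nth_list_update transpose_def)
qed simp

lemma permute_list_update:
  assumes "p permutes {..<length w}" "i < length w" "j < length w"
  shows "permute_list p (w[p i := a, p j := b]) = (permute_list p w)[i := a, j := b]"
proof (rule nth_equalityI)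
  fix k assume k: "k < length (permute_list p (w[p i := a, p j := b]))"
  have "p l = p k \<longleftrightarrow> l = k" for l using permutes_inj[OF assms(1)] by (auto simp: inj_eq)
  moreover have "p k < length w" "p i < length w" "p j < length w"
    using k assms(2,3) permutes_in_image[OF assms(1)] by auto
  ultimately show "permute_list p (w[p i := a, p j := b]) ! k = (permute_list p w)[i := a, j := b] ! k"
    using k assms by (auto simp: permute_list_def nth_list_update)
qed simp

text \<open>By such a permutation any contraction is conjugate to that of the first two
  positions.\<close>

lemma exists_permutation_01:
  assumes "i < n" "j < n" "i \<noteq> j"
  obtains p where "p permutes {..<n}" "p 0 = i" "p 1 = (j::nat)"
proof
  define x where "x = transpose 0 i j"
  have x: "x \<noteq> 0" "x < n" using assms by (auto simp: x_def transpose_def)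
  show "transpose 0 i \<circ> transpose 1 x permutes {..<n}"
    using assms x by (intro permutes_compose permutes_swap_id) auto
  show "(transpose 0 i \<circ> transpose 1 x) 0 = i" using x by (simp add: transpose_def)
  show "(transpose 0 i \<circ> transpose 1 x) 1 = j" by (simp add: x_def)
qed

section \<open>Contractions, insertions of E and the Casimir element\<close>

context tensor_model
begin

definition D :: "nat \<Rightarrow> nat \<Rightarrow> nat \<Rightarrow> ('v list \<Rightarrow> complex) \<Rightarrow> 'v list \<Rightarrow> complex" where
  "D n i j T = (\<lambda>w. if w \<in> words n then ginv (w ! i) (w ! j) * (\<Sum>a\<in>I. \<Sum>b\<in>I. g a b * T (w[i := a, j := b])) else 0)"

definition Aop :: "nat \<Rightarrow> ('v list \<Rightarrow> complex) \<Rightarrow> 'v list \<Rightarrow> complex" where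
  "Aop n T = (\<Sum>(i, j)\<in>pairs n. D n i j T)"

definition Zop :: "nat \<Rightarrow> ('v list \<Rightarrow> complex) \<Rightarrow> 'v list \<Rightarrow> complex" where
  "Zop n T = (\<Sum>(i, j)\<in>pairs n. pact n (transpose i j) T)"

text \<open>Always the first two positions are contracted, so iteration contracts the pairs (0, 1),
  (2, 3), ... and shifts the remaining positions down.\<close>

definition tau :: "('v list \<Rightarrow> complex) \<Rightarrow> 'v list \<Rightarrow> complex" where
  "tau T = (\<lambda>u. \<Sum>a\<in>I. \<Sum>b\<in>I. g a b * T (a # b # u))"

definition Et :: "('v list \<Rightarrow> complex) \<Rightarrow> 'v list \<Rightarrow> complex" where
  "Et z = (\<lambda>w. case w of a # b # u \<Rightarrow> if a \<in> I \<and> b \<in> I then ginv a b * z u else 0 | _ \<Rightarrow> 0)"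

lemma lin_tau: "rep.lin tau"
  by (auto simp: rep.lin_def tau_def tscale_def fun_eq_iff algebra_simps sum.distrib sum_distrib_left)

lemma tau_W: "T \<in> W (Suc (Suc n)) \<Longrightarrow> tau T \<in> W n"
  by (auto simp: tau_def tensor_space_def intro!: sum.neutral)

lemma lin_Et: "rep.lin Et"
  by (auto simp: rep.lin_def Et_def tscale_def fun_eq_iff algebra_simps split: list.split)

lemma Et_W: "z \<in> W n \<Longrightarrow> Et z \<in> W (Suc (Suc n))"
  by (auto simp: Et_def tensor_space_def split: list.split)

lemma lin_D: "rep.lin (D n i j)"
  by (auto simp: rep.lin_def D_def tscale_def fun_eq_iff algebra_simps sum.distrib sum_distrib_left)

lemma D_W: "D n i j T \<in> W n"
  by (auto simp: D_def tensor_space_def)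

lemma pact_W: "pact n p T \<in> W n"
  by (auto simp: pact_def tensor_space_def)

lemma pact_transpose:
  assumes "i < n" "j < n" "i \<noteq> j"
  shows "pact n (transpose i j) T = (\<lambda>w. if w \<in> words n then of_int eps * T (w[i := w ! j, j := w ! i]) else 0)"
proof -
  have "sg (transpose i j) = of_int eps" using assms eps by (auto simp: sg_def sign_swap_id)
  then show ?thesis
    using assms by (auto simp: pact_def fun_eq_iff permute_list_transpose basis_words_length)
qed

lemma W_eqI:
  assumes "T \<in> W n" "U \<in> W n" "\<And>w. w \<in> words n \<Longrightarrow> T w = U w"
  shows "T = U"
  using assms by (auto simp: fun_eq_iff tensor_space_def) metis

lemma D_sym:
  assumes "i < n" "j < n" "i \<noteq> j"
  shows "D n i j T = D n j i T"
proof (rule W_eqI[OF D_W D_W])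
  fix w assume w: "w \<in> words n"
  have "(\<Sum>a\<in>I. \<Sum>b\<in>I. g a b * T (w[i := a, j := b])) = (\<Sum>b\<in>I. \<Sum>a\<in>I. g a b * T (w[i := a, j := b]))"
    by (rule sum.swap)
  also have "\<dots> = (\<Sum>b\<in>I. \<Sum>a\<in>I. of_int eps * (g b a * T (w[j := b, i := a])))"
    using assms(3) by (intro sum.cong refl) (simp add: list_update_swap[of i j w] g_sym[symmetric] mult.assoc[symmetric])
  also have "\<dots> = of_int eps * (\<Sum>b\<in>I. \<Sum>a\<in>I. g b a * T (w[j := b, i := a]))"
    by (simp add: sum_distrib_left)
  finally show "D n i j T w = D n j i T w"
    using w assms ginv_sym[of "w ! i" "w ! j"] basis_words_nth[OF w]
    by (simp add: D_def)
qed

lemma D_conj: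
  assumes p: "p permutes {..<n}" and ij: "i < n" "j < n"
  shows "pact n p (D n i j T) = D n (p i) (p j) (pact n p T)"
proof (rule W_eqI[OF pact_W D_W])
  fix w assume w: "w \<in> words n"
  note l = basis_words_length[OF w]
  have nth: "permute_list p w ! k = w ! p k" if "k < n" for k
    using that p l by (simp add: permute_list_nth)
  have "pact n p T (w[p i := a, p j := b]) = sg p * T ((permute_list p w)[i := a, j := b])" if "a \<in> I" "b \<in> I" for a b
    using that w p ij l by (simp add: pact_def basis_words_update permute_list_update)
  then have "(\<Sum>a\<in>I. \<Sum>b\<in>I. g a b * pact n p T (w[p i := a, p j := b])) =
     sg p * (\<Sum>a\<in>I. \<Sum>b\<in>I. g a b * T ((permute_list p w)[i := a, j := b]))"
    by (simp add: sum_distrib_left mult_ac)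
  moreover have "pact n p (D n i j T) w = sg p * D n i j T (permute_list p w)" using w by (simp add: pact_def)
  ultimately show "pact n p (D n i j T) w = D n (p i) (p j) (pact n p T) w"
    using w p ij by (simp add: D_def nth basis_words_permute)
qed

lemma D_01:
  assumes "T \<in> W (Suc (Suc n))"
  shows "D (Suc (Suc n)) 0 1 T = Et (tau T)"
proof (rule W_eqI[OF D_W Et_W[OF tau_W[OF assms]]])
  fix w assume "w \<in> words (Suc (Suc n))"
  then obtain a b u where "w = a # b # u" "a \<in> I" "b \<in> I" "u \<in> words n"
    unfolding basis_words_Suc by auto
  then show "D (Suc (Suc n)) 0 1 T w = Et (tau T) w" by (simp add: D_def Et_def tau_def)
qed

text \<open>This is the assumption \<open>star\<close> applied in the first two factors: up to the
  sign \<open>eps\<close>, \<open>Et\<close> is adjoint to \<open>tau\<close>.\<close>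

lemma ip_Et: "ip (Suc (Suc n)) (Et z) y = of_int eps * ip n z (tau y)"
proof -
  define H where "H = (\<lambda>u w. \<Prod>k<n. h (u ! k) (w ! k))"
  have "ip (Suc (Suc n)) (Et z) y = (\<Sum>a\<in>I. \<Sum>b\<in>I. \<Sum>u\<in>words n. \<Sum>a'\<in>I. \<Sum>b'\<in>I. \<Sum>w\<in>words n.
      cnj (ginv a b * z u) * (h a a' * (h b b' * H u w)) * y (a' # b' # w))"
    unfolding ip_def sum_basis_words_Suc H_def
    by (intro sum.cong refl) (simp add: Et_def prod.lessThan_Suc_shift del: prod.lessThan_Suc)
  also have "\<dots> = (\<Sum>u\<in>words n. \<Sum>w\<in>words n. \<Sum>a'\<in>I. \<Sum>b'\<in>I. \<Sum>a\<in>I. \<Sum>b\<in>I.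
      cnj (ginv a b * z u) * (h a a' * (h b b' * H u w)) * y (a' # b' # w))"
  proof -
    have "(\<Sum>a\<in>I. \<Sum>b\<in>I. \<Sum>u\<in>words n. \<Sum>a'\<in>I. \<Sum>b'\<in>I. \<Sum>w\<in>words n. f a b u a' b' w) =
      (\<Sum>u\<in>words n. \<Sum>w\<in>words n. \<Sum>a'\<in>I. \<Sum>b'\<in>I. \<Sum>a\<in>I. \<Sum>b\<in>I. f a b u a' b' w)" for f :: "_ \<Rightarrow> _ \<Rightarrow> _ \<Rightarrow> _ \<Rightarrow> _ \<Rightarrow> _ \<Rightarrow> complex"
    proof -
      have "(\<Sum>a\<in>I. \<Sum>b\<in>I. \<Sum>u\<in>words n. \<Sum>a'\<in>I. \<Sum>b'\<in>I. \<Sum>w\<in>words n. f a b u a' b' w) =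
        (\<Sum>(a, b, u, a', b', w)\<in>I \<times> I \<times> words n \<times> I \<times> I \<times> words n. f a b u a' b' w)"
        by (simp add: sum.cartesian_product)
      also have "\<dots> = (\<Sum>(u, w, a', b', a, b)\<in>words n \<times> words n \<times> I \<times> I \<times> I \<times> I. f a b u a' b' w)"
        by (rule sum.reindex_bij_witness[where i = "\<lambda>(u, w, a', b', a, b). (a, b, u, a', b', w)"
            and j = "\<lambda>(a, b, u, a', b', w). (u, w, a', b', a, b)"]) auto
      finally show ?thesis by (simp add: sum.cartesian_product)
    qed
    then show ?thesis .
  qed
  also have "\<dots> = (\<Sum>u\<in>words n. \<Sum>w\<in>words n. \<Sum>a'\<in>I. \<Sum>b'\<in>I.
      (\<Sum>a\<in>I. \<Sum>b\<in>I. cnj (ginv a b) * h a a' * h b b') * (cnj (z u) * H u w * y (a' # b' # w)))"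
    by (simp add: sum_distrib_left sum_distrib_right mult_ac)
  also have "\<dots> = (\<Sum>u\<in>words n. \<Sum>w\<in>words n. \<Sum>a'\<in>I. \<Sum>b'\<in>I.
      of_int eps * g a' b' * (cnj (z u) * H u w * y (a' # b' # w)))"
    by (intro sum.cong refl) (simp add: star)
  also have "\<dots> = of_int eps * ip n z (tau y)"
    unfolding ip_def tau_def H_def by (simp add: sum_distrib_left mult_ac)
  finally show ?thesis .
qed

text \<open>Conjugation reduces to the positions 0 and 1, where the operator is \<open>Et\<close>
  after \<open>tau\<close>. The last claim exhibits \<open>eps\<close> times it as the pullback of a
  Hermitian product, hence as positive semidefinite.\<close>

lemma D_factor:
  assumes "i < Suc (Suc n)" "j < Suc (Suc n)" "i \<noteq> j"
  obtains p where "p permutes {..<Suc (Suc n)}"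
    "\<And>T. T \<in> W (Suc (Suc n)) \<Longrightarrow> D (Suc (Suc n)) i j T = pact (Suc (Suc n)) p (Et (tau (pact (Suc (Suc n)) (inv p) T)))"
    "\<And>T U. T \<in> W (Suc (Suc n)) \<Longrightarrow> U \<in> W (Suc (Suc n)) \<Longrightarrow> ip (Suc (Suc n)) T (D (Suc (Suc n)) i j U) =
      of_int eps * ip n (tau (pact (Suc (Suc n)) (inv p) T)) (tau (pact (Suc (Suc n)) (inv p) U))"
proof -
  let ?n = "Suc (Suc n)"
  obtain p where p: "p permutes {..<?n}" "p 0 = i" "p 1 = j" using exists_permutation_01[OF assms] .
  note ip = permutes_inv[OF p(1)]
  have inv: "pact ?n p (pact ?n (inv p) T) = T" if "T \<in> W ?n" for T
    using rep.act_comp[OF p(1) ip that] rep.act_id[OF that] permutes_inv_o(1)[OF p(1)] by simp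
  have D: "D ?n i j T = pact ?n p (Et (tau (pact ?n (inv p) T)))" if "T \<in> W ?n" for T
    using D_conj[OF p(1), of 0 1 "pact ?n (inv p) T"] inv[OF that] D_01[OF pact_W[of ?n "inv p" T]] p(2,3) by simp
  have "ip ?n T (D ?n i j U) = of_int eps * ip n (tau (pact ?n (inv p) T)) (tau (pact ?n (inv p) U))"
    if T: "T \<in> W ?n" and U: "U \<in> W ?n" for T U
  proof -
    let ?T = "pact ?n (inv p) T" and ?U = "pact ?n (inv p) U"
    have "ip ?n T (D ?n i j U) = ip ?n (pact ?n p ?T) (pact ?n p (Et (tau ?U)))"
      using D[OF U] inv[OF T] by simp
    also have "\<dots> = ip ?n ?T (Et (tau ?U))"
      by (rule rep.act_unitary[OF p(1) pact_W Et_W[OF tau_W[OF pact_W]]])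
    also have "\<dots> = cnj (of_int eps * ip n (tau ?U) (tau ?T))"
      using rep.ip_commute[of ?n ?T "Et (tau ?U)"] ip_Et[of n "tau ?U" ?T] by simp
    also have "\<dots> = of_int eps * ip n (tau ?T) (tau ?U)"
      using rep.ip_commute[of n "tau ?U" "tau ?T"] by simp
    finally show ?thesis .
  qed
  then show thesis using that p(1) D by blast
qed

lemma words2E:
  assumes "w \<in> words (Suc (Suc n))"
  obtains a b u where "w = a # b # u" "a \<in> I" "b \<in> I" "u \<in> words n"
  using assms unfolding basis_words_Suc by auto

lemma g_eps: "a \<in> I \<Longrightarrow> b \<in> I \<Longrightarrow> g a b * (of_int eps * z) = g b a * z"
  "a \<in> I \<Longrightarrow> b \<in> I \<Longrightarrow> of_int eps * (g a b * z) = g b a * z"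
  using g_sym[of a b] by simp_all

lemma tau_swap01:
  assumes "T \<in> W (Suc (Suc n))"
  shows "tau (pact (Suc (Suc n)) (transpose 0 1) T) = tau T"
proof (rule W_eqI[OF tau_W[OF pact_W] tau_W[OF assms]])
  fix u assume u: "u \<in> words n"
  have "tau (pact (Suc (Suc n)) (transpose 0 1) T) u = (\<Sum>a\<in>I. \<Sum>b\<in>I. g a b * (of_int eps * T (b # a # u)))"
    unfolding tau_def using u by (intro sum.cong refl) (simp add: pact_transpose)
  also have "\<dots> = (\<Sum>b\<in>I. \<Sum>a\<in>I. g b a * T (b # a # u))"
    by (subst sum.swap, intro sum.cong refl) (simp add: g_eps)
  finally show "tau (pact (Suc (Suc n)) (transpose 0 1) T) u = tau T u" by (simp add: tau_def)
qed

text \<open>The diagram identity \<open>d_01 s_0k = d_01 d_1k\<close> for \<open>k > 1\<close>: the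
  strands leaving the arc at 0 and 1 are the same on both sides.\<close>

lemma tau_transpose0:
  assumes T: "T \<in> W (Suc (Suc n))" and m: "m < n"
  shows "tau (pact (Suc (Suc n)) (transpose 0 (Suc (Suc m))) T) = tau (D (Suc (Suc n)) 1 (Suc (Suc m)) T)"
proof (rule W_eqI[OF tau_W[OF pact_W] tau_W[OF D_W]])
  fix u assume u: "u \<in> words n"
  define x where "x = u ! m"
  have x: "x \<in> I" using basis_words_nth[OF u m] by (simp add: x_def)
  define Q where "Q = (\<lambda>a. \<Sum>c\<in>I. \<Sum>d\<in>I. g c d * T (a # c # u[m := d]))"
  have "tau (D (Suc (Suc n)) 1 (Suc (Suc m)) T) u = (\<Sum>a\<in>I. \<Sum>b\<in>I. g a b * ginv b x * Q a)"
    unfolding tau_def using u by (intro sum.cong refl) (simp add: D_def x_def Q_def mult.assoc)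
  also have "\<dots> = (\<Sum>a\<in>I. (if a = x then 1 else 0) * Q a)"
    using x by (intro sum.cong refl) (simp add: sum_distrib_right[symmetric] g_ginv)
  also have "\<dots> = Q x" using x finite_I by (simp add: if_distrib[of "\<lambda>z. z * _"] sum.delta cong: if_cong)
  also have "Q x = (\<Sum>d\<in>I. \<Sum>c\<in>I. g d c * (of_int eps * T (x # c # u[m := d])))"
    unfolding Q_def by (subst sum.swap, intro sum.cong refl) (simp add: g_eps mult.assoc)
  also have "\<dots> = tau (pact (Suc (Suc n)) (transpose 0 (Suc (Suc m))) T) u"
    unfolding tau_def using u m by (intro sum.cong refl) (simp add: pact_transpose x_def)
  finally show "tau (pact (Suc (Suc n)) (transpose 0 (Suc (Suc m))) T) u = tau (D (Suc (Suc n)) 1 (Suc (Suc m)) T) u" ..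
qed

lemma tau_transpose1:
  assumes T: "T \<in> W (Suc (Suc n))" and m: "m < n"
  shows "tau (pact (Suc (Suc n)) (transpose 1 (Suc (Suc m))) T) = tau (D (Suc (Suc n)) 0 (Suc (Suc m)) T)"
proof (rule W_eqI[OF tau_W[OF pact_W] tau_W[OF D_W]])
  fix u assume u: "u \<in> words n"
  define x where "x = u ! m"
  have x: "x \<in> I" using basis_words_nth[OF u m] by (simp add: x_def)
  define Q where "Q = (\<lambda>b. \<Sum>c\<in>I. \<Sum>d\<in>I. g c d * T (c # b # u[m := d]))"
  have "tau (D (Suc (Suc n)) 0 (Suc (Suc m)) T) u = (\<Sum>a\<in>I. \<Sum>b\<in>I. g a b * ginv a x * Q b)"
    unfolding tau_def using u by (intro sum.cong refl) (simp add: D_def x_def Q_def mult.assoc)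
  also have "\<dots> = (\<Sum>b\<in>I. \<Sum>a\<in>I. of_int eps * ((g b a * ginv a x) * Q b))"
    by (subst sum.swap, intro sum.cong refl) (simp add: g_eps mult.assoc)
  also have "\<dots> = (\<Sum>b\<in>I. of_int eps * ((if b = x then 1 else 0) * Q b))"
    using x by (intro sum.cong refl) (simp add: sum_distrib_right[symmetric] sum_distrib_left[symmetric] g_ginv)
  also have "\<dots> = of_int eps * Q x"
    using x finite_I by (simp add: if_distrib[of "\<lambda>z. _ * (z * _)"] sum.delta cong: if_cong)
  also have "\<dots> = (\<Sum>c\<in>I. \<Sum>d\<in>I. g c d * (of_int eps * T (c # x # u[m := d])))"
    unfolding Q_def by (simp add: sum_distrib_left mult_ac)
  also have "\<dots> = tau (pact (Suc (Suc n)) (transpose 1 (Suc (Suc m))) T) u"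
    unfolding tau_def using u m by (intro sum.cong refl) (simp add: pact_transpose x_def)
  finally show "tau (pact (Suc (Suc n)) (transpose 1 (Suc (Suc m))) T) u = tau (D (Suc (Suc n)) 0 (Suc (Suc m)) T) u" ..
qed

text \<open>The value of a closed loop; the sign appears because one of the two Gram matrices has to
  be transposed.\<close>

lemma tau_Et: "tau (Et z) = tscale (of_int (eps * int N)) z"
proof
  fix u
  have "tau (Et z) u = (\<Sum>a\<in>I. \<Sum>b\<in>I. g a b * ginv a b) * z u"
    unfolding tau_def by (simp add: Et_def sum_distrib_right mult.assoc)
  also have "(\<Sum>a\<in>I. \<Sum>b\<in>I. g a b * ginv a b) = (\<Sum>b\<in>I. \<Sum>a\<in>I. of_int eps * (g b a * ginv a b))"
    by (subst sum.swap, intro sum.cong refl) (simp add: g_eps mult.assoc)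
  also have "\<dots> = of_int (eps * int N)"
    by (simp add: sum_distrib_left[symmetric] g_ginv card_I)
  finally show "tau (Et z) u = tscale (of_int (eps * int N)) z u" by (simp add: tscale_def)
qed

lemma tau_D_shift:
  assumes T: "T \<in> W (Suc (Suc n))"
  shows "tau (D (Suc (Suc n)) (Suc (Suc i)) (Suc (Suc j)) T) = D n i j (tau T)"
proof (rule W_eqI[OF tau_W[OF D_W] D_W])
  fix u assume u: "u \<in> words n"
  have "tau (D (Suc (Suc n)) (Suc (Suc i)) (Suc (Suc j)) T) u =
    (\<Sum>a\<in>I. \<Sum>b\<in>I. \<Sum>c\<in>I. \<Sum>d\<in>I. ginv (u ! i) (u ! j) * (g c d * (g a b * T (a # b # u[i := c, j := d]))))"
    unfolding tau_def using u by (intro sum.cong refl) (simp add: D_def sum_distrib_left mult_ac)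
  also have "\<dots> = (\<Sum>c\<in>I. \<Sum>d\<in>I. \<Sum>a\<in>I. \<Sum>b\<in>I. ginv (u ! i) (u ! j) * (g c d * (g a b * T (a # b # u[i := c, j := d]))))"
  proof -
    have "(\<Sum>a\<in>I. \<Sum>b\<in>I. \<Sum>c\<in>I. \<Sum>d\<in>I. f a b c d) = (\<Sum>c\<in>I. \<Sum>d\<in>I. \<Sum>a\<in>I. \<Sum>b\<in>I. f a b c d)" for f :: "_ \<Rightarrow> _ \<Rightarrow> _ \<Rightarrow> _ \<Rightarrow> complex"
    proof -
      have "(\<Sum>a\<in>I. \<Sum>b\<in>I. \<Sum>c\<in>I. \<Sum>d\<in>I. f a b c d) = (\<Sum>(a, b, c, d)\<in>I \<times> I \<times> I \<times> I. f a b c d)"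
        by (simp add: sum.cartesian_product)
      also have "\<dots> = (\<Sum>(c, d, a, b)\<in>I \<times> I \<times> I \<times> I. f a b c d)"
        by (rule sum.reindex_bij_witness[where i = "\<lambda>(c, d, a, b). (a, b, c, d)" and j = "\<lambda>(a, b, c, d). (c, d, a, b)"]) auto
      finally show ?thesis by (simp add: sum.cartesian_product)
    qed
    then show ?thesis .
  qed
  also have "\<dots> = D n i j (tau T) u"
    using u by (simp add: D_def tau_def sum_distrib_left)
  finally show "tau (D (Suc (Suc n)) (Suc (Suc i)) (Suc (Suc j)) T) u = D n i j (tau T) u" .
qed

lemma tau_transpose_shift:
  assumes T: "T \<in> W (Suc (Suc n))" and ij: "i < n" "j < n" "i \<noteq> j"
  shows "tau (pact (Suc (Suc n)) (transpose (Suc (Suc i)) (Suc (Suc j))) T) = pact n (transpose i j) (tau T)"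
proof (rule W_eqI[OF tau_W[OF pact_W] pact_W])
  fix u assume u: "u \<in> words n"
  show "tau (pact (Suc (Suc n)) (transpose (Suc (Suc i)) (Suc (Suc j))) T) u = pact n (transpose i j) (tau T) u"
    unfolding tau_def using u ij by (simp add: pact_transpose sum_distrib_left mult_ac)
qed

lemma lin_pact: "rep.lin (pact n p)"
  by (auto simp: rep.lin_def pact_def fun_eq_iff algebra_simps tscale_def)

lemma lin_Aop: "rep.lin (Aop n)"
  unfolding rep.lin_def Aop_def
proof (intro conjI allI)
  fix x y c
  show "(\<Sum>(i, j)\<in>pairs n. D n i j (x + y)) = (\<Sum>(i, j)\<in>pairs n. D n i j x) + (\<Sum>(i, j)\<in>pairs n. D n i j y)"
    unfolding sum.distrib[symmetric] by (intro sum.cong refl) (auto simp: rep.lin_add[OF lin_D])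
  show "(\<Sum>(i, j)\<in>pairs n. D n i j (tscale c x)) = tscale c (\<Sum>(i, j)\<in>pairs n. D n i j x)"
    unfolding rep.scale_sum_right by (intro sum.cong refl) (auto simp: rep.lin_scale[OF lin_D])
qed

lemma lin_Zop: "rep.lin (Zop n)"
  unfolding rep.lin_def Zop_def
proof (intro conjI allI)
  fix x y c
  show "(\<Sum>(i, j)\<in>pairs n. pact n (transpose i j) (x + y)) =
      (\<Sum>(i, j)\<in>pairs n. pact n (transpose i j) x) + (\<Sum>(i, j)\<in>pairs n. pact n (transpose i j) y)"
    unfolding sum.distrib[symmetric] by (intro sum.cong refl) (auto simp: rep.lin_add[OF lin_pact])
  show "(\<Sum>(i, j)\<in>pairs n. pact n (transpose i j) (tscale c x)) = tscale c (\<Sum>(i, j)\<in>pairs n. pact n (transpose i j) x)"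
    unfolding rep.scale_sum_right by (intro sum.cong refl) (auto simp: rep.lin_scale[OF lin_pact])
qed

lemma Aop_W: "Aop n T \<in> W n"
  unfolding Aop_def by (intro rep.subspace_sum[OF rep.subspace_W]) (auto simp: D_W)

lemma Zop_W: "Zop n T \<in> W n"
  unfolding Zop_def by (intro rep.subspace_sum[OF rep.subspace_W]) (auto simp: pact_W)

lemma Zop_jm: "Zop n T = (\<Sum>k<n. rep.jm n 0 k T)"
proof -
  have "(\<Sum>(i, j)\<in>pairs m. pact n (transpose i j) T) = (\<Sum>k<m. rep.jm n 0 k T)" for m
    by (induction m) (auto simp: sum_pairs_Suc rep.jm_def lessThan_atLeast0)
  then show ?thesis by (simp add: Zop_def)
qed

lemma Aop_pact:
  assumes p: "p permutes {..<n}"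
  shows "pact n p (Aop n T) = Aop n (pact n p T)"
proof -
  have "pact n p (Aop n T) = (\<Sum>(i, j)\<in>pairs n. D n (p i) (p j) (pact n p T))"
    unfolding Aop_def rep.lin_sum[OF lin_pact] using D_conj[OF p]
    by (intro sum.cong refl) (auto simp: pairs_def)
  also have "\<dots> = Aop n (pact n p T)"
    unfolding Aop_def by (rule sum_pairs_symmetric[OF _ p]) (metis D_sym)
  finally show ?thesis .
qed

lemma Zop_pact:
  assumes p: "p permutes {..<n}" and T: "T \<in> W n"
  shows "pact n p (Zop n T) = Zop n (pact n p T)"
proof -
  have "pact n p (Zop n T) = (\<Sum>(i, j)\<in>pairs n. pact n (transpose (p i) (p j)) (pact n p T))"
    unfolding Zop_def rep.lin_sum[OF lin_pact] using rep.act_conj[OF p _ _ T]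
    by (intro sum.cong refl) (auto simp: pairs_def)
  also have "\<dots> = Zop n (pact n p T)"
    unfolding Zop_def by (rule sum_pairs_symmetric[OF _ p]) (simp add: transpose_commute)
  finally show ?thesis .
qed

text \<open>The source of the constant \<open>eps * int N - 1\<close>. For the pair (0, 1) the
  contraction gives a loop and the transposition is absorbed, so \<open>eps * int N\<close> stands
  against 1. For pairs with one member in {0, 1}, the transposition with 0 cancels the contraction
  with 1, and vice versa. The other pairs are those of the contracted tensor.\<close>

lemma tau_Casimir:
  assumes T: "T \<in> W (Suc (Suc n))"
  shows "tau (Zop (Suc (Suc n)) T - Aop (Suc (Suc n)) T) =
    Zop n (tau T) - Aop n (tau T) - tscale (of_int (eps * int N - 1)) (tau T)"
proof -
  let ?n = "Suc (Suc n)"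
  have split: "(\<Sum>(i, j)\<in>pairs ?n. f i j) = f 0 1 + (\<Sum>j<n. f 0 (Suc (Suc j))) + (\<Sum>j<n. f 1 (Suc (Suc j))) +
     (\<Sum>(i, j)\<in>pairs n. f (Suc (Suc i)) (Suc (Suc j)))" for f :: "nat \<Rightarrow> nat \<Rightarrow> 'v list \<Rightarrow> complex"
    by (simp add: sum_pairs_first[of f] sum_pairs_first[of "\<lambda>i j. f (Suc i) (Suc j)"]
      sum.lessThan_Suc_shift[of _ n] add.assoc del: sum.lessThan_Suc)
  have "tau (Zop ?n T) = tau T + (\<Sum>j<n. tau (D ?n 1 (Suc (Suc j)) T)) + (\<Sum>j<n. tau (D ?n 0 (Suc (Suc j)) T)) + Zop n (tau T)"
    unfolding Zop_def split rep.lin_add[OF lin_tau] rep.lin_sum[OF lin_tau]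
    using tau_transpose_shift[OF T] tau_swap01[OF T] tau_transpose0[OF T] tau_transpose1[OF T]
    by (auto intro!: arg_cong2[of _ _ _ _ "(+)"] sum.cong simp: pairs_def)
  moreover have "tau (Aop ?n T) = tscale (of_int (eps * int N)) (tau T) + (\<Sum>j<n. tau (D ?n 0 (Suc (Suc j)) T)) +
      (\<Sum>j<n. tau (D ?n 1 (Suc (Suc j)) T)) + Aop n (tau T)"
    unfolding Aop_def split rep.lin_add[OF lin_tau] rep.lin_sum[OF lin_tau]
    using tau_D_shift[OF T] D_01[OF T] tau_Et
    by (auto intro!: arg_cong2[of _ _ _ _ "(+)"] sum.cong)
  moreover have "tscale (of_int (eps * int N - 1)) (tau T) = tscale (of_int (eps * int N)) (tau T) - tau T"
    by (simp add: tscale_def fun_eq_iff algebra_simps)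
  ultimately show ?thesis unfolding rep.lin_diff[OF lin_tau] by (simp add: algebra_simps)
qed

section \<open>Iterated contraction of pairs\<close>

lemma Phi_lin: "rep.lin (tau ^^ f)"
  by (rule rep.lin_funpow[OF lin_tau])

lemma Phi_W: "T \<in> W (n + 2 * f) \<Longrightarrow> (tau ^^ f) T \<in> W n"
  by (induction f arbitrary: T) (auto simp: funpow_swap1 tau_W simp del: funpow.simps(2) simp: funpow_Suc_right)

lemma Phi_Casimir:
  assumes "T \<in> W (n + 2 * f)"
  shows "(tau ^^ f) (Zop (n + 2 * f) T - Aop (n + 2 * f) T) =
    Zop n ((tau ^^ f) T) - Aop n ((tau ^^ f) T) - tscale (of_int (int f * (eps * int N - 1))) ((tau ^^ f) T)"
  using assms
proof (induction f arbitrary: T)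
  case 0
  then show ?case by (simp add: tscale_def fun_eq_iff)
next
  case (Suc f)
  have T: "T \<in> W (Suc (Suc (n + 2 * f)))" using Suc.prems by simp
  have "(tau ^^ Suc f) (Zop (n + 2 * Suc f) T - Aop (n + 2 * Suc f) T) =
    (tau ^^ f) (Zop (n + 2 * f) (tau T) - Aop (n + 2 * f) (tau T)) -
    (tau ^^ f) (tscale (of_int (eps * int N - 1)) (tau T))"
    using tau_Casimir[OF T] rep.lin_diff[OF Phi_lin] by (simp add: funpow_Suc_right del: funpow.simps)
  also have "\<dots> = Zop n ((tau ^^ f) (tau T)) - Aop n ((tau ^^ f) (tau T)) -
      tscale (of_int (int f * (eps * int N - 1))) ((tau ^^ f) (tau T)) -
      tscale (of_int (eps * int N - 1)) ((tau ^^ f) (tau T))"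
    unfolding Suc.IH[OF tau_W[OF T]] rep.lin_scale[OF Phi_lin] ..
  also have "\<dots> = Zop n ((tau ^^ f) (tau T)) - Aop n ((tau ^^ f) (tau T)) -
      tscale (of_int (int (Suc f) * (eps * int N - 1))) ((tau ^^ f) (tau T))"
    by (simp add: tscale_def fun_eq_iff algebra_simps)
  finally show ?case by (simp only: funpow_Suc_right comp_apply)
qed

lemma Phi_transpose:
  assumes "T \<in> W (n + 2 * f)" "i < n" "j < n" "i \<noteq> j"
  shows "(tau ^^ f) (pact (n + 2 * f) (transpose (2 * f + i) (2 * f + j)) T) = pact n (transpose i j) ((tau ^^ f) T)"
  using assms(1)
proof (induction f arbitrary: T)
  case (Suc f)
  have T: "T \<in> W (Suc (Suc (n + 2 * f)))" using Suc.prems by simp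
  show ?case
    using tau_transpose_shift[OF T, of "2 * f + i" "2 * f + j"] Suc.IH[OF tau_W[OF T]] assms
    by (simp add: funpow_Suc_right del: funpow.simps)
qed simp

lemma Phi_sw:
  assumes T: "T \<in> W (n + 2 * f)" and k: "k < f"
  shows "(tau ^^ f) (pact (n + 2 * f) (transpose (2 * k) (Suc (2 * k))) T) = (tau ^^ f) T"
proof -
  define m where "m = n + 2 * (f - Suc k)"
  have r: "n + 2 * f = Suc (Suc m) + 2 * k" using k by (simp add: m_def)
  have f: "f = (f - k) + k" "f - k = Suc (f - Suc k)" using k by auto
  have "(tau ^^ k) (pact (n + 2 * f) (transpose (2 * k) (Suc (2 * k))) T) = pact (Suc (Suc m)) (transpose 0 1) ((tau ^^ k) T)"
    using Phi_transpose[of T "Suc (Suc m)" k 0 1] T by (simp add: r)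
  moreover have "(tau ^^ k) T \<in> W (Suc (Suc m))" using Phi_W[of T "Suc (Suc m)" k] T r by simp
  ultimately have "(tau ^^ Suc k) (pact (n + 2 * f) (transpose (2 * k) (Suc (2 * k))) T) = (tau ^^ Suc k) T"
    using tau_swap01 by simp
  then have "(tau ^^ (f - Suc k)) ((tau ^^ Suc k) (pact (n + 2 * f) (transpose (2 * k) (Suc (2 * k))) T)) =
    (tau ^^ (f - Suc k)) ((tau ^^ Suc k) T)" by simp
  moreover have "(tau ^^ (f - Suc k)) ((tau ^^ Suc k) U) = (tau ^^ f) U" for U
    using k by (metis comp_apply funpow_add le_add_diff_inverse2 Suc_leI)
  ultimately show ?thesis by simp
qed

text \<open>The double contraction does not notice an exchange of its two pairs, nor flips inside
  them; the transpositions (0 3) and (1 2) differ by such a symmetry.\<close>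

lemma tau2_pair:
  assumes T: "T \<in> W (Suc (Suc (Suc (Suc n))))"
  shows "tau (tau (pact (Suc (Suc (Suc (Suc n)))) (transpose 0 2) (pact (Suc (Suc (Suc (Suc n)))) (transpose 1 3) T))) = tau (tau T)"
    and "tau (tau (pact (Suc (Suc (Suc (Suc n)))) (transpose 0 3) T)) = tau (tau (pact (Suc (Suc (Suc (Suc n)))) (transpose 1 2) T))"
proof -
  let ?n = "Suc (Suc (Suc (Suc n)))"
  have tt: "tau (tau U) u = (\<Sum>c\<in>I. \<Sum>d\<in>I. \<Sum>a\<in>I. \<Sum>b\<in>I. g c d * (g a b * U (a # b # c # d # u)))" for U u
    by (simp add: tau_def sum_distrib_left)
  have four: "(\<Sum>c\<in>I. \<Sum>d\<in>I. \<Sum>a\<in>I. \<Sum>b\<in>I. F a b c d) = (\<Sum>(c, d, a, b)\<in>I \<times> I \<times> I \<times> I. F a b c d)" for F :: "_ \<Rightarrow> _ \<Rightarrow> _ \<Rightarrow> _ \<Rightarrow> complex"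
    by (simp add: sum.cartesian_product)
  show "tau (tau (pact ?n (transpose 0 2) (pact ?n (transpose 1 3) T))) = tau (tau T)"
  proof (rule W_eqI[OF tau_W[OF tau_W[OF pact_W]] tau_W[OF tau_W[OF T]]])
    fix u assume u: "u \<in> words n"
    have "tau (tau (pact ?n (transpose 0 2) (pact ?n (transpose 1 3) T))) u =
      (\<Sum>c\<in>I. \<Sum>d\<in>I. \<Sum>a\<in>I. \<Sum>b\<in>I. g c d * (g a b * T (c # d # a # b # u)))"
      unfolding tt using u by (intro sum.cong refl) (simp add: pact_transpose numeral_2_eq_2 numeral_3_eq_3)
    also have "\<dots> = tau (tau T) u"
      unfolding tt four
      by (rule sum.reindex_bij_witness[where i = "\<lambda>(c, d, a, b). (a, b, c, d)" and j = "\<lambda>(c, d, a, b). (a, b, c, d)"])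
        auto
    finally show "tau (tau (pact ?n (transpose 0 2) (pact ?n (transpose 1 3) T))) u = tau (tau T) u" .
  qed
  show "tau (tau (pact ?n (transpose 0 3) T)) = tau (tau (pact ?n (transpose 1 2) T))"
  proof (rule W_eqI[OF tau_W[OF tau_W[OF pact_W]] tau_W[OF tau_W[OF pact_W]]])
    fix u assume u: "u \<in> words n"
    have "tau (tau (pact ?n (transpose 0 3) T)) u =
      (\<Sum>c\<in>I. \<Sum>d\<in>I. \<Sum>a\<in>I. \<Sum>b\<in>I. g c d * (g a b * (of_int eps * T (d # b # c # a # u))))"
      unfolding tt using u by (intro sum.cong refl) (simp add: pact_transpose numeral_3_eq_3)
    also have "\<dots> = (\<Sum>c\<in>I. \<Sum>d\<in>I. \<Sum>a\<in>I. \<Sum>b\<in>I. g d c * (g b a * (of_int eps * T (a # c # b # d # u))))"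
      unfolding four
      by (rule sum.reindex_bij_witness[where i = "\<lambda>(c, d, a, b). (b, a, d, c)" and j = "\<lambda>(c, d, a, b). (b, a, d, c)"])
        (auto simp: mult.left_commute)
    also have "\<dots> = (\<Sum>c\<in>I. \<Sum>d\<in>I. \<Sum>a\<in>I. \<Sum>b\<in>I. g c d * (g a b * (of_int eps * T (a # c # b # d # u))))"
    proof (intro sum.cong refl)
      fix a b c d assume "a \<in> I" "b \<in> I" "c \<in> I" "d \<in> I"
      then have "g d c = of_int eps * g c d" "g b a = of_int eps * g a b" by (auto intro: g_sym)
      then have "g d c * (g b a * z) = of_int eps * (of_int eps * (g c d * (g a b * z)))" for z by simp
      then show "g d c * (g b a * (of_int eps * T (a # c # b # d # u))) = g c d * (g a b * (of_int eps * T (a # c # b # d # u)))"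
        by simp
    qed
    also have "\<dots> = tau (tau (pact ?n (transpose 1 2) T)) u"
      unfolding tt using u by (intro sum.cong refl) (simp add: pact_transpose numeral_2_eq_2)
    finally show "tau (tau (pact ?n (transpose 0 3) T)) u = tau (tau (pact ?n (transpose 1 2) T)) u" .
  qed
qed

lemma Phi_pair:
  assumes T: "T \<in> W (n + 2 * f)" and k: "Suc k < f"
  defines "r \<equiv> n + 2 * f"
  shows "(tau ^^ f) (pact r (transpose (2 * k) (2 * k + 2)) (pact r (transpose (2 * k + 1) (2 * k + 3)) T)) = (tau ^^ f) T"
    and "(tau ^^ f) (pact r (transpose (2 * k) (2 * k + 3)) T) = (tau ^^ f) (pact r (transpose (2 * k + 1) (2 * k + 2)) T)"
proof -
  define m where "m = n + 2 * (f - Suc (Suc k))"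
  let ?m = "Suc (Suc (Suc (Suc m)))"
  have r: "r = ?m + 2 * k" using k by (simp add: m_def r_def)
  have split: "(tau ^^ (f - Suc (Suc k))) (tau (tau ((tau ^^ k) U))) = (tau ^^ f) U" for U
  proof -
    have "f = (f - Suc (Suc k)) + Suc (Suc k)" using k by simp
    then have "(tau ^^ f) U = (tau ^^ (f - Suc (Suc k))) ((tau ^^ Suc (Suc k)) U)" by (metis comp_apply funpow_add)
    then show ?thesis by simp
  qed
  have tr: "(tau ^^ k) (pact r (transpose (2 * k + i) (2 * k + j)) U) = pact ?m (transpose i j) ((tau ^^ k) U)"
    if "i < 4" "j < 4" "i \<noteq> j" "U \<in> W r" for i j U
    using Phi_transpose[of U ?m k i j] that by (simp add: r)
  have TW: "T \<in> W r" "(tau ^^ k) T \<in> W ?m" using T Phi_W[of T ?m k] by (auto simp: r_def[symmetric] r)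
  have "(tau ^^ k) (pact r (transpose (2 * k) (2 * k + 2)) (pact r (transpose (2 * k + 1) (2 * k + 3)) T)) =
    pact ?m (transpose 0 2) (pact ?m (transpose 1 3) ((tau ^^ k) T))"
    using tr[of 0 2 "pact r (transpose (2 * k + 1) (2 * k + 3)) T"] tr[of 1 3 T] pact_W TW by simp
  then show "(tau ^^ f) (pact r (transpose (2 * k) (2 * k + 2)) (pact r (transpose (2 * k + 1) (2 * k + 3)) T)) = (tau ^^ f) T"
    using tau2_pair(1)[OF TW(2)] split[of "pact r (transpose (2 * k) (2 * k + 2)) (pact r (transpose (2 * k + 1) (2 * k + 3)) T)"]
      split[of T] by simp
  have "(tau ^^ k) (pact r (transpose (2 * k) (2 * k + 3)) T) = pact ?m (transpose 0 3) ((tau ^^ k) T)"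
    "(tau ^^ k) (pact r (transpose (2 * k + 1) (2 * k + 2)) T) = pact ?m (transpose 1 2) ((tau ^^ k) T)"
    using tr[of 0 3 T] tr[of 1 2 T] TW by simp_all
  then show "(tau ^^ f) (pact r (transpose (2 * k) (2 * k + 3)) T) = (tau ^^ f) (pact r (transpose (2 * k + 1) (2 * k + 2)) T)"
    using tau2_pair(2)[OF TW(2)] split[of "pact r (transpose (2 * k) (2 * k + 3)) T"]
      split[of "pact r (transpose (2 * k + 1) (2 * k + 2)) T"] by simp
qed

text \<open>Induction over the pairs. Conjugation by the exchange of pair \<open>k\<close> with the
  next one turns the Jucys--Murphy element at \<open>2 * k\<close> into the one at
  \<open>2 * k + 2\<close> up to two transpositions, which join the new position to either member of
  pair \<open>k\<close>. Under the contraction the flip of the new pair interchanges these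
  two.\<close>

lemma Phi_jm_even:
  assumes "T \<in> W (n + 2 * f)" and "k < f"
  defines "r \<equiv> n + 2 * f"
  shows "(tau ^^ f) (rep.jm r 0 (2 * k) (pact r (transpose (2 * k) (Suc (2 * k))) T)) = (tau ^^ f) (rep.jm r 0 (2 * k) T)"
  using assms(1,2)
proof (induction k arbitrary: T)
  case 0
  then show ?case by (simp add: rep.jm_def)
next
  case (Suc k)
  define \<Phi> where "\<Phi> = tau ^^ f"
  define i where "i = 2 * k"
  have i: "Suc (Suc (Suc i)) < r" "2 * Suc k = Suc (Suc i)" using Suc.prems by (auto simp: i_def r_def)
  have T: "T \<in> W r" using Suc.prems by (simp add: r_def)
  let ?t = "\<lambda>a b. pact r (transpose a b)"
  let ?i1 = "Suc i" and ?i2 = "Suc (Suc i)" and ?i3 = "Suc (Suc (Suc i))"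
  define p where "p = transpose i ?i2 \<circ> transpose ?i1 ?i3"
  have p: "p permutes {..<r}" unfolding p_def using i by (intro permutes_compose permutes_swap_id) auto
  have pp: "p \<circ> p = id" by (auto simp: p_def fun_eq_iff transpose_def)
  have pW: "pact r q U \<in> W r" for q U by (rule pact_W)
  have comp: "pact r q (pact r q' U) = pact r (q \<circ> q') U" if "q permutes {..<r}" "q' permutes {..<r}" "U \<in> W r" for q q' U
    by (rule rep.act_comp[OF that])
  have tp: "transpose a b permutes {..<r}" if "a < r" "b < r" for a b using that by (intro permutes_swap_id) auto
  have \<Phi>p: "\<Phi> (pact r p U) = \<Phi> U" if "U \<in> W r" for U
    using Phi_pair(1)[of U n f k] comp[OF tp tp that, of i ?i2 ?i1 ?i3] that Suc.prems i
    by (simp add: \<Phi>_def p_def i_def r_def numeral_3_eq_3)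
  have \<Phi>s: "\<Phi> (?t ?i2 ?i3 U) = \<Phi> U" if "U \<in> W r" for U
    using Phi_sw[of U n f "Suc k"] that Suc.prems i by (simp add: \<Phi>_def r_def)
  have \<Phi>x: "\<Phi> (?t i ?i3 U) = \<Phi> (?t ?i1 ?i2 U)" if "U \<in> W r" for U
    using Phi_pair(2)[of U n f k] that Suc.prems by (simp add: \<Phi>_def i_def r_def numeral_3_eq_3)
  have \<Phi>add: "\<Phi> (x + y) = \<Phi> x + \<Phi> y" for x y by (simp add: \<Phi>_def rep.lin_add[OF Phi_lin])
  have X: "rep.jm r 0 ?i2 U = pact r p (rep.jm r 0 i (pact r p U)) + (?t i ?i2 U + ?t ?i1 ?i2 U)" if U: "U \<in> W r" for U
  proof -
    have "pact r p (rep.jm r 0 i (pact r p U)) = (\<Sum>j\<in>{0..<i}. pact r (transpose (p j) (p i)) (pact r p (pact r p U)))"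
      using i by (intro rep.act_jm[OF p _ pW]) simp
    also have "pact r p (pact r p U) = U" using comp[OF p p U] pp rep.act_id[OF U] by simp
    also have "(\<Sum>j\<in>{0..<i}. pact r (transpose (p j) (p i)) U) = (\<Sum>j\<in>{0..<i}. ?t j ?i2 U)"
      by (intro sum.cong refl) (auto simp: p_def transpose_def)
    finally show ?thesis by (simp add: rep.jm_def add.assoc)
  qed
  have sp: "pact r p (?t ?i2 ?i3 T) = ?t i ?i1 (pact r p T)"
  proof -
    have "p \<circ> transpose ?i2 ?i3 = transpose i ?i1 \<circ> p" by (auto simp: p_def fun_eq_iff transpose_def)
    then show ?thesis using comp[OF p tp T, of ?i2 ?i3] comp[OF tp p T, of i ?i1] i by simp
  qed
  have r1: "\<Phi> (?t i ?i2 (?t ?i2 ?i3 T)) = \<Phi> (?t ?i1 ?i2 T)"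
  proof -
    have "transpose i ?i2 \<circ> transpose ?i2 ?i3 = transpose ?i2 ?i3 \<circ> transpose i ?i3"
      by (auto simp: fun_eq_iff transpose_def)
    then have "?t i ?i2 (?t ?i2 ?i3 T) = ?t ?i2 ?i3 (?t i ?i3 T)"
      using comp[OF tp tp T, of i ?i2 ?i2 ?i3] comp[OF tp tp T, of ?i2 ?i3 i ?i3] i by simp
    then show ?thesis using \<Phi>s[OF pW] \<Phi>x[OF T] by simp
  qed
  have r2: "\<Phi> (?t ?i1 ?i2 (?t ?i2 ?i3 T)) = \<Phi> (?t i ?i2 T)"
  proof -
    have "transpose ?i1 ?i2 \<circ> transpose ?i2 ?i3 = transpose ?i2 ?i3 \<circ> transpose ?i1 ?i3"
      by (auto simp: fun_eq_iff transpose_def)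
    then have "?t ?i1 ?i2 (?t ?i2 ?i3 T) = ?t ?i2 ?i3 (?t ?i1 ?i3 T)"
      using comp[OF tp tp T, of ?i1 ?i2 ?i2 ?i3] comp[OF tp tp T, of ?i2 ?i3 ?i1 ?i3] i by simp
    then have "\<Phi> (?t ?i1 ?i2 (?t ?i2 ?i3 T)) = \<Phi> (?t ?i1 ?i3 T)" using \<Phi>s[OF pW] by simp
    also have "transpose ?i1 ?i3 = p \<circ> transpose i ?i2" by (auto simp: p_def fun_eq_iff transpose_def)
    then have "?t ?i1 ?i3 T = pact r p (?t i ?i2 T)" using comp[OF p tp T, of i ?i2] i by simp
    then have "\<Phi> (?t ?i1 ?i3 T) = \<Phi> (?t i ?i2 T)" using \<Phi>p[OF pW] by simp
    finally show ?thesis .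
  qed
  have jW: "rep.jm r 0 i U \<in> W r" if "U \<in> W r" for U using rep.jm_W[of i r U] i that by simp
  have IH: "\<Phi> (rep.jm r 0 i (?t i ?i1 (pact r p T))) = \<Phi> (rep.jm r 0 i (pact r p T))"
    using Suc.IH[of "pact r p T"] Suc.prems pW by (simp add: \<Phi>_def i_def r_def)
  have "\<Phi> (rep.jm r 0 ?i2 (?t ?i2 ?i3 T)) = \<Phi> (rep.jm r 0 i (pact r p T)) + (\<Phi> (?t ?i1 ?i2 T) + \<Phi> (?t i ?i2 T))"
    unfolding X[OF pW] \<Phi>add r1 r2 \<Phi>p[OF jW[OF pW]] sp IH ..
  also have "\<dots> = \<Phi> (rep.jm r 0 ?i2 T)"
    unfolding X[OF T] \<Phi>add \<Phi>p[OF jW[OF pW]] by (simp add: add.commute)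
  finally show ?case by (simp add: \<Phi>_def i(2) del: mult_Suc_right)
qed

text \<open>Let the Jucys--Murphy element at \<open>2 * k\<close> act on the flipped tensor and
  contract the result. By \<open>Phi_jm_even\<close> this is \<open>c\<close> times the contraction
  of \<open>w\<close>. By the exchange relation \<open>sw_jm\<close>, and because the contraction
  absorbs the flip, it is \<open>c' - 1\<close> times the same tensor.\<close>

theorem domino_contents:
  assumes w: "w \<in> W (n + 2 * f)" and nz: "(tau ^^ f) w \<noteq> 0" and k: "k < f"
    and e: "rep.jm (n + 2 * f) 0 (2 * k) w = tscale c w" "rep.jm (n + 2 * f) 0 (Suc (2 * k)) w = tscale c' w"
  shows "c' = c + 1"
proof -
  define r where "r = n + 2 * f"
  define i where "i = 2 * k"
  let ?s = "pact r (transpose i (Suc i))"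
  have wr: "w \<in> W r" using w by (simp add: r_def)
  have i: "Suc i < r" using k by (simp add: r_def i_def)
  have ss: "?s (?s U) = U" if "U \<in> W r" for U using rep.act_transpose_twice[of i r "Suc i" U] i that by simp
  have e: "rep.jm r 0 i w = tscale c w" "rep.jm r 0 (Suc i) w = tscale c' w" using e by (simp_all add: r_def i_def)
  have "?s (rep.jm r 0 i (?s w)) = rep.jm r 0 (Suc i) (?s (?s w)) - ?s w"
    using rep.sw_jm[of 0 i r "?s w"] i pact_W by simp
  then have "?s (?s (rep.jm r 0 i (?s w))) = ?s (tscale c' w - ?s w)" using ss[OF wr] e by simp
  then have eq: "rep.jm r 0 i (?s w) = tscale c' (?s w) - w"
    using ss[OF wr] ss[OF rep.jm_W[of i r "?s w" 0]] i pact_W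
    by (simp add: rep.lin_diff[OF lin_pact] rep.lin_scale[OF lin_pact])
  have "(tau ^^ f) (rep.jm r 0 i (?s w)) = tscale c' ((tau ^^ f) (?s w)) - (tau ^^ f) w"
    unfolding eq rep.lin_diff[OF Phi_lin] rep.lin_scale[OF Phi_lin] ..
  also have "(tau ^^ f) (?s w) = (tau ^^ f) w" using Phi_sw[OF w k] by (simp add: r_def i_def)
  finally have eq2: "(tau ^^ f) (rep.jm r 0 i (?s w)) = tscale c' ((tau ^^ f) w) - (tau ^^ f) w" .
  have "(tau ^^ f) (rep.jm r 0 i (?s w)) = (tau ^^ f) (rep.jm r 0 i w)"
    using Phi_jm_even[OF w k] by (simp add: r_def i_def)
  then have "(tau ^^ f) (rep.jm r 0 i w) = tscale c' ((tau ^^ f) w) - (tau ^^ f) w" unfolding eq2 ..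
  then have "tscale c ((tau ^^ f) w) = tscale c' ((tau ^^ f) w) - (tau ^^ f) w"
    using e(1) by (simp add: rep.lin_scale[OF Phi_lin])
  moreover obtain u where "(tau ^^ f) w u \<noteq> 0" using nz by (auto simp: fun_eq_iff)
  ultimately have "c * (tau ^^ f) w u = c' * (tau ^^ f) w u - (tau ^^ f) w u"
    by (simp add: tscale_def fun_eq_iff)
  then have "(c + 1 - c') * (tau ^^ f) w u = 0" by (simp add: algebra_simps)
  then show ?thesis using \<open>(tau ^^ f) w u \<noteq> 0\<close> by simp
qed

section \<open>Positivity of the contractions\<close>

lemma ip_D:
  assumes "i < n" "j < n" "i \<noteq> j" "T \<in> W n" "U \<in> W n"
  shows "ip n (D n i j T) U = ip n T (D n i j U)"
    and "0 \<le> Re (of_int eps * ip n T (D n i j T))" "Im (of_int eps * ip n T (D n i j T)) = 0"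
    and "ip n T (D n i j T) = 0 \<Longrightarrow> D n i j T = 0"
proof -
  have "\<exists>m. n = Suc (Suc m)" using assms(1-3) by presburger
  then obtain m where n: "n = Suc (Suc m)" by blast
  obtain p where p: "p permutes {..<n}" "\<And>T. T \<in> W n \<Longrightarrow> D n i j T = pact n p (Et (tau (pact n (inv p) T)))"
    "\<And>T U. T \<in> W n \<Longrightarrow> U \<in> W n \<Longrightarrow> ip n T (D n i j U) = of_int eps * ip m (tau (pact n (inv p) T)) (tau (pact n (inv p) U))"
    using D_factor[of i m j] assms(1-3) unfolding n by blast
  have "ip n (D n i j T) U = cnj (ip n U (D n i j T))" by (rule rep.ip_commute)
  also have "\<dots> = of_int eps * ip m (tau (pact n (inv p) T)) (tau (pact n (inv p) U))"
    using p(3)[OF assms(5,4)] rep.ip_commute[of m "tau (pact n (inv p) T)" "tau (pact n (inv p) U)"] by simp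
  finally show "ip n (D n i j T) U = ip n T (D n i j U)" using p(3)[OF assms(4,5)] by simp
  have eq: "of_int eps * ip n T (D n i j T) = ip m (tau (pact n (inv p) T)) (tau (pact n (inv p) T))"
    using p(3)[OF assms(4,4)] by simp
  show "0 \<le> Re (of_int eps * ip n T (D n i j T))" "Im (of_int eps * ip n T (D n i j T)) = 0"
    unfolding eq by (rule ip_nonneg)+
  show "D n i j T = 0" if "ip n T (D n i j T) = 0"
  proof -
    have "tau (pact n (inv p) T) = 0"
      by (rule ip_definite[OF tau_W]) (use pact_W n eq that in auto)
    then show ?thesis using p(2)[OF assms(4)] by (simp add: rep.lin_zero[OF lin_Et] rep.lin_zero[OF lin_pact])
  qed
qed

lemma Aop_selfadjoint: "rep.selfadjoint n (Aop n)"
  unfolding rep.selfadjoint_def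
proof (intro conjI ballI lin_Aop Aop_W)
  fix T U assume "T \<in> W n" "U \<in> W n"
  then show "ip n (Aop n T) U = ip n T (Aop n U)"
    unfolding Aop_def rep.ip_sum_left rep.ip_sum_right
    by (intro sum.cong refl) (auto simp: pairs_def ip_D(1))
qed

lemma Aop_expand: "of_int eps * ip n T (Aop n T) = (\<Sum>(i, j)\<in>pairs n. of_int eps * ip n T (D n i j T))"
  unfolding Aop_def rep.ip_sum_right sum_distrib_left by (intro sum.cong refl) auto

text \<open>A sum of positive semidefinite operators annihilates a tensor only if each of them
  does.\<close>

lemma Aop_zero:
  assumes T: "T \<in> W n" and z: "Aop n T = 0" and ij: "i < j" "j < n"
  shows "D n i j T = 0"
proof -
  have "(\<Sum>(i, j)\<in>pairs n. Re (of_int eps * ip n T (D n i j T))) = Re (of_int eps * ip n T (Aop n T))"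
    unfolding Aop_expand Re_sum by (intro sum.cong refl) auto
  also have "\<dots> = 0" by (simp add: z)
  finally have "\<forall>x\<in>pairs n. (case x of (i, j) \<Rightarrow> Re (of_int eps * ip n T (D n i j T))) = 0"
    by (subst (asm) sum_nonneg_eq_0_iff[OF finite_pairs])
      (use ip_D(2)[OF _ _ _ T T] in \<open>auto simp: pairs_def\<close>)
  then have "Re (of_int eps * ip n T (D n i j T)) = 0" using ij by (auto simp: pairs_def)
  moreover have "Im (of_int eps * ip n T (D n i j T)) = 0" using ip_D(3)[OF _ _ _ T T, of i j] ij by simp
  ultimately have "of_int eps * ip n T (D n i j T) = 0" by (simp add: complex_eq_iff)
  then have "ip n T (D n i j T) = 0" using eps by auto
  then show ?thesis using ip_D(4)[OF _ _ _ T T] ij by simp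
qed

text \<open>The origin of the intersection with the multiples of \<epsilon> in
  \<open>spec_times\<close>.\<close>

lemma Aop_eigenvalue_nonneg:
  assumes T: "T \<in> W n" "T \<noteq> 0" and e: "Aop n T = tscale (of_int \<alpha>) T"
  shows "0 \<le> eps * \<alpha>"
proof -
  have "Re (of_int eps * ip n T (Aop n T)) = (\<Sum>(i, j)\<in>pairs n. Re (of_int eps * ip n T (D n i j T)))"
    unfolding Aop_expand Re_sum by (intro sum.cong refl) auto
  also have "\<dots> \<ge> 0" using ip_D(2)[OF _ _ _ T(1) T(1)] by (intro sum_nonneg) (auto simp: pairs_def)
  finally have "0 \<le> Re (of_int eps * (of_int \<alpha> * ip n T T))" by (simp add: e rep.ip_scale_right)
  also have "\<dots> = of_int (eps * \<alpha>) * Re (ip n T T)"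
    by (metis Re_complex_of_real mult.assoc of_int_mult of_real_of_int_eq times_complex.sel(1) Im_complex_of_real mult_zero_left diff_zero)
  finally have "0 \<le> of_int (eps * \<alpha>) * Re (ip n T T)" .
  moreover have "Re (ip n T T) > 0" by (rule ip_positive[OF T])
  ultimately show ?thesis by (simp add: zero_le_mult_iff)
qed

end

section \<open>Bounds on rows and columns\<close>

context symmetric_group_rep
begin

definition block_sym :: "complex \<Rightarrow> nat set \<Rightarrow> 'b \<Rightarrow> bool" where
  "block_sym \<sigma> P u \<longleftrightarrow> (\<forall>i\<in>P. \<forall>j\<in>P. i \<noteq> j \<longrightarrow> act (transpose i j) u = \<sigma> *s u)"

lemma block_symI:
  assumes v: "v \<in> W" and \<sigma>: "\<sigma> * \<sigma> = 1" and y: "y \<le> n"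
    and adj: "\<And>k. x \<le> k \<Longrightarrow> Suc k < y \<Longrightarrow> sw k v = \<sigma> *s v"
  shows "block_sym \<sigma> {x..<y} v"
proof -
  have *: "act (transpose i j) v = \<sigma> *s v" if "x \<le> i" "i < j" "j < y" for i j
    using that(2,3)
  proof (induction j)
    case (Suc j)
    note lins = act_lin[OF perm_transpose]
    show ?case
    proof (cases "i = j")
      case True
      then show ?thesis using adj[of j] that(1) Suc.prems by simp
    next
      case False
      then have IH: "act (transpose i j) v = \<sigma> *s v" using Suc by simp
      have s: "sw j v = \<sigma> *s v" using adj[of j] that(1) Suc.prems by simp
      have "transpose i (Suc j) = transpose j (Suc j) \<circ> (transpose i j \<circ> transpose j (Suc j))"
        using False Suc.prems by (auto simp: fun_eq_iff transpose_def)
      then have "act (transpose i (Suc j)) v = sw j (act (transpose i j) (sw j v))"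
        using Suc.prems y v by (simp add: act_comp permutes_compose)
      also have "\<dots> = \<sigma> *s v"
        using Suc.prems y \<sigma> by (simp add: s IH lin_scale[OF lins] mult.assoc)
      finally show ?thesis .
    qed
  qed simp
  show ?thesis
    unfolding block_sym_def
  proof (intro ballI impI)
    fix i j assume "i \<in> {x..<y}" "j \<in> {x..<y}" "i \<noteq> j"
    then show "act (transpose i j) v = \<sigma> *s v"
      using *[of i j] *[of j i] by (cases "i < j") (auto simp: transpose_commute)
  qed
qed

text \<open>The sum over coset representatives of the permutations of \<open>P\<close> in those of
  \<open>insert x P\<close>, twisted by \<sigma> and not normalised. It extends a symmetry on
  \<open>P\<close> to one more position.\<close>

definition coset_sum :: "complex \<Rightarrow> nat \<Rightarrow> nat set \<Rightarrow> 'b \<Rightarrow> 'b" where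
  "coset_sum \<sigma> x P u = u + \<sigma> *s (\<Sum>i\<in>P. act (transpose x i) u)"

lemma coset_sum_W: "x < n \<Longrightarrow> P \<subseteq> {..<n} \<Longrightarrow> u \<in> W \<Longrightarrow> coset_sum \<sigma> x P u \<in> W"
  unfolding coset_sum_def by (intro W_closed subspace_sum[OF subspace_W] act_W) auto

lemma act_coset_sum:
  assumes p: "p permutes {..<n}" and x: "x < n" and P: "P \<subseteq> {..<n}" and u: "u \<in> W" and px: "p x = x" "p ` P = P"
  shows "act p (coset_sum \<sigma> x P u) = coset_sum \<sigma> x P (act p u)"
proof -
  have "act p (\<Sum>i\<in>P. act (transpose x i) u) = (\<Sum>i\<in>P. act (transpose x (p i)) (act p u))"
    unfolding lin_sum[OF act_lin[OF p]] using act_conj[OF p x _ u] P px(1)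
    by (intro sum.cong refl) auto
  also have "\<dots> = (\<Sum>i\<in>p ` P. act (transpose x i) (act p u))"
    using inj_on_subset[OF permutes_inj[OF p] subset_UNIV] by (simp add: sum.reindex)
  finally show ?thesis
    by (simp add: coset_sum_def lin_add[OF act_lin[OF p]] lin_scale[OF act_lin[OF p]] px)
qed

lemma coset_sum_scale:
  assumes x: "x < n" and P: "P \<subseteq> {..<n}"
  shows "coset_sum \<sigma> x P (c *s u) = c *s coset_sum \<sigma> x P u"
proof -
  have "act (transpose x k) (c *s u) = c *s act (transpose x k) u" if "k \<in> P" for k
    using that P x lin_scale[OF act_lin[OF perm_transpose]] by auto
  then have "(\<Sum>k\<in>P. act (transpose x k) (c *s u)) = c *s (\<Sum>k\<in>P. act (transpose x k) u)"
    by (simp add: scale_sum_right)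
  then show ?thesis by (simp add: coset_sum_def scale_right_distrib mult.commute)
qed

text \<open>A transposition with \<open>x\<close> permutes the cosets: \<open>transpose x i \<circ>
  transpose x j = transpose x j \<circ> transpose i j\<close>, and the right factor is absorbed by
  the symmetry on \<open>P\<close>.\<close>

lemma block_sym_coset_sum:
  assumes \<sigma>: "\<sigma> * \<sigma> = 1" and x: "x < n" "x \<notin> P" and P: "P \<subseteq> {..<n}" and u: "u \<in> W" "block_sym \<sigma> P u"
  shows "block_sym \<sigma> (insert x P) (coset_sum \<sigma> x P u)"
proof -
  have fin: "finite P" using P finite_subset by blast
  have new: "act (transpose x i) (coset_sum \<sigma> x P u) = \<sigma> *s coset_sum \<sigma> x P u" if i: "i \<in> P" for i
  proof -
    have il: "i < n" using i P by auto
    note lins = act_lin[OF perm_transpose[OF x(1) il]]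
    have "act (transpose x i) (\<Sum>j\<in>P. act (transpose x j) u) = u + \<sigma> *s (\<Sum>j\<in>P - {i}. act (transpose x j) u)"
    proof -
      have "act (transpose x i) (act (transpose x j) u) = \<sigma> *s act (transpose x j) u" if "j \<in> P - {i}" for j
      proof -
        have jl: "j < n" "j \<noteq> i" "j \<noteq> x" "i \<noteq> x" "j \<in> P" using that P i x by auto
        have "transpose x i \<circ> transpose x j = transpose x j \<circ> transpose i j"
          using jl by (auto simp: fun_eq_iff transpose_def)
        then have "act (transpose x i) (act (transpose x j) u) = act (transpose x j) (act (transpose i j) u)"
          using il jl x u by (simp add: act_comp)
        also have "act (transpose i j) u = \<sigma> *s u" using u(2) i jl by (auto simp: block_sym_def)
        finally show ?thesis by (simp add: lin_scale[OF act_lin[OF perm_transpose[OF x(1) jl(1)]]])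
      qed
      then show ?thesis
        unfolding lin_sum[OF lins] using fin i x il u
        by (subst sum.remove[of P i]) (auto simp: act_transpose_twice scale_sum_right)
    qed
    then have "act (transpose x i) (coset_sum \<sigma> x P u) =
      act (transpose x i) u + \<sigma> *s (u + \<sigma> *s (\<Sum>j\<in>P - {i}. act (transpose x j) u))"
      by (simp add: coset_sum_def lin_add[OF lins] lin_scale[OF lins])
    also have "\<dots> = \<sigma> *s u + (act (transpose x i) u + (\<Sum>j\<in>P - {i}. act (transpose x j) u))"
      using \<sigma> by (simp add: scale_right_distrib)
    also have "\<dots> = \<sigma> *s u + (\<Sum>j\<in>P. act (transpose x j) u)"
      using fin i by (simp add: sum.remove[of P i])
    also have "\<dots> = \<sigma> *s coset_sum \<sigma> x P u"
      using \<sigma> by (simp add: coset_sum_def scale_right_distrib)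
    finally show ?thesis .
  qed
  have old: "act (transpose i j) (coset_sum \<sigma> x P u) = \<sigma> *s coset_sum \<sigma> x P u"
    if ij: "i \<in> P" "j \<in> P" "i \<noteq> j" for i j
  proof -
    have l: "i < n" "j < n" using ij P by auto
    have "transpose i j permutes P" using ij by (intro permutes_swap_id) auto
    then have "act (transpose i j) (coset_sum \<sigma> x P u) = coset_sum \<sigma> x P (act (transpose i j) u)"
      using ij x l P u by (intro act_coset_sum) (auto simp: permutes_image transpose_def)
    also have "act (transpose i j) u = \<sigma> *s u" using u(2) ij by (auto simp: block_sym_def)
    also have "coset_sum \<sigma> x P (\<sigma> *s u) = \<sigma> *s coset_sum \<sigma> x P u"
      by (rule coset_sum_scale[OF x(1) P])
    finally show ?thesis .
  qed
  show ?thesis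
    unfolding block_sym_def using new old by (auto simp: transpose_commute[of _ x])
qed

text \<open>Each coset representative can be moved to \<open>v\<close>, where it acts by \<sigma>;
  so all cosets contribute equally.\<close>

lemma ip_coset_sum:
  assumes \<sigma>: "\<sigma> * \<sigma> = 1" "cnj \<sigma> = \<sigma>" and x: "x < n" "x \<notin> P" and P: "P \<subseteq> {..<n}" and u: "u \<in> W"
    and v: "v \<in> W" "block_sym \<sigma> (insert x P) v"
  shows "ip (coset_sum \<sigma> x P u) v = of_nat (Suc (card P)) * ip u v"
proof -
  have "ip (act (transpose x i) u) v = \<sigma> * ip u v" if "i \<in> P" for i
  proof -
    have "ip (act (transpose x i) u) v = ip u (act (transpose x i) v)"
      using that P x u v by (intro act_transpose_selfadjoint) auto
    also have "act (transpose x i) v = \<sigma> *s v" using v(2) that x by (auto simp: block_sym_def)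
    finally show ?thesis by (simp add: ip_scale_right)
  qed
  then have "ip (coset_sum \<sigma> x P u) v = ip u v + \<sigma> * (of_nat (card P) * (\<sigma> * ip u v))"
    by (simp add: coset_sum_def ip_add_left ip_scale_left ip_sum_left \<sigma>)
  also have "\<dots> = ip u v + (\<sigma> * \<sigma>) * (of_nat (card P) * ip u v)" by (simp only: mult_ac)
  finally show ?thesis by (simp add: \<sigma> algebra_simps)
qed

end

section \<open>Norm estimates for antisymmetric and traceless tensors\<close>

context tensor_model
begin

lemma nonneg_middle: "0 \<le> c * x * d \<Longrightarrow> 0 < d \<Longrightarrow> 0 < c \<Longrightarrow> 0 \<le> x" for c x d :: real
  by (auto simp: zero_le_mult_iff)

text \<open>The tensor is antisymmetric in the first \<open>l\<close> positions, for either value of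
  \<open>eps\<close>. If there are more than \<open>N\<close> of them, every word repeats a letter
  there.\<close>

lemma block_sym_bound:
  assumes v: "v \<in> W n" "v \<noteq> 0" and hn: "l \<le> n" and b: "rep.block_sym n (- of_int eps) {..<l} v"
  shows "l \<le> N"
proof (rule ccontr)
  assume "\<not> l \<le> N"
  have "v w = 0" if w: "w \<in> words n" for w
  proof -
    have "\<not> inj_on ((!) w) {..<l}"
    proof
      assume "inj_on ((!) w) {..<l}"
      moreover have "(!) w ` {..<l} \<subseteq> I" using basis_words_nth[OF w] hn by auto
      ultimately have "card {..<l} \<le> card I" using finite_I by (rule card_inj_on_le)
      then show False using \<open>\<not> l \<le> N\<close> by (simp add: card_I)
    qed
    then obtain i j where ij: "i < l" "j < l" "i \<noteq> j" "w ! i = w ! j" by (auto simp: inj_on_def)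
    then have "pact n (transpose i j) v = tscale (- of_int eps) v"
      using b by (auto simp: rep.block_sym_def)
    then have "pact n (transpose i j) v w = - of_int eps * v w" by (simp add: tscale_def)
    moreover have "w[i := w ! j, j := w ! i] = w" using ij by (metis list_update_id)
    ultimately have "of_int eps * v w = - of_int eps * v w" using w ij hn by (simp add: pact_transpose)
    then show ?thesis using eps by auto
  qed
  then show False using v W_eqI[OF v(1) rep.W_closed(4)] by auto
qed

lemma Et_transpose_shift:
  assumes "z \<in> W n" "i < n" "j < n" "i \<noteq> j"
  shows "pact (Suc (Suc n)) (transpose (Suc (Suc i)) (Suc (Suc j))) (Et z) = Et (pact n (transpose i j) z)"
proof (rule W_eqI[OF pact_W Et_W[OF pact_W]])
  fix w assume "w \<in> words (Suc (Suc n))"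
  then obtain a b u where "w = a # b # u" "a \<in> I" "b \<in> I" "u \<in> words n" by (rule words2E)
  then show "pact (Suc (Suc n)) (transpose (Suc (Suc i)) (Suc (Suc j))) (Et z) w = Et (pact n (transpose i j) z) w"
    using assms by (simp add: pact_transpose Et_def)
qed

lemma Et_swap01:
  assumes "z \<in> W n"
  shows "pact (Suc (Suc n)) (transpose 0 1) (Et z) = Et z"
proof (rule W_eqI[OF pact_W Et_W[OF assms]])
  fix w assume "w \<in> words (Suc (Suc n))"
  then obtain a b u where "w = a # b # u" "a \<in> I" "b \<in> I" "u \<in> words n" by (rule words2E)
  then show "pact (Suc (Suc n)) (transpose 0 1) (Et z) w = Et z w"
    using ginv_sym[of b a] by (simp add: pact_transpose Et_def)
qed

text \<open>The snake identity: after one leg of \<open>E\<close> is exchanged with a factor of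
  \<open>z\<close>, the contraction straightens the line.\<close>

lemma tau_transpose_Et:
  assumes z: "z \<in> W n" and j: "j < n"
  shows "tau (pact (Suc (Suc n)) (transpose 0 (Suc (Suc j))) (Et z)) = z"
    and "tau (pact (Suc (Suc n)) (transpose 1 (Suc (Suc j))) (Et z)) = z"
proof -
  have g2: "(\<Sum>b\<in>I. g a b * ginv x b) = of_int eps * (if a = x then 1 else 0)" if "a \<in> I" "x \<in> I" for a x
  proof -
    have "(\<Sum>b\<in>I. g a b * ginv x b) = (\<Sum>b\<in>I. of_int eps * (g a b * ginv b x))"
      using that by (intro sum.cong refl) (simp add: ginv_sym[of b x for b])
    then show ?thesis using that by (simp add: sum_distrib_left[symmetric] g_ginv)
  qed
  have g3: "(\<Sum>a\<in>I. g a b * ginv a x) = of_int eps * (if b = x then 1 else 0)" if "b \<in> I" "x \<in> I" for b x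
  proof -
    have "(\<Sum>a\<in>I. g a b * ginv a x) = (\<Sum>a\<in>I. of_int eps * (g b a * ginv a x))"
      using that by (intro sum.cong refl) (simp add: g_eps)
    then show ?thesis using that by (simp add: sum_distrib_left[symmetric] g_ginv)
  qed
  show "tau (pact (Suc (Suc n)) (transpose 0 (Suc (Suc j))) (Et z)) = z"
  proof (rule W_eqI[OF tau_W[OF pact_W] z])
    fix u assume u: "u \<in> words n"
    define x where "x = u ! j"
    have x: "x \<in> I" using basis_words_nth[OF u j] by (simp add: x_def)
    have "tau (pact (Suc (Suc n)) (transpose 0 (Suc (Suc j))) (Et z)) u =
      (\<Sum>a\<in>I. \<Sum>b\<in>I. (g a b * ginv x b) * (of_int eps * z (u[j := a])))"
      unfolding tau_def using u j x by (intro sum.cong refl) (simp add: pact_transpose Et_def x_def mult_ac)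
    also have "\<dots> = (\<Sum>a\<in>I. if a = x then z (u[j := a]) else 0)"
      using x by (intro sum.cong refl) (simp add: sum_distrib_right[symmetric] g2)
    also have "\<dots> = z u" using x finite_I by (simp add: x_def)
    finally show "tau (pact (Suc (Suc n)) (transpose 0 (Suc (Suc j))) (Et z)) u = z u" .
  qed
  show "tau (pact (Suc (Suc n)) (transpose 1 (Suc (Suc j))) (Et z)) = z"
  proof (rule W_eqI[OF tau_W[OF pact_W] z])
    fix u assume u: "u \<in> words n"
    define x where "x = u ! j"
    have x: "x \<in> I" using basis_words_nth[OF u j] by (simp add: x_def)
    have "tau (pact (Suc (Suc n)) (transpose 1 (Suc (Suc j))) (Et z)) u =
      (\<Sum>a\<in>I. \<Sum>b\<in>I. (g a b * ginv a x) * (of_int eps * z (u[j := b])))"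
      unfolding tau_def using u j x by (intro sum.cong refl) (simp add: pact_transpose Et_def x_def mult_ac)
    also have "\<dots> = (\<Sum>b\<in>I. \<Sum>a\<in>I. (g a b * ginv a x) * (of_int eps * z (u[j := b])))" by (rule sum.swap)
    also have "\<dots> = (\<Sum>b\<in>I. if b = x then z (u[j := b]) else 0)"
      using x by (intro sum.cong refl) (simp add: sum_distrib_right[symmetric] g3)
    also have "\<dots> = z u" using x finite_I by (simp add: x_def)
    finally show "tau (pact (Suc (Suc n)) (transpose 1 (Suc (Suc j))) (Et z)) u = z u" .
  qed
qed

text \<open>When both legs of \<open>E\<close> are exchanged with factors of \<open>z\<close>, the
  operator \<open>tau\<close> contracts these two factors, and the legs are left in their
  places.\<close>

lemma tau_transpose2_Et:
  assumes z: "z \<in> W n" and ij: "i < n" "j < n" "i \<noteq> j" and D0: "D n i j z = 0"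
  shows "tau (pact (Suc (Suc n)) (transpose 1 (Suc (Suc j))) (pact (Suc (Suc n)) (transpose 0 (Suc (Suc i))) (Et z))) = 0"
proof (rule W_eqI[OF tau_W[OF pact_W] rep.W_closed(4)])
  fix u assume u: "u \<in> words n"
  have "u ! i \<in> I" "u ! j \<in> I" using basis_words_nth[OF u] ij by auto
  then have "tau (pact (Suc (Suc n)) (transpose 1 (Suc (Suc j))) (pact (Suc (Suc n)) (transpose 0 (Suc (Suc i))) (Et z))) u =
    (\<Sum>a\<in>I. \<Sum>b\<in>I. ginv (u ! i) (u ! j) * (g a b * z (u[i := a, j := b])))"
    unfolding tau_def using u ij
    by (intro sum.cong refl) (simp add: pact_transpose Et_def basis_words_update list_update_swap[of i j] mult_ac)
  also have "\<dots> = D n i j z u" using u by (simp add: D_def sum_distrib_left)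
  finally show "tau (pact (Suc (Suc n)) (transpose 1 (Suc (Suc j))) (pact (Suc (Suc n)) (transpose 0 (Suc (Suc i))) (Et z))) u = 0 u"
    by (simp add: D0)
qed

lemma block_sym_Et:
  assumes z: "z \<in> W n" and b: "rep.block_sym n \<sigma> {x..<y} z" and y: "y \<le> n"
  shows "rep.block_sym (Suc (Suc n)) \<sigma> {Suc (Suc x)..<Suc (Suc y)} (Et z)"
  unfolding rep.block_sym_def
proof (intro ballI impI)
  fix i j assume i: "i \<in> {Suc (Suc x)..<Suc (Suc y)}" and j: "j \<in> {Suc (Suc x)..<Suc (Suc y)}" and "i \<noteq> j"
  define i' j' where "i' = i - 2" and "j' = j - 2"
  have e: "i = Suc (Suc i')" "j = Suc (Suc j')" using i j by (auto simp: i'_def j'_def)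
  have "pact n (transpose i' j') z = tscale \<sigma> z"
    using b i j \<open>i \<noteq> j\<close> unfolding rep.block_sym_def by (auto simp: e)
  then show "pact (Suc (Suc n)) (transpose i j) (Et z) = tscale \<sigma> (Et z)"
    using Et_transpose_shift[OF z, of i' j'] i j \<open>i \<noteq> j\<close> y by (simp add: e rep.lin_scale[OF lin_Et])
qed

lemma sum_shift2: "(\<Sum>i\<in>{Suc (Suc x)..<Suc (Suc y)}. f i) = (\<Sum>i\<in>{x..<y}. f (Suc (Suc i)))"
  by (simp only: sum.shift_bounds_Suc_ivl)

text \<open>The identity gives the loop \<open>eps * int N\<close>; each of the \<open>y - x\<close>
  exchanges gives \<sigma> times \<open>z\<close> by the snake identity.\<close>

lemma tau_coset_sum_Et:
  assumes z: "z \<in> W n" and y: "y \<le> n"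
  shows "tau (rep.coset_sum (Suc (Suc n)) \<sigma> 0 {Suc (Suc x)..<Suc (Suc y)} (Et z)) =
    tscale (of_int (eps * int N) + \<sigma> * of_nat (y - x)) z"
proof -
  have "tau (\<Sum>i\<in>{Suc (Suc x)..<Suc (Suc y)}. pact (Suc (Suc n)) (transpose 0 i) (Et z)) = (\<Sum>i\<in>{x..<y}. z)"
    unfolding sum_shift2 rep.lin_sum[OF lin_tau] using tau_transpose_Et(1)[OF z] y by (intro sum.cong) auto
  also have "\<dots> = tscale (of_nat (y - x)) z" by (simp only: rep.sum_constant_scale card_atLeastLessThan)
  finally show ?thesis
    by (simp add: rep.coset_sum_def rep.lin_add[OF lin_tau] rep.lin_scale[OF lin_tau] tau_Et rep.scale_left_distrib)
qed

text \<open>The two legs of \<open>E\<close> are antisymmetrised into the two columns; the squared norm of the resulting tensor is a positive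
  multiple of \<open>N - p - q\<close>.\<close>

theorem traceless_two_columns:
  assumes z: "z \<in> W n" "z \<noteq> 0" and traceless: "\<And>i j. i < j \<Longrightarrow> j < n \<Longrightarrow> D n i j z = 0" and e1: "eps = 1"
    and pq: "p + q \<le> n" and b: "rep.block_sym n (-1) {0..<p} z" "rep.block_sym n (-1) {p..<p+q} z"
  shows "p + q \<le> N"
proof -
  let ?r = "Suc (Suc n)"
  let ?\<sigma> = "-1 :: complex"
  define P where "P = {Suc (Suc 0)..<Suc (Suc p)}"
  define Q where "Q = {Suc (Suc p)..<Suc (Suc (p + q))}"
  define y0 where "y0 = Et z"
  define u where "u = rep.coset_sum ?r ?\<sigma> 0 P y0"
  \<comment> \<open>The leg 0 of \<open>E\<close> has joined the first column; now the leg 1 joins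
    the second.\<close>
  define y where "y = rep.coset_sum ?r ?\<sigma> 1 Q u"
  have y0W: "y0 \<in> W ?r" using Et_W[OF z(1)] by (simp add: y0_def)
  have PQ: "P \<subseteq> {..<?r}" "Q \<subseteq> {..<?r}" "0 \<notin> P" "1 \<notin> Q" "0 \<notin> Q" "1 \<notin> P" "P \<inter> Q = {}"
    using pq by (auto simp: P_def Q_def)
  have uW: "u \<in> W ?r" unfolding u_def using PQ y0W by (intro rep.coset_sum_W) auto
  have yW: "y \<in> W ?r" unfolding y_def using PQ uW by (intro rep.coset_sum_W) auto
  have bP: "rep.block_sym ?r ?\<sigma> P y0" unfolding y0_def P_def using b(1) pq by (intro block_sym_Et z) auto
  have bQ: "rep.block_sym ?r ?\<sigma> Q y0" unfolding y0_def Q_def using b(2) pq by (intro block_sym_Et z) auto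
  have buP: "rep.block_sym ?r ?\<sigma> (insert 0 P) u"
    unfolding u_def using PQ y0W bP by (intro rep.block_sym_coset_sum) auto
  \<comment> \<open>Transpositions inside \<open>Q\<close> fix 0 and preserve \<open>P\<close>, so
    they commute with the first coset sum.\<close>
  have commQ: "rep.block_sym ?r ?\<sigma> Q u"
    unfolding rep.block_sym_def
  proof (intro ballI impI)
    fix i j assume ij: "i \<in> Q" "j \<in> Q" "i \<noteq> j"
    have l: "i < ?r" "j < ?r" using ij PQ by auto
    have fx: "transpose i j k = k" if "k \<notin> Q" for k using ij that by (auto simp: transpose_def)
    have "k \<notin> Q" if "k \<in> P" for k using that PQ(7) by auto
    then have "transpose i j ` P = (\<lambda>k. k) ` P" by (intro image_cong refl fx)
    then have "transpose i j ` P = P" by simp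
    then have "pact ?r (transpose i j) u = rep.coset_sum ?r ?\<sigma> 0 P (pact ?r (transpose i j) y0)"
      unfolding u_def using l PQ y0W fx[of 0] by (intro rep.act_coset_sum) auto
    also have "pact ?r (transpose i j) y0 = tscale ?\<sigma> y0" using bQ ij by (auto simp: rep.block_sym_def)
    also have "rep.coset_sum ?r ?\<sigma> 0 P (tscale ?\<sigma> y0) = tscale ?\<sigma> u"
      unfolding u_def using PQ by (intro rep.coset_sum_scale) auto
    finally show "pact ?r (transpose i j) u = tscale ?\<sigma> u" .
  qed
  have byQ: "rep.block_sym ?r ?\<sigma> (insert 1 Q) y"
    unfolding y_def using PQ uW commQ by (intro rep.block_sym_coset_sum) auto
  have byP: "rep.block_sym ?r ?\<sigma> (insert 0 P) y"
    unfolding rep.block_sym_def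
  proof (intro ballI impI)
    fix i j assume ij: "i \<in> insert 0 P" "j \<in> insert 0 P" "i \<noteq> j"
    have l: "i < ?r" "j < ?r" using ij PQ by auto
    have fx: "transpose i j k = k" if "k \<notin> insert 0 P" for k using ij that by (auto simp: transpose_def)
    have "k \<notin> insert 0 P" if "k \<in> Q" for k using that PQ(5,7) by auto
    then have "transpose i j ` Q = (\<lambda>k. k) ` Q" by (intro image_cong refl fx)
    then have "transpose i j ` Q = Q" by simp
    then have "pact ?r (transpose i j) y = rep.coset_sum ?r ?\<sigma> 1 Q (pact ?r (transpose i j) u)"
      unfolding y_def using l PQ uW fx[of 1] by (intro rep.act_coset_sum) auto
    also have "pact ?r (transpose i j) u = tscale ?\<sigma> u" using buP ij by (auto simp: rep.block_sym_def)
    also have "rep.coset_sum ?r ?\<sigma> 1 Q (tscale ?\<sigma> u) = tscale ?\<sigma> y"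
      unfolding y_def using PQ by (intro rep.coset_sum_scale) auto
    finally show "pact ?r (transpose i j) y = tscale ?\<sigma> y" .
  qed
  have tau_u: "tau u = tscale (of_nat N - of_nat p) z"
    unfolding u_def y0_def P_def using tau_coset_sum_Et[OF z(1), of p ?\<sigma> 0] pq by (simp add: e1)
  \<comment> \<open>The terms in which both legs are exchanged contract two factors of
    \<open>z\<close> and vanish; the term with a single exchange is \<open>z\<close>.\<close>
  have tau_Q: "tau (pact ?r (transpose 1 (Suc (Suc j))) u) = z" if j: "p \<le> j" "j < p + q" for j
  proof -
    have "tau (pact ?r (transpose 1 (Suc (Suc j))) u) = z - (\<Sum>i\<in>{0..<p}. tau (pact ?r (transpose 1 (Suc (Suc j))) (pact ?r (transpose 0 (Suc (Suc i))) (Et z))))"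
      unfolding u_def rep.coset_sum_def P_def sum_shift2 y0_def
      using tau_transpose_Et(2)[OF z(1), of j] j pq
      by (simp add: rep.lin_diff[OF lin_pact] rep.lin_sum[OF lin_pact] rep.lin_diff[OF lin_tau] rep.lin_sum[OF lin_tau])
    also have "\<dots> = z - (\<Sum>i\<in>{0..<p}. 0)"
      using j pq traceless by (intro arg_cong2[of _ _ _ _ "(-)"] sum.cong refl tau_transpose2_Et[OF z(1)]) auto
    finally show ?thesis by simp
  qed
  \<comment> \<open>The loop counts \<open>N\<close>, and every cell of either column is subtracted
    once.\<close>
  have "tau y = tscale (of_int (int N - int p - int q)) z"
  proof -
    have "tau (\<Sum>j\<in>Q. pact ?r (transpose 1 j) u) = (\<Sum>j\<in>{p..<p + q}. z)"
      unfolding Q_def sum_shift2 rep.lin_sum[OF lin_tau] using tau_Q by (intro sum.cong) auto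
    also have "\<dots> = tscale (of_nat q) z" by (simp only: rep.sum_constant_scale card_atLeastLessThan add_diff_cancel_left')
    finally show ?thesis
      unfolding y_def rep.coset_sum_def rep.lin_add[OF lin_tau] rep.lin_scale[OF lin_tau] tau_u
      by (simp add: rep.scale_left_diff_distrib)
  qed
  then have "ip ?r y0 y = of_int (int N - int p - int q) * ip n z z"
    using ip_Et[of n z y] by (simp add: y0_def e1 rep.ip_scale_right)
  moreover have "ip ?r y y = of_nat (Suc (card Q)) * (of_nat (Suc (card P)) * ip ?r y0 y)"
  proof -
    have "ip ?r y y = of_nat (Suc (card Q)) * ip ?r u y"
      using PQ uW yW byQ by (intro rep.ip_coset_sum[of ?\<sigma> 1 ?r Q u y, folded y_def]) auto
    moreover have "ip ?r u y = of_nat (Suc (card P)) * ip ?r y0 y"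
      using PQ y0W yW byP by (intro rep.ip_coset_sum[of ?\<sigma> 0 ?r P y0 y, folded u_def]) auto
    ultimately show ?thesis by simp
  qed
  ultimately have "ip ?r y y = of_real (real (Suc (card Q)) * real (Suc (card P)) * real_of_int (int N - int p - int q)) * ip n z z"
    by simp
  then have "Re (ip ?r y y) = real (Suc (card Q)) * real (Suc (card P)) * real_of_int (int N - int p - int q) * Re (ip n z z)"
    by (simp only: Re_complex_of_real Im_complex_of_real times_complex.sel mult_zero_left diff_zero)
  then have "0 \<le> real (Suc (card Q)) * real (Suc (card P)) * real_of_int (int N - int p - int q) * Re (ip n z z)"
    using ip_nonneg(1)[of ?r y] by simp
  moreover have "Re (ip n z z) > 0" by (rule ip_positive[OF z])
  ultimately have "0 \<le> real_of_int (int N - int p - int q)" by (rule nonneg_middle) simp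
  then have "0 \<le> int N - int p - int q" by (simp only: of_int_0_le_iff)
  then show ?thesis by simp
qed

text \<open>Both legs of \<open>E\<close> are symmetrised into the row; the squared norm is a positive multiple of \<open>N - 2 * p\<close>.\<close>

theorem traceless_row:
  assumes z: "z \<in> W n" "z \<noteq> 0" and traceless: "\<And>i j. i < j \<Longrightarrow> j < n \<Longrightarrow> D n i j z = 0" and e1: "eps = -1"
    and pn: "p \<le> n" and b: "rep.block_sym n 1 {0..<p} z"
  shows "2 * p \<le> N"
proof -
  let ?r = "Suc (Suc n)"
  let ?\<sigma> = "1 :: complex"
  define P where "P = {Suc (Suc 0)..<Suc (Suc p)}"
  define y0 where "y0 = Et z"
  define u where "u = rep.coset_sum ?r ?\<sigma> 0 P y0"
  \<comment> \<open>The second leg is symmetrised with the whole enlarged row, which includes the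
    first leg.\<close>
  define y where "y = rep.coset_sum ?r ?\<sigma> 1 (insert 0 P) u"
  have y0W: "y0 \<in> W ?r" using Et_W[OF z(1)] by (simp add: y0_def)
  have P: "P \<subseteq> {..<?r}" "0 \<notin> P" "1 \<notin> P" "finite P" "card P = p" using pn by (auto simp: P_def)
  have uW: "u \<in> W ?r" unfolding u_def using P y0W by (intro rep.coset_sum_W) auto
  have yW: "y \<in> W ?r" unfolding y_def using P uW by (intro rep.coset_sum_W) auto
  have bP: "rep.block_sym ?r ?\<sigma> P y0" unfolding y0_def P_def using b(1) pn by (intro block_sym_Et z) auto
  have buP: "rep.block_sym ?r ?\<sigma> (insert 0 P) u"
    unfolding u_def using P y0W bP by (intro rep.block_sym_coset_sum) auto
  have by1: "rep.block_sym ?r ?\<sigma> (insert 1 (insert 0 P)) y"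
    unfolding y_def using P uW buP by (intro rep.block_sym_coset_sum) auto
  then have byP: "rep.block_sym ?r ?\<sigma> (insert 0 P) y" by (auto simp: rep.block_sym_def)
  have tau_u: "tau u = tscale (of_nat p - of_nat N) z"
    unfolding u_def y0_def P_def using tau_coset_sum_Et[OF z(1), of p ?\<sigma> 0] pn by (simp add: e1)
  have tau_1: "tau (pact ?r (transpose 1 (Suc (Suc j))) u) = z + z" if j: "j < p" for j
  proof -
    have "tau (pact ?r (transpose 1 (Suc (Suc j))) u) = z + (\<Sum>i\<in>{0..<p}. tau (pact ?r (transpose 1 (Suc (Suc j))) (pact ?r (transpose 0 (Suc (Suc i))) (Et z))))"
      unfolding u_def rep.coset_sum_def P_def sum_shift2 y0_def
      using tau_transpose_Et(2)[OF z(1), of j] j pn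
      by (simp add: rep.lin_add[OF lin_pact] rep.lin_sum[OF lin_pact] rep.lin_add[OF lin_tau] rep.lin_sum[OF lin_tau])
    also have "(\<Sum>i\<in>{0..<p}. tau (pact ?r (transpose 1 (Suc (Suc j))) (pact ?r (transpose 0 (Suc (Suc i))) (Et z)))) =
      (\<Sum>i\<in>{0..<p}. if i = j then z else 0)"
    proof (intro sum.cong refl)
      fix i assume i: "i \<in> {0..<p}"
      show "tau (pact ?r (transpose 1 (Suc (Suc j))) (pact ?r (transpose 0 (Suc (Suc i))) (Et z))) = (if i = j then z else 0)"
      proof (cases "i = j")
        case True
        \<comment> \<open>Both legs meet the same factor here. As \<open>E\<close> is invariant
          under the transposition (0 1), the product reduces to a single exchange and yields a
          second copy of \<open>z\<close>.\<close>
        have "transpose 1 (Suc (Suc j)) \<circ> transpose 0 (Suc (Suc j)) = transpose 0 (Suc (Suc j)) \<circ> transpose 0 1"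
          by (auto simp: fun_eq_iff transpose_def)
        then have "pact ?r (transpose 1 (Suc (Suc j))) (pact ?r (transpose 0 (Suc (Suc j))) (Et z)) =
          pact ?r (transpose 0 (Suc (Suc j))) (pact ?r (transpose 0 1) (Et z))"
          using j pn Et_W[OF z(1)] rep.act_comp[OF rep.perm_transpose rep.perm_transpose] by simp
        then show ?thesis using True Et_swap01[OF z(1)] tau_transpose_Et(1)[OF z(1), of j] j pn by simp
      next
        case False
        have "D n i j z = 0"
          using traceless[of i j] traceless[of j i] D_sym[of i n j z] False i j pn by (cases "i < j") auto
        then show ?thesis using tau_transpose2_Et[OF z(1), of i j] False i j pn by simp
      qed
    qed
    also have "\<dots> = z" using j by simp
    finally show ?thesis .
  qed
  \<comment> \<open>\<open>tau u\<close> enters twice, the second time through the transposition of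
    the two legs, and every cell of the row contributes two copies of \<open>z\<close>:
    \<open>2 * (p - N) + 2 * p\<close>. The sign \<open>eps = -1\<close> in \<open>ip_Et\<close>
    then makes the pairing proportional to \<open>2 * N - 4 * p\<close>.\<close>
  have ty: "tau y = tscale (of_int (4 * int p - 2 * int N)) z"
  proof -
    have "(\<Sum>j\<in>insert 0 P. pact ?r (transpose 1 j) u) = pact ?r (transpose 0 1) u + (\<Sum>j\<in>P. pact ?r (transpose 1 j) u)"
      using P by (simp add: transpose_commute[of "Suc 0" 0])
    moreover have "tau (\<Sum>j\<in>P. pact ?r (transpose 1 j) u) = (\<Sum>j\<in>{0..<p}. z + z)"
      unfolding P_def sum_shift2 rep.lin_sum[OF lin_tau] using tau_1 by (intro sum.cong) auto
    moreover have "(\<Sum>j\<in>{0..<p}. z + z) = tscale (of_nat (2 * p)) z"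
      unfolding rep.sum_constant_scale by (simp add: tscale_def fun_eq_iff algebra_simps)
    moreover have "tau (pact ?r (transpose 0 1) u) = tau u" by (rule tau_swap01[OF uW])
    ultimately show ?thesis
      unfolding y_def rep.coset_sum_def rep.lin_add[OF lin_tau] rep.lin_scale[OF lin_tau] tau_u
      by (simp add: rep.lin_add[OF lin_tau] tau_u) (simp add: tscale_def fun_eq_iff algebra_simps)
  qed
  have "ip ?r y0 y = of_int (2 * int N - 4 * int p) * ip n z z"
    unfolding y0_def ip_Et ty rep.ip_scale_right by (simp add: e1 algebra_simps)
  moreover have "ip ?r y y = of_nat (Suc (Suc p)) * (of_nat (Suc p) * ip ?r y0 y)"
  proof -
    have "ip ?r y y = of_nat (Suc (card (insert 0 P))) * ip ?r u y"
      using P uW yW by1 by (intro rep.ip_coset_sum[of ?\<sigma> 1 ?r "insert 0 P" u y, folded y_def]) auto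
    moreover have "ip ?r u y = of_nat (Suc (card P)) * ip ?r y0 y"
      using P y0W yW byP by (intro rep.ip_coset_sum[of ?\<sigma> 0 ?r P y0 y, folded u_def]) auto
    ultimately show ?thesis using P by simp
  qed
  ultimately have "ip ?r y y = of_real (real (Suc (Suc p)) * real (Suc p) * real_of_int (2 * int N - 4 * int p)) * ip n z z"
    by simp
  then have "Re (ip ?r y y) = real (Suc (Suc p)) * real (Suc p) * real_of_int (2 * int N - 4 * int p) * Re (ip n z z)"
    by (simp only: Re_complex_of_real Im_complex_of_real times_complex.sel mult_zero_left diff_zero)
  then have "0 \<le> real (Suc (Suc p)) * real (Suc p) * real_of_int (2 * int N - 4 * int p) * Re (ip n z z)"
    using ip_nonneg(1)[of ?r y] by simp
  moreover have "Re (ip n z z) > 0" by (rule ip_positive[OF z])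
  ultimately have "0 \<le> real_of_int (2 * int N - 4 * int p)" by (rule nonneg_middle) simp
  then have "0 \<le> 2 * int N - 4 * int p" by (simp only: of_int_0_le_iff)
  then show ?thesis by simp
qed

end

section \<open>Eigenvalues of the sum of all contractions\<close>

lemma shape_shift: "shape (\<lambda>i. a (lo + i)) 0 k = shape a lo (lo + k)"
proof -
  have "content_count (\<lambda>i. a (lo + i)) 0 k c = content_count a lo (lo + k) c" for c
  proof -
    have "(+) lo ` {i \<in> {0..<k}. a (lo + i) = c} = {i \<in> {lo..<lo + k}. a i = c}"
    proof (intro equalityI subsetI)
      fix i assume "i \<in> {i \<in> {lo..<lo + k}. a i = c}"
      then show "i \<in> (+) lo ` {i \<in> {0..<k}. a (lo + i) = c}" by (intro image_eqI[of _ _ "i - lo"]) auto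
    qed auto
    moreover have "card ((+) lo ` {i \<in> {0..<k}. a (lo + i) = c}) = card {i \<in> {0..<k}. a (lo + i) = c}"
      by (rule card_image) simp
    ultimately show ?thesis unfolding content_count_def by simp
  qed
  then show ?thesis by (simp add: shape_def)
qed

text \<open>In a sorted sequence the row index increases weakly, so the cells of the first rows
  occupy an initial segment of the positions.\<close>

lemma card_cells_initial:
  assumes a: "tableau_seq a lo n" and sorted: "\<And>k. lo \<le> k \<Longrightarrow> Suc k < n \<Longrightarrow> a (Suc k) \<le> a k + 1" and lo: "lo \<le> n"
  shows "{k \<in> {lo..<n}. fst (cell a lo k) < i} = {lo..<lo + (\<Sum>i'<i. row_card (shape a lo n) i')}"
proof -
  let ?A = "{k \<in> {lo..<n}. fst (cell a lo k) < i}"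
  have "card ?A = (\<Sum>i'<i. row_card (shape a lo n) i')"
  proof (induction i)
    case (Suc i)
    have "{k \<in> {lo..<n}. fst (cell a lo k) < Suc i} =
      {k \<in> {lo..<n}. fst (cell a lo k) < i} \<union> {k \<in> {lo..<n}. fst (cell a lo k) = i}" by auto
    then have "card {k \<in> {lo..<n}. fst (cell a lo k) < Suc i} =
      card {k \<in> {lo..<n}. fst (cell a lo k) < i} + card {k \<in> {lo..<n}. fst (cell a lo k) = i}"
      by (simp add: card_Un_disjoint disjoint_iff)
    then show ?case using Suc card_row_cells[of lo lo n a i] lo by (simp add: row_card_def)
  qed simp
  moreover have "?A = {lo..<lo + card ?A}"
  proof (cases "?A = {}")
    case False
    define m where "m = Max ?A"
    have m: "m \<in> ?A" unfolding m_def using False by (intro Max_in) auto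
    have "?A = {lo..m}"
    proof (intro equalityI subsetI)
      fix k assume "k \<in> ?A"
      then show "k \<in> {lo..m}" by (auto simp: m_def)
    next
      fix k assume k: "k \<in> {lo..m}"
      then have "fst (cell a lo k) \<le> fst (cell a lo m)"
        using m by (intro row_cell_mono'[OF a order_refl sorted]) auto
      then show "k \<in> ?A" using k m by auto
    qed
    then have e: "?A = {lo..<Suc m}" by (simp add: atLeastLessThanSuc_atLeastAtMost)
    then have "card ?A = Suc m - lo" by simp
    moreover have "lo \<le> m" using m by simp
    ultimately have "lo + card ?A = Suc m" by simp
    then show ?thesis using e by (simp only:)
  next
    case True
    then have "card ?A = 0" by (simp only: card.empty)
    then show ?thesis using True by (simp only: add_0_right atLeastLessThan_empty order_refl)
  qed
  ultimately show ?thesis by simp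
qed

context symmetric_group_rep
begin

text \<open>For \<sigma> = -1 the rows of the shape of \<open>\<sigma> * b\<close> are the columns
  of the shape of \<open>b\<close>, and successive cells of a column are exchanged with the sign -1.
  One statement thus covers symmetric rows and antisymmetric columns.\<close>

lemma sorted_rows_block_sym:
  fixes \<sigma> :: int
  assumes v: "jm_content lo v b" and \<sigma>: "\<sigma> = 1 \<or> \<sigma> = -1" and lo: "lo \<le> n"
    and sorted: "\<And>k. lo \<le> k \<Longrightarrow> Suc k < n \<Longrightarrow> \<sigma> * b (Suc k) \<le> \<sigma> * b k + 1"
  defines "P \<equiv> row_card (shape (\<lambda>k. \<sigma> * b k) lo n)"
  shows "block_sym (of_int \<sigma>) {lo..<lo + P 0} v" "block_sym (of_int \<sigma>) {lo + P 0..<lo + P 0 + P 1} v"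
    "lo + P 0 + P 1 \<le> n"
proof -
  let ?c = "\<lambda>k. \<sigma> * b k"
  have tab: "tableau_seq ?c lo n"
    using \<sigma> jm_content_tableau[OF v] tableau_seq_uminus[OF jm_content_tableau[OF v]] by auto
  note init = card_cells_initial[OF tab sorted lo]
  have i1: "{k \<in> {lo..<n}. fst (cell ?c lo k) < 1} = {lo..<lo + P 0}"
    using init[of 1] by (simp add: P_def)
  have i2: "{k \<in> {lo..<n}. fst (cell ?c lo k) < 2} = {lo..<lo + P 0 + P 1}"
    using init[of 2] by (simp add: P_def numeral_2_eq_2 add.assoc)
  have row0: "fst (cell ?c lo k) = 0" if "lo \<le> k" "k < lo + P 0" for k
  proof -
    have "k \<in> {k \<in> {lo..<n}. fst (cell ?c lo k) < 1}" unfolding i1 using that by auto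
    then show ?thesis by simp
  qed
  have row1: "fst (cell ?c lo k) = 1" if "lo + P 0 \<le> k" "k < lo + P 0 + P 1" for k
  proof -
    have "k \<in> {k \<in> {lo..<n}. fst (cell ?c lo k) < 2}" unfolding i2 using that by auto
    moreover have "k \<notin> {k \<in> {lo..<n}. fst (cell ?c lo k) < 1}" unfolding i1 using that by auto
    ultimately show ?thesis by auto
  qed
  show le: "lo + P 0 + P 1 \<le> n"
  proof (rule ccontr)
    assume "\<not> ?thesis"
    then have "n \<in> {lo..<lo + P 0 + P 1}" using lo by auto
    then show False unfolding i2[symmetric] by simp
  qed
  have adj: "sw k v = of_int \<sigma> *s v" if k: "lo \<le> k" "Suc k < n" "fst (cell ?c lo k) = fst (cell ?c lo (Suc k))" for k
  proof -
    have "?c (Suc k) = ?c k + 1" using same_row_consecutive[OF tab k] .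
    then have "(\<sigma> = 1 \<and> b (Suc k) = b k + 1) \<or> (\<sigma> = -1 \<and> b (Suc k) = b k - 1)" using \<sigma> by auto
    then show ?thesis using jm_content_swap(2,3)[OF v k(1,2)] by auto
  qed
  have vW: "v \<in> W" using v by (simp add: jm_content_def)
  have ss: "of_int \<sigma> * of_int \<sigma> = (1 :: complex)" using \<sigma> by auto
  show "block_sym (of_int \<sigma>) {lo..<lo + P 0} v"
    using le row0 by (intro block_symI vW ss adj) auto
  show "block_sym (of_int \<sigma>) {lo + P 0..<lo + P 0 + P 1} v"
    using le row1 by (intro block_symI vW ss adj) auto
qed

end

section \<open>Eigenspaces and their contractions\<close>

context tensor_model
begin

lemma Phi_pact:
  assumes "p permutes {..<m}"
  obtains p' where "p' permutes {..<m + 2 * f}"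
    "\<And>T. T \<in> W (m + 2 * f) \<Longrightarrow> (tau ^^ f) (pact (m + 2 * f) p' T) = pact m p ((tau ^^ f) T)"
proof -
  have "\<exists>p'. p' permutes {..<m + 2 * f} \<and>
    (\<forall>T\<in>W (m + 2 * f). (tau ^^ f) (pact (m + 2 * f) p' T) = pact m p ((tau ^^ f) T))"
    using assms finite_lessThan
  proof (induction p rule: permutes_induct)
    case id
    show ?case
    proof (intro exI[of _ id] conjI ballI)
      fix T assume T: "T \<in> W (m + 2 * f)"
      then show "(tau ^^ f) (pact (m + 2 * f) id T) = pact m id ((tau ^^ f) T)"
        by (simp add: rep.act_id Phi_W)
    qed (rule permutes_id)
  next
    case (swap a b p)
    then obtain p' where p': "p' permutes {..<m + 2 * f}"
      "\<And>T. T \<in> W (m + 2 * f) \<Longrightarrow> (tau ^^ f) (pact (m + 2 * f) p' T) = pact m p ((tau ^^ f) T)" by blast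
    let ?t = "transpose (2 * f + a) (2 * f + b)"
    have t: "?t permutes {..<m + 2 * f}" using swap by (intro permutes_swap_id) auto
    have tab: "transpose a b permutes {..<m}" using swap by (intro permutes_swap_id) auto
    show ?case
    proof (intro exI[of _ "?t \<circ> p'"] conjI ballI)
      show "?t \<circ> p' permutes {..<m + 2 * f}" by (rule permutes_compose[OF p'(1) t])
      fix T assume T: "T \<in> W (m + 2 * f)"
      have "(tau ^^ f) (pact (m + 2 * f) (?t \<circ> p') T) = (tau ^^ f) (pact (m + 2 * f) ?t (pact (m + 2 * f) p' T))"
        by (simp add: rep.act_comp[OF t p'(1) T])
      also have "\<dots> = pact m (transpose a b) ((tau ^^ f) (pact (m + 2 * f) p' T))"
        using swap by (intro Phi_transpose pact_W) auto
      also have "\<dots> = pact m (transpose a b \<circ> p) ((tau ^^ f) T)"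
        using swap.hyps by (simp add: p'(2)[OF T] rep.act_comp[OF tab _ Phi_W[OF T]])
      finally show "(tau ^^ f) (pact (m + 2 * f) (?t \<circ> p') T) = pact m (transpose a b \<circ> p) ((tau ^^ f) T)" .
    qed
  qed
  then show ?thesis using that by blast
qed

definition eigenspace :: "nat \<Rightarrow> complex \<Rightarrow> ('v list \<Rightarrow> complex) set" where
  "eigenspace n \<alpha> = {T \<in> W n. Aop n T = tscale \<alpha> T}"

lemma eigenspace_pact: "T \<in> eigenspace n \<alpha> \<Longrightarrow> p permutes {..<n} \<Longrightarrow> pact n p T \<in> eigenspace n \<alpha>"
  unfolding eigenspace_def using pact_W by (auto simp: Aop_pact[symmetric] rep.lin_scale[OF lin_pact])

lemma subspace_eigenspace: "rep.subspace (eigenspace n \<alpha>)"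
  unfolding rep.subspace_def eigenspace_def
  by (auto simp: rep.W_closed rep.lin_add[OF lin_Aop] rep.lin_scale[OF lin_Aop] rep.lin_zero[OF lin_Aop]
      rep.scale_right_distrib mult.commute)

lemma eigenspace_jm:
  assumes T: "T \<in> eigenspace n \<alpha>" and k: "k < n"
  shows "rep.jm n lo k T \<in> eigenspace n \<alpha>"
  unfolding rep.jm_def using k by (intro rep.subspace_sum[OF subspace_eigenspace] eigenspace_pact[OF T]) auto

text \<open>Maximality yields tracelessness: a further contraction of a contracted eigentensor, at
  any two positions, is up to permutations an \<open>f + 1\<close>-fold contraction of another
  eigentensor. For \<open>f = 0\<close> the eigentensor itself would be traceless, and \<alpha>
  would be 0.\<close>

lemma exists_maximal_contraction:
  assumes T: "T \<in> eigenspace n \<alpha>" "T \<noteq> 0" and \<alpha>: "\<alpha> \<noteq> 0"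
  obtains m f x where "n = m + 2 * f" "1 \<le> f" "x \<in> eigenspace n \<alpha>" "(tau ^^ f) x \<noteq> 0"
    "\<And>y i j. y \<in> eigenspace n \<alpha> \<Longrightarrow> i < j \<Longrightarrow> j < m \<Longrightarrow> D m i j ((tau ^^ f) y) = 0"
proof -
  define Q where "Q = (\<lambda>f. 2 * f \<le> n \<and> (\<exists>x\<in>eigenspace n \<alpha>. (tau ^^ f) x \<noteq> 0))"
  define f where "f = (GREATEST f. Q f)"
  have Q0: "Q 0" using T by (auto simp: Q_def)
  have bound: "\<And>f. Q f \<Longrightarrow> f \<le> n" by (auto simp: Q_def)
  have Qf: "Q f" unfolding f_def by (rule GreatestI_nat[where P = Q and b = n and k = 0]) (use Q0 bound in auto)
  have max: "f' \<le> f" if "Q f'" for f' unfolding f_def by (rule Greatest_le_nat[where P = Q and b = n]) (use that bound in auto)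
  obtain x where x: "x \<in> eigenspace n \<alpha>" "(tau ^^ f) x \<noteq> 0" using Qf by (auto simp: Q_def)
  define m where "m = n - 2 * f"
  have nm: "n = m + 2 * f" using Qf by (simp add: m_def Q_def)
  have D0: "D m i j ((tau ^^ f) y) = 0" if y: "y \<in> eigenspace n \<alpha>" and ij: "i < j" "j < m" for y i j
  proof -
    obtain m' where m': "m = Suc (Suc m')" using ij by (metis Suc_diff_Suc less_imp_Suc_add less_Suc_eq_0_disj not_less0)
    have yW: "y \<in> W (m + 2 * f)" using y nm by (simp add: eigenspace_def)
    have zW: "(tau ^^ f) y \<in> W m" by (rule Phi_W[OF yW])
    obtain p where p: "p permutes {..<m}"
      "\<And>T. T \<in> W m \<Longrightarrow> D m i j T = pact m p (Et (tau (pact m (inv p) T)))"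
      using D_factor[of i m' j] ij unfolding m'[symmetric] by (metis less_trans less_irrefl)
    obtain p' where p': "p' permutes {..<m + 2 * f}"
      "(tau ^^ f) (pact (m + 2 * f) p' y) = pact m (inv p) ((tau ^^ f) y)"
      using Phi_pact[OF permutes_inv[OF p(1)], of f] yW by metis
    have "pact n p' y \<in> eigenspace n \<alpha>" using eigenspace_pact[OF y] p'(1) nm by simp
    moreover have "\<not> Q (Suc f)" using max[of "Suc f"] by auto
    moreover have "2 * Suc f \<le> n" using nm m' by simp
    ultimately have "(tau ^^ Suc f) (pact n p' y) = 0" unfolding Q_def by blast
    then have "tau (pact m (inv p) ((tau ^^ f) y)) = 0" using p'(2) nm by simp
    then show ?thesis
      using p(2)[OF zW] by (simp add: rep.lin_zero[OF lin_Et] rep.lin_zero[OF lin_pact])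
  qed
  have "f \<noteq> 0"
  proof
    assume "f = 0"
    then have "D n i j x = 0" if "i < j" "j < n" for i j using D0[OF x(1) that(1)] that nm by simp
    then have "Aop n x = 0" unfolding Aop_def by (intro sum.neutral) (auto simp: pairs_def)
    then have "tscale \<alpha> x = 0" using x by (simp add: eigenspace_def)
    then have "x = 0" using \<alpha> by simp
    then show False using x(2) \<open>f = 0\<close> by simp
  qed
  then show ?thesis using that[OF nm _ x D0] by simp
qed

lemma Phi_jm:
  assumes T: "T \<in> W (m + 2 * f)" and i: "i < m"
  shows "(tau ^^ f) (rep.jm (m + 2 * f) (2 * f) (2 * f + i) T) = rep.jm m 0 i ((tau ^^ f) T)"
proof -
  have "rep.jm (m + 2 * f) (2 * f) (2 * f + i) T =
    (\<Sum>j\<in>{0..<i}. pact (m + 2 * f) (transpose (2 * f + j) (2 * f + i)) T)"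
    unfolding rep.jm_def using sum.shift_bounds_nat_ivl[of "\<lambda>j. pact (m + 2 * f) (transpose j (2 * f + i)) T" 0 "2 * f" i]
    by (simp add: add.commute)
  then have "(tau ^^ f) (rep.jm (m + 2 * f) (2 * f) (2 * f + i) T) =
    (\<Sum>j\<in>{0..<i}. (tau ^^ f) (pact (m + 2 * f) (transpose (2 * f + j) (2 * f + i)) T))"
    by (simp only: rep.lin_sum[OF Phi_lin])
  also have "\<dots> = (\<Sum>j\<in>{0..<i}. pact m (transpose j i) ((tau ^^ f) T))"
    using i by (intro sum.cong refl Phi_transpose[OF T]) auto
  finally show ?thesis by (simp only: rep.jm_def)
qed

end

context symmetric_group_rep
begin

lemma jm_commute_window:
  assumes "j < lo" "lo \<le> l" "l < n" "v \<in> W"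
  shows "jm 0 j (jm lo l v) = jm lo l (jm 0 j v)"
proof -
  have "act (transpose i j) (jm lo l v) = jm lo l (act (transpose i j) v)" if "i \<in> {0..<j}" for i
  proof (rule act_jm_commute)
    have "transpose i j ` {lo..<l} = (\<lambda>x. x) ` {lo..<l}"
      using that assms by (intro image_cong) (auto simp: transpose_def)
    then show "transpose i j ` {lo..<l} = {lo..<l}" by simp
  qed (use that assms in \<open>auto simp: transpose_def\<close>)
  then show ?thesis
    using assms(3) by (simp add: jm_def[of 0 j] lin_sum[OF jm_lin])
qed

end

context tensor_model
begin

lemma Zop_jm_commute:
  assumes "k < n" "T \<in> W n"
  shows "Zop n (rep.jm n lo k T) = rep.jm n lo k (Zop n T)"
  unfolding rep.jm_def rep.lin_sum[OF lin_Zop] using assms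
  by (intro sum.cong refl Zop_pact[symmetric]) auto

lemma Zop_selfadjoint: "rep.selfadjoint n (Zop n)"
  unfolding rep.selfadjoint_def
proof (intro conjI ballI lin_Zop Zop_W)
  fix x y assume "x \<in> W n" "y \<in> W n"
  then show "ip n (Zop n x) y = ip n x (Zop n y)"
    unfolding Zop_jm rep.ip_sum_left rep.ip_sum_right
    using rep.jm_selfadjoint[of _ n 0] by (intro sum.cong refl) (auto simp: rep.selfadjoint_def)
qed

text \<open>The Jucys--Murphy elements of the last \<open>m\<close> positions, taken relative to
  \<open>2 * f\<close>, are kept apart: their eigenvalues are permuted by the sorting, while
  everything recorded here survives it.\<close>

definition lifted :: "nat \<Rightarrow> nat \<Rightarrow> complex \<Rightarrow> (nat \<Rightarrow> complex) \<Rightarrow> complex \<Rightarrow> ('v list \<Rightarrow> complex) \<Rightarrow> bool" where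
  "lifted m f \<alpha> c \<zeta> w \<longleftrightarrow> w \<in> eigenspace (m + 2 * f) \<alpha> \<and> (tau ^^ f) w \<noteq> 0 \<and>
     (\<forall>k<2 * f. rep.jm (m + 2 * f) 0 k w = tscale (c k) w) \<and> Zop (m + 2 * f) w = tscale \<zeta> w"

lemma exists_lifted:
  assumes x: "x \<in> eigenspace (m + 2 * f) \<alpha>" "(tau ^^ f) x \<noteq> 0"
  obtains w c \<zeta> a where "lifted m f \<alpha> c \<zeta> w" "rep.jm_content (m + 2 * f) (2 * f) w a"
proof -
  let ?r = "m + 2 * f"
  \<comment> \<open>The Jucys--Murphy elements of both blocks and the central sum commute pairwise
    and preserve the eigenspace.\<close>
  define Xs where "Xs = map (rep.jm ?r 0) [0..<2 * f] @ map (rep.jm ?r (2 * f)) [2 * f..<?r] @ [Zop ?r]"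
  have Xs: "X \<in> set Xs \<longleftrightarrow> (\<exists>k<2 * f. X = rep.jm ?r 0 k) \<or> (\<exists>k. 2 * f \<le> k \<and> k < ?r \<and> X = rep.jm ?r (2 * f) k) \<or> X = Zop ?r" for X
    unfolding Xs_def by auto
  obtain u where u: "((tau ^^ f) x) u \<noteq> 0" using x(2) by (auto simp: fun_eq_iff)
  \<comment> \<open>A component of the contraction that is nonzero at \<open>x\<close>; choosing the
    eigenvector by it keeps the contraction from vanishing.\<close>
  define \<Psi> where "\<Psi> = (\<lambda>x. ((tau ^^ f) x) u)"
  have EW: "eigenspace ?r \<alpha> \<subseteq> W ?r" by (auto simp: eigenspace_def)
  have comm: "Y (X z) = X (Y z)"
    if "(\<exists>k<2 * f. X = rep.jm ?r 0 k) \<or> (\<exists>k. 2 * f \<le> k \<and> k < ?r \<and> X = rep.jm ?r (2 * f) k) \<or> X = Zop ?r"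
      "(\<exists>k<2 * f. Y = rep.jm ?r 0 k) \<or> (\<exists>k. 2 * f \<le> k \<and> k < ?r \<and> Y = rep.jm ?r (2 * f) k) \<or> Y = Zop ?r" "z \<in> W ?r" for X Y z
    using that
  proof (elim disjE exE conjE)
    fix k j assume "k < 2 * f" "X = rep.jm ?r 0 k" "j < 2 * f" "Y = rep.jm ?r 0 j" "z \<in> W ?r"
    then show ?thesis by (simp add: rep.jm_commute)
  next
    fix k j assume "k < 2 * f" "X = rep.jm ?r 0 k" "2 * f \<le> j" "j < ?r" "Y = rep.jm ?r (2 * f) j" "z \<in> W ?r"
    then show ?thesis by (simp add: rep.jm_commute_window)
  next
    fix k j assume "2 * f \<le> k" "k < ?r" "X = rep.jm ?r (2 * f) k" "j < 2 * f" "Y = rep.jm ?r 0 j" "z \<in> W ?r"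
    then show ?thesis by (simp add: rep.jm_commute_window)
  next
    fix k j assume "2 * f \<le> k" "k < ?r" "X = rep.jm ?r (2 * f) k" "2 * f \<le> j" "j < ?r" "Y = rep.jm ?r (2 * f) j" "z \<in> W ?r"
    then show ?thesis by (simp add: rep.jm_commute)
  qed (auto simp: Zop_jm_commute)
  have "\<exists>v\<in>eigenspace ?r \<alpha>. \<Psi> v \<noteq> 0 \<and> (\<forall>X\<in>set Xs. \<exists>c. X v = tscale c v)"
  proof (rule rep.exists_joint_eigenvector[where n = ?r and w = x])
    show "rep.selfadjoint ?r X" if "X \<in> set Xs" for X
      using that unfolding Xs by (auto intro: rep.jm_selfadjoint Zop_selfadjoint)
    show "X z \<in> eigenspace ?r \<alpha>" if X: "X \<in> set Xs" and z: "z \<in> eigenspace ?r \<alpha>" for X z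
    proof -
      have "Zop ?r z \<in> eigenspace ?r \<alpha>"
        unfolding Zop_jm using z by (intro rep.subspace_sum[OF subspace_eigenspace] eigenspace_jm) auto
      then show ?thesis using X z unfolding Xs by (auto intro: eigenspace_jm)
    qed
    show "X (Y z) = Y (X z)" if "X \<in> set Xs" "Y \<in> set Xs" "z \<in> eigenspace ?r \<alpha>" for X Y z
      using comm[of Y X z] that EW unfolding Xs by blast
    show "\<Psi> (y + z) = \<Psi> y + \<Psi> z" for y z by (simp add: \<Psi>_def rep.lin_add[OF Phi_lin])
    show "\<Psi> (tscale c y) = c * \<Psi> y" for c y by (simp add: \<Psi>_def rep.lin_scale[OF Phi_lin]) (simp add: tscale_def)
    show "\<Psi> x \<noteq> 0" using u by (simp add: \<Psi>_def)
  qed (use x EW subspace_eigenspace in auto)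
  then obtain w where w: "w \<in> eigenspace ?r \<alpha>" "\<Psi> w \<noteq> 0" "\<And>X. X \<in> set Xs \<Longrightarrow> \<exists>c. X w = tscale c w" by blast
  have nz: "(tau ^^ f) w \<noteq> 0" using w(2) by (auto simp: \<Psi>_def)
  then have "w \<noteq> 0" using rep.lin_zero[OF Phi_lin] by auto
  moreover have "\<exists>c. rep.jm ?r (2 * f) k w = tscale c w" if "2 * f \<le> k" "k < ?r" for k
    using that by (intro w(3)) (auto simp: Xs)
  ultimately obtain a where a: "rep.jm_content ?r (2 * f) w a"
    using rep.exists_jm_content[of w ?r "2 * f"] w(1) EW by blast
  have "\<exists>c. rep.jm ?r 0 k w = tscale c w" if "k < 2 * f" for k
    using that by (intro w(3)) (auto simp: Xs)
  then obtain c where c: "\<And>k. k < 2 * f \<Longrightarrow> rep.jm ?r 0 k w = tscale (c k) w" by metis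
  obtain \<zeta> where "Zop ?r w = tscale \<zeta> w" using w(3)[of "Zop ?r"] by (auto simp: Xs)
  then show ?thesis using that[OF _ a, of c \<zeta>] w(1) nz c by (auto simp: lifted_def)
qed

text \<open>The recorded operators commute with the exchange. If the new vector had contraction 0,
  so would its image under the transposition, and \<open>u\<close> is a combination of these
  two.\<close>

lemma lifted_swap:
  assumes u: "lifted m f \<alpha> c \<zeta> u" "rep.jm_content (m + 2 * f) (2 * f) u b" and k: "2 * f \<le> k" "Suc k < m + 2 * f"
    and far: "b (Suc k) \<noteq> b k + 1" "b (Suc k) \<noteq> b k - 1"
  shows "lifted m f \<alpha> c \<zeta> (rep.swap_vec (m + 2 * f) k b u)"
proof -
  let ?r = "m + 2 * f"
  let ?y = "rep.swap_vec ?r k b u"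
  define d :: complex where "d = 1 / of_int (b (Suc k) - b k)"
  have y: "?y = pact ?r (transpose k (Suc k)) u - tscale d u" by (simp only: rep.swap_vec_def d_def)
  have t: "transpose k (Suc k) permutes {..<?r}" using k by (intro permutes_swap_id) auto
  have uE: "u \<in> eigenspace ?r \<alpha>" and uW: "u \<in> W ?r" using u by (auto simp: lifted_def eigenspace_def)
  have yE: "?y \<in> eigenspace ?r \<alpha>"
    unfolding y using eigenspace_pact[OF uE t] uE by (intro rep.subspace_diff rep.subspace_scale subspace_eigenspace) auto
  have yW: "?y \<in> W ?r" using yE by (simp add: eigenspace_def)
  have "rep.jm ?r 0 j ?y = tscale (c j) ?y" if j: "j < 2 * f" for j
  proof -
    have e: "rep.jm ?r 0 j u = tscale (c j) u" using u(1) j by (simp add: lifted_def)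
    have l: "rep.lin (rep.jm ?r 0 j)" using j by (intro rep.jm_lin) auto
    have "rep.jm ?r 0 j (pact ?r (transpose k (Suc k)) u) = pact ?r (transpose k (Suc k)) (rep.jm ?r 0 j u)"
      using j k uW by (intro rep.sw_jm_commute[symmetric]) auto
    then show ?thesis
      unfolding y rep.lin_diff[OF l] rep.lin_scale[OF l] e
      by (simp only: rep.lin_scale[OF lin_pact] rep.scale_right_diff_distrib rep.scale_scale mult.commute)
  qed
  moreover have "Zop ?r ?y = tscale \<zeta> ?y"
  proof -
    have e: "Zop ?r u = tscale \<zeta> u" using u(1) by (simp add: lifted_def)
    show ?thesis
      unfolding y rep.lin_diff[OF lin_Zop] rep.lin_scale[OF lin_Zop] e Zop_pact[OF t uW, symmetric]
      by (simp only: rep.lin_scale[OF lin_pact] rep.scale_right_diff_distrib rep.scale_scale mult.commute)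
  qed
  moreover have "(tau ^^ f) ?y \<noteq> 0"
  proof
    assume z: "(tau ^^ f) ?y = 0"
    obtain a a' where "u = tscale a (pact ?r (transpose k (Suc k)) ?y) + tscale a' ?y"
      using rep.jm_content_swap(5)[OF u(2) k far] by blast
    then have "(tau ^^ f) u = tscale a ((tau ^^ f) (pact ?r (transpose k (Suc k)) ?y)) + tscale a' ((tau ^^ f) ?y)"
      by (metis rep.lin_add[OF Phi_lin] rep.lin_scale[OF Phi_lin])
    also have "(tau ^^ f) (pact ?r (transpose k (Suc k)) ?y) = pact m (transpose (k - 2 * f) (Suc (k - 2 * f))) ((tau ^^ f) ?y)"
      using Phi_transpose[OF yW, of "k - 2 * f" "Suc (k - 2 * f)"] k by simp
    also have "\<dots> = 0" by (simp only: z rep.lin_zero[OF lin_pact])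
    finally have "(tau ^^ f) u = 0" by (simp only: z rep.scale_zero_right add_0_right)
    then show False using u(1) by (simp add: lifted_def)
  qed
  ultimately show ?thesis using yE unfolding lifted_def by blast
qed

lemma lifted_sorting:
  fixes \<sigma> :: int
  assumes w: "lifted m f \<alpha> c \<zeta> w" "rep.jm_content (m + 2 * f) (2 * f) w a" and \<sigma>: "\<sigma> = 1 \<or> \<sigma> = -1"
  obtains \<pi> u where "\<pi> permutes {2 * f..<m + 2 * f}" "lifted m f \<alpha> c \<zeta> u" "rep.jm_content (m + 2 * f) (2 * f) u (a \<circ> \<pi>)"
    "\<And>k. 2 * f \<le> k \<Longrightarrow> Suc k < m + 2 * f \<Longrightarrow> \<sigma> * (a \<circ> \<pi>) (Suc k) \<le> \<sigma> * (a \<circ> \<pi>) k + 1"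
proof (rule rep.jm_sorting[where P = "\<lambda>u b. lifted m f \<alpha> c \<zeta> u", OF w(2,1) order_refl order_refl \<sigma>])
  fix u b k assume "rep.jm_content (m + 2 * f) (2 * f) u b" "lifted m f \<alpha> c \<zeta> u" "2 * f \<le> k" "Suc k < m + 2 * f"
    "\<sigma> * b k + 2 \<le> \<sigma> * b (Suc k)"
  then show "lifted m f \<alpha> c \<zeta> (rep.swap_vec (m + 2 * f) k b u)"
    using \<sigma> by (intro lifted_swap) auto
qed (rule that)

lemma jm_content_Phi:
  assumes w: "lifted m f \<alpha> c \<zeta> w" "rep.jm_content (m + 2 * f) (2 * f) w a"
  shows "rep.jm_content m 0 ((tau ^^ f) w) (\<lambda>i. a (2 * f + i))"
proof -
  have wW: "w \<in> W (m + 2 * f)" using w by (auto simp: lifted_def eigenspace_def)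
  have "rep.jm m 0 i ((tau ^^ f) w) = tscale (of_int (a (2 * f + i))) ((tau ^^ f) w)" if i: "i < m" for i
  proof -
    have "rep.jm (m + 2 * f) (2 * f) (2 * f + i) w = tscale (of_int (a (2 * f + i))) w"
      using w(2) i by (auto simp: rep.jm_content_def)
    then show ?thesis
      unfolding Phi_jm[OF wW i, symmetric] by (simp only: rep.lin_scale[OF Phi_lin])
  qed
  then show ?thesis using w Phi_W[OF wW] by (auto simp: rep.jm_content_def lifted_def)
qed

text \<open>The joint eigenvectors of all Jucys--Murphy elements span the common eigenspace
  \<open>Z\<close> of \<open>w\<close>, so one of them is not orthogonal to \<open>w\<close>. It
  shares the contents of the first \<open>2 * f\<close> positions with \<open>w\<close>, and its
  contents add up to the eigenvalue \<zeta> of the central sum. Sorting its later contents may make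
  it orthogonal to \<open>w\<close> itself, but not to all permutations of \<open>w\<close> in these
  positions.\<close>

lemma exists_paired_content:
  assumes w: "lifted m f \<alpha> c \<zeta> w"
  obtains \<xi> b q where "rep.jm_content (m + 2 * f) 0 \<xi> b"
    "\<And>k. 2 * f \<le> k \<Longrightarrow> Suc k < m + 2 * f \<Longrightarrow> b (Suc k) \<le> b k + 1"
    "q permutes {2 * f..<m + 2 * f}" "ip (m + 2 * f) \<xi> (pact (m + 2 * f) q w) \<noteq> 0"
    "\<And>k. k < 2 * f \<Longrightarrow> c k = of_int (b k)" "\<zeta> = of_int (\<Sum>k<m + 2 * f. b k)"
proof -
  define r where "r = m + 2 * f"
  define Z where "Z = {x \<in> W r. (\<forall>k<2 * f. rep.jm r 0 k x = tscale (c k) x) \<and> Zop r x = tscale \<zeta> x}"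
  have fr: "2 * f \<le> r" by (simp add: r_def)
  have wW: "w \<in> W r" and w0: "w \<noteq> 0" and wZ: "w \<in> Z"
    using w rep.lin_zero[OF Phi_lin] by (auto simp: lifted_def eigenspace_def r_def Z_def)
  have subZ: "rep.subspace Z"
    unfolding rep.subspace_def Z_def using fr
    by (auto simp: rep.W_closed rep.lin_add[OF rep.jm_lin] rep.lin_scale[OF rep.jm_lin] rep.lin_zero[OF rep.jm_lin]
        rep.lin_add[OF lin_Zop] rep.lin_scale[OF lin_Zop] rep.lin_zero[OF lin_Zop] rep.scale_right_distrib mult.commute)
  have "\<exists>v\<in>Z. ip r w v \<noteq> 0 \<and> (\<forall>X\<in>set (map (rep.jm r 0) [0..<r]). \<exists>c. X v = tscale c v)"
  proof (rule rep.exists_joint_eigenvector[where n = r and w = w])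
    show "X z \<in> Z" if X: "X \<in> set (map (rep.jm r 0) [0..<r])" and z: "z \<in> Z" for X z
    proof -
      obtain j where j: "j < r" "X = rep.jm r 0 j" using X by auto
      have zW: "z \<in> W r" using z by (simp add: Z_def)
      have "rep.jm r 0 k (rep.jm r 0 j z) = tscale (c k) (rep.jm r 0 j z)" if "k < 2 * f" for k
      proof -
        have "rep.jm r 0 k (rep.jm r 0 j z) = rep.jm r 0 j (rep.jm r 0 k z)"
          using rep.jm_commute[OF _ j(1) zW] that fr by simp
        also have "rep.jm r 0 k z = tscale (c k) z" using z that by (simp add: Z_def)
        finally show ?thesis by (simp only: rep.lin_scale[OF rep.jm_lin[OF j(1)]])
      qed
      moreover have "Zop r (rep.jm r 0 j z) = tscale \<zeta> (rep.jm r 0 j z)"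
      proof -
        have "Zop r z = tscale \<zeta> z" using z by (simp add: Z_def)
        then show ?thesis by (simp only: Zop_jm_commute[OF j(1) zW] rep.lin_scale[OF rep.jm_lin[OF j(1)]])
      qed
      ultimately show ?thesis using rep.jm_W[OF j(1) zW] by (simp add: Z_def j)
    qed
    show "X (Y z) = Y (X z)" if "X \<in> set (map (rep.jm r 0) [0..<r])" "Y \<in> set (map (rep.jm r 0) [0..<r])" "z \<in> Z" for X Y z
      using that by (auto simp: Z_def intro: rep.jm_commute)
    show "ip r w w \<noteq> 0" using ip_definite[OF wW] w0 by blast
  qed (use subZ wZ in \<open>auto simp: Z_def rep.ip_add_right rep.ip_scale_right intro: rep.jm_selfadjoint\<close>)
  then obtain v where v: "v \<in> Z" "ip r w v \<noteq> 0" "\<And>k. k < r \<Longrightarrow> \<exists>c. rep.jm r 0 k v = tscale c v" by auto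
  have v0: "v \<noteq> 0" using v(2) by auto
  obtain b0 where b0: "rep.jm_content r 0 v b0"
    using rep.exists_jm_content[of v r 0] v v0 by (auto simp: Z_def)
  define P where "P = (\<lambda>u b :: nat \<Rightarrow> int. u \<in> Z \<and> (\<exists>q. q permutes {2 * f..<r} \<and> ip r (pact r q w) u \<noteq> 0))"
  have P0: "P v b0"
    unfolding P_def using v rep.act_id[OF wW] by (intro conjI exI[of _ id] permutes_id) auto
  obtain \<pi> \<xi> where \<xi>: "rep.jm_content r 0 \<xi> (b0 \<circ> \<pi>)" "P \<xi> (b0 \<circ> \<pi>)"
    and sorted: "\<And>k. 2 * f \<le> k \<Longrightarrow> Suc k < r \<Longrightarrow> 1 * (b0 \<circ> \<pi>) (Suc k) \<le> 1 * (b0 \<circ> \<pi>) k + 1"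
  proof (rule rep.jm_sorting[where P = P and n = r and lo' = "2 * f" and hi = r and \<sigma> = 1, OF b0 P0])
    fix u b k assume u: "rep.jm_content r 0 u b" "P u b" and k: "2 * f \<le> k" "Suc k < r" and far: "1 * b k + 2 \<le> 1 * b (Suc k)"
    let ?y = "rep.swap_vec r k b u"
    define d :: complex where "d = 1 / of_int (b (Suc k) - b k)"
    have y: "?y = pact r (transpose k (Suc k)) u - tscale d u" by (simp only: rep.swap_vec_def d_def)
    have t: "transpose k (Suc k) permutes {..<r}" "transpose k (Suc k) permutes {2 * f..<r}"
      using k by (auto intro!: permutes_swap_id)
    have uZ: "u \<in> Z" and uW: "u \<in> W r" using u by (auto simp: P_def Z_def)
    have "pact r (transpose k (Suc k)) u \<in> Z"
    proof -
      have "rep.jm r 0 j (pact r (transpose k (Suc k)) u) = tscale (c j) (pact r (transpose k (Suc k)) u)" if j: "j < 2 * f" for j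
      proof -
        have e: "rep.jm r 0 j u = tscale (c j) u" using uZ j by (simp add: Z_def)
        have "rep.jm r 0 j (pact r (transpose k (Suc k)) u) = pact r (transpose k (Suc k)) (rep.jm r 0 j u)"
          using j k uW fr by (intro rep.sw_jm_commute[symmetric]) auto
        then show ?thesis by (simp only: e rep.lin_scale[OF lin_pact])
      qed
      moreover have "Zop r (pact r (transpose k (Suc k)) u) = tscale \<zeta> (pact r (transpose k (Suc k)) u)"
      proof -
        have "Zop r u = tscale \<zeta> u" using uZ by (simp add: Z_def)
        then show ?thesis by (simp only: Zop_pact[OF t(1) uW, symmetric] rep.lin_scale[OF lin_pact])
      qed
      ultimately show ?thesis using pact_W by (simp add: Z_def)
    qed
    then have yZ: "?y \<in> Z" unfolding y using uZ subZ by (intro rep.subspace_diff rep.subspace_scale)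
    then have yW: "?y \<in> W r" by (simp add: Z_def)
    obtain q where q: "q permutes {2 * f..<r}" "ip r (pact r q w) u \<noteq> 0" using u by (auto simp: P_def)
    have qr: "q permutes {..<r}" using q(1) by (rule permutes_subset) auto
    obtain a a' where u_eq: "u = tscale a (pact r (transpose k (Suc k)) ?y) + tscale a' ?y"
      using rep.jm_content_swap(5)[OF u(1) _ k(2)] far by fastforce
    have "ip r (pact r q w) u = a * ip r (pact r q w) (pact r (transpose k (Suc k)) ?y) + a' * ip r (pact r q w) ?y"
      by (subst u_eq) (simp only: rep.ip_add_right rep.ip_scale_right)
    also have "ip r (pact r q w) (pact r (transpose k (Suc k)) ?y) = ip r (pact r (transpose k (Suc k)) (pact r q w)) ?y"
      using k yW by (intro rep.act_transpose_selfadjoint[symmetric] pact_W) auto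
    also have "pact r (transpose k (Suc k)) (pact r q w) = pact r (transpose k (Suc k) \<circ> q) w"
      by (rule rep.act_comp[OF t(1) qr wW])
    finally have "ip r (pact r (transpose k (Suc k) \<circ> q) w) ?y \<noteq> 0 \<or> ip r (pact r q w) ?y \<noteq> 0"
      using q(2) by auto
    then show "P ?y (b \<circ> transpose k (Suc k))"
      unfolding P_def using yZ q(1) permutes_compose[OF q(1) t(2)] by blast
  qed (use fr in auto)
  define b where "b = b0 \<circ> \<pi>"
  have \<xi>Z: "\<xi> \<in> Z" and \<xi>W: "\<xi> \<in> W r" and \<xi>0: "\<xi> \<noteq> 0" and jm\<xi>: "\<And>k. k < r \<Longrightarrow> rep.jm r 0 k \<xi> = tscale (of_int (b k)) \<xi>"
    using \<xi> by (auto simp: P_def rep.jm_content_def b_def)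
  obtain q where q: "q permutes {2 * f..<r}" "ip r (pact r q w) \<xi> \<noteq> 0" using \<xi> by (auto simp: P_def)
  have ck: "c k = of_int (b k)" if "k < 2 * f" for k
  proof -
    have "tscale (c k) \<xi> = tscale (of_int (b k)) \<xi>" using \<xi>Z jm\<xi>[of k] that fr by (simp add: Z_def)
    then show ?thesis using \<xi>0 by (simp only: rep.scale_cancel_right) simp
  qed
  have "tscale \<zeta> \<xi> = tscale (of_int (\<Sum>k<r. b k)) \<xi>"
  proof -
    have "Zop r \<xi> = (\<Sum>k<r. tscale (of_int (b k)) \<xi>)" unfolding Zop_jm by (intro sum.cong refl jm\<xi>) auto
    also have "\<dots> = tscale (of_int (\<Sum>k<r. b k)) \<xi>" by (simp only: rep.scale_sum_left of_int_sum)
    finally have "Zop r \<xi> = tscale (of_int (\<Sum>k<r. b k)) \<xi>" .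
    moreover have "Zop r \<xi> = tscale \<zeta> \<xi>" using \<xi>Z by (simp only: Z_def mem_Collect_eq)
    ultimately show ?thesis by (simp only:)
  qed
  then have z: "\<zeta> = of_int (\<Sum>k<r. b k)" using \<xi>0 by (simp only: rep.scale_cancel_right) simp
  have "ip r \<xi> (pact r q w) \<noteq> 0"
    using q(2) rep.ip_commute[of r \<xi> "pact r q w"] by auto
  moreover have "b (Suc k) \<le> b k + 1" if "2 * f \<le> k" "Suc k < r" for k
    using sorted[OF that] by (simp add: b_def)
  ultimately show ?thesis
    using that[of \<xi> b q] \<xi>(1) q(1) ck z unfolding r_def b_def[symmetric] by blast
qed

text \<open>Sorting for the sign \<open>- eps\<close> turns the first row of the shape of
  \<open>- eps * b\<close> into a block on which transpositions act by \<open>- eps\<close>. It is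
  the first column of the shape of \<open>b\<close> if \<open>eps = 1\<close>, and its first row if
  \<open>eps = -1\<close>.\<close>

lemma first_row_bound:
  assumes v: "rep.jm_content n 0 v b"
  shows "row_card (shape (\<lambda>k. - eps * b k) 0 n) 0 \<le> N"
proof -
  have \<sigma>: "- eps = 1 \<or> - eps = -1" using eps by auto
  obtain \<pi> u where u: "\<pi> permutes {0..<n}" "rep.jm_content n 0 u (b \<circ> \<pi>)"
    "\<And>k. 0 \<le> k \<Longrightarrow> Suc k < n \<Longrightarrow> - eps * (b \<circ> \<pi>) (Suc k) \<le> - eps * (b \<circ> \<pi>) k + 1"
    by (rule rep.jm_sorting[where P = "\<lambda>_ _. True" and \<sigma> = "- eps", OF v TrueI order_refl order_refl \<sigma>]) auto
  note rows = rep.sorted_rows_block_sym[OF u(2) \<sigma> _ u(3)]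
  have "(\<lambda>k. - eps * (b \<circ> \<pi>) k) = (\<lambda>k. - eps * b k) \<circ> \<pi>" by auto
  then have "shape (\<lambda>k. - eps * (b \<circ> \<pi>) k) 0 n = shape (\<lambda>k. - eps * b k) 0 n"
    using shape_permute[OF u(1), of 0] by simp
  then have "rep.block_sym n (- of_int eps) {..<row_card (shape (\<lambda>k. - eps * b k) 0 n) 0} u"
    "row_card (shape (\<lambda>k. - eps * b k) 0 n) 0 \<le> n"
    using rows(1,3) by (simp_all add: lessThan_atLeast0)
  then show ?thesis using u(2) by (intro block_sym_bound) (auto simp: rep.jm_content_def)
qed

lemma row_card_uminus: "row_card (shape (\<lambda>k. - a k) lo n) j = card {i. (i, j) \<in> shape a lo n}"
  by (simp add: row_card_def shape_uminus)

text \<open>Sorting does not change the shape, so the vector may be sorted for \<open>- eps\<close>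
  here, while it is sorted by rows for the Littlewood--Richardson coefficient. Its contraction is a
  traceless tensor with the same contents, to which the norm estimates apply.\<close>

lemma contraction_shape_bound:
  assumes w: "lifted m f \<alpha> c \<zeta> w" "rep.jm_content (m + 2 * f) (2 * f) w a"
    and traceless: "\<And>y i j. y \<in> eigenspace (m + 2 * f) \<alpha> \<Longrightarrow> i < j \<Longrightarrow> j < m \<Longrightarrow> D m i j ((tau ^^ f) y) = 0"
  shows "if eps = 1 then row_card (shape (\<lambda>k. - a k) (2 * f) (m + 2 * f)) 0 + row_card (shape (\<lambda>k. - a k) (2 * f) (m + 2 * f)) 1 \<le> N
    else 2 * row_card (shape a (2 * f) (m + 2 * f)) 0 \<le> N"
proof -
  let ?r = "m + 2 * f"
  have \<sigma>: "- eps = 1 \<or> - eps = -1" using eps by auto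
  obtain \<pi> u where \<pi>: "\<pi> permutes {2 * f..<?r}" and u: "lifted m f \<alpha> c \<zeta> u" "rep.jm_content ?r (2 * f) u (a \<circ> \<pi>)"
    and sorted: "\<And>k. 2 * f \<le> k \<Longrightarrow> Suc k < ?r \<Longrightarrow> - eps * (a \<circ> \<pi>) (Suc k) \<le> - eps * (a \<circ> \<pi>) k + 1"
    by (rule lifted_sorting[OF w \<sigma>]) (rule that)
  have z: "rep.jm_content m 0 ((tau ^^ f) u) (\<lambda>i. (a \<circ> \<pi>) (2 * f + i))" by (rule jm_content_Phi[OF u])
  have "- eps * (a \<circ> \<pi>) (2 * f + Suc k) \<le> - eps * (a \<circ> \<pi>) (2 * f + k) + 1" if "0 \<le> k" "Suc k < m" for k
    using sorted[of "2 * f + k"] that by simp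
  note rows = rep.sorted_rows_block_sym[OF z \<sigma> _ this]
  have "shape (\<lambda>i. - eps * (a \<circ> \<pi>) (2 * f + i)) 0 m = shape ((\<lambda>k. - eps * a k) \<circ> \<pi>) (2 * f) (2 * f + m)"
    using shape_shift[of "(\<lambda>k. - eps * a k) \<circ> \<pi>" "2 * f" m] by simp
  also have "\<dots> = shape (\<lambda>k. - eps * a k) (2 * f) ?r"
    using shape_permute[OF \<pi>, of "2 * f"] by (simp add: add.commute)
  finally have sh: "shape (\<lambda>i. - eps * (a \<circ> \<pi>) (2 * f + i)) 0 m = shape (\<lambda>k. - eps * a k) (2 * f) ?r" .
  have t: "D m i j ((tau ^^ f) u) = 0" if "i < j" "j < m" for i j
    using u(1) that by (intro traceless) (auto simp: lifted_def)
  have zz: "(tau ^^ f) u \<in> W m" "(tau ^^ f) u \<noteq> 0" using z by (auto simp: rep.jm_content_def)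
  show ?thesis
  proof (cases "eps = 1")
    case True
    define p where "p = row_card (shape (\<lambda>k. - a k) (2 * f) ?r) 0"
    define q where "q = row_card (shape (\<lambda>k. - a k) (2 * f) ?r) 1"
    have "rep.block_sym m (-1) {0..<p} ((tau ^^ f) u)" "rep.block_sym m (-1) {p..<p + q} ((tau ^^ f) u)" "p + q \<le> m"
      using rows sh True by (simp_all add: p_def q_def)
    then have "p + q \<le> N" using t True by (intro traceless_two_columns[OF zz]) auto
    then show ?thesis using True by (simp add: p_def q_def)
  next
    case False
    then have e: "eps = -1" using eps by auto
    define p where "p = row_card (shape a (2 * f) ?r) 0"
    have "rep.block_sym m 1 {0..<p} ((tau ^^ f) u)" "p \<le> m"
      using rows(1,3) sh e by (simp_all add: p_def)
    then have "2 * p \<le> N" using t e by (intro traceless_row[OF zz]) auto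
    then show ?thesis using e by (simp add: p_def)
  qed
qed

end

section \<open>The eigenvalues lie in the given set\<close>

lemma partition_of_content:
  assumes "tableau_seq a lo n" "lo \<le> k" "k \<le> n"
  obtains l where "l \<in> partitions (k - lo)" "young l = shape a lo k" "l = map (row_card (shape a lo k)) [0..<length l]"
  using partition_of_downset[OF downset_shape[OF assms] finite_shape[OF assms(2)]] card_shape[OF assms(2)] by metis

lemma content_of_shape: "young l = shape a lo k \<Longrightarrow> lo \<le> k \<Longrightarrow> Defs.content l = (\<Sum>i\<in>{lo..<k}. a i)"
  by (simp add: Defs.content_def sum_content_shape)

context tensor_model
begin

text \<open>The Casimir element acts on \<open>w\<close> by \<zeta> - \<alpha>. On the contraction
  of \<open>w\<close> the operator \<open>Aop\<close> vanishes and the central sum is the sum of the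
  contents of the last \<open>m\<close> positions; \<open>Phi_Casimir\<close> compares the
  two.\<close>

lemma eigenvalue_formula:
  assumes w: "lifted m f \<alpha> c \<zeta> w" "rep.jm_content (m + 2 * f) (2 * f) w a"
    and traceless: "\<And>y i j. y \<in> eigenspace (m + 2 * f) \<alpha> \<Longrightarrow> i < j \<Longrightarrow> j < m \<Longrightarrow> D m i j ((tau ^^ f) y) = 0"
    and \<zeta>: "\<zeta> = of_int z"
  shows "\<alpha> = of_int ((eps * int N - 1) * int f + (z - (\<Sum>k\<in>{2 * f..<m + 2 * f}. a k)))"
proof -
  let ?r = "m + 2 * f"
  let ?x = "(tau ^^ f) w"
  let ?s = "\<Sum>k\<in>{2 * f..<m + 2 * f}. a k"
  have wE: "w \<in> eigenspace ?r \<alpha>" and wW: "w \<in> W ?r" and x0: "?x \<noteq> 0"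
    and Aw: "Aop ?r w = tscale \<alpha> w" and Zw: "Zop ?r w = tscale \<zeta> w"
    using w by (auto simp: lifted_def eigenspace_def)
  have "Aop m ?x = 0"
    unfolding Aop_def using traceless[OF wE] by (intro sum.neutral) (auto simp: pairs_def)
  moreover have "Zop m ?x = tscale (of_int ?s) ?x"
  proof -
    have "Zop m ?x = (\<Sum>i<m. tscale (of_int (a (2 * f + i))) ?x)"
      unfolding Zop_jm using jm_content_Phi[OF w] by (intro sum.cong refl) (auto simp: rep.jm_content_def)
    also have "\<dots> = tscale (of_int (\<Sum>i<m. a (2 * f + i))) ?x" by (simp only: rep.scale_sum_left of_int_sum)
    also have "(\<Sum>i<m. a (2 * f + i)) = ?s"
      using sum.shift_bounds_nat_ivl[of a 0 "2 * f" m] by (simp add: lessThan_atLeast0 add.commute)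
    finally show ?thesis .
  qed
  ultimately have "(tau ^^ f) (tscale \<zeta> w - tscale \<alpha> w) =
      tscale (of_int ?s) ?x - 0 - tscale (of_int (int f * (eps * int N - 1))) ?x"
    using Phi_Casimir[OF wW] by (simp only: Aw Zw)
  then have "tscale (\<zeta> - \<alpha>) ?x = tscale (of_int ?s - of_int (int f * (eps * int N - 1))) ?x"
    by (simp only: rep.scale_left_diff_distrib rep.lin_diff[OF Phi_lin] rep.lin_scale[OF Phi_lin] diff_zero)
  then have "\<zeta> - \<alpha> = of_int ?s - of_int (int f * (eps * int N - 1))"
    using x0 by (simp only: rep.scale_cancel_right) simp
  then have "\<alpha> = \<zeta> - (of_int ?s - of_int (int f * (eps * int N - 1)))" by (simp add: algebra_simps)
  then show ?thesis by (simp add: \<zeta> algebra_simps)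
qed

theorem eigenvalue_in_spec:
  assumes T: "T \<in> W n" "T \<noteq> 0" and e: "Aop n T = tscale \<alpha> T" and \<alpha>: "\<alpha> \<noteq> 0"
  obtains k where "k \<in> spec_times eps n N" "\<alpha> = of_int k"
proof -
  have "T \<in> eigenspace n \<alpha>" using T e by (simp add: eigenspace_def)
  from exists_maximal_contraction[OF this T(2) \<alpha>]
  obtain m f x where n: "n = m + 2 * f" and f: "1 \<le> f" and x: "x \<in> eigenspace (m + 2 * f) \<alpha>" "(tau ^^ f) x \<noteq> 0"
    and traceless: "\<And>y i j. y \<in> eigenspace (m + 2 * f) \<alpha> \<Longrightarrow> i < j \<Longrightarrow> j < m \<Longrightarrow> D m i j ((tau ^^ f) y) = 0"
    by metis
  obtain w0 c \<zeta> a0 where w0: "lifted m f \<alpha> c \<zeta> w0" "rep.jm_content (m + 2 * f) (2 * f) w0 a0"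
    by (rule exists_lifted[OF x])
  obtain \<pi> w where w: "lifted m f \<alpha> c \<zeta> w" "rep.jm_content (m + 2 * f) (2 * f) w (a0 \<circ> \<pi>)"
    and asort: "\<And>k. 2 * f \<le> k \<Longrightarrow> Suc k < m + 2 * f \<Longrightarrow> 1 * (a0 \<circ> \<pi>) (Suc k) \<le> 1 * (a0 \<circ> \<pi>) k + 1"
    by (rule lifted_sorting[OF w0, of 1]) (auto intro: that)
  define a where "a = a0 \<circ> \<pi>"
  note w = w[folded a_def] and asort = asort[folded a_def, simplified]
  obtain \<xi> b q where \<xi>: "rep.jm_content (m + 2 * f) 0 \<xi> b"
    and bsort: "\<And>k. 2 * f \<le> k \<Longrightarrow> Suc k < m + 2 * f \<Longrightarrow> b (Suc k) \<le> b k + 1"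
    and q: "q permutes {2 * f..<m + 2 * f}" "ip (m + 2 * f) \<xi> (pact (m + 2 * f) q w) \<noteq> 0"
    and cb: "\<And>k. k < 2 * f \<Longrightarrow> c k = of_int (b k)" and \<zeta>: "\<zeta> = of_int (\<Sum>k<m + 2 * f. b k)"
    by (rule exists_paired_content[OF w(1)]) (rule that)
  have tabb: "tableau_seq b 0 (m + 2 * f)" by (rule rep.jm_content_tableau[OF \<xi>])
  have taba: "tableau_seq a (2 * f) (m + 2 * f)" by (rule rep.jm_content_tableau[OF w(2)])
  obtain mu where mu: "mu \<in> partitions (m + 2 * f - 0)" "young mu = shape b 0 (m + 2 * f)"
    by (rule partition_of_content[OF tabb, of "m + 2 * f"]) auto
  obtain nu where nu: "nu \<in> partitions (2 * f - 0)" "young nu = shape b 0 (2 * f)"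
    "nu = map (row_card (shape b 0 (2 * f))) [0..<length nu]"
    by (rule partition_of_content[OF tabb, of "2 * f"]) auto
  obtain lam where lam: "lam \<in> partitions (m + 2 * f - 2 * f)" "young lam = shape a (2 * f) (m + 2 * f)"
    by (rule partition_of_content[OF taba, of "m + 2 * f"]) auto
  \<comment> \<open>\<open>domino_contents\<close> speaks of \<open>w\<close>, whose contraction is
    nonzero, and not of \<xi>; but on the first \<open>2 * f\<close> positions both have the same
    contents.\<close>
  have dom: "b (2 * k + 1) = b (2 * k) + 1" if k: "k < f" for k
  proof -
    have "complex_of_int (b (Suc (2 * k))) = of_int (b (2 * k)) + 1"
      using w(1) k cb[of "2 * k"] cb[of "Suc (2 * k)"]
      by (intro domino_contents[where f = f and n = m and w = w and k = k]) (auto simp: lifted_def eigenspace_def)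
    then have "complex_of_int (b (Suc (2 * k))) = of_int (b (2 * k) + 1)" by simp
    then show ?thesis by (simp only: of_int_eq_iff Suc_eq_plus1)
  qed
  have "even (row_card (shape b 0 (2 * f)) i)" for i using dom by (intro even_rows[OF tabb]) auto
  then have even: "even_partition nu" unfolding even_partition_def by (subst nu(3)) auto
  have lr: "lr_coeff mu nu lam \<noteq> 0" "young lam \<subseteq> young mu"
    using rep.lr_coeff_nonzero[OF \<xi> bsort w(2) asort _ q mu(2) nu(2) lam(2)] by auto
  have \<alpha>_eq: "\<alpha> = of_int ((eps * int N - 1) * int f + (Defs.content mu - Defs.content lam))"
    using eigenvalue_formula[OF w traceless \<zeta>] content_of_shape[OF mu(2)] content_of_shape[OF lam(2)]
    by (simp add: lessThan_atLeast0)
  define k where "k = (eps * int N - 1) * int f + (Defs.content mu - Defs.content lam)"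
  have mu_bound: "if eps = 1 then col_len mu 0 \<le> N else row_len mu 0 \<le> N"
  proof (cases "eps = 1")
    case True
    then show ?thesis using first_row_bound[OF \<xi>] by (simp add: col_len_def mu(2) row_card_uminus)
  next
    case False
    then have "eps = -1" using eps by auto
    then show ?thesis using first_row_bound[OF \<xi>, unfolded row_card_def] by (simp add: row_len_def mu(2))
  qed
  have lam_bound: "if eps = 1 then col_len lam 0 + col_len lam 1 \<le> N else 2 * row_len lam 0 \<le> N"
    using contraction_shape_bound[OF w traceless]
    by (auto simp: col_len_def row_len_def lam(2) row_card_uminus split: if_splits) (simp add: row_card_def)
  have "lam \<in> Lambda_set eps (n - 2 * f) N" using lam(1) lam_bound n by (simp add: Lambda_set_def)
  moreover have "mu \<in> cl_set eps n N f lam"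
    using mu(1) nu(1) lr even mu_bound n by (auto simp: cl_set_def Sigma_set_def)
  moreover have "f \<le> n div 2" using n by simp
  ultimately have "\<exists>f lam mu. k = (eps * int N - 1) * int f + (Defs.content mu - Defs.content lam) \<and>
      1 \<le> f \<and> f \<le> n div 2 \<and> lam \<in> Lambda_set eps (n - 2 * f) N \<and> mu \<in> cl_set eps n N f lam"
    using f k_def by blast
  moreover have "\<exists>l\<ge>1. k = eps * int l"
  proof -
    have "Aop n T = tscale (of_int k) T" using e \<alpha>_eq by (simp add: k_def)
    then have "0 \<le> eps * k" by (rule Aop_eigenvalue_nonneg[OF T])
    moreover have "k \<noteq> 0" using \<alpha> \<alpha>_eq[folded k_def] by (simp only: of_int_eq_0_iff) simp
    ultimately have "0 < eps * k" using eps by auto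
    then show ?thesis using eps by (intro exI[of _ "nat (eps * k)"]) auto
  qed
  ultimately have "k \<in> spec_times eps n N" unfolding spec_times_def by blast
  then show ?thesis using that[of k] \<alpha>_eq by (simp add: k_def)
qed

section \<open>The spectral product\<close>

definition spectral_factor :: "nat \<Rightarrow> int \<Rightarrow> ('v list \<Rightarrow> complex) \<Rightarrow> 'v list \<Rightarrow> complex" where
  "spectral_factor n k T = T - tscale (1 / of_int k) (Aop n T)"

lemma spectral_factor_foldr_eigenvector:
  assumes "Aop n T = tscale \<alpha> T"
  shows "foldr (spectral_factor n) ks T = tscale (\<Prod>k\<leftarrow>ks. 1 - \<alpha> / of_int k) T"
proof (induction ks)
  case (Cons k ks)
  have "Aop n (tscale d T) = tscale (d * \<alpha>) T" for d by (simp add: rep.lin_scale[OF lin_Aop] assms)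
  then have "spectral_factor n k (tscale d T) = tscale (d - 1 / of_int k * (d * \<alpha>)) T" for d
    unfolding spectral_factor_def by (simp only: rep.scale_left_diff_distrib rep.scale_scale)
  moreover have "d - 1 / of_int k * (d * \<alpha>) = (1 - \<alpha> / of_int k) * d" for d by (simp add: algebra_simps)
  ultimately show ?case unfolding foldr.simps o_apply Cons by (simp only: list.map prod_list.Cons)
qed simp

lemma spectral_factor_lin: "rep.lin (foldr (spectral_factor n) ks)"
proof (induction ks)
  case (Cons k ks)
  then show ?case
    unfolding rep.lin_def foldr.simps o_apply spectral_factor_def
    by (simp add: rep.lin_add[OF lin_Aop] rep.lin_scale[OF lin_Aop] rep.scale_right_distrib rep.scale_right_diff_distrib mult.commute)
qed (simp add: rep.lin_def)

lemma spectral_factor_W: "T \<in> W n \<Longrightarrow> foldr (spectral_factor n) ks T \<in> W n"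
  by (induction ks) (auto simp: spectral_factor_def intro!: rep.W_closed Aop_W)

text \<open>It suffices to look at eigenvectors, which span. Either the eigenvalue is 0, or it
  occurs among the \<open>k\<close> and its own factor vanishes.\<close>

theorem Aop_spectral_product:
  assumes T: "T \<in> W n" and ks: "set ks = spec_times eps n N"
  shows "Aop n (foldr (spectral_factor n) ks T) = 0"
proof -
  let ?E = "{z \<in> W n. \<exists>c. Aop n z = tscale c z}"
  let ?F = "foldr (spectral_factor n) ks"
  have "?E \<subseteq> {z. Aop n (?F z) = 0}"
  proof
    fix z assume "z \<in> ?E"
    then obtain c where z: "z \<in> W n" and c: "Aop n z = tscale c z" by blast
    have "c * (\<Prod>k\<leftarrow>ks. 1 - c / of_int k) = 0 \<or> z = 0"
    proof (rule ccontr)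
      assume *: "\<not> ?thesis"
      then obtain k where k: "k \<in> spec_times eps n N" "c = of_int k"
        using eigenvalue_in_spec[OF z _ c] by auto
      then have "k \<noteq> 0" using * by auto
      then have "0 \<in> set (map (\<lambda>k. 1 - c / of_int k) ks)" using k ks by (auto intro!: image_eqI[of _ _ k])
      then show False using * by (simp add: prod_list_zero_iff)
    qed
    moreover have "Aop n (?F z) = tscale (c * (\<Prod>k\<leftarrow>ks. 1 - c / of_int k)) z"
      unfolding spectral_factor_foldr_eigenvector[OF c] rep.lin_scale[OF lin_Aop] c by (simp add: mult.commute)
    ultimately show "z \<in> {z. Aop n (?F z) = 0}" by auto
  qed
  moreover have "rep.subspace {z. Aop n (?F z) = 0}"
    by (auto simp: rep.subspace_def rep.lin_add[OF spectral_factor_lin] rep.lin_scale[OF spectral_factor_lin]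
        rep.lin_zero[OF spectral_factor_lin] rep.lin_add[OF lin_Aop] rep.lin_scale[OF lin_Aop] rep.lin_zero[OF lin_Aop])
  ultimately have "rep.span ?E \<subseteq> {z. Aop n (?F z) = 0}" by (rule rep.span_minimal)
  moreover have "T \<in> rep.span ?E"
    by (rule rep.eigen_span[OF Aop_selfadjoint rep.subspace_W order_refl _ T]) (rule Aop_W)
  ultimately show ?thesis by blast
qed

end

section \<open>Canonical bases\<close>

locale bilinear_space = finite_dimensional_vector_space scale Basis
  for scale :: "complex \<Rightarrow> 'v::ab_group_add \<Rightarrow> 'v" and Basis +
  fixes form :: "'v \<Rightarrow> 'v \<Rightarrow> complex" and eps :: int
  assumes eps: "eps = 1 \<or> eps = -1" and nondegenerate: "nondegenerate_form scale eps form"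
begin

lemma form_add_right: "form x (y + z) = form x y + form x z"
  and form_scale_right: "form x (scale c y) = c * form x y"
  and form_add_left: "form (y + z) x = form y x + form z x"
  and form_scale_left: "form (scale c y) x = c * form y x"
  using nondegenerate unfolding nondegenerate_form_def Vector_Spaces.linear_iff by blast+

lemma form_commute: "form y x = of_int eps * form x y"
  using nondegenerate unfolding nondegenerate_form_def by blast

lemma form_definite: "(\<And>y. form x y = 0) \<Longrightarrow> x = 0"
  using nondegenerate unfolding nondegenerate_form_def by blast

lemma form_zero [simp]: "form 0 x = 0" "form x 0 = 0"
  using form_scale_left[of 0 0 x] form_scale_right[of x 0 0] by simp_all

lemma form_sum_right: "form x (\<Sum>i\<in>A. f i) = (\<Sum>i\<in>A. form x (f i))"
  by (induction A rule: infinite_finite_induct) (auto simp: form_add_right)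

lemma form_sum_left: "form (\<Sum>i\<in>A. f i) x = (\<Sum>i\<in>A. form (f i) x)"
  by (induction A rule: infinite_finite_induct) (auto simp: form_add_left)

lemma form_diff_left: "form (y - z) x = form y x - form z x"
  using form_add_left[of "y - z" z x] by simp

lemma eps_mult [simp]: "of_int eps * (of_int eps * z) = (z :: complex)"
  using eps by auto

text \<open>A condition that orthonormal bases and symplectic pairs satisfy alike: the Gram matrix
  is real with square \<open>eps\<close>, so its inverse is \<open>eps\<close> times itself.\<close>

definition canonical :: "'v set \<Rightarrow> bool" where
  "canonical S \<longleftrightarrow> finite S \<and> (\<forall>x\<in>S. \<forall>y\<in>S. cnj (form x y) = form x y \<and>
     (\<Sum>z\<in>S. form x z * form z y) = (if x = y then of_int eps else 0))"

lemma canonical_independent: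
  assumes "canonical S"
  shows "independent S"
proof (rule independent_if_scalars_zero)
  show fin: "finite S" using assms by (simp add: canonical_def)
  fix c x assume s: "(\<Sum>x\<in>S. scale (c x) x) = 0" and x: "x \<in> S"
  have "0 = (\<Sum>z\<in>S. form (\<Sum>y\<in>S. scale (c y) y) z * form z x)" by (simp add: s)
  also have "\<dots> = (\<Sum>z\<in>S. \<Sum>y\<in>S. c y * (form y z * form z x))"
    by (simp add: form_sum_left form_scale_left sum_distrib_right mult.assoc)
  also have "\<dots> = (\<Sum>y\<in>S. c y * (\<Sum>z\<in>S. form y z * form z x))"
    by (subst sum.swap) (simp add: sum_distrib_left)
  also have "\<dots> = (\<Sum>y\<in>S. if y = x then c y * of_int eps else 0)"
    using assms x by (intro sum.cong refl) (auto simp: canonical_def)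
  also have "\<dots> = c x * of_int eps" using fin x by simp
  finally show "c x = 0" using eps by auto
qed

lemma canonical_insert:
  assumes S: "canonical S" and X: "canonical X" and orth: "\<And>x y. x \<in> S \<Longrightarrow> y \<in> X \<Longrightarrow> form y x = 0" and disj: "S \<inter> X = {}"
  shows "canonical (S \<union> X)"
proof -
  have orth': "form x y = 0" if "x \<in> S" "y \<in> X" for x y
    using orth[OF that] form_commute[of x y] by simp
  have fin: "finite S" "finite X" using S X by (auto simp: canonical_def)
  have split: "(\<Sum>z\<in>S \<union> X. form x z * form z y) = (\<Sum>z\<in>S. form x z * form z y) + (\<Sum>z\<in>X. form x z * form z y)" for x y
    using fin disj by (intro sum.union_disjoint)
  have z: "(\<Sum>z\<in>S. form x z * form z y) = 0" if "x \<in> X \<or> y \<in> X" for x y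
    using that orth orth' by (intro sum.neutral) auto
  have z': "(\<Sum>z\<in>X. form x z * form z y) = 0" if "x \<in> S \<or> y \<in> S" for x y
    using that orth orth' by (intro sum.neutral) auto
  show ?thesis
    unfolding canonical_def
  proof (intro conjI ballI)
    fix x y assume xy: "x \<in> S \<union> X" "y \<in> S \<union> X"
    show "cnj (form x y) = form x y" using xy S X orth orth' by (auto simp: canonical_def)
    consider "x \<in> S" "y \<in> S" | "x \<in> X" "y \<in> X" | "x \<in> S" "y \<in> X" | "x \<in> X" "y \<in> S" using xy by auto
    then show "(\<Sum>z\<in>S \<union> X. form x z * form z y) = (if x = y then of_int eps else 0)"
    proof cases
      case 1 then show ?thesis using S by (simp add: split z' canonical_def)
    next
      case 2 then show ?thesis using X by (simp add: split z canonical_def)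
    next
      case 3 then show ?thesis using disj by (auto simp: split z z')
    next
      case 4 then show ?thesis using disj by (auto simp: split z z')
    qed
  qed (use fin in simp)
qed

lemma orthogonal_projection:
  assumes S: "canonical S"
  obtains v' where "v - v' \<in> span S" "\<And>z. z \<in> S \<Longrightarrow> form v' z = 0"
proof
  \<comment> \<open>The coefficients use \<open>eps\<close> times the Gram matrix of
    \<open>S\<close> as its inverse.\<close>
  define p where "p = (\<Sum>x\<in>S. \<Sum>y\<in>S. scale (of_int eps * form v x * form x y) y)"
  show "v - (v - p) \<in> span S"
    unfolding p_def by (simp add: span_sum span_scale span_base)
  fix z assume z: "z \<in> S"
  have "form p z = (\<Sum>x\<in>S. of_int eps * form v x * (\<Sum>y\<in>S. form x y * form y z))"
    unfolding p_def by (simp add: form_sum_left form_scale_left sum_distrib_left mult.assoc)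
  also have "\<dots> = (\<Sum>x\<in>S. if x = z then form v x else 0)"
    using S z by (intro sum.cong refl) (auto simp: canonical_def mult_ac)
  also have "\<dots> = form v z" using z S by (simp add: canonical_def)
  finally show "form (v - p) z = 0" by (simp add: form_diff_left)
qed

text \<open>For \<open>eps = 1\<close> polarisation yields a vector with
  \<open>form u u \<noteq> 0\<close>, normalised by a complex square root. For
  \<open>eps = -1\<close> every vector is isotropic, and \<open>v\<close> with a rescaled
  \<open>w\<close> is a symplectic pair.\<close>

lemma exists_canonical_pair:
  assumes vw: "form v w \<noteq> 0" and U: "subspace U" "v \<in> U" "w \<in> U"
  obtains X where "canonical X" "X \<subseteq> U" "X \<noteq> {}"
proof (cases "eps = 1")
  case True
  have "\<exists>u\<in>U. form u u \<noteq> 0"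
  proof (rule ccontr)
    assume no: "\<not> ?thesis"
    have "form (v + w) (v + w) = form v v + form w w + 2 * form v w"
      using form_commute[of w v] True by (simp add: form_add_left form_add_right)
    then show False using no vw U subspace_add[OF U] by auto
  qed
  then obtain u where u: "u \<in> U" "form u u \<noteq> 0" by blast
  define x where "x = scale (1 / csqrt (form u u)) u"
  have "form x x = form u u / (csqrt (form u u))\<^sup>2"
    by (simp add: x_def form_scale_left form_scale_right power2_eq_square)
  then have "form x x = 1" using u by simp
  then have "canonical {x}" unfolding canonical_def using True by simp
  then show ?thesis using that[of "{x}"] U u by (auto simp: x_def subspace_scale)
next
  case False
  then have e: "eps = -1" using eps by auto
  define w' where "w' = scale (1 / form v w) w"
  have self: "form x x = 0" for x using form_commute[of x x] e by simp
  have f: "form v w' = 1" "form w' v = -1"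
    using vw form_commute[of w' v] e by (simp_all add: w'_def form_scale_right)
  have "v \<noteq> w'" using f self by auto
  then have "canonical {v, w'}" unfolding canonical_def using f self e by auto
  then show ?thesis using that[of "{v, w'}"] U by (auto simp: w'_def subspace_scale)
qed

text \<open>A canonical set of maximal size spans. Otherwise a vector outside its span and a partner
  of it, both projected to the orthogonal complement, would allow the set to be enlarged.\<close>

lemma exists_canonical_basis:
  obtains S where "canonical S" "independent S" "span S = UNIV"
proof -
  have bound: "card S \<le> card Basis" if "canonical S" for S
    using independent_span_bound[OF finite_Basis canonical_independent[OF that]] by (simp add: span_Basis)
  have "canonical {}" by (simp add: canonical_def)
  then obtain S where S: "canonical S" and max: "\<And>S'. canonical S' \<Longrightarrow> card S' \<le> card S"
  proof -
    have "\<exists>S. canonical S \<and> (\<forall>S'. canonical S' \<longrightarrow> card S' \<le> card S)"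
      by (rule ex_has_greatest_nat[where k = "{}" and b = "Suc (card Basis)"]) (use bound \<open>canonical {}\<close> in \<open>auto simp: le_SucI less_Suc_eq_le\<close>)
    then show ?thesis using that by blast
  qed
  have "span S = UNIV"
  proof (rule ccontr)
    assume "span S \<noteq> UNIV"
    then obtain v where v: "v \<notin> span S" by auto
    obtain v' where v': "v - v' \<in> span S" "\<And>z. z \<in> S \<Longrightarrow> form v' z = 0" by (rule orthogonal_projection[OF S, of v]) (rule that)
    have "v' \<noteq> 0" using v v' by auto
    then obtain w where w: "form v' w \<noteq> 0" using form_definite by blast
    obtain w' where w': "w - w' \<in> span S" "\<And>z. z \<in> S \<Longrightarrow> form w' z = 0" by (rule orthogonal_projection[OF S, of w]) (rule that)
    have "form v' x = 0" if "x \<in> span S" for x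
      using that
    proof (induction rule: span_induct_alt)
      case (step c x y)
      then show ?case by (simp add: form_add_right form_scale_right v'(2))
    qed simp
    \<comment> \<open>\<open>v'\<close> is already orthogonal to the span of \<open>S\<close>, so
      projecting its partner does not change their product.\<close>
    then have "form v' (w - w') = 0" using w' by blast
    then have "form v' w' = form v' w" using form_add_right[of v' "w - w'" w'] by simp
    then have nz: "form v' w' \<noteq> 0" using w by simp
    define U where "U = {u. \<forall>z\<in>S. form u z = 0}"
    have U: "subspace U" "v' \<in> U" "w' \<in> U"
      using v' w' by (auto simp: U_def subspace_def form_add_left form_scale_left)
    obtain X where X: "canonical X" "X \<subseteq> U" "X \<noteq> {}" by (rule exists_canonical_pair[OF nz U])
    have "S \<inter> X = {}"
    proof (rule ccontr)
      assume "S \<inter> X \<noteq> {}"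
      then obtain x where x: "x \<in> S" "x \<in> X" by auto
      then have "form x z = 0" if "z \<in> S" for z using X that by (auto simp: U_def)
      then have "(\<Sum>z\<in>S. form x z * form z x) = 0" by (intro sum.neutral) auto
      then show False using S x eps by (auto simp: canonical_def)
    qed
    moreover from this have "canonical (S \<union> X)" using S X by (intro canonical_insert) (auto simp: U_def)
    moreover have "finite S" "finite X" using S X by (auto simp: canonical_def)
    ultimately have "card (S \<union> X) = card S + card X" "card X > 0" "canonical (S \<union> X)"
      using X(3) by (auto simp: card_Un_disjoint card_gt_0_iff)
    then show False using max[of "S \<union> X"] by simp
  qed
  then show ?thesis using that S canonical_independent by blast
qed

text \<open>\<open>C\<close> gives coordinates in the canonical basis and \<open>K\<close>
  coordinates in \<open>Basis\<close>. The matrix \<open>gi\<close> transports the inverse Gram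
  matrix from the canonical basis to \<open>Basis\<close>. As the canonical Gram matrix is real,
  conjugating \<open>gi\<close> affects \<open>K\<close> only, and \<open>h\<close> turns the
  conjugate of \<open>K\<close> into \<open>C\<close>; this is \<open>star\<close>.\<close>

theorem tensor_model_exists:
  assumes ginv: "inverse_gram Basis form ginv"
  obtains h S C K where "tensor_model Basis (card Basis) eps form ginv h (S :: 'v set) C K"
proof -
  obtain S where S: "canonical S" "independent S" "span S = UNIV" by (rule exists_canonical_basis)
  have fin: "finite S" using S by (simp add: canonical_def)
  define C where "C = (\<lambda>x a. representation S a x)"
  define K where "K = (\<lambda>a x. representation Basis x a)"
  define h where "h = (\<lambda>a b. \<Sum>x\<in>S. cnj (C x a) * C x b)"
  define gi where "gi = (\<lambda>a b. \<Sum>x\<in>S. \<Sum>y\<in>S. of_int eps * (K a x * form x y * K b y))"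
  have expS: "(\<Sum>x\<in>S. scale (C x v) x) = v" for v
    unfolding C_def using sum_representation_eq[OF S(2) _ fin order_refl, of v] S(3) by simp
  have expB: "(\<Sum>a\<in>Basis. scale (K a v) a) = v" for v
    unfolding K_def using sum_representation_eq[OF independent_Basis _ finite_Basis order_refl, of v] span_Basis by simp
  have KC: "(\<Sum>x\<in>S. K a x * C x v) = K a v" for a v
  proof -
    have "K a v = representation Basis (\<Sum>x\<in>S. scale (C x v) x) a" by (simp add: expS K_def)
    also have "\<dots> = (\<Sum>x\<in>S. representation Basis (scale (C x v) x) a)"
      using span_Basis by (subst representation_sum[OF independent_Basis]) auto
    also have "\<dots> = (\<Sum>x\<in>S. K a x * C x v)"
      using span_Basis by (simp add: representation_scale[OF independent_Basis] K_def mult.commute)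
    finally show ?thesis by simp
  qed
  have CK: "(\<Sum>a\<in>Basis. C z a * K a v) = C z v" for z v
  proof -
    have "C z v = representation S (\<Sum>a\<in>Basis. scale (K a v) a) z" by (simp add: expB C_def)
    also have "\<dots> = (\<Sum>a\<in>Basis. representation S (scale (K a v) a) z)"
      using S by (subst representation_sum[OF S(2)]) auto
    also have "\<dots> = (\<Sum>a\<in>Basis. C z a * K a v)"
      using S by (simp add: representation_scale[OF S(2)] C_def mult.commute)
    finally show ?thesis by simp
  qed
  have K_basis: "K a b = (if a = b then 1 else 0)" if "b \<in> Basis" for a b
    using representation_basis[OF independent_Basis that] by (simp add: K_def)
  have C_basis: "C z x = (if z = x then 1 else 0)" if "x \<in> S" for z x
    using representation_basis[OF S(2) that] by (simp add: C_def)
  have form_left: "form a x = (\<Sum>z\<in>S. C z a * form z x)" for a x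
    by (subst expS[of a, symmetric]) (simp only: form_sum_left form_scale_left)
  have form_right: "form x a = (\<Sum>z\<in>S. C z a * form x z)" for a x
    by (subst expS[of a, symmetric]) (simp only: form_sum_right form_scale_right)
  have form_K: "(\<Sum>c\<in>Basis. form a c * K c x) = form a x" for a x
    by (subst (2) expB[of x, symmetric]) (simp add: form_sum_right form_scale_right mult.commute)
  have g_gi: "(\<Sum>c\<in>Basis. form a c * gi c b) = (if a = b then 1 else 0)" if ab: "a \<in> Basis" "b \<in> Basis" for a b
  proof -
    have "(\<Sum>c\<in>Basis. form a c * gi c b) = (\<Sum>c\<in>Basis. \<Sum>x\<in>S. \<Sum>y\<in>S. of_int eps * ((form a c * K c x) * form x y * K b y))"
      by (simp add: gi_def sum_distrib_left mult_ac)
    also have "\<dots> = (\<Sum>x\<in>S. \<Sum>y\<in>S. \<Sum>c\<in>Basis. of_int eps * ((form a c * K c x) * form x y * K b y))"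
      by (rule trans[OF sum.swap sum.cong[OF refl sum.swap]])
    also have "\<dots> = (\<Sum>x\<in>S. \<Sum>y\<in>S. of_int eps * (form a x * form x y * K b y))"
      by (simp add: sum_distrib_left[symmetric] sum_distrib_right[symmetric] form_K)
    also have "\<dots> = (\<Sum>x\<in>S. \<Sum>y\<in>S. \<Sum>z\<in>S. of_int eps * (C z a * (form z x * form x y) * K b y))"
      by (intro sum.cong refl, subst form_left[of a]) (simp add: sum_distrib_left sum_distrib_right mult_ac)
    also have "\<dots> = (\<Sum>y\<in>S. \<Sum>z\<in>S. \<Sum>x\<in>S. of_int eps * (C z a * (form z x * form x y) * K b y))"
      by (rule trans[OF sum.swap sum.cong[OF refl sum.swap]])
    also have "\<dots> = (\<Sum>y\<in>S. \<Sum>z\<in>S. of_int eps * (C z a * (\<Sum>x\<in>S. form z x * form x y) * K b y))"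
      by (simp add: sum_distrib_left sum_distrib_right)
    also have "\<dots> = (\<Sum>y\<in>S. \<Sum>z\<in>S. if z = y then K b y * C z a else 0)"
      using S(1) by (intro sum.cong refl) (auto simp: canonical_def mult_ac)
    also have "\<dots> = (\<Sum>y\<in>S. K b y * C y a)" using fin by (intro sum.cong refl) simp
    also have "\<dots> = K b a" by (rule KC)
    finally show ?thesis using K_basis[OF ab(1), of b] by auto
  qed
  have ginv_g: "(\<Sum>c\<in>Basis. ginv a c * form c b) = (if a = b then 1 else 0)" if "a \<in> Basis" "b \<in> Basis" for a b
    using ginv that by (simp add: inverse_gram_def)
  \<comment> \<open>\<open>ginv\<close> is a left inverse and \<open>gi\<close> a right inverse of
    the same matrix.\<close>
  have gi: "ginv a b = gi a b" if ab: "a \<in> Basis" "b \<in> Basis" for a b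
  proof -
    have "ginv a b = (\<Sum>d\<in>Basis. if d = b then ginv a d else 0)" using ab finite_Basis by simp
    also have "\<dots> = (\<Sum>d\<in>Basis. ginv a d * (\<Sum>c\<in>Basis. form d c * gi c b))"
      using ab by (intro sum.cong refl) (simp add: g_gi)
    also have "\<dots> = (\<Sum>d\<in>Basis. \<Sum>c\<in>Basis. (ginv a d * form d c) * gi c b)"
      by (simp add: sum_distrib_left mult.assoc)
    also have "\<dots> = (\<Sum>c\<in>Basis. (\<Sum>d\<in>Basis. ginv a d * form d c) * gi c b)"
      by (subst sum.swap) (simp add: sum_distrib_right)
    also have "\<dots> = (\<Sum>c\<in>Basis. if c = a then gi c b else 0)"
      using ab by (intro sum.cong refl) (simp add: ginv_g)
    also have "\<dots> = gi a b" using ab finite_Basis by simp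
    finally show ?thesis .
  qed
  have gi_sym: "gi b a = of_int eps * gi a b" for a b
  proof -
    have "gi b a = (\<Sum>y\<in>S. \<Sum>x\<in>S. of_int eps * (K b x * form x y * K a y))" unfolding gi_def by (rule sum.swap)
    also have "\<dots> = (\<Sum>y\<in>S. \<Sum>x\<in>S. K a y * form y x * K b x)"
      by (intro sum.cong refl, subst form_commute) (simp add: mult_ac)
    also have "\<dots> = of_int eps * gi a b" by (simp add: gi_def sum_distrib_left)
    finally show ?thesis .
  qed
  have Kh: "(\<Sum>a\<in>Basis. cnj (K a x) * h a a') = C x a'" if x: "x \<in> S" for x a'
  proof -
    have "(\<Sum>a\<in>Basis. cnj (K a x) * h a a') = (\<Sum>a\<in>Basis. \<Sum>z\<in>S. cnj (C z a * K a x) * C z a')"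
      by (simp add: h_def sum_distrib_left mult_ac)
    also have "\<dots> = (\<Sum>z\<in>S. cnj (\<Sum>a\<in>Basis. C z a * K a x) * C z a')"
      by (subst sum.swap) (simp add: sum_distrib_right)
    also have "\<dots> = (\<Sum>z\<in>S. if z = x then C z a' else 0)"
      by (intro sum.cong refl) (simp add: CK C_basis[OF x])
    also have "\<dots> = C x a'" using x fin by simp
    finally show ?thesis .
  qed
  have star: "(\<Sum>a\<in>Basis. \<Sum>b\<in>Basis. cnj (ginv a b) * h a a' * h b b') = of_int eps * form a' b'" for a' b'
  proof -
    have "(\<Sum>a\<in>Basis. \<Sum>b\<in>Basis. cnj (ginv a b) * h a a' * h b b') =
      (\<Sum>a\<in>Basis. \<Sum>b\<in>Basis. \<Sum>x\<in>S. \<Sum>y\<in>S. of_int eps * (form x y * (cnj (K a x) * h a a') * (cnj (K b y) * h b b')))"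
    proof (intro sum.cong refl)
      fix a b assume ab: "a \<in> Basis" "b \<in> Basis"
      have "cnj (ginv a b) = (\<Sum>x\<in>S. \<Sum>y\<in>S. of_int eps * (cnj (K a x) * form x y * cnj (K b y)))"
        unfolding gi[OF ab] gi_def using S(1) by (simp add: canonical_def)
      then show "cnj (ginv a b) * h a a' * h b b' =
        (\<Sum>x\<in>S. \<Sum>y\<in>S. of_int eps * (form x y * (cnj (K a x) * h a a') * (cnj (K b y) * h b b')))"
        by (simp add: sum_distrib_left mult_ac)
    qed
    also have "\<dots> = (\<Sum>a\<in>Basis. \<Sum>x\<in>S. \<Sum>y\<in>S. \<Sum>b\<in>Basis. of_int eps * (form x y * (cnj (K a x) * h a a') * (cnj (K b y) * h b b')))"
      by (rule sum.cong[OF refl trans[OF sum.swap sum.cong[OF refl sum.swap]]])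
    also have "\<dots> = (\<Sum>a\<in>Basis. \<Sum>x\<in>S. \<Sum>y\<in>S. of_int eps * (form x y * (cnj (K a x) * h a a') * C y b'))"
      by (simp add: sum_distrib_left[symmetric] Kh)
    also have "\<dots> = (\<Sum>x\<in>S. \<Sum>y\<in>S. \<Sum>a\<in>Basis. of_int eps * (form x y * (cnj (K a x) * h a a') * C y b'))"
      by (rule trans[OF sum.swap sum.cong[OF refl sum.swap]])
    also have "\<dots> = (\<Sum>x\<in>S. \<Sum>y\<in>S. of_int eps * (form x y * C x a' * C y b'))"
      by (simp add: sum_distrib_left[symmetric] sum_distrib_right[symmetric] Kh)
    also have "\<dots> = of_int eps * (\<Sum>x\<in>S. C x a' * (\<Sum>y\<in>S. C y b' * form x y))"
      by (simp add: sum_distrib_left mult_ac)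
    also have "\<dots> = of_int eps * form a' b'"
      by (simp only: form_right[of _ b', symmetric] form_left[of a' b', symmetric])
    finally show ?thesis .
  qed
  have "tensor_model Basis (card Basis) eps form ginv h S C K"
  proof
    fix a b assume ab: "a \<in> Basis" "b \<in> Basis"
    show "form b a = of_int eps * form a b" by (rule form_commute)
    show "ginv b a = of_int eps * ginv a b" using ab by (simp add: gi gi_sym[of b a])
    show "(\<Sum>c\<in>Basis. ginv a c * form c b) = (if a = b then 1 else 0)" by (rule ginv_g[OF ab])
    show "(\<Sum>c\<in>Basis. form a c * ginv c b) = (if a = b then 1 else 0)"
      using g_gi[OF ab] ab by (simp add: gi)
    show "(\<Sum>x\<in>S. K a x * C x b) = (if a = b then 1 else 0)" by (simp add: KC K_basis[OF ab(2)])
    show "(\<Sum>a'\<in>Basis. \<Sum>b'\<in>Basis. cnj (ginv a' b') * h a' a * h b' b) = of_int eps * form a b" by (rule star)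
  qed (use fin eps finite_Basis in \<open>auto simp: h_def\<close>)
  then show ?thesis by (rule that)
qed

end

section \<open>Brauer diagrams\<close>

lemma finite_nodes: "finite (nodes n)"
  by (simp add: nodes_def)

lemma node_mem [simp]: "Upper k \<in> nodes n \<longleftrightarrow> k < n" "Lower k \<in> nodes n \<longleftrightarrow> k < n"
  by (auto simp: nodes_def)

lemma finite_brauer_diagrams: "finite (brauer_diagrams n)"
proof (rule finite_subset)
  show "brauer_diagrams n \<subseteq> Pow (Pow (nodes n))"
    by (auto simp: brauer_diagrams_def partition_on_def)
qed (simp add: finite_nodes)

lemma brauer_diagramsI:
  assumes "\<And>x. x \<in> nodes n \<Longrightarrow> \<exists>y. y \<noteq> x \<and> {x, y} \<in> b"
    and "\<And>e. e \<in> b \<Longrightarrow> \<exists>x y. e = {x, y} \<and> x \<noteq> y \<and> x \<in> nodes n \<and> y \<in> nodes n"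
    and "\<And>x y z. {x, y} \<in> b \<Longrightarrow> {x, z} \<in> b \<Longrightarrow> y = z"
  shows "b \<in> brauer_diagrams n"
  unfolding brauer_diagrams_def partition_on_def
proof (intro CollectI conjI ballI disjointI)
  show "\<Union>b = nodes n"
  proof (intro equalityI subsetI)
    fix x assume "x \<in> \<Union>b" then show "x \<in> nodes n" using assms(2) by fastforce
  next
    fix x assume "x \<in> nodes n" then show "x \<in> \<Union>b" using assms(1)[of x] by auto
  qed
  fix e assume e: "e \<in> b"
  then show "card e = 2" using assms(2)[OF e] by auto
  fix e' assume e': "e' \<in> b" "e \<noteq> e'"
  show "e \<inter> e' = {}"
  proof (rule ccontr)
    assume "e \<inter> e' \<noteq> {}"
    then obtain x where x: "x \<in> e" "x \<in> e'" by auto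
    obtain y where "e = {x, y}" using assms(2)[OF e] x(1) by (metis insert_commute insert_iff singletonD)
    moreover obtain z where "e' = {x, z}" using assms(2)[OF e'(1)] x(2) by (metis insert_commute insert_iff singletonD)
    ultimately show False using assms(3)[of x y z] e e' by simp
  qed
next
  show "{} \<notin> b" using assms(2) by blast
qed

lemma brauer_diagramsD:
  assumes b: "b \<in> brauer_diagrams n"
  shows "x \<in> nodes n \<Longrightarrow> \<exists>y. y \<noteq> x \<and> {x, y} \<in> b"
    and "e \<in> b \<Longrightarrow> \<exists>x y. e = {x, y} \<and> x \<noteq> y \<and> x \<in> nodes n \<and> y \<in> nodes n"
    and "{x, y} \<in> b \<Longrightarrow> x \<noteq> y \<and> x \<in> nodes n \<and> y \<in> nodes n"
    and "{x, y} \<in> b \<Longrightarrow> {x, z} \<in> b \<Longrightarrow> y = z"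
proof -
  have U: "\<Union>b = nodes n" and disj: "disjoint b" and c2: "\<And>e. e \<in> b \<Longrightarrow> card e = 2"
    using b by (auto simp: brauer_diagrams_def partition_on_def)
  show 2: "\<exists>x y. e = {x, y} \<and> x \<noteq> y \<and> x \<in> nodes n \<and> y \<in> nodes n" if e: "e \<in> b" for e
    using c2[OF e] U e unfolding card_2_iff by blast
  show "\<exists>y. y \<noteq> x \<and> {x, y} \<in> b" if x: "x \<in> nodes n" for x
  proof -
    obtain e where e: "e \<in> b" "x \<in> e" using U x by auto
    obtain p q where pq: "e = {p, q}" "p \<noteq> q" using 2[OF e(1)] by blast
    then show ?thesis using e by (cases "x = p") (auto simp: insert_commute)
  qed
  show "{x, y} \<in> b \<Longrightarrow> x \<noteq> y \<and> x \<in> nodes n \<and> y \<in> nodes n" for x y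
    using c2[of "{x, y}"] U by auto
  show "y = z" if "{x, y} \<in> b" "{x, z} \<in> b" for x y z
  proof -
    have "{x, y} = {x, z}" using disjointD[OF disj that] by auto
    then show ?thesis by (auto simp: doubleton_eq_iff)
  qed
qed

text \<open>Composition with a permutation diagram on either side only relabels nodes. So does
  placing a diagram \<open>d_ij\<close> below: it amounts to a transposition of two nodes that
  depends on the other diagram.\<close>

definition relabel :: "(node \<Rightarrow> node) \<Rightarrow> node set set \<Rightarrow> node set set" where
  "relabel \<phi> b = (`) \<phi> ` b"

lemma relabel_mem: "{x, y} \<in> b \<Longrightarrow> {\<phi> x, \<phi> y} \<in> relabel \<phi> b"
  unfolding relabel_def by (rule image_eqI[of _ _ "{x, y}"]) simp_all

lemma relabel_Un: "relabel \<phi> (b \<union> b') = relabel \<phi> b \<union> relabel \<phi> b'"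
  by (simp add: relabel_def image_Un)

lemma relabel_pair: "relabel \<phi> {{x, y}, {z, w}} = {{\<phi> x, \<phi> y}, {\<phi> z, \<phi> w}}"
  by (simp add: relabel_def)

lemma relabel_family: "relabel \<phi> {{x k, y k} | k. P k} = {{\<phi> (x k), \<phi> (y k)} | k. P k}"
proof -
  have "{{x k, y k} | k. P k} = (\<lambda>k. {x k, y k}) ` {k. P k}" "{{\<phi> (x k), \<phi> (y k)} | k. P k} = (\<lambda>k. {\<phi> (x k), \<phi> (y k)}) ` {k. P k}"
    by blast+
  then show ?thesis by (simp add: relabel_def image_image)
qed

lemma relabelE:
  assumes "{u, v} \<in> relabel \<phi> b" "b \<in> brauer_diagrams n"
  obtains x y where "{x, y} \<in> b" "u = \<phi> x" "v = \<phi> y"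
proof -
  obtain e where e: "e \<in> b" "{u, v} = \<phi> ` e" using assms(1) by (auto simp: relabel_def)
  obtain x y where xy: "e = {x, y}" using brauer_diagramsD(2)[OF assms(2) e(1)] by blast
  then have "{u, v} = {\<phi> x, \<phi> y}" using e by simp
  then consider "u = \<phi> x" "v = \<phi> y" | "u = \<phi> y" "v = \<phi> x" by (auto simp: doubleton_eq_iff)
  then show ?thesis
  proof cases
    case 1 then show ?thesis using that[of x y] e xy by simp
  next
    case 2 then show ?thesis using that[of y x] e xy by (simp add: insert_commute)
  qed
qed

lemma relabel_brauer_diagrams:
  assumes b: "b \<in> brauer_diagrams n" and \<phi>: "\<phi> permutes nodes n"
  shows "relabel \<phi> b \<in> brauer_diagrams n"
proof (rule brauer_diagramsI)
  fix x assume "x \<in> nodes n"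
  then obtain x' where x': "x' \<in> nodes n" "x = \<phi> x'" using permutes_image[OF \<phi>] by (metis imageE)
  obtain y where "y \<noteq> x'" "{x', y} \<in> b" using brauer_diagramsD(1)[OF b x'(1)] by blast
  then show "\<exists>y. y \<noteq> x \<and> {x, y} \<in> relabel \<phi> b"
    using relabel_mem[of x' y b \<phi>] permutes_inj[OF \<phi>] x' by (intro exI[of _ "\<phi> y"]) (simp add: inj_eq)
next
  fix e assume "e \<in> relabel \<phi> b"
  then obtain e' where e': "e' \<in> b" "e = \<phi> ` e'" by (auto simp: relabel_def)
  obtain x y where xy: "e' = {x, y}" "x \<noteq> y" "x \<in> nodes n" "y \<in> nodes n"
    using brauer_diagramsD(2)[OF b e'(1)] by blast
  then have "\<phi> x \<noteq> \<phi> y" "\<phi> x \<in> nodes n" "\<phi> y \<in> nodes n"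
    using permutes_inj[OF \<phi>] permutes_in_image[OF \<phi>] by (auto simp: inj_eq)
  then show "\<exists>x y. e = {x, y} \<and> x \<noteq> y \<and> x \<in> nodes n \<and> y \<in> nodes n"
    unfolding e'(2) xy(1) by (intro exI[of _ "\<phi> x"] exI[of _ "\<phi> y"]) simp
next
  fix x y z assume "{x, y} \<in> relabel \<phi> b" "{x, z} \<in> relabel \<phi> b"
  then obtain x1 y1 x2 z2 where 1: "{x1, y1} \<in> b" "x = \<phi> x1" "y = \<phi> y1" and 2: "{x2, z2} \<in> b" "x = \<phi> x2" "z = \<phi> z2"
    by (metis relabelE b)
  have "x1 = x2" using 1(2) 2(2) permutes_inj[OF \<phi>] by (simp add: inj_eq)
  then show "y = z" using brauer_diagramsD(4)[OF b 1(1)] 2 1(3) by simp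
qed

lemma stack_below: "{x, y} \<in> b1 \<Longrightarrow> (place_below x, place_below y) \<in> stack_connected b1 b2"
  and stack_above: "{x, y} \<in> b2 \<Longrightarrow> (place_above x, place_above y) \<in> stack_connected b1 b2"
  unfolding stack_connected_def by (rule r_into_rtrancl; blast)+

lemma stack_trans: "(u, v) \<in> stack_connected b1 b2 \<Longrightarrow> (v, w) \<in> stack_connected b1 b2 \<Longrightarrow> (u, w) \<in> stack_connected b1 b2"
  unfolding stack_connected_def by (rule rtrancl_trans)

lemma stack_refl: "(u, u) \<in> stack_connected b1 b2"
  unfolding stack_connected_def by (rule rtrancl_refl)

text \<open>The map \<open>c\<close> sends every site to an outer node of its component, up to the partner of that node.\<close>

lemma diagram_comp_eqI:
  assumes b: "b \<in> brauer_diagrams n" and c: "\<And>x. c (outer_site x) = x"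
    and below: "\<And>x y. {x, y} \<in> b1 \<Longrightarrow> c (place_below x) = c (place_below y) \<or> {c (place_below x), c (place_below y)} \<in> b"
    and above: "\<And>x y. {x, y} \<in> b2 \<Longrightarrow> c (place_above x) = c (place_above y) \<or> {c (place_above x), c (place_above y)} \<in> b"
    and conn: "\<And>x y. {x, y} \<in> b \<Longrightarrow> (outer_site x, outer_site y) \<in> stack_connected b1 b2"
  shows "diagram_comp n b1 b2 = b"
proof -
  have inv: "c u = c v \<or> {c u, c v} \<in> b" if "(u, v) \<in> stack_connected b1 b2" for u v
    using that unfolding stack_connected_def
  proof (induction rule: rtrancl_induct)
    case (step v w)
    have vw: "c v = c w \<or> {c v, c w} \<in> b" using step.hyps(2) below above by auto
    show ?case
    proof (cases "c u = c v \<or> c v = c w")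
      case True
      then show ?thesis using vw step.IH by auto
    next
      case False
      then have "{c v, c u} \<in> b" "{c v, c w} \<in> b" using vw step.IH by (auto simp: insert_commute)
      then show ?thesis using brauer_diagramsD(4)[OF b] by blast
    qed
  qed simp
  show ?thesis
  proof (intro equalityI subsetI)
    fix e assume "e \<in> diagram_comp n b1 b2"
    then obtain x y where e: "e = {x, y}" "x \<noteq> y" "(outer_site x, outer_site y) \<in> stack_connected b1 b2"
      by (auto simp: diagram_comp_def)
    then show "e \<in> b" using inv[OF e(3)] by (simp add: c)
  next
    fix e assume e: "e \<in> b"
    obtain x y where xy: "e = {x, y}" "x \<noteq> y" "x \<in> nodes n" "y \<in> nodes n"
      using brauer_diagramsD(2)[OF b e] by blast
    then show "e \<in> diagram_comp n b1 b2" using conn[of x y] e unfolding diagram_comp_def by blast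
  qed
qed

lemma diagram_loops_0:
  assumes "\<And>k. k < n \<Longrightarrow> \<exists>x. (Mid k, outer_site x) \<in> stack_connected b1 b2"
  shows "diagram_loops n b1 b2 = 0"
proof -
  have "\<not> stack_connected b1 b2 `` {Mid k} \<subseteq> range Mid" if k: "k < n" for k
  proof
    assume sub: "stack_connected b1 b2 `` {Mid k} \<subseteq> range Mid"
    obtain x where "(Mid k, outer_site x) \<in> stack_connected b1 b2" using assms[OF k] by blast
    then have "outer_site x \<in> range Mid" using sub by auto
    then show False by (cases x) auto
  qed
  then have "{C. \<exists>k<n. C = stack_connected b1 b2 `` {Mid k} \<and> C \<subseteq> range Mid} = {}" by blast
  then show ?thesis unfolding diagram_loops_def by (simp only: card.empty)
qed

section \<open>Composition with permutations and contractions\<close>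

fun map_lower :: "(nat \<Rightarrow> nat) \<Rightarrow> node \<Rightarrow> node" where
  "map_lower p (Upper k) = Upper k"
| "map_lower p (Lower k) = Lower (p k)"

fun map_upper :: "(nat \<Rightarrow> nat) \<Rightarrow> node \<Rightarrow> node" where
  "map_upper p (Upper k) = Upper (p k)"
| "map_upper p (Lower k) = Lower k"

lemma permutes_nodesI:
  assumes "\<And>x. x \<in> nodes n \<Longrightarrow> \<phi> x \<in> nodes n" "\<And>x. x \<in> nodes n \<Longrightarrow> \<psi> x \<in> nodes n"
    "\<And>x. \<psi> (\<phi> x) = x" "\<And>x. \<phi> (\<psi> x) = x" "\<And>x. x \<notin> nodes n \<Longrightarrow> \<phi> x = x"
  shows "\<phi> permutes nodes n"
  unfolding permutes_altdef
proof (intro conjI bij_betw_byWitness[where f' = \<psi>] ballI)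
  show "{x. \<phi> x \<noteq> x} \<subseteq> nodes n" using assms(5) by blast
qed (use assms in auto)

lemma map_lower_permutes:
  assumes p: "p permutes {..<n}"
  shows "map_lower p permutes nodes n"
proof (rule permutes_nodesI[where \<psi> = "map_lower (inv p)"])
  have pi: "inv p permutes {..<n}" by (rule permutes_inv[OF p])
  fix x
  show "x \<in> nodes n \<Longrightarrow> map_lower p x \<in> nodes n" "x \<in> nodes n \<Longrightarrow> map_lower (inv p) x \<in> nodes n"
    using permutes_in_image[OF p] permutes_in_image[OF pi] by (cases x; force)+
  show "map_lower (inv p) (map_lower p x) = x" "map_lower p (map_lower (inv p) x) = x" "x \<notin> nodes n \<Longrightarrow> map_lower p x = x"
    using permutes_inverses[OF p] permutes_not_in[OF p] by (cases x; force)+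
qed

lemma map_upper_permutes:
  assumes p: "p permutes {..<n}"
  shows "map_upper p permutes nodes n"
proof (rule permutes_nodesI[where \<psi> = "map_upper (inv p)"])
  have pi: "inv p permutes {..<n}" by (rule permutes_inv[OF p])
  fix x
  show "x \<in> nodes n \<Longrightarrow> map_upper p x \<in> nodes n" "x \<in> nodes n \<Longrightarrow> map_upper (inv p) x \<in> nodes n"
    using permutes_in_image[OF p] permutes_in_image[OF pi] by (cases x; force)+
  show "map_upper (inv p) (map_upper p x) = x" "map_upper p (map_upper (inv p) x) = x" "x \<notin> nodes n \<Longrightarrow> map_upper p x = x"
    using permutes_inverses[OF p] permutes_not_in[OF p] by (cases x; force)+
qed

lemma perm_diagramI: "i < n \<Longrightarrow> {Upper i, Lower (s i)} \<in> perm_diagram n s"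
  by (auto simp: perm_diagram_def)

lemma perm_diagram_brauer:
  assumes s: "s permutes {..<n}"
  shows "perm_diagram n s \<in> brauer_diagrams n"
proof (rule brauer_diagramsI)
  fix x assume x: "x \<in> nodes n"
  show "\<exists>y. y \<noteq> x \<and> {x, y} \<in> perm_diagram n s"
  proof (cases x)
    case (Upper k)
    then show ?thesis using x by (intro exI[of _ "Lower (s k)"]) (auto simp: perm_diagramI)
  next
    case (Lower k)
    then have "inv s k < n" "s (inv s k) = k"
      using x permutes_in_image[OF permutes_inv[OF s]] permutes_inverses[OF s] by auto
    then have "{Upper (inv s k), Lower k} \<in> perm_diagram n s" using perm_diagramI[of "inv s k" n s] by simp
    then show ?thesis using Lower by (intro exI[of _ "Upper (inv s k)"]) (auto simp: insert_commute)
  qed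
next
  fix e assume "e \<in> perm_diagram n s"
  then obtain i where i: "i < n" "e = {Upper i, Lower (s i)}" by (auto simp: perm_diagram_def)
  then have "s i < n" using permutes_in_image[OF s, of i] by simp
  then show "\<exists>x y. e = {x, y} \<and> x \<noteq> y \<and> x \<in> nodes n \<and> y \<in> nodes n"
    using i by (intro exI[of _ "Upper i"] exI[of _ "Lower (s i)"]) auto
next
  fix x y z assume "{x, y} \<in> perm_diagram n s" "{x, z} \<in> perm_diagram n s"
  then obtain i j where "{x, y} = {Upper i, Lower (s i)}" "{x, z} = {Upper j, Lower (s j)}"
    by (auto simp: perm_diagram_def)
  then show "y = z" using permutes_inj[OF s] by (auto simp: doubleton_eq_iff inj_eq)
qed

lemma perm_below:
  assumes b: "b \<in> brauer_diagrams n" and s: "s permutes {..<n}"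
  shows "diagram_comp n (perm_diagram n s) b = relabel (map_lower s) b" "diagram_loops n (perm_diagram n s) b = 0"
proof -
  have edge: "(Mid k, Bot (s k)) \<in> stack_connected (perm_diagram n s) b" "(Bot (s k), Mid k) \<in> stack_connected (perm_diagram n s) b" if "k < n" for k
    using stack_below[of "Upper k" "Lower (s k)" "perm_diagram n s" b] stack_below[of "Lower (s k)" "Upper k" "perm_diagram n s" b]
      perm_diagramI[OF that, of s] by (auto simp: insert_commute)
  have out: "(place_above x, outer_site (map_lower s x)) \<in> stack_connected (perm_diagram n s) b"
    "(outer_site (map_lower s x), place_above x) \<in> stack_connected (perm_diagram n s) b" if "x \<in> nodes n" for x
    using that edge by (cases x; auto simp: stack_refl)+
  show "diagram_comp n (perm_diagram n s) b = relabel (map_lower s) b"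
  proof (rule diagram_comp_eqI[where c = "case_site Upper (\<lambda>k. Lower (s k)) Lower"])
    show "relabel (map_lower s) b \<in> brauer_diagrams n"
      by (rule relabel_brauer_diagrams[OF b map_lower_permutes[OF s]])
    show "case_site Upper (\<lambda>k. Lower (s k)) Lower (outer_site x) = x" for x by (cases x) auto
    fix x y
    {
      assume "{x, y} \<in> perm_diagram n s"
      then obtain i where "{x, y} = {Upper i, Lower (s i)}" by (auto simp: perm_diagram_def)
      then show "case_site Upper (\<lambda>k. Lower (s k)) Lower (place_below x) = case_site Upper (\<lambda>k. Lower (s k)) Lower (place_below y) \<or>
        {case_site Upper (\<lambda>k. Lower (s k)) Lower (place_below x), case_site Upper (\<lambda>k. Lower (s k)) Lower (place_below y)} \<in> relabel (map_lower s) b"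
        by (auto simp: doubleton_eq_iff)
    next
      assume "{x, y} \<in> b"
      moreover have "case_site Upper (\<lambda>k. Lower (s k)) Lower (place_above x) = map_lower s x" for x by (cases x) auto
      ultimately show "case_site Upper (\<lambda>k. Lower (s k)) Lower (place_above x) = case_site Upper (\<lambda>k. Lower (s k)) Lower (place_above y) \<or>
        {case_site Upper (\<lambda>k. Lower (s k)) Lower (place_above x), case_site Upper (\<lambda>k. Lower (s k)) Lower (place_above y)} \<in> relabel (map_lower s) b"
        by (simp add: relabel_mem)
    next
      assume "{x, y} \<in> relabel (map_lower s) b"
      then obtain p q where pq: "{p, q} \<in> b" "x = map_lower s p" "y = map_lower s q" by (rule relabelE[OF _ b])
      then have "p \<in> nodes n" "q \<in> nodes n" using brauer_diagramsD(3)[OF b pq(1)] by auto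
      then show "(outer_site x, outer_site y) \<in> stack_connected (perm_diagram n s) b"
        using stack_trans[OF stack_trans[OF out(2) stack_above[OF pq(1)]] out(1)] pq(2,3) by simp
    }
  qed
  show "diagram_loops n (perm_diagram n s) b = 0"
    using edge(1) by (intro diagram_loops_0) (metis outer_site.simps(2))
qed

text \<open>The lower node \<open>k\<close> of the permutation diagram is joined to its upper node
  \<open>inv s k\<close>, which therefore replaces the upper node \<open>k\<close> of
  \<open>b\<close>.\<close>

lemma perm_above:
  assumes b: "b \<in> brauer_diagrams n" and s: "s permutes {..<n}"
  shows "diagram_comp n b (perm_diagram n s) = relabel (map_upper (inv s)) b" "diagram_loops n b (perm_diagram n s) = 0"
proof -
  have edge: "(Mid k, Top (inv s k)) \<in> stack_connected b (perm_diagram n s)" "(Top (inv s k), Mid k) \<in> stack_connected b (perm_diagram n s)" if "k < n" for k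
  proof -
    have "inv s k < n" "s (inv s k) = k"
      using that permutes_in_image[OF permutes_inv[OF s]] permutes_inverses[OF s] by auto
    then have "{Upper (inv s k), Lower k} \<in> perm_diagram n s" using perm_diagramI[of "inv s k" n s] by simp
    then show "(Mid k, Top (inv s k)) \<in> stack_connected b (perm_diagram n s)" "(Top (inv s k), Mid k) \<in> stack_connected b (perm_diagram n s)"
      using stack_above[of "Upper (inv s k)" "Lower k" "perm_diagram n s" b] stack_above[of "Lower k" "Upper (inv s k)" "perm_diagram n s" b]
      by (auto simp: insert_commute)
  qed
  have out: "(place_below x, outer_site (map_upper (inv s) x)) \<in> stack_connected b (perm_diagram n s)"
    "(outer_site (map_upper (inv s) x), place_below x) \<in> stack_connected b (perm_diagram n s)" if "x \<in> nodes n" for x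
    using that edge by (cases x; auto simp: stack_refl)+
  let ?c = "case_site Upper (\<lambda>k. Upper (inv s k)) Lower"
  show "diagram_comp n b (perm_diagram n s) = relabel (map_upper (inv s)) b"
  proof (rule diagram_comp_eqI[where c = ?c])
    show "relabel (map_upper (inv s)) b \<in> brauer_diagrams n"
      by (rule relabel_brauer_diagrams[OF b map_upper_permutes[OF permutes_inv[OF s]]])
    show "?c (outer_site x) = x" for x by (cases x) auto
    fix x y
    {
      assume "{x, y} \<in> perm_diagram n s"
      then obtain i where "{x, y} = {Upper i, Lower (s i)}" by (auto simp: perm_diagram_def)
      then show "?c (place_above x) = ?c (place_above y) \<or> {?c (place_above x), ?c (place_above y)} \<in> relabel (map_upper (inv s)) b"
        using permutes_inverses[OF s] by (auto simp: doubleton_eq_iff)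
    next
      assume "{x, y} \<in> b"
      moreover have "?c (place_below x) = map_upper (inv s) x" for x by (cases x) auto
      ultimately show "?c (place_below x) = ?c (place_below y) \<or> {?c (place_below x), ?c (place_below y)} \<in> relabel (map_upper (inv s)) b"
        by (simp add: relabel_mem)
    next
      assume "{x, y} \<in> relabel (map_upper (inv s)) b"
      then obtain p q where pq: "{p, q} \<in> b" "x = map_upper (inv s) p" "y = map_upper (inv s) q" by (rule relabelE[OF _ b])
      then have "p \<in> nodes n" "q \<in> nodes n" using brauer_diagramsD(3)[OF b pq(1)] by auto
      then show "(outer_site x, outer_site y) \<in> stack_connected b (perm_diagram n s)"
        using stack_trans[OF stack_trans[OF out(2) stack_below[OF pq(1)]] out(1)] pq(2,3) by simp
    }
  qed
  show "diagram_loops n b (perm_diagram n s) = 0"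
    using edge(1) by (intro diagram_loops_0) (metis outer_site.simps(1))
qed

lemma perm_diagram_comp:
  assumes s: "s permutes {..<n}" and t: "t permutes {..<n}"
  shows "relabel (map_lower s) (perm_diagram n t) = perm_diagram n (s \<circ> t)"
  unfolding perm_diagram_def relabel_family by simp

lemma d_diagram_brauer:
  assumes ij: "i < n" "j < n" "i \<noteq> j"
  shows "d_diagram n i j \<in> brauer_diagrams n"
proof (rule brauer_diagramsI)
  fix x assume x: "x \<in> nodes n"
  show "\<exists>y. y \<noteq> x \<and> {x, y} \<in> d_diagram n i j"
  proof (cases x)
    case (Upper k)
    then have "k < n" using x by simp
    then show ?thesis
      using Upper ij by (intro exI[of _ "if k = i then Upper j else if k = j then Upper i else Lower k"])
        (auto simp: d_diagram_def insert_commute)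
  next
    case (Lower k)
    then have "k < n" using x by simp
    then show ?thesis
      using Lower ij by (intro exI[of _ "if k = i then Lower j else if k = j then Lower i else Upper k"])
        (auto simp: d_diagram_def insert_commute)
  qed
next
  fix e assume "e \<in> d_diagram n i j"
  then consider "e = {Upper i, Upper j}" | "e = {Lower i, Lower j}" | k where "k < n" "e = {Upper k, Lower k}"
    by (auto simp: d_diagram_def)
  then show "\<exists>x y. e = {x, y} \<and> x \<noteq> y \<and> x \<in> nodes n \<and> y \<in> nodes n"
  proof cases
    case 1 then show ?thesis using ij by (intro exI[of _ "Upper i"] exI[of _ "Upper j"]) auto
  next
    case 2 then show ?thesis using ij by (intro exI[of _ "Lower i"] exI[of _ "Lower j"]) auto
  next
    case 3 then show ?thesis by (intro exI[of _ "Upper k"] exI[of _ "Lower k"]) auto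
  qed
next
  fix x y z assume "{x, y} \<in> d_diagram n i j" "{x, z} \<in> d_diagram n i j"
  then show "y = z" using ij by (auto simp: d_diagram_def doubleton_eq_iff)
qed

text \<open>The relation \<open>s d_ij = d_(s i)(s j) s\<close>, by which contractions of distant
  positions are reached from adjacent ones.\<close>

lemma d_diagram_conj:
  assumes s: "s permutes {..<n}" and ij: "i < n" "j < n"
  shows "relabel (map_lower s) (d_diagram n i j) = relabel (map_upper (inv s)) (d_diagram n (s i) (s j))"
proof -
  have "relabel (map_upper (inv s)) (d_diagram n (s i) (s j)) =
    {{Upper i, Upper j}, {Lower (s i), Lower (s j)}} \<union> {{Upper (inv s k), Lower k} | k. k < n \<and> k \<noteq> s i \<and> k \<noteq> s j}"
    using permutes_inverses[OF s] unfolding d_diagram_def relabel_Un relabel_pair relabel_family by simp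
  also have "{{Upper (inv s k), Lower k} | k. k < n \<and> k \<noteq> s i \<and> k \<noteq> s j} = {{Upper k, Lower (s k)} | k. k < n \<and> k \<noteq> i \<and> k \<noteq> j}"
  proof (intro equalityI subsetI)
    fix e assume "e \<in> {{Upper (inv s k), Lower k} | k. k < n \<and> k \<noteq> s i \<and> k \<noteq> s j}"
    then obtain k where k: "e = {Upper (inv s k), Lower k}" "k < n" "k \<noteq> s i" "k \<noteq> s j" by blast
    have "e = {Upper (inv s k), Lower (s (inv s k))}" "inv s k < n" "inv s k \<noteq> i" "inv s k \<noteq> j"
      using k permutes_inverses[OF s] permutes_in_image[OF permutes_inv[OF s], of k] by auto
    then show "e \<in> {{Upper k, Lower (s k)} | k. k < n \<and> k \<noteq> i \<and> k \<noteq> j}" by blast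
  next
    fix e assume "e \<in> {{Upper k, Lower (s k)} | k. k < n \<and> k \<noteq> i \<and> k \<noteq> j}"
    then obtain k where k: "e = {Upper k, Lower (s k)}" "k < n" "k \<noteq> i" "k \<noteq> j" by blast
    have "e = {Upper (inv s (s k)), Lower (s k)}" "s k < n" "s k \<noteq> s i" "s k \<noteq> s j"
      using k permutes_inverses[OF s] permutes_in_image[OF s, of k] permutes_inj[OF s] by (auto simp: inj_eq)
    then show "e \<in> {{Upper (inv s k), Lower k} | k. k < n \<and> k \<noteq> s i \<and> k \<noteq> s j}" by blast
  qed
  finally show ?thesis unfolding d_diagram_def relabel_Un relabel_pair relabel_family by simp
qed

text \<open>With \<open>x\<close> and \<open>y\<close> the partners of \<open>Lower i\<close> and
  \<open>Lower j\<close>, the composite joins \<open>x\<close> to \<open>y\<close> and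
  \<open>Lower i\<close> to \<open>Lower j\<close>. It is \<open>b\<close> relabelled by the
  transposition of \<open>x\<close> and \<open>Lower j\<close>. If \<open>x = Lower j\<close>, a
  loop is closed and this transposition is the identity.\<close>

lemma d_diagram_below:
  assumes b: "b \<in> brauer_diagrams n" and ij: "i < n" "j < n" "i \<noteq> j"
  shows "diagram_comp n (d_diagram n i j) b \<in> brauer_diagrams n"
proof -
  let ?d = "d_diagram n i j"
  obtain x where x: "x \<noteq> Lower i" "{Lower i, x} \<in> b" using brauer_diagramsD(1)[OF b, of "Lower i"] ij by auto
  obtain y where y: "y \<noteq> Lower j" "{Lower j, y} \<in> b" using brauer_diagramsD(1)[OF b, of "Lower j"] ij by auto
  define \<phi> where "\<phi> = transpose x (Lower j)"
  have xn: "x \<in> nodes n" and yn: "y \<in> nodes n" using brauer_diagramsD(3)[OF b] x y by blast+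
  have \<phi>: "\<phi> permutes nodes n" unfolding \<phi>_def using xn ij by (intro permutes_swap_id) auto
  have uniq: "y' = z" if "{x', y'} \<in> b" "{x', z} \<in> b" for x' y' z using brauer_diagramsD(4)[OF b] that by blast
  have x1: "{x, Lower i} \<in> b" and y1: "{y, Lower j} \<in> b" using x(2) y(2) by (simp_all only: insert_commute)
  have xj: "x = Lower j \<longleftrightarrow> y = Lower i"
    using uniq[OF x(2), of "Lower j"] uniq[OF y(2), of "Lower i"] x1 y1 by blast
  have xy: "x \<noteq> y" using uniq[OF x1, of "Lower j"] y1 ij by auto
  have far: "p \<noteq> x \<and> p \<noteq> y \<and> q \<noteq> x \<and> q \<noteq> y \<and> \<phi> p = p \<and> \<phi> q = q"
    if "{p, q} \<in> b" "p \<notin> {Lower i, Lower j}" "q \<notin> {Lower i, Lower j}" for p q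
  proof -
    have qp: "{q, p} \<in> b" using that(1) by (simp only: insert_commute)
    have "p \<noteq> x" "p \<noteq> y" using uniq[OF x1, of q] uniq[OF y1, of q] that by auto
    moreover have "q \<noteq> x" "q \<noteq> y" using uniq[OF x1, of p] uniq[OF y1, of p] qp that by auto
    ultimately have "p \<noteq> x" "p \<noteq> y" "q \<noteq> x" "q \<noteq> y" by auto
    then show ?thesis using that by (simp add: \<phi>_def transpose_def)
  qed
  have arcs: "{x, y} \<in> relabel \<phi> b" "{Lower i, Lower j} \<in> relabel \<phi> b"
  proof -
    show "{Lower i, Lower j} \<in> relabel \<phi> b"
      using relabel_mem[OF x(2), of \<phi>] x(1) ij by (simp add: \<phi>_def transpose_def split: if_splits)
    then show "{x, y} \<in> relabel \<phi> b"
      using relabel_mem[OF y(2), of \<phi>] xy xj y(1) by (cases "x = Lower j") (auto simp: \<phi>_def transpose_def insert_commute)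
  qed
  have arcs': "{y, x} \<in> relabel \<phi> b" "{Lower j, Lower i} \<in> relabel \<phi> b" using arcs by (simp_all add: insert_commute)
  have cases_b: "(p = Lower i \<and> q = x) \<or> (p = x \<and> q = Lower i) \<or> (p = Lower j \<and> q = y) \<or> (p = y \<and> q = Lower j) \<or>
    (p \<notin> {Lower i, Lower j} \<and> q \<notin> {Lower i, Lower j})" if "{p, q} \<in> b" for p q
  proof -
    have qp: "{q, p} \<in> b" using that by (simp only: insert_commute)
    consider "p = Lower i" | "p = Lower j" | "q = Lower i" | "q = Lower j" | "p \<notin> {Lower i, Lower j} \<and> q \<notin> {Lower i, Lower j}" by blast
    then show ?thesis
    proof cases
      case 1 then show ?thesis using uniq[of "Lower i" q x] x that by simp
    next
      case 2 then show ?thesis using uniq[of "Lower j" q y] y that by simp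
    next
      case 3 then show ?thesis using uniq[of "Lower i" p x] x qp by simp
    next
      case 4 then show ?thesis using uniq[of "Lower j" p y] y qp by simp
    qed blast
  qed
  \<comment> \<open>A middle node of the arc leads up to its partner in \<open>b\<close>, any other
    one down its vertical line.\<close>
  define c where "c = case_site Upper (\<lambda>k. if k = i then x else if k = j then y else Lower k) Lower"
  have c_above: "c (place_above p) = (if p = Lower i then x else if p = Lower j then y else p)" for p
    by (cases p) (auto simp: c_def)
  have c_Mid: "c (Mid i) = x" "c (Mid j) = y" using ij by (auto simp: c_def)
  have vert: "(outer_site p, place_above p) \<in> stack_connected ?d b" "(place_above p, outer_site p) \<in> stack_connected ?d b"
    if "p \<in> nodes n" "p \<notin> {Lower i, Lower j}" for p
  proof -
    have "(Bot k, Mid k) \<in> stack_connected ?d b \<and> (Mid k, Bot k) \<in> stack_connected ?d b" if "k < n" "k \<noteq> i" "k \<noteq> j" for k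
    proof -
      have "{Upper k, Lower k} \<in> ?d" "{Lower k, Upper k} \<in> ?d" using that by (auto simp: d_diagram_def)
      then show ?thesis using stack_below[of _ _ ?d b] by fastforce
    qed
    then show "(outer_site p, place_above p) \<in> stack_connected ?d b" "(place_above p, outer_site p) \<in> stack_connected ?d b"
      using that by (cases p; auto simp: stack_refl)+
  qed
  have arc: "(Mid i, Mid j) \<in> stack_connected ?d b" "(Mid j, Mid i) \<in> stack_connected ?d b"
    "(Bot i, Bot j) \<in> stack_connected ?d b" "(Bot j, Bot i) \<in> stack_connected ?d b"
  proof -
    have "{Upper i, Upper j} \<in> ?d" "{Upper j, Upper i} \<in> ?d" "{Lower i, Lower j} \<in> ?d" "{Lower j, Lower i} \<in> ?d"
      by (auto simp: d_diagram_def)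
    then show "(Mid i, Mid j) \<in> stack_connected ?d b" "(Mid j, Mid i) \<in> stack_connected ?d b"
      "(Bot i, Bot j) \<in> stack_connected ?d b" "(Bot j, Bot i) \<in> stack_connected ?d b"
      using stack_below[of _ _ ?d b] by fastforce+
  qed
  have path: "(outer_site x, outer_site y) \<in> stack_connected ?d b" "(outer_site y, outer_site x) \<in> stack_connected ?d b"
    if "x \<noteq> Lower j"
  proof -
    have xo: "x \<notin> {Lower i, Lower j}" and yo: "y \<notin> {Lower i, Lower j}" using x y xj that by auto
    have "(outer_site x, Mid i) \<in> stack_connected ?d b" "(Mid i, outer_site x) \<in> stack_connected ?d b"
      using stack_trans[OF vert(1)[OF xn xo] stack_above[OF x1]] stack_trans[OF stack_above[OF x(2)] vert(2)[OF xn xo]] by simp_all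
    moreover have "(outer_site y, Mid j) \<in> stack_connected ?d b" "(Mid j, outer_site y) \<in> stack_connected ?d b"
      using stack_trans[OF vert(1)[OF yn yo] stack_above[OF y1]] stack_trans[OF stack_above[OF y(2)] vert(2)[OF yn yo]] by simp_all
    ultimately show "(outer_site x, outer_site y) \<in> stack_connected ?d b" "(outer_site y, outer_site x) \<in> stack_connected ?d b"
      using arc stack_trans by metis+
  qed
  have b': "relabel \<phi> b \<in> brauer_diagrams n" by (rule relabel_brauer_diagrams[OF b \<phi>])
  have "diagram_comp n ?d b = relabel \<phi> b"
  proof (rule diagram_comp_eqI[OF b', where c = c])
    show "c (outer_site p) = p" for p by (cases p) (auto simp: c_def)
    fix p q
    show "c (place_below p) = c (place_below q) \<or> {c (place_below p), c (place_below q)} \<in> relabel \<phi> b" if d: "{p, q} \<in> ?d"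
    proof -
      consider "{p, q} = {Upper i, Upper j}" | "{p, q} = {Lower i, Lower j}" | k where "k \<noteq> i" "k \<noteq> j" "{p, q} = {Upper k, Lower k}"
        using d unfolding d_diagram_def by blast
      then show ?thesis
        using arcs arcs' ij by cases (auto simp: doubleton_eq_iff c_def)
    qed
    show "c (place_above p) = c (place_above q) \<or> {c (place_above p), c (place_above q)} \<in> relabel \<phi> b" if pq: "{p, q} \<in> b"
    proof -
      show ?thesis
      proof (cases "p \<notin> {Lower i, Lower j} \<and> q \<notin> {Lower i, Lower j}")
        case True
        then show ?thesis using far[OF pq] relabel_mem[OF pq, of \<phi>] by (simp add: c_above)
      next
        case False
        then have "(p = Lower i \<and> q = x) \<or> (p = x \<and> q = Lower i) \<or> (p = Lower j \<and> q = y) \<or> (p = y \<and> q = Lower j)"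
          using cases_b[OF pq] by blast
        then show ?thesis using arcs arcs' xj x(1) y(1) ij by (elim disjE) (auto simp: c_above c_Mid)
      qed
    qed
    show "(outer_site p, outer_site q) \<in> stack_connected ?d b" if d: "{p, q} \<in> relabel \<phi> b"
    proof -
      obtain p' q' where pq: "{p', q'} \<in> b" "p = \<phi> p'" "q = \<phi> q'" by (rule relabelE[OF d b])
      show ?thesis
      proof (cases "p' \<notin> {Lower i, Lower j} \<and> q' \<notin> {Lower i, Lower j}")
        case True
        then have "p = p'" "q = q'" using far[OF pq(1)] pq by auto
        moreover have "p' \<in> nodes n" "q' \<in> nodes n" using brauer_diagramsD(3)[OF b pq(1)] by auto
        ultimately show ?thesis
          using stack_trans[OF stack_trans[OF vert(1) stack_above[OF pq(1)]] vert(2)] True by simp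
      next
        case False
        have \<phi>i: "\<phi> (Lower i) = Lower i" "\<phi> x = Lower j" "\<phi> (Lower j) = x"
          using x(1) ij by (auto simp: \<phi>_def transpose_def)
        have \<phi>y: "\<phi> y = y" using xy y(1) by (auto simp: \<phi>_def transpose_def)
        have "(p' = Lower i \<and> q' = x) \<or> (p' = x \<and> q' = Lower i) \<or> (p' = Lower j \<and> q' = y) \<or> (p' = y \<and> q' = Lower j)"
          using cases_b[OF pq(1)] False by blast
        then show ?thesis
          using arc path xj by (cases "x = Lower j") (auto simp: pq(2,3) \<phi>i \<phi>y)
      qed
    qed
  qed
  then show ?thesis using b' by simp
qed

section \<open>Elements of the Brauer algebra\<close>

lemma brauer_basis_space: "b \<in> brauer_diagrams n \<Longrightarrow> brauer_basis b \<in> brauer_space n"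
  by (auto simp: brauer_basis_def brauer_space_def)

lemma brauer_mult_basis:
  assumes "b1 \<in> brauer_diagrams n" "b2 \<in> brauer_diagrams n"
  shows "brauer_mult n \<delta> (brauer_basis b1) (brauer_basis b2) =
    (\<lambda>b. \<delta> ^ diagram_loops n b1 b2 * brauer_basis (diagram_comp n b1 b2) b)"
proof
  fix b
  have "brauer_mult n \<delta> (brauer_basis b1) (brauer_basis b2) b =
    (\<Sum>c1\<in>brauer_diagrams n. if c1 = b1 then (\<Sum>c2\<in>brauer_diagrams n. if c2 = b2 then
      \<delta> ^ diagram_loops n c1 c2 * brauer_basis (diagram_comp n c1 c2) b else 0) else 0)"
    unfolding brauer_mult_def brauer_basis_def[of b1] brauer_basis_def[of b2]
    by (intro sum.cong refl) (auto intro!: sum.cong)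
  also have "\<dots> = \<delta> ^ diagram_loops n b1 b2 * brauer_basis (diagram_comp n b1 b2) b"
    using assms finite_brauer_diagrams by simp
  finally show "brauer_mult n \<delta> (brauer_basis b1) (brauer_basis b2) b =
    \<delta> ^ diagram_loops n b1 b2 * brauer_basis (diagram_comp n b1 b2) b" .
qed

text \<open>Closure is asked only for diagrams in the support of the left factor. In the product
  \<open>P_elem\<close> these are the identity and the diagrams \<open>d_ij\<close>, placed below an
  arbitrary diagram.\<close>

lemma brauer_mult_space:
  assumes "\<And>b1 b2. b1 \<in> brauer_diagrams n \<Longrightarrow> b2 \<in> brauer_diagrams n \<Longrightarrow> x b1 \<noteq> 0 \<Longrightarrow> diagram_comp n b1 b2 \<in> brauer_diagrams n"
  shows "brauer_mult n \<delta> x y \<in> brauer_space n"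
  unfolding brauer_space_def
proof (intro CollectI allI impI)
  fix b assume b: "b \<notin> brauer_diagrams n"
  have "x b1 * y b2 * \<delta> ^ diagram_loops n b1 b2 * brauer_basis (diagram_comp n b1 b2) b = 0"
    if "b1 \<in> brauer_diagrams n" "b2 \<in> brauer_diagrams n" for b1 b2
    using assms[OF that] b by (auto simp: brauer_basis_def)
  then show "brauer_mult n \<delta> x y b = 0" unfolding brauer_mult_def by (intro sum.neutral ballI)
qed

lemma brauer_one_space: "brauer_one n \<in> brauer_space n"
  unfolding brauer_one_def by (intro brauer_basis_space perm_diagram_brauer permutes_id)

lemma A_elem_pairs: "A_elem n = (\<lambda>b. \<Sum>(i, j)\<in>pairs n. brauer_basis (d_diagram n i j) b)"
  by (simp add: A_elem_def pairs_def)

lemma A_elem_space: "A_elem n \<in> brauer_space n"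
  unfolding A_elem_pairs brauer_space_def brauer_basis_def
  using d_diagram_brauer by (fastforce simp: pairs_def intro!: sum.neutral)

lemma P_factor_space: "P_factor n k \<in> brauer_space n"
  using brauer_one_space A_elem_space by (simp add: P_factor_def brauer_space_def)

lemma P_factor_support:
  assumes "P_factor n k b \<noteq> 0"
  shows "b = perm_diagram n id \<or> (\<exists>i j. i < n \<and> j < n \<and> i \<noteq> j \<and> b = d_diagram n i j)"
proof (rule ccontr)
  assume *: "\<not> ?thesis"
  then have "brauer_one n b = 0" by (simp add: brauer_one_def brauer_basis_def)
  moreover have "A_elem n b = 0"
  proof -
    have "brauer_basis (d_diagram n i j) b = 0" if "i < j" "j < n" for i j
    proof -
      have "b \<noteq> d_diagram n i j" using * that less_trans[OF that] by blast
      then show ?thesis by (simp add: brauer_basis_def)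
    qed
    then show ?thesis unfolding A_elem_pairs by (intro sum.neutral) (auto simp: pairs_def)
  qed
  ultimately show False using assms by (simp add: P_factor_def)
qed

lemma P_factor_mult_space: "brauer_mult n \<delta> (P_factor n k) Q \<in> brauer_space n"
proof (rule brauer_mult_space)
  fix b1 b2 assume b: "b2 \<in> brauer_diagrams n" and nz: "P_factor n k b1 \<noteq> 0"
  from P_factor_support[OF nz] show "diagram_comp n b1 b2 \<in> brauer_diagrams n"
  proof
    assume "b1 = perm_diagram n id"
    then show ?thesis
      using perm_below(1)[OF b permutes_id] relabel_brauer_diagrams[OF b map_lower_permutes[OF permutes_id]] by simp
  qed (use d_diagram_below[OF b] in blast)
qed

section \<open>The action on tensors\<close>

lemma update_word_iff:
  assumes "length u = n" "length w = n" "i < n" "j < n" "i \<noteq> j"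
  shows "w = u[i := a, j := b] \<longleftrightarrow> a = w ! i \<and> b = w ! j \<and> w = u[i := w ! i, j := w ! j]"
proof
  assume e: "w = u[i := a, j := b]"
  have ab: "w ! i = a" "w ! j = b" unfolding e using assms by (simp_all add: nth_list_update)
  show "a = w ! i \<and> b = w ! j \<and> w = u[i := w ! i, j := w ! j]" unfolding ab by (intro conjI refl e)
qed auto

lemma update_word_sym:
  assumes "length u = n" "length w = n" "i < n" "j < n" "i \<noteq> j"
  shows "w = u[i := w ! i, j := w ! j] \<longleftrightarrow> u = w[i := u ! i, j := u ! j]"
proof -
  have *: "u = w[i := u ! i, j := u ! j]" if "length u = n" "length w = n" "w = u[i := w ! i, j := w ! j]" for u w :: "'a list"
  proof (rule nth_equalityI)
    fix k assume k: "k < length u"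
    have "w ! k = u[i := w ! i, j := w ! j] ! k" by (rule arg_cong[OF that(3)])
    then show "u ! k = w[i := u ! i, j := u ! j] ! k" using that(1,2) assms k by (auto simp: nth_list_update)
  qed (use that in simp)
  show ?thesis using *[of u w] *[of w u] assms by blast
qed

locale brauer_tensors = finite_dimensional_vector_space scale Basis + tensor_model Basis N eps form ginv h S C K
  for scale :: "complex \<Rightarrow> 'v::ab_group_add \<Rightarrow> 'v" and Basis N eps form ginv h and S :: "'s set" and C K +
  fixes n :: nat and r :: "brauer \<Rightarrow> ('v list \<Rightarrow> complex) \<Rightarrow> 'v list \<Rightarrow> complex"
  assumes action: "brauer_action scale Basis eps form ginv n r"
begin

abbreviation pure :: "'v list \<Rightarrow> 'v list \<Rightarrow> complex" where
  "pure \<equiv> pure_tensor scale Basis"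

lemma pure_word: "w \<in> words m \<Longrightarrow> pure w = (\<lambda>u. if u = w then 1 else 0)"
  by (rule pure_tensor_basis_word[OF finite_dimensional_vector_space_axioms])

lemma pure_W: "w \<in> words m \<Longrightarrow> pure w \<in> W m"
  by (auto simp: pure_word tensor_space_def)

lemma pure_expansion: "T \<in> W m \<Longrightarrow> T = (\<Sum>w\<in>words m. tscale (T w) (pure w))"
  using word_expansion[of T m] by (simp only: pure_word cong: sum.cong)

lemma r_W: "x \<in> brauer_space n \<Longrightarrow> T \<in> W n \<Longrightarrow> r x T \<in> W n"
  using action unfolding brauer_action_def tensor_endomorphism_def by blast

lemma r_combination:
  assumes "x \<in> brauer_space n" "T \<in> W n" "U \<in> W n"
  shows "r x (tscale a T + tscale b U) = tscale a (r x T) + tscale b (r x U)"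
proof -
  have "r x (\<lambda>w. a * T w + b * U w) = (\<lambda>w. a * r x T w + b * r x U w)"
    using action assms unfolding brauer_action_def tensor_endomorphism_def by blast
  then show ?thesis by (simp add: tscale_def plus_fun_def)
qed

lemma r_combination_left:
  assumes "x \<in> brauer_space n" "y \<in> brauer_space n" "T \<in> W n"
  shows "r (\<lambda>b. a * x b + c * y b) T = tscale a (r x T) + tscale c (r y T)"
proof -
  have "r (\<lambda>b. a * x b + c * y b) T = (\<lambda>w. a * r x T w + c * r y T w)"
    using action assms unfolding brauer_action_def by blast
  then show ?thesis by (simp add: tscale_def plus_fun_def)
qed

lemma r_one: "T \<in> W n \<Longrightarrow> r (brauer_one n) T = T"
  using action unfolding brauer_action_def by blast

lemma r_mult:
  assumes "x \<in> brauer_space n" "y \<in> brauer_space n" "T \<in> W n"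
  shows "r (brauer_mult n (of_int (eps * int N)) x y) T = r x (r y T)"
  using action assms unfolding brauer_action_def by (simp add: card_I)

text \<open>\<open>r x\<close> is known to be linear on the tensor space only, so agreement on basis
  words is extended along partial sums that stay inside it.\<close>

lemma r_eqI:
  assumes x: "x \<in> brauer_space n" and F: "rep.lin F" and eq: "\<And>w. w \<in> words n \<Longrightarrow> r x (pure w) = F (pure w)" and T: "T \<in> W n"
  shows "r x T = F T"
proof -
  have "r x (\<Sum>w\<in>X. tscale (T w) (pure w)) = F (\<Sum>w\<in>X. tscale (T w) (pure w))" if "finite X" "X \<subseteq> words n" for X
    using that
  proof (induction X)
    case empty
    have "r x (tscale 0 0 + tscale 0 0) = tscale 0 (r x 0) + tscale 0 (r x 0)"
      using x by (intro r_combination rep.W_closed(4))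
    then have "r x 0 = 0" by (simp only: rep.scale_zero_left add_0_left)
    then show ?case by (simp only: sum.empty rep.lin_zero[OF F])
  next
    case (insert w X)
    have sW: "(\<Sum>w\<in>X. tscale (T w) (pure w)) \<in> W n"
      using insert.prems pure_W by (intro rep.subspace_sum[OF rep.subspace_W] rep.W_closed(3)) auto
    have "r x (tscale (T w) (pure w) + tscale 1 (\<Sum>w\<in>X. tscale (T w) (pure w))) =
      tscale (T w) (r x (pure w)) + tscale 1 (r x (\<Sum>w\<in>X. tscale (T w) (pure w)))"
      using insert.prems by (intro r_combination x pure_W sW) auto
    moreover have "r x (pure w) = F (pure w)" using insert.prems by (intro eq) auto
    moreover have "r x (\<Sum>w\<in>X. tscale (T w) (pure w)) = F (\<Sum>w\<in>X. tscale (T w) (pure w))" using insert by simp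
    ultimately show ?case
      by (simp only: sum.insert[OF insert.hyps] rep.lin_add[OF F] rep.lin_scale[OF F] rep.scale_one)
  qed
  from this[OF finite_words order_refl] show ?thesis using pure_expansion[OF T] by simp
qed

lemma r_swap:
  assumes i: "Suc i < n" and T: "T \<in> W n"
  shows "r (brauer_basis (perm_diagram n (transpose i (Suc i)))) T = pact n (transpose i (Suc i)) T"
proof (rule r_eqI[OF _ lin_pact _ T])
  show "brauer_basis (perm_diagram n (transpose i (Suc i))) \<in> brauer_space n"
    using i by (intro brauer_basis_space perm_diagram_brauer permutes_swap_id) auto
  fix u assume u: "u \<in> words n"
  have lu: "length u = n" using u by (simp add: basis_words_def)
  define v where "v = u[i := u ! Suc i, Suc i := u ! i]"
  have v: "v \<in> words n" unfolding v_def using u i by (intro basis_words_update basis_words_nth[OF u]) auto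
  have "r (brauer_basis (perm_diagram n (transpose i (Suc i)))) (pure u) = (\<lambda>w. of_int eps * pure v w)"
    using action lu i unfolding brauer_action_def v_def by blast
  also have "\<dots> = pact n (transpose i (Suc i)) (pure u)"
  proof
    fix w
    show "of_int eps * pure v w = pact n (transpose i (Suc i)) (pure u) w"
    proof (cases "w \<in> words n")
      case True
      then have lw: "length w = n" by (simp add: basis_words_def)
      have "w = v \<longleftrightarrow> w[i := w ! Suc i, Suc i := w ! i] = u"
      proof
        assume "w = v"
        then show "w[i := w ! Suc i, Suc i := w ! i] = u"
          using lu i by (intro nth_equalityI) (auto simp: v_def nth_list_update)
      next
        assume "w[i := w ! Suc i, Suc i := w ! i] = u"
        then show "w = v"
          using lw i by (intro nth_equalityI) (auto simp: v_def nth_list_update)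
      qed
      then show ?thesis using True i by (simp add: pact_transpose pure_word[OF u] pure_word[OF v])
    next
      case False
      then show ?thesis using v by (auto simp: pure_word[OF v] pact_def)
    qed
  qed
  finally show "r (brauer_basis (perm_diagram n (transpose i (Suc i)))) (pure u) = pact n (transpose i (Suc i)) (pure u)" .
qed

lemma r_d_adjacent:
  assumes i: "Suc i < n" and T: "T \<in> W n"
  shows "r (brauer_basis (d_diagram n i (Suc i))) T = D n i (Suc i) T"
proof (rule r_eqI[OF _ lin_D _ T])
  let ?j = "Suc i"
  show "brauer_basis (d_diagram n i ?j) \<in> brauer_space n"
    using i by (intro brauer_basis_space d_diagram_brauer) auto
  fix u assume u: "u \<in> words n"
  have lu: "length u = n" using u by (simp add: basis_words_def)
  \<comment> \<open>Of all replacements at the two positions, only the one by the letters of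
    \<open>w\<close> itself can produce \<open>w\<close>.\<close>
  have single: "(\<Sum>a\<in>Basis. \<Sum>b\<in>Basis. f a b * (if w = v[i := a, ?j := b] then 1 else 0)) =
    (if w = v[i := w ! i, ?j := w ! ?j] then f (w ! i) (w ! ?j) else 0)"
    if v: "v \<in> words n" and w: "w \<in> words n" for v w and f :: "'v \<Rightarrow> 'v \<Rightarrow> complex"
  proof -
    have wB: "w ! i \<in> Basis" "w ! ?j \<in> Basis" using basis_words_nth[OF w] i by auto
    have l: "length v = n" "length w = n" using v w by (auto simp: basis_words_def)
    have "(\<Sum>a\<in>Basis. \<Sum>b\<in>Basis. f a b * (if w = v[i := a, ?j := b] then 1 else 0)) =
      (\<Sum>a\<in>Basis. if a = w ! i then (\<Sum>b\<in>Basis. if b = w ! ?j then (if w = v[i := w ! i, ?j := w ! ?j] then f a b else 0) else 0) else 0)"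
    proof (intro sum.cong refl)
      fix a
      show "(\<Sum>b\<in>Basis. f a b * (if w = v[i := a, ?j := b] then 1 else 0)) =
        (if a = w ! i then (\<Sum>b\<in>Basis. if b = w ! ?j then (if w = v[i := w ! i, ?j := w ! ?j] then f a b else 0) else 0) else 0)"
        by (subst update_word_iff[OF l]) (use i in \<open>auto intro!: sum.cong sum.neutral\<close>)
    qed
    then show ?thesis using wB finite_Basis by simp
  qed
  have "r (brauer_basis (d_diagram n i ?j)) (pure u) =
    (\<lambda>w. form (u ! i) (u ! ?j) * (\<Sum>a\<in>Basis. \<Sum>b\<in>Basis. ginv a b * pure (u[i := a, ?j := b]) w))"
    using action lu i unfolding brauer_action_def by blast
  also have "\<dots> = D n i ?j (pure u)"
  proof
    fix w
    have up: "u[i := a, ?j := b] \<in> words n" if "a \<in> Basis" "b \<in> Basis" for a b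
      using u that by (intro basis_words_update)
    show "form (u ! i) (u ! ?j) * (\<Sum>a\<in>Basis. \<Sum>b\<in>Basis. ginv a b * pure (u[i := a, ?j := b]) w) = D n i ?j (pure u) w"
    proof (cases "w \<in> words n")
      case True
      have lw: "length w = n" using True by (simp add: basis_words_def)
      have "(\<Sum>a\<in>Basis. \<Sum>b\<in>Basis. ginv a b * pure (u[i := a, ?j := b]) w) =
        (\<Sum>a\<in>Basis. \<Sum>b\<in>Basis. ginv a b * (if w = u[i := a, ?j := b] then 1 else 0))"
        using pure_word[OF up] by (intro sum.cong refl) simp
      also have "\<dots> = (if w = u[i := w ! i, ?j := w ! ?j] then ginv (w ! i) (w ! ?j) else 0)"
        by (rule single[OF u True])
      finally have L: "(\<Sum>a\<in>Basis. \<Sum>b\<in>Basis. ginv a b * pure (u[i := a, ?j := b]) w) = \<dots>" .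
      have "(\<Sum>a\<in>Basis. \<Sum>b\<in>Basis. form a b * pure u (w[i := a, ?j := b])) =
        (\<Sum>a\<in>Basis. \<Sum>b\<in>Basis. form a b * (if u = w[i := a, ?j := b] then 1 else 0))"
        by (intro sum.cong refl) (auto simp: pure_word[OF u])
      also have "\<dots> = (if u = w[i := u ! i, ?j := u ! ?j] then form (u ! i) (u ! ?j) else 0)"
        by (rule single[OF True u])
      finally have R: "(\<Sum>a\<in>Basis. \<Sum>b\<in>Basis. form a b * pure u (w[i := a, ?j := b])) = \<dots>" .
      show ?thesis
        unfolding L D_def using True R update_word_sym[OF lu lw, of i ?j] i by simp
    next
      case False
      have "pure (u[i := a, ?j := b]) w = 0" if "a \<in> Basis" "b \<in> Basis" for a b
        using pure_word[OF up[OF that]] up[OF that] False by auto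
      then show ?thesis using False by (simp add: D_def)
    qed
  qed
  finally show "r (brauer_basis (d_diagram n i ?j)) (pure u) = D n i ?j (pure u)" .
qed

lemma r_basis_mult:
  assumes b: "b1 \<in> brauer_diagrams n" "b2 \<in> brauer_diagrams n" and T: "T \<in> W n" and l: "diagram_loops n b1 b2 = 0"
  shows "r (brauer_basis (diagram_comp n b1 b2)) T = r (brauer_basis b1) (r (brauer_basis b2) T)"
  using r_mult[OF brauer_basis_space[OF b(1)] brauer_basis_space[OF b(2)] T]
  by (simp add: brauer_mult_basis[OF b] l)

lemma r_perm_comp:
  assumes s: "s permutes {..<n}" and t: "t permutes {..<n}" and T: "T \<in> W n"
  shows "r (brauer_basis (perm_diagram n (s \<circ> t))) T = r (brauer_basis (perm_diagram n s)) (r (brauer_basis (perm_diagram n t)) T)"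
  using r_basis_mult[OF perm_diagram_brauer[OF s] perm_diagram_brauer[OF t] T perm_below(2)[OF perm_diagram_brauer[OF t] s]]
  by (simp add: perm_below(1)[OF perm_diagram_brauer[OF t] s] perm_diagram_comp[OF s t])

text \<open>The action is prescribed on adjacent transpositions; distant ones are conjugates of
  these.\<close>

lemma r_transpose:
  assumes ij: "i < j" "j < n" and T: "T \<in> W n"
  shows "r (brauer_basis (perm_diagram n (transpose i j))) T = pact n (transpose i j) T"
  using ij T
proof (induction j arbitrary: T)
  case (Suc j)
  show ?case
  proof (cases "i = j")
    case True
    then show ?thesis using Suc.prems by (simp add: r_swap)
  next
    case False
    let ?s = "transpose j (Suc j)" and ?t = "transpose i j"
    have p: "?s permutes {..<n}" "?t permutes {..<n}" using Suc.prems by (auto intro!: permutes_swap_id)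
    have e: "transpose i (Suc j) = ?s \<circ> (?t \<circ> ?s)"
      using False Suc.prems by (auto simp: fun_eq_iff transpose_def)
    have IH: "r (brauer_basis (perm_diagram n ?t)) U = pact n ?t U" if "U \<in> W n" for U
      using Suc.IH[of U] False Suc.prems that by simp
    have "r (brauer_basis (perm_diagram n (transpose i (Suc j)))) T = pact n ?s (pact n ?t (pact n ?s T))"
      unfolding e using Suc.prems p
      by (simp add: r_perm_comp permutes_compose r_swap IH pact_W)
    also have "\<dots> = pact n (?s \<circ> (?t \<circ> ?s)) T"
      using p Suc.prems by (simp add: rep.act_comp permutes_compose pact_W)
    finally show ?thesis by (simp only: e)
  qed
qed simp

lemma r_perm:
  assumes "s permutes {..<n}" "T \<in> W n"
  shows "r (brauer_basis (perm_diagram n s)) T = pact n s T"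
  using assms(1) finite_lessThan assms(2)
proof (induction s arbitrary: T rule: permutes_induct)
  case id
  then show ?case using r_one[OF id] rep.act_id[OF id] by (simp only: brauer_one_def)
next
  case (swap a b p)
  have t: "transpose a b permutes {..<n}" using swap by (intro permutes_swap_id) auto
  have "r (brauer_basis (perm_diagram n (transpose a b))) U = pact n (transpose a b) U" if "U \<in> W n" for U
    using r_transpose[of a b U] r_transpose[of b a U] swap that by (cases "a < b") (auto simp: transpose_commute)
  moreover have p: "p permutes {..<n}" and T: "T \<in> W n" using swap by simp_all
  moreover have "r (brauer_basis (perm_diagram n p)) T = pact n p T" using swap by simp
  ultimately show ?case
    unfolding r_perm_comp[OF t p T] rep.act_comp[OF t p T, symmetric] by (simp add: pact_W)
qed

text \<open>Induction on the second position: \<open>d_i(j+1)\<close> is the conjugate of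
  \<open>d_ij\<close> by \<open>transpose j (Suc j)\<close>. No loop is closed in these products, so
  they become compositions without a scalar factor.\<close>

lemma r_d:
  assumes "i < j" "j < n" "T \<in> W n"
  shows "r (brauer_basis (d_diagram n i j)) T = D n i j T"
  using assms
proof (induction j arbitrary: T)
  case (Suc j)
  show ?case
  proof (cases "i = j")
    case True
    then show ?thesis using Suc.prems by (simp add: r_d_adjacent)
  next
    case False
    let ?s = "transpose j (Suc j)"
    have s: "?s permutes {..<n}" using Suc.prems by (auto intro!: permutes_swap_id)
    have si: "?s i = i" "?s j = Suc j" using False Suc.prems by (auto simp: transpose_def)
    have d: "d_diagram n i j \<in> brauer_diagrams n" "d_diagram n i (Suc j) \<in> brauer_diagrams n"
      using Suc.prems False by (auto intro!: d_diagram_brauer)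
    have sd: "perm_diagram n ?s \<in> brauer_diagrams n" by (rule perm_diagram_brauer[OF s])
    have comp: "diagram_comp n (perm_diagram n ?s) (d_diagram n i j) = diagram_comp n (d_diagram n i (Suc j)) (perm_diagram n ?s)"
      using d_diagram_conj[OF s, of i j] Suc.prems False by (simp add: perm_below(1)[OF d(1) s] perm_above(1)[OF d(2) s] si)
    define U where "U = pact n ?s T"
    have U: "U \<in> W n" by (simp add: U_def pact_W)
    have sU: "pact n ?s U = T" unfolding U_def using Suc.prems by (intro rep.act_transpose_twice) auto
    have "r (brauer_basis (d_diagram n i (Suc j))) T = r (brauer_basis (d_diagram n i (Suc j))) (r (brauer_basis (perm_diagram n ?s)) U)"
      by (simp only: r_perm[OF s U] sU)
    also have "\<dots> = r (brauer_basis (perm_diagram n ?s)) (r (brauer_basis (d_diagram n i j)) U)"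
      using r_basis_mult[OF d(2) sd U perm_above(2)[OF d(2) s]] r_basis_mult[OF sd d(1) U perm_below(2)[OF d(1) s]] by (simp only: comp)
    also have "r (brauer_basis (d_diagram n i j)) U = D n i j U"
      using Suc.IH[of U] Suc.prems False U by simp
    also have "r (brauer_basis (perm_diagram n ?s)) (D n i j U) = D n i (Suc j) T"
      using D_conj[OF s, of i j U] Suc.prems False by (simp only: r_perm[OF s D_W] si sU)
    finally show ?thesis .
  qed
qed simp

lemma r_A:
  assumes T: "T \<in> W n"
  shows "r (A_elem n) T = Aop n T"
proof -
  have "r (\<lambda>b. \<Sum>(i, j)\<in>X. brauer_basis (d_diagram n i j) b) T = (\<Sum>(i, j)\<in>X. D n i j T)
      \<and> (\<lambda>b. \<Sum>(i, j)\<in>X. brauer_basis (d_diagram n i j) b) \<in> brauer_space n"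
    if "finite X" "X \<subseteq> pairs n" for X
    using that
  proof (induction X)
    case empty
    have "r (\<lambda>b. 0 * brauer_one n b + 0 * brauer_one n b) T = 0"
      unfolding r_combination_left[OF brauer_one_space brauer_one_space T] by simp
    then show ?case by (simp add: brauer_space_def)
  next
    case (insert x X)
    obtain i j where x: "x = (i, j)" by fastforce
    have ij: "i < j" "j < n" using insert.prems by (auto simp: pairs_def x)
    have bij: "brauer_basis (d_diagram n i j) \<in> brauer_space n" using ij by (intro brauer_basis_space d_diagram_brauer) auto
    let ?y = "\<lambda>b. \<Sum>(i, j)\<in>X. brauer_basis (d_diagram n i j) b"
    have IH: "r ?y T = (\<Sum>(i, j)\<in>X. D n i j T)" "?y \<in> brauer_space n" using insert by auto
    have "(\<lambda>b. \<Sum>(i, j)\<in>insert x X. brauer_basis (d_diagram n i j) b) = (\<lambda>b. 1 * brauer_basis (d_diagram n i j) b + 1 * ?y b)"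
      using insert.hyps by (simp add: x)
    moreover have "(\<lambda>b. 1 * brauer_basis (d_diagram n i j) b + 1 * ?y b) \<in> brauer_space n"
      using bij IH(2) by (simp add: brauer_space_def)
    moreover have "r (\<lambda>b. 1 * brauer_basis (d_diagram n i j) b + 1 * ?y b) T = D n i j T + (\<Sum>(i, j)\<in>X. D n i j T)"
      unfolding r_combination_left[OF bij IH(2) T] IH(1) r_d[OF ij T] by simp
    ultimately show ?case using insert.hyps by (simp add: x)
  qed
  from this[OF finite_pairs order_refl] show ?thesis by (simp add: A_elem_pairs Aop_def)
qed

lemma r_P_factor:
  assumes T: "T \<in> W n"
  shows "r (P_factor n k) T = spectral_factor n k T"
proof -
  have "P_factor n k = (\<lambda>b. 1 * brauer_one n b + (- (1 / of_int k)) * A_elem n b)"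
    by (simp add: P_factor_def)
  then show ?thesis
    using r_combination_left[OF brauer_one_space A_elem_space T, of 1 "- (1 / of_int k)"]
    by (simp add: r_one[OF T] r_A[OF T] spectral_factor_def)
qed

lemma r_P_product:
  "T \<in> W n \<Longrightarrow> r (foldr (\<lambda>k Q. brauer_mult n (of_int (eps * int N)) (P_factor n k) Q) ks (brauer_one n)) T =
    foldr (spectral_factor n) ks T"
proof (induction ks)
  case Nil
  then show ?case by (simp add: r_one)
next
  case (Cons k ks)
  let ?Q = "foldr (\<lambda>k Q. brauer_mult n (of_int (eps * int N)) (P_factor n k) Q) ks (brauer_one n)"
  have Q: "?Q \<in> brauer_space n" by (cases ks) (auto simp: brauer_one_space P_factor_mult_space)
  show ?case
    using Cons r_mult[OF P_factor_space Q Cons.prems, of k] r_P_factor[OF r_W[OF Q Cons.prems]] by simp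
qed

end

section \<open>Traces and the projector\<close>

lemma nths_delete_eq_iff:
  assumes "length w = n" "length v = n" "i < j" "j < n"
  shows "nths w (- {i, j}) = nths v (- {i, j}) \<longleftrightarrow> w = v[i := w ! i, j := w ! j]"
proof -
  define js where "js = filter (\<lambda>k. k \<noteq> i \<and> k \<noteq> j) [0..<n]"
  have nths_eq: "nths xs (- {i, j}) = map ((!) xs) js" if "length xs = n" for xs :: "'a list"
  proof -
    have "nths xs (- {i, j}) = map ((!) xs) (nths [0..<n] (- {i, j}))"
      using that by (metis map_nth nths_map)
    also have "nths [0..<n] (- {i, j}) = js"
      by (simp add: nths_def js_def zip_same_conv_map filter_map o_def)
    finally show ?thesis .
  qed
  have "nths w (- {i, j}) = nths v (- {i, j}) \<longleftrightarrow> (\<forall>k<n. k \<noteq> i \<and> k \<noteq> j \<longrightarrow> w ! k = v ! k)"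
    by (auto simp: nths_eq assms js_def)
  also have "\<dots> \<longleftrightarrow> w = v[i := w ! i, j := w ! j]"
  proof
    assume *: "\<forall>k<n. k \<noteq> i \<and> k \<noteq> j \<longrightarrow> w ! k = v ! k"
    show "w = v[i := w ! i, j := w ! j]"
      using * assms by (intro nth_equalityI) (auto simp: nth_list_update)
  next
    assume e: "w = v[i := w ! i, j := w ! j]"
    show "\<forall>k<n. k \<noteq> i \<and> k \<noteq> j \<longrightarrow> w ! k = v ! k"
    proof (intro allI impI)
      fix k assume "k < n" "k \<noteq> i \<and> k \<noteq> j"
      then show "w ! k = v ! k" using arg_cong[OF e, of "\<lambda>x. x ! k"] by simp
    qed
  qed
  finally show ?thesis .
qed

context brauer_tensors
begin

lemma trace_at_word:
  assumes v: "v \<in> words n" and ij: "i < j" "j < n"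
  shows "tensor_trace scale Basis form n i j T (nths v (- {i, j})) =
    (\<Sum>a\<in>Basis. \<Sum>b\<in>Basis. form a b * T (v[i := a, j := b]))"
proof -
  have lv: "length v = n" using v by (simp add: basis_words_def)
  have pw: "pure (nths w (- {i, j})) (nths v (- {i, j})) = (if w = v[i := w ! i, j := w ! j] then 1 else 0)" if w: "w \<in> words n" for w
  proof -
    have lw: "length w = n" using w by (simp add: basis_words_def)
    have "nths w (- {i, j}) \<in> words (length (nths w (- {i, j})))"
      using w set_nths_subset[of w "- {i, j}"] by (auto simp: basis_words_def)
    then show ?thesis using nths_delete_eq_iff[OF lw lv ij] by (auto simp: pure_word)
  qed
  have "tensor_trace scale Basis form n i j T (nths v (- {i, j})) =
    (\<Sum>w\<in>words n. if w = v[i := w ! i, j := w ! j] then T w * form (w ! i) (w ! j) else 0)"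
    unfolding tensor_trace_def by (intro sum.cong refl) (simp add: pw)
  also have "\<dots> = (\<Sum>w\<in>{w \<in> words n. w = v[i := w ! i, j := w ! j]}. T w * form (w ! i) (w ! j))"
    by (simp add: sum.inter_filter)
  also have "\<dots> = (\<Sum>(a, b)\<in>Basis \<times> Basis. form a b * T (v[i := a, j := b]))"
  proof (rule sum.reindex_bij_witness[where i = "\<lambda>(a, b). v[i := a, j := b]" and j = "\<lambda>w. (w ! i, w ! j)"])
    fix w assume "w \<in> {w \<in> words n. w = v[i := w ! i, j := w ! j]}"
    then have w: "w \<in> words n" and e: "v[i := w ! i, j := w ! j] = w" by auto
    show "(case (w ! i, w ! j) of (a, b) \<Rightarrow> v[i := a, j := b]) = w" using e by simp
    show "(w ! i, w ! j) \<in> Basis \<times> Basis" using basis_words_nth[OF w] ij by auto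
    show "(case (w ! i, w ! j) of (a, b) \<Rightarrow> form a b * T (v[i := a, j := b])) = T w * form (w ! i) (w ! j)"
      using e by simp
  next
    fix p assume "p \<in> Basis \<times> Basis"
    then obtain a b where p: "p = (a, b)" "a \<in> Basis" "b \<in> Basis" by auto
    have "v[i := a, j := b] ! i = a" "v[i := a, j := b] ! j = b" using lv ij by (auto simp: nth_list_update)
    then show "((case p of (a, b) \<Rightarrow> v[i := a, j := b]) ! i, (case p of (a, b) \<Rightarrow> v[i := a, j := b]) ! j) = p"
      "(case p of (a, b) \<Rightarrow> v[i := a, j := b]) \<in> {w \<in> words n. w = v[i := w ! i, j := w ! j]}"
      using p v by (auto intro!: basis_words_update)
  qed
  finally show ?thesis by (simp add: sum.cartesian_product)
qed

text \<open>\<open>D n i j\<close> inserts \<open>E\<close> after taking the trace, and nothing is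
  lost: \<open>ginv\<close> has a nonzero entry in every column, while the trace does not depend on
  the letters at \<open>i\<close> and \<open>j\<close>, so these can be chosen to meet such an
  entry.\<close>

lemma trace_zero_iff:
  assumes T: "T \<in> W n" and ij: "i < j" "j < n"
  shows "tensor_trace scale Basis form n i j T = (\<lambda>_. 0) \<longleftrightarrow> D n i j T = 0"
proof -
  define G where "G = (\<lambda>v. \<Sum>a\<in>Basis. \<Sum>b\<in>Basis. form a b * T (v[i := a, j := b]))"
  have "tensor_trace scale Basis form n i j T = (\<lambda>_. 0) \<longleftrightarrow> (\<forall>v\<in>words n. G v = 0)"
  proof
    assume "tensor_trace scale Basis form n i j T = (\<lambda>_. 0)"
    then show "\<forall>v\<in>words n. G v = 0" using trace_at_word[OF _ ij, of _ T] by (metis G_def)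
  next
    assume G: "\<forall>v\<in>words n. G v = 0"
    show "tensor_trace scale Basis form n i j T = (\<lambda>_. 0)"
    proof
      fix u
      show "tensor_trace scale Basis form n i j T u = 0"
      proof (cases "\<exists>v\<in>words n. u = nths v (- {i, j})")
        case True
        then show ?thesis using G trace_at_word[OF _ ij, of _ T] by (auto simp: G_def)
      next
        case False
        have "pure (nths w (- {i, j})) u = 0" if w: "w \<in> words n" for w
        proof -
          have "nths w (- {i, j}) \<in> words (length (nths w (- {i, j})))"
            using w set_nths_subset[of w "- {i, j}"] by (auto simp: basis_words_def)
          then show ?thesis using False w by (auto simp: pure_word)
        qed
        then show ?thesis unfolding tensor_trace_def by (intro sum.neutral) simp
      qed
    qed
  qed
  also have "\<dots> \<longleftrightarrow> D n i j T = 0"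
  proof
    assume "\<forall>v\<in>words n. G v = 0"
    then show "D n i j T = 0" by (auto simp: D_def G_def fun_eq_iff)
  next
    assume D0: "D n i j T = 0"
    show "\<forall>v\<in>words n. G v = 0"
    proof
      fix v assume v: "v \<in> words n"
      have lv: "length v = n" using v by (simp add: basis_words_def)
      define a where "a = v ! i"
      have a: "a \<in> Basis" using basis_words_nth[OF v] ij by (simp add: a_def)
      have "\<exists>c\<in>Basis. ginv c a \<noteq> 0"
      proof (rule ccontr)
        assume "\<not> ?thesis"
        then have "(\<Sum>c\<in>Basis. form a c * ginv c a) = 0" by (intro sum.neutral) auto
        then show False using g_ginv[OF a a] by simp
      qed
      then obtain c where c: "c \<in> Basis" "ginv c a \<noteq> 0" by blast
      define w where "w = v[i := c, j := a]"
      have w: "w \<in> words n" unfolding w_def by (intro basis_words_update v c a)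
      have wij: "w ! i = c" "w ! j = a" using lv ij by (auto simp: w_def nth_list_update)
      have "w[i := x, j := y] = v[i := x, j := y]" for x y
        using ij unfolding w_def by (simp add: list_update_swap[of j i])
      then have "G w = G v" by (simp add: G_def)
      moreover have "ginv c a * G w = 0"
        using fun_cong[OF D0, of w] w by (simp add: D_def G_def wij)
      ultimately show "G v = 0" using c by simp
    qed
  qed
  finally show ?thesis .
qed

lemma Aop_zero_iff:
  assumes "T \<in> W n"
  shows "Aop n T = 0 \<longleftrightarrow> (\<forall>i j. i < j \<and> j < n \<longrightarrow> tensor_trace scale Basis form n i j T = (\<lambda>_. 0))"
proof -
  have "Aop n T = 0" if "\<And>i j. i < j \<Longrightarrow> j < n \<Longrightarrow> D n i j T = 0"
    unfolding Aop_def using that by (intro sum.neutral) (auto simp: pairs_def)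
  then show ?thesis using Aop_zero[OF assms] trace_zero_iff[OF assms] by blast
qed

lemma spectral_factor_pact:
  assumes "p permutes {..<n}"
  shows "foldr (spectral_factor n) ks (pact n p T) = pact n p (foldr (spectral_factor n) ks T)"
  by (induction ks)
    (simp_all only: foldr.simps id_apply o_apply spectral_factor_def rep.lin_diff[OF lin_pact] rep.lin_scale[OF lin_pact] Aop_pact[OF assms])

lemma spectral_factor_fixed:
  assumes "Aop n T = 0"
  shows "foldr (spectral_factor n) ks T = T"
proof -
  have "(\<Prod>k\<leftarrow>ks. 1 - 0 / of_int k) = (1 :: complex)" by (induction ks) auto
  moreover have "Aop n T = tscale 0 T" using assms by simp
  ultimately show ?thesis using spectral_factor_foldr_eigenvector by (metis rep.scale_one)
qed

text \<open>The product maps into the kernel of \<open>Aop\<close>, which consists of the traceless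
  tensors and on which every factor is the identity. This gives idempotence and the first two
  properties; the last one holds because \<open>Aop\<close> commutes with permutations.\<close>

theorem traceless_projector:
  defines "PP \<equiv> r (P_elem eps n N)"
  assumes T: "T \<in> W n"
  shows "PP (PP T) = PP T"
    and "i < j \<Longrightarrow> j < n \<Longrightarrow> tensor_trace scale Basis form n i j (PP T) = (\<lambda>_. 0)"
    and "(\<And>k l. k < l \<Longrightarrow> l < n \<Longrightarrow> tensor_trace scale Basis form n k l T = (\<lambda>_. 0)) \<Longrightarrow> PP T = T"
    and "s permutes {..<n} \<Longrightarrow> PP (r (brauer_basis (perm_diagram n s)) T) = r (brauer_basis (perm_diagram n s)) (PP T)"
proof -
  let ?F = "foldr (spectral_factor n) (sorted_list_of_set (spec_times eps n N))"
  have PP: "PP U = ?F U" if "U \<in> W n" for U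
    using r_P_product[OF that] by (simp only: PP_def P_elem_def)
  have FW: "?F T \<in> W n" by (rule spectral_factor_W[OF T])
  have A: "Aop n (?F T) = 0" by (rule Aop_spectral_product[OF T]) (simp add: finite_spec_times)
  show "PP (PP T) = PP T" using spectral_factor_fixed[OF A] by (simp only: PP[OF T] PP[OF FW])
  show "tensor_trace scale Basis form n i j (PP T) = (\<lambda>_. 0)" if "i < j" "j < n"
    using A Aop_zero_iff[OF FW] that by (simp only: PP[OF T])
  show "PP T = T" if "\<And>k l. k < l \<Longrightarrow> l < n \<Longrightarrow> tensor_trace scale Basis form n k l T = (\<lambda>_. 0)"
    using spectral_factor_fixed[of T] Aop_zero_iff[OF T] that PP[OF T] by simp
  show "PP (r (brauer_basis (perm_diagram n s)) T) = r (brauer_basis (perm_diagram n s)) (PP T)" if s: "s permutes {..<n}"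
    by (simp only: PP[OF T] r_perm[OF s T] r_perm[OF s FW] PP[OF pact_W] spectral_factor_pact[OF s])
qed

end

theorem theorem4p1:
  fixes scale :: "complex \<Rightarrow> 'v::ab_group_add \<Rightarrow> 'v"
    and Basis :: "'v set"
    and form ginv :: "'v \<Rightarrow> 'v \<Rightarrow> complex"
    and r :: "brauer \<Rightarrow> ('v list \<Rightarrow> complex) \<Rightarrow> 'v list \<Rightarrow> complex"
    and eps :: int and n N :: nat
  assumes "finite_dimensional_vector_space scale Basis"
    and "card Basis = N" and "N \<ge> 1"
    and "eps = 1 \<or> (eps = -1 \<and> even N)"
    and "nondegenerate_form scale eps form"
    and "inverse_gram Basis form ginv"
    and "n \<ge> 2"
    and "brauer_action scale Basis eps form ginv n r"
  shows "let PP = r (P_elem eps n N) in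
    (\<forall>T\<in>tensor_space Basis n. PP (PP T) = PP T) \<and>
    (\<forall>T\<in>tensor_space Basis n. \<forall>i j. i < j \<and> j < n \<longrightarrow>
       tensor_trace scale Basis form n i j (PP T) = (\<lambda>_. 0)) \<and>
    (\<forall>T\<in>tensor_space Basis n.
       (\<forall>k l. k < l \<and> l < n \<longrightarrow> tensor_trace scale Basis form n k l T = (\<lambda>_. 0)) \<longrightarrow> PP T = T) \<and>
    (\<forall>T\<in>tensor_space Basis n. \<forall>s. s permutes {..<n} \<longrightarrow>
       PP (r (brauer_basis (perm_diagram n s)) T) = r (brauer_basis (perm_diagram n s)) (PP T))"
proof -
  interpret finite_dimensional_vector_space scale Basis by fact
  interpret bilinear_space scale Basis form eps by unfold_locales (use assms in auto)
  obtain h and S :: "'v set" and C K where "tensor_model Basis N eps form ginv h S C K"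
    using tensor_model_exists[OF assms(6)] assms(2) by metis
  then interpret brauer_tensors scale Basis N eps form ginv h S C K n r
    using assms by (intro brauer_tensors.intro brauer_tensors_axioms.intro)
  show ?thesis
    unfolding Let_def
  proof (intro conjI ballI allI impI)
    fix T assume T: "T \<in> tensor_space Basis n"
    let ?PP = "r (P_elem eps n N)"
    show "?PP (?PP T) = ?PP T" by (rule traceless_projector(1)[OF T])
    show "tensor_trace scale Basis form n i j (?PP T) = (\<lambda>_. 0)" if "i < j \<and> j < n" for i j
      using that by (intro traceless_projector(2)[OF T]) auto
    show "?PP T = T" if "\<forall>k l. k < l \<and> l < n \<longrightarrow> tensor_trace scale Basis form n k l T = (\<lambda>_. 0)"
      using that by (intro traceless_projector(3)[OF T]) auto
    show "?PP (r (brauer_basis (perm_diagram n s)) T) = r (brauer_basis (perm_diagram n s)) (?PP T)"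
      if "s permutes {..<n}" for s
      by (rule traceless_projector(4)[OF T that])
  qed
qed

end
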